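(* There is a polynomial-time randomized algorithm for FTFP which always outputs a feasible integral solution and whose expected cost is at most $1.575\cdot\mathrm{LP}^\ast\le 1.575\cdot\mathrm{OPT}$, where $\mathrm{LP}^\ast$ is the optimal value of the LP relaxation and $\mathrm{OPT}$ the optimal integral cost.
   Context: FTFP (Fault-Tolerant Facility Placement): given a finite set $\mathbb{F}$ of sites and a finite set $\mathbb{C}$ of clients, an opening cost $f_i\ge 0$ for each site $i$, connection costs $d_{ij}\ge 0$ forming a metric (symmetric, triangle inequality), and a positive integer demand $r_j$ for each client $j$. Any number of facilities may be opened at a site; a feasible integral solution consists of nonnegative integers $y_i$ (facilities opened at site $i$) and $x_{ij}$ (connections of $j$ to facilities at site $i$) with $x_{ij}\le y_i$ and $\sum_{i}x_{ij}\ge r_j$, so that each client is connected to $r_j$ distinct facilities; its cost is $\sum_i f_iy_i+\sum_{i,j}d_{ij}x_{ij}$. The LP relaxation is the same program with real $x_{ij},y_i\ge 0$. *)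

theory Defs
  imports "HOL-Probability.Probability_Mass_Function" "HOL-Computational_Algebra.Polynomial"
    "HOL-Library.Log_Nat"
begin

section \<open>Randomized polynomial time\<close>

text \<open>
  The machine model is a random access machine over the natural numbers with structured control
  flow, fair coin flips and the logarithmic cost criterion: every value that occurs during an
  evaluation (constants, addresses, contents of cells read, intermediate results) is charged its bit
  length, so multiplication and division may be primitive and the model is polynomially equivalent
  to probabilistic Turing machines.
\<close>

type_synonym mem = "nat \<Rightarrow> nat"

definition bit_length :: "nat \<Rightarrow> nat" where
  "bit_length k = max 1 (floorlog 2 k)"

datatype aexp =
    Const nat
  | Mem aexp
  | Add aexp aexp
  | Sub aexp aexp
  | Mul aexp aexp
  | Div aexp aexp

primrec aval :: "aexp \<Rightarrow> mem \<Rightarrow> nat" where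
  "aval (Const k) M = k"
| "aval (Mem a) M = M (aval a M)"
| "aval (Add a b) M = aval a M + aval b M"
| "aval (Sub a b) M = aval a M - aval b M"
| "aval (Mul a b) M = aval a M * aval b M"
| "aval (Div a b) M = aval a M div aval b M"

primrec acost :: "aexp \<Rightarrow> mem \<Rightarrow> nat" where
  "acost (Const k) M = bit_length k"
| "acost (Mem a) M = acost a M + bit_length (aval (Mem a) M)"
| "acost (Add a b) M = acost a M + acost b M + bit_length (aval (Add a b) M)"
| "acost (Sub a b) M = acost a M + acost b M + bit_length (aval (Sub a b) M)"
| "acost (Mul a b) M = acost a M + acost b M + bit_length (aval (Mul a b) M)"
| "acost (Div a b) M = acost a M + acost b M + bit_length (aval (Div a b) M)"

text \<open>
  \<open>Store a e\<close> writes the value of \<open>e\<close> to the cell with address \<open>a\<close>; \<open>Flip a\<close> writes a fair random bit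
  there.  A test succeeds if its value is nonzero.
\<close>

datatype com =
    Store aexp aexp
  | Flip aexp
  | Cond aexp "com list" "com list"
  | While aexp "com list"

text \<open>
  A configuration consists of the commands still to be executed, the memory, and the cost so far.
\<close>

type_synonym config = "com list \<times> mem \<times> nat"

fun step :: "config \<Rightarrow> config pmf" where
  "step ([], M, t) = return_pmf ([], M, t)"
| "step (Store a e # K, M, t) =
     return_pmf (K, M(aval a M := aval e M), t + acost a M + acost e M)"
| "step (Flip a # K, M, t) =
     map_pmf (\<lambda>b. (K, M(aval a M := of_bool b), t + acost a M + 1)) (bernoulli_pmf (1 / 2))"
| "step (Cond e cs ds # K, M, t) =
     return_pmf ((if aval e M \<noteq> 0 then cs else ds) @ K, M, t + acost e M)"
| "step (While e cs # K, M, t) =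
     return_pmf (if aval e M \<noteq> 0 then cs @ While e cs # K else K, M, t + acost e M)"

primrec run :: "nat \<Rightarrow> config \<Rightarrow> config pmf" where
  "run 0 c = return_pmf c"
| "run (Suc n) c = bind_pmf (step c) (run n)"

definition load :: "nat list \<Rightarrow> mem" where
  "load xs = (\<lambda>a. if a < length xs then xs ! a else 0)"

definition input_size :: "nat list \<Rightarrow> nat" where
  "input_size xs = (\<Sum>k\<leftarrow>xs. bit_length k)"

text \<open>
  \<open>A\<close> maps every input in \<open>D\<close> to a distribution of outputs.  It is computable in randomized polynomial
  time if one fixed program produces this distribution and, whatever the coin flips, halts within a
  cost polynomial in the bit length of the encoded input.  Every step costs at least one, so that a
  run of cost at most \<open>T\<close> is over after \<open>T\<close> steps, and halted configurations no longer change.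
\<close>

definition rand_polytime ::
  "('a \<Rightarrow> nat list) \<Rightarrow> ('a \<Rightarrow> mem \<Rightarrow> 'b) \<Rightarrow> 'a set \<Rightarrow> ('a \<Rightarrow> 'b pmf) \<Rightarrow> bool" where
  "rand_polytime enc dec D A \<longleftrightarrow>
     (\<exists>(P :: com list) (p :: nat poly). \<forall>I\<in>D.
        let T = poly p (input_size (enc I));
            R = run T (P, load (enc I), 0)
        in (\<forall>(K, M, t)\<in>set_pmf R. K = [] \<and> t \<le> T) \<and>
           A I = map_pmf (\<lambda>(K, M, t). dec I M) R)"


section \<open>Fault-tolerant facility placement\<close>

text \<open>
  Sites and clients are numbered from 0.  Distances live on the disjoint union of sites (\<open>Inl\<close>) and
  clients (\<open>Inr\<close>).  Costs are rational, so that instances can be given to a machine.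
\<close>

record ftfp =
  nsites :: nat
  nclients :: nat
  open_cost :: "nat \<Rightarrow> rat"
  dist_fn :: "nat + nat \<Rightarrow> nat + nat \<Rightarrow> rat"
  demand :: "nat \<Rightarrow> nat"

definition points :: "ftfp \<Rightarrow> (nat + nat) set" where
  "points I = {..<nsites I} <+> {..<nclients I}"

definition conn_cost :: "ftfp \<Rightarrow> nat \<Rightarrow> nat \<Rightarrow> rat" where
  "conn_cost I i j = dist_fn I (Inl i) (Inr j)"

text \<open>
  Distinct points may have distance 0 (a client may be located at a site).  The first condition
  excludes only the instances that have clients but no site, which have no feasible solution.
\<close>

definition ftfp_instance :: "ftfp \<Rightarrow> bool" where
  "ftfp_instance I \<longleftrightarrow>
     (nclients I > 0 \<longrightarrow> nsites I > 0) \<and>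
     (\<forall>i<nsites I. open_cost I i \<ge> 0) \<and>
     (\<forall>j<nclients I. demand I j > 0) \<and>
     (\<forall>u\<in>points I. dist_fn I u u = 0) \<and>
     (\<forall>u\<in>points I. \<forall>v\<in>points I. dist_fn I u v \<ge> 0 \<and> dist_fn I u v = dist_fn I v u) \<and>
     (\<forall>u\<in>points I. \<forall>v\<in>points I. \<forall>w\<in>points I.
        dist_fn I u w \<le> dist_fn I u v + dist_fn I v w)"

definition lp_feasible :: "ftfp \<Rightarrow> (nat \<Rightarrow> real) \<Rightarrow> (nat \<Rightarrow> nat \<Rightarrow> real) \<Rightarrow> bool" where
  "lp_feasible I y x \<longleftrightarrow>
     (\<forall>i<nsites I. y i \<ge> 0) \<and>
     (\<forall>i<nsites I. \<forall>j<nclients I. x i j \<ge> 0 \<and> x i j \<le> y i) \<and>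
     (\<forall>j<nclients I. (\<Sum>i<nsites I. x i j) \<ge> real (demand I j))"

definition lp_cost :: "ftfp \<Rightarrow> (nat \<Rightarrow> real) \<Rightarrow> (nat \<Rightarrow> nat \<Rightarrow> real) \<Rightarrow> real" where
  "lp_cost I y x =
     (\<Sum>i<nsites I. of_rat (open_cost I i) * y i) +
     (\<Sum>i<nsites I. \<Sum>j<nclients I. of_rat (conn_cost I i j) * x i j)"

definition int_feasible :: "ftfp \<Rightarrow> (nat \<Rightarrow> nat) \<Rightarrow> (nat \<Rightarrow> nat \<Rightarrow> nat) \<Rightarrow> bool" where
  "int_feasible I y x \<longleftrightarrow>
     (\<forall>i<nsites I. \<forall>j<nclients I. x i j \<le> y i) \<and>
     (\<forall>j<nclients I. (\<Sum>i<nsites I. x i j) \<ge> demand I j)"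

definition int_cost :: "ftfp \<Rightarrow> (nat \<Rightarrow> nat) \<Rightarrow> (nat \<Rightarrow> nat \<Rightarrow> nat) \<Rightarrow> real" where
  "int_cost I y x =
     (\<Sum>i<nsites I. of_rat (open_cost I i) * real (y i)) +
     (\<Sum>i<nsites I. \<Sum>j<nclients I. of_rat (conn_cost I i j) * real (x i j))"

definition LP_opt :: "ftfp \<Rightarrow> real" where
  "LP_opt I = Inf {lp_cost I y x | y x. lp_feasible I y x}"

definition OPT :: "ftfp \<Rightarrow> real" where
  "OPT I = Inf {int_cost I y x | y x. int_feasible I y x}"

definition encode_rat :: "rat \<Rightarrow> nat list" where
  "encode_rat q = (case quotient_of q of (a, b) \<Rightarrow> [nat a, nat b])"

text \<open>
  The encoding contains the data of the linear program, i.e. only the distances between sites and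
  clients.  All numbers, including the demands, are measured by their binary length.
\<close>

definition encode_ftfp :: "ftfp \<Rightarrow> nat list" where
  "encode_ftfp I =
     [nsites I, nclients I] @
     concat (map (\<lambda>i. encode_rat (open_cost I i)) [0..<nsites I]) @
     concat (map (\<lambda>i. concat (map (\<lambda>j. encode_rat (conn_cost I i j)) [0..<nclients I]))
       [0..<nsites I]) @
     map (demand I) [0..<nclients I]"

text \<open>
  The output \<open>(y, x)\<close> is read off the initial segment of the memory: first \<open>y\<close>, then \<open>x\<close> row by row.
\<close>

definition decode_solution :: "ftfp \<Rightarrow> mem \<Rightarrow> (nat \<Rightarrow> nat) \<times> (nat \<Rightarrow> nat \<Rightarrow> nat)" where
  "decode_solution I M = (\<lambda>i. M i, \<lambda>i j. M (nsites I + i * nclients I + j))"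

end

theory Submission
  imports Defs "HOL-Probability.Product_PMF"
begin

text \<open>
  The algorithm never solves the linear program exactly.  A multiplicative weights method, whose oracle
  opens the star of the best ratio of covered weight to cost, produces after polynomially many rounds an
  integral vector that covers every demand \<open>N\<close> times at a cost of at most about \<open>N\<close> times the
  optimum of the relaxation.  All but fewer than \<open>2N\<close> units at each site are rounded deterministically,
  the rest is cut into unit pieces, so that large demands never have to be enumerated.

  Dividing by \<open>n\<close> instead of \<open>N\<close>, where \<open>N / n\<close> is slightly less than \<open>1.575\<close>, makes each piece worth \<open>1 / n\<close>
  of a facility.  Every unit of demand receives \<open>N\<close> pieces of its own client.  Clusters are formed
  greedily by the average plus the maximal distance of the nearest \<open>n\<close> pieces; a cluster opens exactly
  one of its \<open>n\<close> pieces, the remaining pieces open independently with probability \<open>1 / n\<close>.  A unit of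
  demand uses the nearest open piece among its own pieces and those of its cluster, and the expected
  distance is at most \<open>N / n\<close> times the average distance of its pieces as soon as
  \<open>exp (-1) + exp (-N / n) \<le> N / n - 1\<close>.

  For the running time, the algorithm is written in a small language of bounded loops and bounded
  searches over arrays, which is compiled to the machine; bit lengths of all arrays are polynomial.
\<close>

text \<open>The obstacle is fault tolerance: the units of one client need different facilities on
  every outcome, not only on average. Therefore a unit that joins a cluster claims all remaining
  pieces of its client in that cluster. Units of one client then belong to different clusters, and
  their candidate sets are disjoint. Pieces of equal size make this pure counting; no facility of
  fractional value has to be split. The ratio \<open>gG / gQ\<close> lies just above the root
  1.5749... of exp (-1) + exp (-x) = x - 1, and the gap to 1.575 pays for solving the linear program
  only approximately. \<open>n\<close> is a power of two, so that fair coins yield an exactly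
  uniform position, and it grows with the number of clients, so that the additive loss of the
  multiplicative weights stays negligible. The running time is settled by syntax: loop counts come
  from arrays with polynomial values, all other values have polynomial bit length, and the bound for
  an array refers only to arrays with smaller numbers. Several commands owe their form to this
  check.\<close>

section \<open>Big-step semantics of the machine with cost bounds\<close>

inductive big :: "com list => mem => mem pmf => nat => bool" where
 big_Nil: "big [] M (return_pmf M) T"
| big_Store: "big C (M(aval a M := aval e M)) D T ==> acost a M + acost e M + T <= T' ==>
  big (Store a e # C) M D T'"
| big_Flip: "(!!b. big C (M(aval a M := of_bool b)) (D b) T) ==> acost a M + 1 + T <= T' ==>
  big (Flip a # C) M (bind_pmf (bernoulli_pmf (1 / 2)) D) T'"
| big_While_True: "aval e M \<noteq> 0 ==> big (cs @ While e cs # C) M D T ==> acost e M + T <= T' ==>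
  big (While e cs # C) M D T'"
| big_While_False: "aval e M = 0 ==> big C M D T ==> acost e M + T <= T' ==>
  big (While e cs # C) M D T'"

lemma bit_length_pos: "1 <= bit_length k"
 by (simp add: bit_length_def)

lemma acost_pos: "1 <= acost e M"
 using bit_length_pos[of "aval e M"] by (cases e) auto

lemma run_Nil: "run n ([], M, t) = return_pmf ([], M, t)"
 by (induction n) (auto simp: bind_return_pmf)

text \<open>Every step costs at least one (\<open>acost_pos\<close>), so a bound \<open>T\<close> on
  the cost also bounds the number of steps; further steps find an empty command list and change
  nothing (\<open>run_Nil\<close>).\<close>

lemma big_run:
 assumes "big C M D T" "T <= n"
 shows "map_pmf (%(K, M, t). M) (run n (C, M, t)) = D \<and>
  (\<forall>(K, M', t') \<in> set_pmf (run n (C, M, t)). K = [] \<and> t' <= t + T)"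
 using assms
proof (induction arbitrary: n t rule: big.induct)
 case (big_Nil M T)
 then show ?case by (simp add: run_Nil)
next
 case (big_Store C M a e D T T')
 have "acost a M \<ge> 1" by (rule acost_pos)
 then obtain m where m: "n = Suc m" "T <= m"
  using big_Store.hyps big_Store.prems by (cases n) auto
 have r: "run n (Store a e # C, M, t) = run m (C, M(aval a M := aval e M), t + acost a M + acost e M)"
  using big_Store.hyps(1) by (simp add: m bind_return_pmf del: fun_upd_apply)
 have "K = [] \<and> t' <= t + T'" if "(K, M', t') \<in> set_pmf (run n (Store a e # C, M, t))" for K M' t'
 proof -
  have "K = [] \<and> t' <= t + acost a M + acost e M + T"
   using conjunct2[OF big_Store.IH[OF m(2)]] that unfolding r by blast
  then show ?thesis using big_Store.hyps by linarith
 qed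
 then show ?case unfolding r using conjunct1[OF big_Store.IH[OF m(2)]] by blast
next
 case (big_Flip C M a D T T')
 obtain m where m: "n = Suc m" "T <= m"
  using big_Flip.hyps big_Flip.prems by (cases n) auto
 have r: "run n (Flip a # C, M, t) = bind_pmf (bernoulli_pmf (1 / 2))
   (%b. run m (C, M(aval a M := of_bool b), t + acost a M + 1))"
  by (simp add: m bind_map_pmf del: fun_upd_apply)
 have "map_pmf (%(K, M, t). M) (run n (Flip a # C, M, t)) = bind_pmf (bernoulli_pmf (1 / 2)) D"
  unfolding r map_bind_pmf using conjunct1[OF big_Flip.IH[OF m(2)]] by (simp del: fun_upd_apply)
 moreover have "K = [] \<and> t' <= t + T'"
  if asm: "(K, M', t') \<in> set_pmf (run n (Flip a # C, M, t))" for K M' t'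
 proof -
  obtain b where "(K, M', t') \<in> set_pmf (run m (C, M(aval a M := of_bool b), t + acost a M + 1))"
   using asm unfolding r set_bind_pmf by blast
  then have "K = [] \<and> t' <= t + acost a M + 1 + T"
   using conjunct2[OF big_Flip.IH[OF m(2)]] by blast
  then show ?thesis using big_Flip.hyps by linarith
 qed
 ultimately show ?case by blast
next
 case (big_While_True e M cs C D T T')
 have "acost e M \<ge> 1" by (rule acost_pos)
 then obtain m where m: "n = Suc m" "T <= m"
  using big_While_True.hyps big_While_True.prems by (cases n) auto
 have r: "run n (While e cs # C, M, t) = run m (cs @ While e cs # C, M, t + acost e M)"
  using big_While_True.hyps(1) by (simp add: m bind_return_pmf del: fun_upd_apply)
 have "K = [] \<and> t' <= t + T'" if "(K, M', t') \<in> set_pmf (run n (While e cs # C, M, t))" for K M' t'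
 proof -
  have "K = [] \<and> t' <= t + acost e M + T"
   using conjunct2[OF big_While_True.IH[OF m(2)]] that unfolding r by blast
  then show ?thesis using big_While_True.hyps by linarith
 qed
 then show ?case unfolding r using conjunct1[OF big_While_True.IH[OF m(2)]] by blast
next
 case (big_While_False e M C D T T' cs)
 have "acost e M \<ge> 1" by (rule acost_pos)
 then obtain m where m: "n = Suc m" "T <= m"
  using big_While_False.hyps big_While_False.prems by (cases n) auto
 have r: "run n (While e cs # C, M, t) = run m (C, M, t + acost e M)"
  using big_While_False.hyps(1) by (simp add: m bind_return_pmf del: fun_upd_apply)
 have "K = [] \<and> t' <= t + T'" if "(K, M', t') \<in> set_pmf (run n (While e cs # C, M, t))" for K M' t'
 proof -
  have "K = [] \<and> t' <= t + acost e M + T"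
   using conjunct2[OF big_While_False.IH[OF m(2)]] that unfolding r by blast
  then show ?thesis using big_While_False.hyps by linarith
 qed
 then show ?case unfolding r using conjunct1[OF big_While_False.IH[OF m(2)]] by blast
qed

lemma big_mono: "big C M D T ==> T <= T' ==> big C M D T'"
proof (induction arbitrary: T' rule: big.induct)
 case (big_Nil M T)
 show ?case by (rule big.big_Nil)
next
 case (big_Store C M a e D T T'')
 show ?case by (rule big.big_Store[OF big_Store.hyps(1)]) (use big_Store in simp)
next
 case (big_Flip C M a D T T'')
 show ?case by (rule big.big_Flip[OF big_Flip.hyps(1)]) (use big_Flip in simp)
next
 case (big_While_True e M cs C D T T'')
 show ?case
  by (rule big.big_While_True[OF big_While_True.hyps(1,2)]) (use big_While_True in simp)
next
 case (big_While_False e M C D T T'' cs)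
 show ?case
  by (rule big.big_While_False[OF big_While_False.hyps(1,2)]) (use big_While_False in simp)
qed

text \<open>The rules of \<open>big\<close> carry the list of remaining commands along, so
  sequential composition has to be derived, by induction on the first program. One bound
  \<open>T2\<close> must serve all memories that the first program can reach.\<close>

lemma big_append:
 assumes "big C1 M D1 T1" "!!M'. M' \<in> set_pmf D1 ==> big C2 M' (D2 M') T2"
 shows "big (C1 @ C2) M (bind_pmf D1 D2) (T1 + T2)"
 using assms
proof (induction arbitrary: T2 rule: big.induct)
 case (big_Nil M T)
 have "big C2 M (D2 M) T2" by (rule big_Nil.prems) simp
 then have "big C2 M (D2 M) (T + T2)" by (rule big_mono) simp
 then show ?case by (simp add: bind_return_pmf)
next
 case (big_Store C M a e D T T')
 have "big (C @ C2) (M(aval a M := aval e M)) (bind_pmf D D2) (T + T2)"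
  by (rule big_Store.IH) (rule big_Store.prems)
 from big.big_Store[OF this, of "T' + T2"] show ?case using big_Store.hyps by simp
next
 case (big_Flip C M a D T T')
 have "big (C @ C2) (M(aval a M := of_bool b)) (bind_pmf (D b) D2) (T + T2)" for b
  by (rule big_Flip.IH) (use big_Flip.prems in \<open>auto split: if_splits\<close>)
 from big.big_Flip[OF this, of "T' + T2"] show ?case
  using big_Flip.hyps by (simp add: bind_assoc_pmf)
next
 case (big_While_True e M cs C D T T')
 have "big ((cs @ While e cs # C) @ C2) M (bind_pmf D D2) (T + T2)"
  by (rule big_While_True.IH) (rule big_While_True.prems)
 then have "big (cs @ While e cs # (C @ C2)) M (bind_pmf D D2) (T + T2)" by simp
 from big.big_While_True[OF big_While_True.hyps(1) this, of "T' + T2"] show ?case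
  using big_While_True.hyps by simp
next
 case (big_While_False e M C D T T' cs)
 have "big (C @ C2) M (bind_pmf D D2) (T + T2)"
  by (rule big_While_False.IH) (rule big_While_False.prems)
 from big.big_While_False[OF big_While_False.hyps(1) this, of "T' + T2"] show ?case
  using big_While_False.hyps by simp
qed

lemma big_append_det:
 assumes "big C1 M (return_pmf M') T1" "big C2 M' D T2"
 shows "big (C1 @ C2) M D (T1 + T2)"
 using big_append[OF assms(1), of C2 "%_. D" T2] assms(2) by (simp add: bind_return_pmf)

section \<open>A language of bounded loops over arrays and its compiler\<close>

text \<open>The first argument is the number of an array, the second the index of a cell; arrays
  have no length. An \<open>env\<close> holds the values of the loop variables.\<close>

type_synonym st = "nat => nat => nat"
type_synonym env = "nat => nat"

datatype arith_op = PLUS | MINUS | TIMES | DIVIDE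
datatype iter_kind = ISum | IProd | IFind

datatype exp =
  Num nat
 | Var nat
 | Rd nat exp
 | Op arith_op exp exp
 | Iter iter_kind nat exp exp

fun op_val :: "arith_op => nat => nat => nat" where
 "op_val PLUS x y = x + y"
| "op_val MINUS x y = x - y"
| "op_val TIMES x y = x * y"
| "op_val DIVIDE x y = x div y"

fun it_init :: "iter_kind => nat" where
 "it_init IProd = 1"
| "it_init _ = 0"

text \<open>The search works without branching. As long as nothing is found the accumulator equals
  \<open>v\<close>, the factor \<open>1 - (v - acc)\<close> is 1, and a zero test value moves the
  accumulator to \<open>v + 1\<close>. After a hit it stays behind \<open>v\<close> and truncated
  subtraction turns the factor into 0. The outcome is the first hit, or the count if there is
  none.\<close>

fun it_step :: "iter_kind => nat => nat => nat => nat" where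
 "it_step ISum acc v y = acc + y"
| "it_step IProd acc v y = acc * y"
| "it_step IFind acc v y = acc + (1 - (v - acc)) * (1 - y)"

primrec it_val :: "iter_kind => (nat => nat) => nat => nat" where
 "it_val k f 0 = it_init k"
| "it_val k f (Suc v) = it_step k (it_val k f v) v (f v)"

primrec eval :: "exp => st => env => nat" where
 "eval (Num k) \<sigma> \<rho> = k"
| "eval (Var x) \<sigma> \<rho> = \<rho> x"
| "eval (Rd a e) \<sigma> \<rho> = \<sigma> a (eval e \<sigma> \<rho>)"
| "eval (Op p a b) \<sigma> \<rho> = op_val p (eval a \<sigma> \<rho>) (eval b \<sigma> \<rho>)"
| "eval (Iter k x n e) \<sigma> \<rho> = it_val k (%v. eval e \<sigma> (\<rho>(x := v))) (eval n \<sigma> \<rho>)"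

datatype cmd =
  Wr nat exp exp
 | Rnd nat exp exp
 | Seq cmd cmd
 | For nat exp cmd

primrec for_loop :: "(nat => st => st pmf) => nat => nat => st => st pmf" where
 "for_loop f 0 i \<sigma> = return_pmf \<sigma>"
| "for_loop f (Suc k) i \<sigma> = bind_pmf (f i \<sigma>) (for_loop f k (Suc i))"

definition wr :: "st => nat => nat => nat => st" where
 "wr \<sigma> a k v = \<sigma>(a := (\<sigma> a)(k := v))"

primrec exec :: "cmd => env => st => st pmf" where
 "exec (Wr a i e) \<rho> \<sigma> = return_pmf (wr \<sigma> a (eval i \<sigma> \<rho>) (eval e \<sigma> \<rho>))"
| "exec (Rnd a i k) \<rho> \<sigma> =
   map_pmf (%u. wr \<sigma> a (eval i \<sigma> \<rho>) u) (pmf_of_set {..<2 ^ eval k \<sigma> \<rho>})"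
| "exec (Seq p q) \<rho> \<sigma> = bind_pmf (exec p \<rho> \<sigma>) (exec q \<rho>)"
| "exec (For x n p) \<rho> \<sigma> = for_loop (%v. exec p (\<rho>(x := v))) (eval n \<sigma> \<rho>) 0 \<sigma>"

definition radr :: "nat => aexp" where
 "radr r = Add (Mem (Const 0)) (Const r)"

text \<open>Cell 0 holds the base pointer \<open>b\<close>, the length of the input. Array 0 is the
  input itself, left in place; the nested truncated subtractions clip the index at
  \<open>b - 1\<close>, so that it cannot run into the registers. The other arrays are interleaved
  with stride 50 above the 100 registers, so all of them can grow without bound.\<close>

definition aadr :: "nat => aexp => aexp" where
 "aadr a x = (if a = 0 then Sub (Sub (Mem (Const 0)) (Const 1)) (Sub (Sub (Mem (Const 0)) (Const 1)) x)
   else Add (Mem (Const 0)) (Add (Const (100 + a)) (Mul (Const 50) x)))"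

fun op_aexp :: "arith_op => aexp => aexp => aexp" where
 "op_aexp PLUS = Add"
| "op_aexp MINUS = Sub"
| "op_aexp TIMES = Mul"
| "op_aexp DIVIDE = Div"

fun step_aexp :: "iter_kind => aexp => aexp => aexp => aexp" where
 "step_aexp ISum acc v y = Add acc y"
| "step_aexp IProd acc v y = Mul acc y"
| "step_aexp IFind acc v y = Add acc (Mul (Sub (Const 1) (Sub v acc)) (Sub (Const 1) y))"

text \<open>The registers from \<open>d\<close> on form an evaluation stack with the result in
  register \<open>d\<close>; loop variable \<open>x\<close> lives in register \<open>x\<close>,
  below the stack.\<close>

primrec comp :: "exp => nat => com list" where
 "comp (Num k) d = [Store (radr d) (Const k)]"
| "comp (Var x) d = [Store (radr d) (Mem (radr x))]"
| "comp (Rd a e) d = comp e d @ [Store (radr d) (Mem (aadr a (Mem (radr d))))]"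
| "comp (Op p a b) d = comp a d @ comp b (d + 1) @
   [Store (radr d) (op_aexp p (Mem (radr d)) (Mem (radr (d + 1))))]"
| "comp (Iter k x n e) d = comp n d @
   [Store (radr (d + 1)) (Const (it_init k)), Store (radr x) (Const 0)] @
   [While (Sub (Mem (radr d)) (Mem (radr x)))
    (comp e (d + 2) @
     [Store (radr (d + 1)) (step_aexp k (Mem (radr (d + 1))) (Mem (radr x)) (Mem (radr (d + 2)))),
     Store (radr x) (Add (Mem (radr x)) (Const 1))])] @
   [Store (radr d) (Mem (radr (d + 1)))]"

primrec ccomp :: "cmd => nat => com list" where
 "ccomp (Wr a i e) d = comp i d @ comp e (d + 1) @
   [Store (aadr a (Mem (radr d))) (Mem (radr (d + 1)))]"
| "ccomp (Rnd a i k) d = comp i d @ comp k (d + 1) @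
   [Store (radr (d + 2)) (Const 0)] @
   [While (Mem (radr (d + 1)))
    [Flip (radr (d + 3)),
     Store (radr (d + 2)) (Add (Mul (Const 2) (Mem (radr (d + 2)))) (Mem (radr (d + 3)))),
     Store (radr (d + 1)) (Sub (Mem (radr (d + 1))) (Const 1))]] @
   [Store (aadr a (Mem (radr d))) (Mem (radr (d + 2)))]"
| "ccomp (Seq p q) d = ccomp p d @ ccomp q d"
| "ccomp (For x n p) d = comp n d @ [Store (radr x) (Const 0)] @
   [While (Sub (Mem (radr d)) (Mem (radr x)))
    (ccomp p (d + 1) @ [Store (radr x) (Add (Mem (radr x)) (Const 1))])]"

text \<open>Registers below 30 hold the bound variables, the others are temporaries.\<close>

primrec wf_exp :: "nat list => exp => nat => bool" where
 "wf_exp \<Gamma> (Num k) d \<longleftrightarrow> d < 100"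
| "wf_exp \<Gamma> (Var x) d \<longleftrightarrow> x \<in> set \<Gamma> \<and> d < 100"
| "wf_exp \<Gamma> (Rd a e) d \<longleftrightarrow> a < 50 \<and> wf_exp \<Gamma> e d \<and> d < 100"
| "wf_exp \<Gamma> (Op p a b) d \<longleftrightarrow> wf_exp \<Gamma> a d \<and> wf_exp \<Gamma> b (d + 1) \<and> d < 99"
| "wf_exp \<Gamma> (Iter k x n e) d \<longleftrightarrow>
   x \<notin> set \<Gamma> \<and> x < 30 \<and> wf_exp \<Gamma> n d \<and> wf_exp (x # \<Gamma>) e (d + 2) \<and> d < 98"

primrec wf_cmd :: "nat list => cmd => nat => bool" where
 "wf_cmd \<Gamma> (Wr a i e) d \<longleftrightarrow> 0 < a \<and> a < 50 \<and> wf_exp \<Gamma> i d \<and> wf_exp \<Gamma> e (d + 1) \<and> d < 99"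
| "wf_cmd \<Gamma> (Rnd a i k) d \<longleftrightarrow> 0 < a \<and> a < 50 \<and> wf_exp \<Gamma> i d \<and> wf_exp \<Gamma> k (d + 1) \<and> d < 97"
| "wf_cmd \<Gamma> (Seq p q) d \<longleftrightarrow> wf_cmd \<Gamma> p d \<and> wf_cmd \<Gamma> q d"
| "wf_cmd \<Gamma> (For x n p) d \<longleftrightarrow>
   x \<notin> set \<Gamma> \<and> x < 30 \<and> wf_exp \<Gamma> n d \<and> wf_cmd (x # \<Gamma>) p (d + 1) \<and> d < 98"

section \<open>Memory layout, and bounds on values and on the cost of expressions\<close>

definition adr :: "nat => nat => nat => nat" where
 "adr b a k = (if a = 0 then min k (b - 1) else b + (100 + a + 50 * k))"

text \<open>The guard keeps the arrays disjoint: only for numbers below 50 does the residue of an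
  address modulo 50 determine the array.\<close>

definition absm :: "nat => mem => st" where
 "absm b M = (%a k. if a < 50 then M (adr b a k) else 0)"

fun it_bd :: "iter_kind => nat => nat => nat" where
 "it_bd ISum m y = m * y"
| "it_bd IProd m y = (y + 1) ^ m"
| "it_bd IFind m y = m"

text \<open>A truncated difference or a quotient is bounded by its first operand alone. The program
  exploits this: what is large, or depends on the array about to be written, is placed to the right
  of a subtraction.\<close>

fun op_bd :: "arith_op => nat => nat => nat" where
 "op_bd PLUS x y = x + y"
| "op_bd TIMES x y = x * y"
| "op_bd _ x y = x"

primrec ebd :: "exp => (nat => nat) => env => nat" where
 "ebd (Num k) B \<beta> = k"
| "ebd (Var x) B \<beta> = \<beta> x"
| "ebd (Rd a e) B \<beta> = B a"
| "ebd (Op p a b) B \<beta> = op_bd p (ebd a B \<beta>) (ebd b B \<beta>)"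
| "ebd (Iter k x n e) B \<beta> = it_bd k (ebd n B \<beta>) (ebd e B (\<beta>(x := ebd n B \<beta>)))"

lemma it_val_IFind_le: "it_val IFind f m <= m"
proof (induction m)
 case (Suc m)
 show ?case
 proof (cases "it_val IFind f m = m")
  case True
  then show ?thesis by (cases "f m") simp_all
 next
  case False
  then have "it_val IFind f m < m" using Suc by simp
  then show ?thesis by simp
 qed
qed simp

lemma it_val_IFind: "it_val IFind f m = (if \<exists>v<m. f v \<noteq> 0 then LEAST v. f v \<noteq> 0 else m)"
proof (induction m)
 case (Suc m)
 show ?case
 proof (cases "\<exists>v<m. f v \<noteq> 0")
  case True
  then obtain v where v: "v < m" "f v \<noteq> 0" by blast
  then have l: "(LEAST v. f v \<noteq> 0) < m" by (meson Least_le le_less_trans)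
  have e: "it_val IFind f m = (LEAST v. f v \<noteq> 0)" using Suc True by simp
  have "\<exists>v<Suc m. f v \<noteq> 0" using v less_SucI by blast
  then show ?thesis using l by (simp only: it_val.simps it_step.simps e if_True) simp
 next
  case False
  have e: "it_val IFind f m = m" unfolding Suc using False by (simp only: if_False)
  show ?thesis
  proof (cases "f m = 0")
   case True
   have "\<not> (\<exists>v<Suc m. f v \<noteq> 0)" using True False less_Suc_eq by metis
   then show ?thesis using True by (simp only: it_val.simps it_step.simps e if_False) simp
  next
   case nz: False
   have "(LEAST v. f v \<noteq> 0) = m" using nz False
    by (intro Least_equality) (meson not_le)+
   moreover have "\<exists>v<Suc m. f v \<noteq> 0" using nz by blast
   ultimately show ?thesis using nz by (simp only: it_val.simps it_step.simps e if_True) simp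
  qed
 qed
qed simp

lemma it_val_ISum [simp]: "it_val ISum f m = (\<Sum>v<m. f v)"
 by (induction m) auto

lemma it_val_IProd [simp]: "it_val IProd f m = (\<Prod>v<m. f v)"
 by (induction m) auto

lemma it_val_le:
 assumes "i <= m" "m <= m'" "!!v. v < m ==> f v <= y"
 shows "it_val k f i <= it_bd k m' y"
proof (cases k)
 case ISum
 have "(\<Sum>v<i. f v) <= (\<Sum>v<i. y)" using assms by (intro sum_mono) auto
 also have "\<dots> <= m' * y" using assms by simp
 finally show ?thesis using ISum by simp
next
 case IProd
 have "(\<Prod>v<i. f v) <= (\<Prod>v<i. y + 1)" using assms by (intro prod_mono) (auto intro: le_SucI)
 also have "\<dots> <= (y + 1) ^ m'" using assms by (simp add: power_increasing del: power_Suc)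
 finally show ?thesis using IProd by simp
next
 case IFind
 show ?thesis using it_val_IFind_le[of f i] IFind assms by simp
qed

lemma eval_le_ebd:
 assumes "!!a k. \<sigma> a k <= B a" "!!x. \<rho> x <= \<beta> x"
 shows "eval e \<sigma> \<rho> <= ebd e B \<beta>"
 using assms(2)
proof (induction e arbitrary: \<rho> \<beta>)
 case (Op p a b)
 have "eval a \<sigma> \<rho> <= ebd a B \<beta>" "eval b \<sigma> \<rho> <= ebd b B \<beta>" using Op by auto
 then show ?case
  by (cases p) (auto intro: add_mono mult_mono order.trans[OF diff_le_self] order.trans[OF div_le_dividend])
next
 case (Iter k x n e)
 have n: "eval n \<sigma> \<rho> <= ebd n B \<beta>" using Iter by auto
 show ?case unfolding eval.simps ebd.simps
 proof (rule it_val_le[OF order.refl n])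
  fix v assume "v < eval n \<sigma> \<rho>"
  then show "eval e \<sigma> (\<rho>(x := v)) <= ebd e B (\<beta>(x := ebd n B \<beta>))"
   using n Iter.prems by (intro Iter.IH) (auto intro: order.trans)
 qed
qed (use assms(1) in auto)

definition same :: "nat => nat list => nat => mem => mem => bool" where
 "same b \<Gamma> d M M' \<longleftrightarrow> (\<forall>c. (\<forall>r<100. c \<noteq> b + r) \<longrightarrow> M' c = M c) \<and>
   (\<forall>x\<in>set \<Gamma>. M' (b + x) = M (b + x)) \<and> (\<forall>r. 30 <= r \<and> r < d \<longrightarrow> M' (b + r) = M (b + r))"

lemma same_refl: "same b \<Gamma> d M M"
 by (simp add: same_def)

lemma same_trans: "same b \<Gamma> d M M' ==> same b \<Gamma> d M' M'' ==> same b \<Gamma> d M M''"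
 by (simp add: same_def)

lemma same_weaken: "same b \<Gamma>' d' M M' ==> set \<Gamma> \<subseteq> set \<Gamma>' ==> d <= d' ==> same b \<Gamma> d M M'"
 unfolding same_def by auto

lemma same_upd:
 assumes "r < 100" "d <= r \<or> r < 30" "r \<notin> set \<Gamma>"
 shows "same b \<Gamma> d M (M(b + r := v))"
 using assms by (auto simp: same_def)

lemma same_base: "same b \<Gamma> d M M' ==> 0 < b ==> M' 0 = M 0"
 by (simp add: same_def)

lemma same_absm: "same b \<Gamma> d M M' ==> 0 < b ==> absm b M' = absm b M"
proof (intro ext)
 fix a k assume s: "same b \<Gamma> d M M'" and b: "0 < b"
 have "\<forall>r<100. adr b a k \<noteq> b + r" using b by (auto simp: adr_def min_def)
 then show "absm b M' a k = absm b M a k" using s unfolding same_def absm_def by simp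
qed

lemma bit_length_mono: "x <= y ==> bit_length x <= bit_length y"
 unfolding bit_length_def by (intro max.mono floorlog_mono) auto

text \<open>Bounds all values that occur during the evaluation, while \<open>ebd\<close> bounds the
  result only: a difference can be small although its operands are large, and the machine pays for
  the operands as well.\<close>

primrec vE :: "exp => (nat => nat) => env => nat" where
 "vE (Num k) B \<beta> = k"
| "vE (Var x) B \<beta> = \<beta> x"
| "vE (Rd a e) B \<beta> = vE e B \<beta> + B a"
| "vE (Op p a b) B \<beta> = vE a B \<beta> + vE b B \<beta> + op_bd p (ebd a B \<beta>) (ebd b B \<beta>)"
| "vE (Iter k x n e) B \<beta> = 1 + vE n B \<beta> + vE e B (\<beta>(x := ebd n B \<beta>)) +
   it_bd k (ebd n B \<beta>) (ebd e B (\<beta>(x := ebd n B \<beta>)))"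

text \<open>\<open>60 * L\<close> is the price of one compiled store (\<open>big_StoreR\<close>),
  where \<open>L\<close> is a bit length exceeded by no address and no value.\<close>

primrec tE :: "exp => (nat => nat) => env => nat => nat" where
 "tE (Num k) B \<beta> L = 60 * L"
| "tE (Var x) B \<beta> L = 60 * L"
| "tE (Rd a e) B \<beta> L = tE e B \<beta> L + 60 * L"
| "tE (Op p a b) B \<beta> L = tE a B \<beta> L + tE b B \<beta> L + 60 * L"
| "tE (Iter k x n e) B \<beta> L = tE n B \<beta> L + 240 * L +
   ebd n B \<beta> * (tE e B (\<beta>(x := ebd n B \<beta>)) L + 180 * L)"

lemma ebd_le_vE: "ebd e B \<beta> <= vE e B \<beta>"
 by (cases e) auto

lemma aval_radr [simp]: "aval (radr r) M = M 0 + r"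
 by (simp add: radr_def)

lemma aval_aadr [simp]: "aval (aadr a x) M = adr (M 0) a (aval x M)"
 by (auto simp: aadr_def adr_def)

lemma aval_op_aexp [simp]: "aval (op_aexp p x y) M = op_val p (aval x M) (aval y M)"
 by (cases p) auto

lemma aval_step_aexp [simp]:
 "aval (step_aexp k x v y) M = it_step k (aval x M) (aval v M) (aval y M)"
 by (cases k) auto

context
 fixes b v L :: nat
 assumes L: "bit_length (b + 300 + 50 * v) <= L"
begin

text \<open>A cell with index at most \<open>v\<close> has an address below
  \<open>b + 300 + 50 * v\<close>, so a single length \<open>L\<close> covers addresses, constants
  and values.\<close>

lemma bl: "c <= b + 300 + 50 * v ==> bit_length c <= L"
 using L bit_length_mono order.trans by blast

lemma L_pos: "1 <= L"
 using L bit_length_pos order.trans by blast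

lemma acost_radr: "M 0 = b ==> r < 100 ==> acost (radr r) M <= 4 * L"
 using bl[of 0] bl[of b] bl[of r] bl[of "b + r"] by (simp add: radr_def)

lemma acost_reg: "M 0 = b ==> r < 100 ==> M (b + r) <= v ==> acost (Mem (radr r)) M <= 5 * L"
 using acost_radr[of M r] bl[of "M (b + r)"] by simp

lemma acost_aadr:
 assumes "M 0 = b" "a < 50" "acost x M <= 5 * L" "aval x M <= v"
 shows "acost (aadr a x) M <= 20 * L"
proof -
 have "bit_length 0 <= L" "bit_length b <= L" "bit_length (Suc 0) <= L" "bit_length (b - Suc 0) <= L"
  "bit_length (b - Suc 0 - aval x M) <= L" "bit_length (b - Suc 0 - (b - Suc 0 - aval x M)) <= L"
  "bit_length (100 + a) <= L" "bit_length 50 <= L" "bit_length (50 * aval x M) <= L"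
  "bit_length (100 + a + 50 * aval x M) <= L" "bit_length (b + (100 + a + 50 * aval x M)) <= L"
  using assms by (auto intro!: bl)
 then show ?thesis using assms by (auto simp: aadr_def)
qed

lemma acost_op:
 assumes "acost x M <= 5 * L" "acost y M <= 5 * L" "op_val p (aval x M) (aval y M) <= v"
 shows "acost (op_aexp p x y) M <= 20 * L"
 using assms bl[of "op_val p (aval x M) (aval y M)"] by (cases p) auto

lemma acost_step:
 assumes "acost x M <= 5 * L" "acost y M <= 5 * L" "acost z M <= 5 * L"
  "aval x M <= v" "aval z M <= v" "it_step k (aval x M) (aval z M) (aval y M) <= v"
 shows "acost (step_aexp k x z y) M <= 40 * L"
proof -
 have "bit_length (it_step k (aval x M) (aval z M) (aval y M)) <= L" "bit_length (aval z M - aval x M) <= L"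
  "bit_length (Suc 0) <= L" "bit_length (Suc 0 - (aval z M - aval x M)) <= L"
  "bit_length (Suc 0 - aval y M) <= L"
  "bit_length ((Suc 0 - (aval z M - aval x M)) * (Suc 0 - aval y M)) <= L"
  using assms mult_le_mono[of "Suc 0 - (aval z M - aval x M)" 1 "Suc 0 - aval y M" 1]
  by (auto intro!: bl)
 then show ?thesis using assms by (cases k) auto
qed

lemma acost_incr:
 assumes "M 0 = b" "M (b + x) = i" "x < 100" "acost (Mem (radr x)) M <= 5 * L" "bit_length (Suc i) <= L"
 shows "acost (Add (Mem (radr x)) (Const 1)) M <= 50 * L"
 using assms bl[of "Suc 0"] by simp

lemma big_StoreR:
 assumes "M 0 = b" "r < 100" "acost e M <= 50 * L" "big C (M(b + r := aval e M)) D T"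
 shows "big (Store (radr r) e # C) M D (60 * L + T)"
proof -
 have "acost (radr r) M + acost e M + T <= 60 * L + T"
  using acost_radr[of M r] assms by linarith
 moreover have "aval (radr r) M = b + r" using assms(1) by simp
 ultimately show ?thesis using assms(4) big_Store by metis
qed

end

text \<open>The induction generalises over scope, stack height, memory and environment, because a
  loop body runs higher on the stack and with one more variable in scope. The bounds
  \<open>B\<close> can stay fixed: evaluating an expression touches registers only
  (\<open>same_absm\<close>).\<close>

lemma comp_correct:
 assumes "M 0 = b" "0 < b" "wf_exp \<Gamma> e d" "set \<Gamma> \<subseteq> {..<30}" "30 <= d"
  "!!x. x \<in> set \<Gamma> ==> M (b + x) = \<rho> x" "!!a k. absm b M a k <= B a" "!!x. \<rho> x <= \<beta> x"
  "bit_length (b + 300 + 50 * vE e B \<beta>) <= L"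
 shows "\<exists>M'. big (comp e d) M (return_pmf M') (tE e B \<beta> L) \<and>
  M' (b + d) = eval e (absm b M) \<rho> \<and> same b \<Gamma> d M M'"
 using assms
proof (induction e arbitrary: \<Gamma> d M \<rho> \<beta>)
 case (Num k)
 note L = Num.prems(9)
 have "big (comp (Num k) d) M (return_pmf (M(b + d := k))) (60 * L + 0)"
  unfolding comp.simps
  using Num.prems bl[OF L, of k] by (intro big_StoreR[OF L]) (auto simp: big_Nil)
 moreover have "same b \<Gamma> d M (M(b + d := k))" using Num.prems by (intro same_upd) auto
 moreover have "(M(b + d := k)) (b + d) = eval (Num k) (absm b M) \<rho>" by simp
 ultimately show ?case unfolding tE.simps add_0_right by blast
next
 case (Var x)
 note L = Var.prems(9)
 have x: "x \<in> set \<Gamma>" "x < 30" "M (b + x) = \<rho> x" "\<rho> x <= \<beta> x" using Var.prems by auto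
 have "acost (Mem (radr x)) M <= 5 * L" using x Var.prems by (intro acost_reg[OF L]) auto
 then have "big (comp (Var x) d) M (return_pmf (M(b + d := \<rho> x))) (60 * L + 0)"
  unfolding comp.simps
  using Var.prems x by (intro big_StoreR[OF L]) (auto simp: big_Nil)
 moreover have "same b \<Gamma> d M (M(b + d := \<rho> x))" using Var.prems by (intro same_upd) auto
 moreover have "(M(b + d := \<rho> x)) (b + d) = eval (Var x) (absm b M) \<rho>" by simp
 ultimately show ?case unfolding tE.simps add_0_right by blast
next
 case (Rd a e)
 note L = Rd.prems(9)
 have "bit_length (b + 300 + 50 * vE e B \<beta>) <= L"
  using bl[OF L, of "b + 300 + 50 * vE e B \<beta>"] by simp
 then obtain M1 where M1: "big (comp e d) M (return_pmf M1) (tE e B \<beta> L)"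
  "M1 (b + d) = eval e (absm b M) \<rho>" "same b \<Gamma> d M M1"
  using Rd.IH[of M \<Gamma> d \<rho> \<beta>] Rd.prems by auto
 have base: "M1 0 = b" using M1(3) Rd.prems by (simp add: same_base)
 have ab: "absm b M1 = absm b M" using M1(3) Rd.prems by (simp add: same_absm)
 let ?x = "eval e (absm b M) \<rho>"
 have xv: "?x <= vE e B \<beta>"
  using eval_le_ebd[of "absm b M" B \<rho> \<beta> e] Rd.prems ebd_le_vE[of e B \<beta>] by (meson order.trans)
 have val: "M1 (adr b a ?x) = absm b M a ?x" using ab Rd.prems(3) by (metis absm_def wf_exp.simps(3))
 have d: "d < 100" using Rd.prems by simp
 have c1: "acost (Mem (radr d)) M1 <= 5 * L" using base d M1(2) xv by (intro acost_reg[OF L]) auto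
 have c2: "acost (aadr a (Mem (radr d))) M1 <= 20 * L"
  using base d M1(2) xv Rd.prems c1 by (intro acost_aadr[OF L]) auto
 have c3: "bit_length (absm b M a ?x) <= L"
  using Rd.prems(7)[of a ?x] by (intro bl[OF L]) auto
 have "big [Store (radr d) (Mem (aadr a (Mem (radr d))))] M1
   (return_pmf (M1(b + d := absm b M a ?x))) (60 * L + 0)"
  using c2 c3 val base d M1(2) by (intro big_StoreR[OF L]) (auto simp: big_Nil)
 from big_append_det[OF M1(1) this]
 have "big (comp (Rd a e) d) M (return_pmf (M1(b + d := absm b M a ?x))) (tE (Rd a e) B \<beta> L)"
  by simp
 moreover have "same b \<Gamma> d M (M1(b + d := absm b M a ?x))"
  using Rd.prems d by (intro same_trans[OF M1(3)] same_upd) auto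
 moreover have "(M1(b + d := absm b M a ?x)) (b + d) = eval (Rd a e) (absm b M) \<rho>" by simp
 ultimately show ?case by blast
next
 case (Op p e1 e2)
 note L = Op.prems(9)
 let ?\<sigma> = "absm b M"
 have L1: "bit_length (b + 300 + 50 * vE e1 B \<beta>) <= L" "bit_length (b + 300 + 50 * vE e2 B \<beta>) <= L"
  by (intro bl[OF L]; simp)+
 obtain M1 where M1: "big (comp e1 d) M (return_pmf M1) (tE e1 B \<beta> L)"
  "M1 (b + d) = eval e1 ?\<sigma> \<rho>" "same b \<Gamma> d M M1"
  using Op.IH(1)[of M \<Gamma> d \<rho> \<beta>] Op.prems L1 by auto
 have base: "M1 0 = b" using M1(3) Op.prems by (simp add: same_base)
 have ab: "absm b M1 = ?\<sigma>" using M1(3) Op.prems by (simp add: same_absm)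
 have "!!x. x \<in> set \<Gamma> ==> M1 (b + x) = \<rho> x" using M1(3) Op.prems by (simp add: same_def)
 then obtain M2 where M2: "big (comp e2 (d + 1)) M1 (return_pmf M2) (tE e2 B \<beta> L)"
  "M2 (b + (d + 1)) = eval e2 ?\<sigma> \<rho>" "same b \<Gamma> (d + 1) M1 M2"
  using Op.IH(2)[of M1 \<Gamma> "d + 1" \<rho> \<beta>] Op.prems L1 ab base by auto
 have base2: "M2 0 = b" using M2(3) base Op.prems by (simp add: same_base)
 have M2d: "M2 (b + d) = eval e1 ?\<sigma> \<rho>" using M2(3) M1(2) Op.prems by (simp add: same_def)
 have v1: "eval e1 ?\<sigma> \<rho> <= vE e1 B \<beta>" "eval e2 ?\<sigma> \<rho> <= vE e2 B \<beta>"
  using eval_le_ebd[of ?\<sigma> B \<rho> \<beta>] Op.prems ebd_le_vE by (meson order.trans)+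
 have v2: "op_val p (eval e1 ?\<sigma> \<rho>) (eval e2 ?\<sigma> \<rho>) <= op_bd p (ebd e1 B \<beta>) (ebd e2 B \<beta>)"
  using eval_le_ebd[of ?\<sigma> B \<rho> \<beta> "Op p e1 e2"] Op.prems by simp
 have d: "d < 100" "d + 1 < 100" using Op.prems by simp_all
 have c1: "acost (Mem (radr d)) M2 <= 5 * L" using base2 d M2d v1 by (intro acost_reg[OF L]) auto
 have c2: "acost (Mem (radr (d + 1))) M2 <= 5 * L"
  using base2 d M2(2) v1 by (intro acost_reg[OF L]) auto
 have c3: "acost (op_aexp p (Mem (radr d)) (Mem (radr (d + 1)))) M2 <= 20 * L"
  using c1 c2 v2 base2 M2d M2(2) by (intro acost_op[OF L]) auto
 let ?M3 = "M2(b + d := op_val p (eval e1 ?\<sigma> \<rho>) (eval e2 ?\<sigma> \<rho>))"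
 have "big [Store (radr d) (op_aexp p (Mem (radr d)) (Mem (radr (d + 1))))] M2
   (return_pmf ?M3) (60 * L + 0)"
  using c3 base2 d M2d M2(2) by (intro big_StoreR[OF L]) (auto simp: big_Nil)
 from big_append_det[OF M1(1) big_append_det[OF M2(1) this]]
 have "big (comp (Op p e1 e2) d) M (return_pmf ?M3) (tE (Op p e1 e2) B \<beta> L)"
  by (simp add: add.assoc)
 moreover have "same b \<Gamma> d M ?M3"
  using Op.prems d by (intro same_trans[OF M1(3)] same_trans[OF same_weaken[OF M2(3)]] same_upd) auto
 moreover have "?M3 (b + d) = eval (Op p e1 e2) ?\<sigma> \<rho>" by simp
 ultimately show ?case by blast
next
 case (Iter k x n e)
 note L = Iter.prems(9)
 let ?\<sigma> = "absm b M"
 let ?\<beta> = "\<beta>(x := ebd n B \<beta>)"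
 have d: "d < 98" "x < 30" "x \<notin> set \<Gamma>" "30 <= d" using Iter.prems by auto
 have nd: "d \<notin> set \<Gamma>" "d + 1 \<notin> set \<Gamma>" using Iter.prems(4) d by auto
 have L1: "bit_length (b + 300 + 50 * vE n B \<beta>) <= L" "bit_length (b + 300 + 50 * vE e B ?\<beta>) <= L"
  by (intro bl[OF L]; simp)+
 obtain M1 where M1: "big (comp n d) M (return_pmf M1) (tE n B \<beta> L)"
  "M1 (b + d) = eval n ?\<sigma> \<rho>" "same b \<Gamma> d M M1"
  using Iter.IH(1)[of M \<Gamma> d \<rho> \<beta>] Iter.prems L1 by auto
 have base: "M1 0 = b" using M1(3) Iter.prems by (simp add: same_base)
 define m where "m = eval n ?\<sigma> \<rho>"
 define f where "f i = eval e ?\<sigma> (\<rho>(x := i))" for i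
 have mle: "m <= ebd n B \<beta>" unfolding m_def
  using eval_le_ebd[of ?\<sigma> B \<rho> \<beta> n] Iter.prems by blast
 have fle: "f i <= ebd e B ?\<beta>" if "i <= m" for i unfolding f_def
  using that mle Iter.prems by (intro eval_le_ebd) (auto intro: order.trans)
 have itle: "it_val k f i <= it_bd k (ebd n B \<beta>) (ebd e B ?\<beta>)" if "i <= m" for i
  using that fle mle by (intro it_val_le[of i m]) auto
 have mv: "m <= vE n B \<beta>" using mle ebd_le_vE order.trans by blast
 define W where "W = While (Sub (Mem (radr d)) (Mem (radr x)))
    (comp e (d + 2) @
     [Store (radr (d + 1)) (step_aexp k (Mem (radr (d + 1))) (Mem (radr x)) (Mem (radr (d + 2)))),
     Store (radr x) (Add (Mem (radr x)) (Const 1))])"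
 \<comment> \<open>Induction on the number \<open>m - i\<close> of rounds left. The store that
   follows the loop is included, as \<open>big\<close> speaks about the whole rest of the
   program.\<close>
 have loop: "\<exists>M'. big (W # [Store (radr d) (Mem (radr (d + 1)))]) Mi (return_pmf M')
    ((m - i) * (tE e B ?\<beta> L + 180 * L) + 120 * L) \<and>
   M' (b + d) = it_val k f m \<and> same b \<Gamma> d M M'"
  if "i <= m" "Mi (b + d) = m" "Mi (b + x) = i" "Mi (b + (d + 1)) = it_val k f i" "same b \<Gamma> d M Mi"
  for i Mi
  using that
 proof (induction "m - i" arbitrary: i Mi)
  case 0
  then have im: "i = m" by simp
  have bi: "Mi 0 = b" using 0 Iter.prems by (simp add: same_base)
  have c1: "acost (Mem (radr d)) Mi <= 5 * L" "acost (Mem (radr x)) Mi <= 5 * L"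
   by (rule acost_reg[OF L]; use bi d 0 mv im in simp)+
  have c2: "acost (Mem (radr (d + 1))) Mi <= 5 * L"
   using bi d 0 itle[of i] by (intro acost_reg[OF L]) auto
  have c3: "acost (Sub (Mem (radr d)) (Mem (radr x))) Mi <= 11 * L"
   using c1 0 bl[OF L, of 0] im bi by simp
  let ?M = "Mi(b + d := it_val k f m)"
  have "big [Store (radr d) (Mem (radr (d + 1)))] Mi (return_pmf ?M) (60 * L + 0)"
   using c2 bi d 0 im by (intro big_StoreR[OF L]) (auto simp: big_Nil)
  then have "big (W # [Store (radr d) (Mem (radr (d + 1)))]) Mi (return_pmf ?M)
    ((m - i) * (tE e B ?\<beta> L + 180 * L) + 120 * L)"
   unfolding W_def using c3 0 im bi by (intro big_While_False[where T = "60 * L"]) auto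
  moreover have "same b \<Gamma> d M ?M" using 0 d Iter.prems by (intro same_trans[OF 0(6)] same_upd) auto
  moreover have "?M (b + d) = it_val k f m" by simp
  ultimately show ?case by blast
 next
  case (Suc q)
  then have im: "i < m" by simp
  have bi: "Mi 0 = b" using Suc.prems Iter.prems by (simp add: same_base)
  have ai: "absm b Mi = ?\<sigma>" using Suc.prems Iter.prems by (simp add: same_absm)
  have c1: "acost (Mem (radr d)) Mi <= 5 * L" "acost (Mem (radr x)) Mi <= 5 * L"
   by (rule acost_reg[OF L]; use bi d Suc.prems mv im in simp)+
  have c3: "acost (Sub (Mem (radr d)) (Mem (radr x))) Mi <= 11 * L"
  proof -
   have "bit_length (m - i) <= L" by (rule bl[OF L]) (use mv in simp)
   then show ?thesis using c1 Suc.prems bi by simp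
  qed
  have "\<exists>M'. big (comp e (d + 2)) Mi (return_pmf M') (tE e B ?\<beta> L) \<and>
    M' (b + (d + 2)) = eval e (absm b Mi) (\<rho>(x := i)) \<and> same b (x # \<Gamma>) (d + 2) Mi M'"
  proof (rule Iter.IH(2)[of Mi "x # \<Gamma>" "d + 2" "\<rho>(x := i)" ?\<beta>])
   show "Mi (b + y) = (\<rho>(x := i)) y" if "y \<in> set (x # \<Gamma>)" for y
    using that Suc.prems Iter.prems(6) d unfolding same_def by auto
   show "(\<rho>(x := i)) y <= ?\<beta> y" for y using Iter.prems(8) mle im by (auto intro: less_imp_le less_le_trans)
  qed (use Iter.prems(2-5,7) L1 ai bi in \<open>auto simp del: fun_upd_apply\<close>)
  then obtain M2 where M2: "big (comp e (d + 2)) Mi (return_pmf M2) (tE e B ?\<beta> L)"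
   "M2 (b + (d + 2)) = f i" "same b (x # \<Gamma>) (d + 2) Mi M2"
   unfolding ai f_def by blast
  have b2: "M2 0 = b" using M2(3) bi Iter.prems by (simp add: same_base)
  have M2v: "M2 (b + (d + 1)) = it_val k f i" "M2 (b + x) = i" "M2 (b + d) = m"
  proof -
   have "!!r. 30 <= r ==> r < d + 2 ==> M2 (b + r) = Mi (b + r)" "M2 (b + x) = Mi (b + x)"
    using M2(3) unfolding same_def by auto
   from this(2) this(1)[of d] this(1)[of "d + 1"]
   show "M2 (b + (d + 1)) = it_val k f i" "M2 (b + x) = i" "M2 (b + d) = m"
    using Suc.prems d by auto
  qed
  have c4: "acost (Mem (radr (d + 1))) M2 <= 5 * L"
   using b2 d M2v itle[of i] im by (intro acost_reg[OF L]) auto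
  have c5: "acost (Mem (radr x)) M2 <= 5 * L" using b2 d M2v mv im by (intro acost_reg[OF L]) auto
  have c6: "acost (Mem (radr (d + 2))) M2 <= 5 * L"
   using b2 d M2(2) fle[of i] im ebd_le_vE[of e B ?\<beta>] by (intro acost_reg[OF L]) auto
  have c7: "acost (step_aexp k (Mem (radr (d + 1))) (Mem (radr x)) (Mem (radr (d + 2)))) M2 <= 40 * L"
  proof (rule acost_step[OF L c4 c6 c5])
   have "it_val k f (Suc i) <= it_bd k (ebd n B \<beta>) (ebd e B ?\<beta>)" using itle im Suc_leI by blast
   then show "it_step k (aval (Mem (radr (d + 1))) M2) (aval (Mem (radr x)) M2)
     (aval (Mem (radr (d + 2))) M2) <= vE (Iter k x n e) B \<beta>"
    using b2 M2v M2(2) by simp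
   show "aval (Mem (radr (d + 1))) M2 <= vE (Iter k x n e) B \<beta>"
    using b2 M2v itle[of i] im by simp
   show "aval (Mem (radr x)) M2 <= vE (Iter k x n e) B \<beta>" using b2 M2v mv im by simp
  qed
  let ?M3 = "M2(b + (d + 1) := it_val k f (Suc i))"
  let ?M4 = "?M3(b + x := Suc i)"
  have b3: "?M3 0 = b" "?M3 (b + x) = i" using b2 M2v d Iter.prems by auto
  have c8: "acost (Mem (radr x)) ?M3 <= 5 * L" using b3 d mv im by (intro acost_reg[OF L]) auto
  have d_x: "x < 100" using d by simp
  have c9: "acost (Add (Mem (radr x)) (Const 1)) ?M3 <= 50 * L"
  proof -
   have "bit_length (Suc i) <= L" by (rule bl[OF L]) (use mv im in simp)
   then show ?thesis by (rule acost_incr[where M = ?M3, OF L b3 d_x c8])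
  qed
  have s3: "same b \<Gamma> d M ?M4"
  proof -
   have "same b \<Gamma> d Mi M2" by (rule same_weaken[OF M2(3)]) auto
   moreover have "same b \<Gamma> d M2 ?M3" by (rule same_upd) (use d nd in auto)
   moreover have "same b \<Gamma> d ?M3 ?M4" by (rule same_upd) (use d in auto)
   ultimately show ?thesis using Suc.prems(5) same_trans by blast
  qed
  have "\<exists>M'. big (W # [Store (radr d) (Mem (radr (d + 1)))]) ?M4 (return_pmf M')
    ((m - Suc i) * (tE e B ?\<beta> L + 180 * L) + 120 * L) \<and>
   M' (b + d) = it_val k f m \<and> same b \<Gamma> d M M'"
   
  proof (rule Suc.hyps(1)[OF _ _ _ _ _ s3])
   show "q = m - Suc i" "Suc i <= m" using Suc.hyps(2) im by auto
   show "?M4 (b + d) = m" "?M4 (b + x) = Suc i" "?M4 (b + (d + 1)) = it_val k f (Suc i)"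
    using M2v d by auto
  qed
  then obtain M' where M': "big (W # [Store (radr d) (Mem (radr (d + 1)))]) ?M4 (return_pmf M')
    ((m - Suc i) * (tE e B ?\<beta> L + 180 * L) + 120 * L)"
   "M' (b + d) = it_val k f m" "same b \<Gamma> d M M'" by blast
  have "big (Store (radr x) (Add (Mem (radr x)) (Const 1)) # W # [Store (radr d) (Mem (radr (d + 1)))])
    ?M3 (return_pmf M') (60 * L + ((m - Suc i) * (tE e B ?\<beta> L + 180 * L) + 120 * L))"
  proof (rule big_StoreR[where M = ?M3, OF L b3(1) _ c9])
   show "big (W # [Store (radr d) (Mem (radr (d + 1)))])
    (?M3(b + x := aval (Add (Mem (radr x)) (Const 1)) ?M3)) (return_pmf M')
    ((m - Suc i) * (tE e B ?\<beta> L + 180 * L) + 120 * L)"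
    using M'(1) b3 by (simp del: fun_upd_apply)
  qed (use d in simp)
  then have "big (Store (radr (d + 1)) (step_aexp k (Mem (radr (d + 1))) (Mem (radr x)) (Mem (radr (d + 2)))) #
    Store (radr x) (Add (Mem (radr x)) (Const 1)) # W # [Store (radr d) (Mem (radr (d + 1)))]) M2 (return_pmf M')
    (60 * L + (60 * L + ((m - Suc i) * (tE e B ?\<beta> L + 180 * L) + 120 * L)))"
   using c7 b2 d M2v M2(2) by (intro big_StoreR[where M = M2, OF L b2]) (simp_all del: fun_upd_apply)
  from big_append_det[OF M2(1) this]
  have "big (W # [Store (radr d) (Mem (radr (d + 1)))]) Mi (return_pmf M')
    (11 * L + (tE e B ?\<beta> L + (60 * L + (60 * L + ((m - Suc i) * (tE e B ?\<beta> L + 180 * L) + 120 * L)))))"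
   unfolding W_def using c3 Suc.prems im bi
   by (intro big_While_True[where T = "tE e B ?\<beta> L + (60 * L + (60 * L +
    ((m - Suc i) * (tE e B ?\<beta> L + 180 * L) + 120 * L)))"]) simp_all
  moreover have "m - i = Suc (m - Suc i)" using im by simp
  ultimately have "big (W # [Store (radr d) (Mem (radr (d + 1)))]) Mi (return_pmf M')
    ((m - i) * (tE e B ?\<beta> L + 180 * L) + 120 * L)"
   by (elim big_mono) simp
  then show ?case using M' by blast
 qed
 let ?M2 = "M1(b + (d + 1) := it_init k)"
 let ?M3 = "?M2(b + x := 0)"
 have s3: "same b \<Gamma> d M ?M3"
 proof -
  have "same b \<Gamma> d M1 ?M2" by (rule same_upd) (use d nd in auto)
  moreover have "same b \<Gamma> d ?M2 ?M3" by (rule same_upd) (use d in auto)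
  ultimately show ?thesis using M1(3) same_trans by blast
 qed
 have "\<exists>M'. big (W # [Store (radr d) (Mem (radr (d + 1)))]) ?M3 (return_pmf M')
    ((m - 0) * (tE e B ?\<beta> L + 180 * L) + 120 * L) \<and>
   M' (b + d) = it_val k f m \<and> same b \<Gamma> d M M'"
 proof (rule loop[OF _ _ _ _ s3])
  show "?M3 (b + d) = m" "?M3 (b + x) = 0" "?M3 (b + (d + 1)) = it_val k f 0"
   using M1(2) d by (auto simp: m_def)
 qed simp
 then obtain M' where M': "big (W # [Store (radr d) (Mem (radr (d + 1)))]) ?M3 (return_pmf M')
    (m * (tE e B ?\<beta> L + 180 * L) + 120 * L)"
   "M' (b + d) = it_val k f m" "same b \<Gamma> d M M'" by auto
 have s2: "big (Store (radr x) (Const 0) # W # [Store (radr d) (Mem (radr (d + 1)))]) ?M2 (return_pmf M')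
   (60 * L + (m * (tE e B ?\<beta> L + 180 * L) + 120 * L))"
 proof (rule big_StoreR[OF L])
  show "acost (Const 0) ?M2 <= 50 * L" using bl[OF L, of 0] by simp
  show "big (W # [Store (radr d) (Mem (radr (d + 1)))]) (?M2(b + x := aval (Const 0) ?M2))
   (return_pmf M') (m * (tE e B ?\<beta> L + 180 * L) + 120 * L)" using M'(1) by (simp del: fun_upd_apply)
 qed (use base d Iter.prems(2) in auto)
 have "big (Store (radr (d + 1)) (Const (it_init k)) # Store (radr x) (Const 0) # W #
   [Store (radr d) (Mem (radr (d + 1)))]) M1 (return_pmf M')
   (60 * L + (60 * L + (m * (tE e B ?\<beta> L + 180 * L) + 120 * L)))"
 proof (rule big_StoreR[OF L])
  have "it_init k <= 1" by (cases k) auto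
  then have "bit_length (it_init k) <= L" by (intro bl[OF L]) simp
  then show "acost (Const (it_init k)) M1 <= 50 * L" by simp
 qed (use base d s2 in \<open>auto simp del: fun_upd_apply\<close>)
 from big_append_det[OF M1(1) this]
 have "big (comp (Iter k x n e) d) M (return_pmf M')
  (tE n B \<beta> L + (60 * L + (60 * L + (m * (tE e B ?\<beta> L + 180 * L) + 120 * L))))"
  by (simp add: W_def)
 moreover have "m * (tE e B ?\<beta> L + 180 * L) <= ebd n B \<beta> * (tE e B ?\<beta> L + 180 * L)"
  using mle by (rule mult_right_mono) simp
 ultimately have "big (comp (Iter k x n e) d) M (return_pmf M') (tE (Iter k x n e) B \<beta> L)"
  by (elim big_mono) simp
 then show ?case using M' by (auto simp: m_def f_def[abs_def])
qed

section \<open>Compiled commands and random draws\<close>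

primrec vC :: "cmd => (nat => nat) => env => nat" where
 "vC (Wr a i e) B \<beta> = vE i B \<beta> + vE e B \<beta>"
| "vC (Rnd a i k) B \<beta> = vE i B \<beta> + vE k B \<beta> + 2 ^ ebd k B \<beta>"
| "vC (Seq p q) B \<beta> = vC p B \<beta> + vC q B \<beta>"
| "vC (For x n p) B \<beta> = 1 + vE n B \<beta> + vC p B (\<beta>(x := ebd n B \<beta>))"

primrec tC :: "cmd => (nat => nat) => env => nat => nat" where
 "tC (Wr a i e) B \<beta> L = tE i B \<beta> L + tE e B \<beta> L + 60 * L"
| "tC (Rnd a i k) B \<beta> L = tE i B \<beta> L + tE k B \<beta> L + 200 * L + ebd k B \<beta> * (200 * L)"
| "tC (Seq p q) B \<beta> L = tC p B \<beta> L + tC q B \<beta> L"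
| "tC (For x n p) B \<beta> L = tE n B \<beta> L + 120 * L +
   ebd n B \<beta> * (tC p B (\<beta>(x := ebd n B \<beta>)) L + 80 * L)"

primrec write_bd :: "cmd => (nat => nat) => env => nat => nat" where
 "write_bd (Wr a i e) B \<beta> a' = (if a' = a then ebd e B \<beta> else 0)"
| "write_bd (Rnd a i k) B \<beta> a' = (if a' = a then 2 ^ ebd k B \<beta> else 0)"
| "write_bd (Seq p q) B \<beta> a' = write_bd p B \<beta> a' + write_bd q B \<beta> a'"
| "write_bd (For x n p) B \<beta> a' = write_bd p B (\<beta>(x := ebd n B \<beta>)) a'"

lemma pow2_lessThan_ne: "{..<2 ^ q} \<noteq> ({} :: nat set)"
 by (metis empty_iff lessThan_iff pos2 zero_less_power)

lemma for_loop_inv: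
 assumes "!!v \<sigma> \<sigma>'. i <= v ==> v < i + k ==> P \<sigma> ==> \<sigma>' \<in> set_pmf (f v \<sigma>) ==> P \<sigma>'"
  "P \<sigma>" "\<sigma>' \<in> set_pmf (for_loop f k i \<sigma>)"
 shows "P \<sigma>'"
 using assms
proof (induction k arbitrary: i \<sigma>)
 case (Suc k)
 obtain \<sigma>1 where "\<sigma>1 \<in> set_pmf (f i \<sigma>)" and 2: "\<sigma>' \<in> set_pmf (for_loop f k (Suc i) \<sigma>1)"
  using Suc.prems(3) by auto
 then have "P \<sigma>1" using Suc.prems(1)[of i \<sigma> \<sigma>1] Suc.prems(2) by auto
 then show ?case
  by (rule Suc.IH[rotated 1, OF _ 2]) (rule Suc.prems(1), auto)
qed auto

text \<open>\<open>write_bd\<close> estimates every written value under the assumption that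
  \<open>B\<close> already bounds all arrays. A \<open>B\<close> that dominates its own
  \<open>write_bd\<close> is thus preserved by each assignment, hence by loops of any
  length.\<close>

lemma exec_le_bound:
 assumes "!!a k. \<sigma> a k <= B a" "!!x. \<rho> x <= \<beta> x" "!!a. write_bd c B \<beta> a <= B a"
  "\<sigma>' \<in> set_pmf (exec c \<rho> \<sigma>)"
 shows "\<sigma>' a k <= B a"
 using assms
proof (induction c arbitrary: \<rho> \<beta> \<sigma> \<sigma>' a k)
 case (Wr a' i e)
 have "eval e \<sigma> \<rho> <= ebd e B \<beta>" using Wr by (intro eval_le_ebd)
 then have "eval e \<sigma> \<rho> <= B a'" using Wr(3)[of a'] by simp
 then show ?case using Wr by (auto simp: wr_def)
next
 case (Rnd a' i e)
 have "eval e \<sigma> \<rho> <= ebd e B \<beta>" using Rnd by (intro eval_le_ebd)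
 then have "(2::nat) ^ eval e \<sigma> \<rho> <= 2 ^ ebd e B \<beta>" by (intro power_increasing) auto
 also have "\<dots> <= B a'" using Rnd(3)[of a'] by simp
 finally have "2 ^ eval e \<sigma> \<rho> <= B a'" .
 moreover have "set_pmf (pmf_of_set {..<(2::nat) ^ eval e \<sigma> \<rho>}) = {..<2 ^ eval e \<sigma> \<rho>}"
  by (intro set_pmf_of_set pow2_lessThan_ne) auto
 ultimately show ?case using Rnd(1,4) by (auto simp: wr_def)
next
 case (Seq p q)
 obtain \<sigma>1 where s1: "\<sigma>1 \<in> set_pmf (exec p \<rho> \<sigma>)" "\<sigma>' \<in> set_pmf (exec q \<rho> \<sigma>1)"
  using Seq.prems(4) by auto
 have w: "!!a. write_bd p B \<beta> a <= B a" "!!a. write_bd q B \<beta> a <= B a"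
  using Seq.prems(3) by (metis add_leD1 write_bd.simps(3), metis add_leD2 write_bd.simps(3))
 show ?case
  by (rule Seq.IH(2)[OF Seq.IH(1)[OF Seq.prems(1,2) w(1) s1(1)] Seq.prems(2) w(2) s1(2)])
next
 case (For x n p)
 have n: "eval n \<sigma> \<rho> <= ebd n B \<beta>" using For by (intro eval_le_ebd)
 have "\<forall>a k. \<sigma>' a k <= B a"
 proof (rule for_loop_inv[where P = "%\<sigma>. \<forall>a k. \<sigma> a k <= B a"])
  show "\<sigma>' \<in> set_pmf (for_loop (%v. exec p (\<rho>(x := v))) (eval n \<sigma> \<rho>) 0 \<sigma>)"
   using For.prems(4) by simp
  show "\<forall>a k. \<sigma> a k <= B a" using For.prems(1) by blast
  fix v \<tau> \<tau>'
  assume v: "v < 0 + eval n \<sigma> \<rho>" "\<forall>a k. \<tau> a k <= B a" "\<tau>' \<in> set_pmf (exec p (\<rho>(x := v)) \<tau>)"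
  have 1: "!!y. (\<rho>(x := v)) y <= (\<beta>(x := ebd n B \<beta>)) y" using For.prems(2) v n by auto
  have 2: "!!a. write_bd p B (\<beta>(x := ebd n B \<beta>)) a <= B a" using For.prems(3) by simp
  show "\<forall>a k. \<tau>' a k <= B a" using For.IH[OF _ 1 2 v(3)] v(2) by blast
 qed
 then show ?case by blast
qed

text \<open>The frame condition for commands. In contrast to \<open>same\<close> it lets the arrays
  change, except those cells below \<open>b\<close> that carry the input and the base
  pointer.\<close>

definition kept :: "nat => nat list => nat => mem => mem => bool" where
 "kept b \<Gamma> d M M' \<longleftrightarrow> (\<forall>c<b. M' c = M c) \<and>
   (\<forall>x\<in>set \<Gamma>. M' (b + x) = M (b + x)) \<and> (\<forall>r. 30 <= r \<and> r < d \<longrightarrow> M' (b + r) = M (b + r))"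

lemma same_kept: "same b \<Gamma> d M M' ==> kept b \<Gamma> d M M'"
proof -
 assume s: "same b \<Gamma> d M M'"
 have "M' c = M c" if "c < b" for c
 proof -
  have "\<forall>r<100. c \<noteq> b + r" using that by simp
  then show ?thesis using s unfolding same_def by blast
 qed
 then show ?thesis using s unfolding same_def kept_def by blast
qed

lemma kept_trans: "kept b \<Gamma> d M M' ==> kept b \<Gamma> d M' M'' ==> kept b \<Gamma> d M M''"
 unfolding kept_def by metis

lemma kept_weaken: "kept b \<Gamma>' d' M M' ==> set \<Gamma> \<subseteq> set \<Gamma>' ==> d <= d' ==> kept b \<Gamma> d M M'"
 unfolding kept_def by auto

lemma adr_eq_iff:
 assumes "0 < a" "a < 50" "a' < 50" "0 < b"
 shows "adr b a' k' = adr b a k \<longleftrightarrow> a' = a \<and> k' = k"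
proof
 assume eq: "adr b a' k' = adr b a k"
 have ge: "b < adr b a k" using assms by (simp add: adr_def)
 have "a' \<noteq> 0"
 proof
  assume "a' = 0"
  then have "adr b a' k' <= b - 1" by (simp add: adr_def)
  then show False using eq ge by linarith
 qed
 then have sum: "a' + 50 * k' = a + 50 * k" using eq assms by (simp add: adr_def)
 have "a' = (a' + 50 * k') mod 50" using assms by simp
 also have "\<dots> = a" unfolding sum using assms by simp
 finally show "a' = a \<and> k' = k" using sum by simp
qed simp

lemma absm_upd:
 assumes "0 < a" "a < 50" "0 < b"
 shows "absm b (M(adr b a k := v)) = wr (absm b M) a k v"
proof (intro ext)
 fix a' k'
 show "absm b (M(adr b a k := v)) a' k' = wr (absm b M) a k v a' k'"
  using assms adr_eq_iff[of a a' b k' k] by (cases "a' < 50") (auto simp: absm_def wr_def)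
qed

lemma kept_upd_adr:
 assumes "0 < a" "set \<Gamma> \<subseteq> {..<30}" "d <= 100"
 shows "kept b \<Gamma> d M (M(adr b a k := v))"
proof -
 have "adr b a k \<ge> b + 100" using assms by (simp add: adr_def)
 then show ?thesis using assms unfolding kept_def by fastforce
qed

lemma pmf_of_set_pow2_Suc:
 "pmf_of_set {..<(2::nat) ^ Suc q} =
  bind_pmf (bernoulli_pmf (1 / 2)) (%c. map_pmf (%r. of_bool c * 2 ^ q + r) (pmf_of_set {..<2 ^ q}))"
 for q :: nat
proof (rule pmf_eqI)
 fix x :: nat
 have m: "map_pmf (%r. (d::nat) + r) (pmf_of_set {..<2 ^ q}) = pmf_of_set {d..<d + 2 ^ q}" for d
 proof -
  have "map_pmf (%r. d + r) (pmf_of_set {..<2 ^ q}) = pmf_of_set ((%r. d + r) ` {..<2 ^ q})"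
   by (intro map_pmf_of_set_inj pow2_lessThan_ne) auto
  also have "(%r. d + r) ` {..<2 ^ q} = {d..<d + 2 ^ q}"
   by (simp add: lessThan_atLeast0 image_add_atLeastLessThan add.commute)
  finally show ?thesis .
 qed
 have p: "pmf (pmf_of_set {d..<d + 2 ^ q}) x = indicator {d..<d + 2 ^ q} x / 2 ^ q" for d :: nat
  by (subst pmf_of_set) auto
 have p0: "pmf (pmf_of_set {..<2 ^ Suc q}) x = indicator {..<2 ^ Suc q} x / 2 ^ Suc q"
  by (subst pmf_of_set[OF pow2_lessThan_ne]) auto
 show "pmf (pmf_of_set {..<2 ^ Suc q}) x = pmf (bind_pmf (bernoulli_pmf (1 / 2))
   (%c. map_pmf (%r. of_bool c * 2 ^ q + r) (pmf_of_set {..<2 ^ q}))) x"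
  unfolding m pmf_bind p0 p by (simp add: indicator_def)
qed

text \<open>The bits arrive most significant first: a flip \<open>c\<close> turns the accumulator
  \<open>u\<close> into \<open>2 * u + c\<close>. With \<open>q\<close> flips to come the result is
  \<open>u * 2 ^ q\<close> plus a uniform number below \<open>2 ^ q\<close>, which matches the
  recursion in \<open>pmf_of_set_pow2_Suc\<close>.\<close>

lemma rnd_loop_correct:
 fixes b v L d :: nat and \<Gamma> :: "nat list"
 defines "W \<equiv> While (Mem (radr (d + 1)))
    [Flip (radr (d + 3)),
     Store (radr (d + 2)) (Add (Mul (Const 2) (Mem (radr (d + 2)))) (Mem (radr (d + 3)))),
     Store (radr (d + 1)) (Sub (Mem (radr (d + 1))) (Const 1))]"
 assumes L: "bit_length (b + 300 + 50 * v) <= L" and b: "0 < b" and d: "30 <= d" "d < 97"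
  and \<Gamma>: "set \<Gamma> \<subseteq> {..<30}"
 shows "M 0 = b ==> M (b + (d + 1)) = q ==> M (b + (d + 2)) = u ==> (u + 1) * 2 ^ q <= v ==> q <= v ==>
  \<exists>D. big [W] M D (q * (200 * L) + 10 * L) \<and>
   map_pmf (%M'. M' (b + (d + 2))) D = map_pmf (%r. u * 2 ^ q + r) (pmf_of_set {..<2 ^ q}) \<and>
   (\<forall>M'\<in>set_pmf D. same b \<Gamma> (d + 1) M M')"
proof (induction q arbitrary: M u)
 case 0
 have c: "acost (Mem (radr (d + 1))) M <= 5 * L"
  by (rule acost_reg[OF L]) (use 0 d in auto)
 have "big [W] M (return_pmf M) (10 * L)"
  unfolding W_def by (rule big_While_False[where T = 0]) (use 0 c in \<open>auto intro: big_Nil\<close>)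
 moreover have "pmf_of_set {..<2 ^ 0 :: nat} = return_pmf 0"
  by (simp add: lessThan_Suc pmf_of_set_singleton)
 ultimately show ?case using 0 by (intro exI[of _ "return_pmf M"]) (auto simp: same_refl)
next
 case (Suc q)
 have nG: "d + 1 \<notin> set \<Gamma>" "d + 2 \<notin> set \<Gamma>" "d + 3 \<notin> set \<Gamma>" using \<Gamma> d by auto
 have u: "2 * u + 1 <= v" "u <= v" "2 * u <= v"
 proof -
  have "(u + 1) * 2 <= (u + 1) * 2 ^ Suc q" by (intro mult_left_mono) auto
  then show "2 * u + 1 <= v" "u <= v" "2 * u <= v" using Suc.prems by auto
 qed
 have "\<exists>D. big [W] (M(b + (d + 3) := of_bool c, b + (d + 2) := 2 * u + of_bool c, b + (d + 1) := q)) D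
    (q * (200 * L) + 10 * L) \<and>
   map_pmf (%M'. M' (b + (d + 2))) D =
    map_pmf (%r. (2 * u + of_bool c) * 2 ^ q + r) (pmf_of_set {..<2 ^ q}) \<and>
   (\<forall>M'\<in>set_pmf D. same b \<Gamma> (d + 1)
    (M(b + (d + 3) := of_bool c, b + (d + 2) := 2 * u + of_bool c, b + (d + 1) := q)) M')" for c
 proof (rule Suc.IH)
  have "(2 * u + of_bool c + 1) * 2 ^ q <= (u + 1) * 2 ^ Suc q"
   by (cases c) auto
  then show "(2 * u + of_bool c + 1) * 2 ^ q <= v" using Suc.prems by linarith
 qed (use Suc.prems b in auto)
 then obtain D where D:
  "!!c. big [W] (M(b + (d + 3) := of_bool c, b + (d + 2) := 2 * u + of_bool c, b + (d + 1) := q)) (D c)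
    (q * (200 * L) + 10 * L)"
  "!!c. map_pmf (%M'. M' (b + (d + 2))) (D c) =
    map_pmf (%r. (2 * u + of_bool c) * 2 ^ q + r) (pmf_of_set {..<2 ^ q})"
  "!!c M'. M'\<in>set_pmf (D c) ==> same b \<Gamma> (d + 1)
    (M(b + (d + 3) := of_bool c, b + (d + 2) := 2 * u + of_bool c, b + (d + 1) := q)) M'"
  by metis
 have c0: "acost (Mem (radr (d + 1))) M <= 5 * L"
  by (rule acost_reg[OF L]) (use Suc.prems d in auto)
 have st: "big (Store (radr (d + 2)) (Add (Mul (Const 2) (Mem (radr (d + 2)))) (Mem (radr (d + 3)))) #
   Store (radr (d + 1)) (Sub (Mem (radr (d + 1))) (Const 1)) # [W])
   (M(b + (d + 3) := of_bool c)) (D c) (60 * L + (60 * L + (q * (200 * L) + 10 * L)))" for c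
 proof -
  let ?M1 = "M(b + (d + 3) := of_bool c)"
  let ?M2 = "?M1(b + (d + 2) := 2 * u + of_bool c)"
  have b1: "?M1 0 = b" "?M2 0 = b" "?M1 (b + (d + 2)) = u" "?M1 (b + (d + 3)) = of_bool c"
   "?M2 (b + (d + 1)) = Suc q"
   using Suc.prems b by auto
  have v1: "1 <= v" using u by simp
  have "acost (Mem (radr (d + 2))) ?M1 <= 5 * L"
   by (rule acost_reg[OF L]) (use b1 d u in auto)
  moreover have "acost (Mem (radr (d + 3))) ?M1 <= 5 * L"
   by (rule acost_reg[OF L]) (use b1 d v1 in auto)
  moreover have "bit_length 2 <= L" "bit_length (2 * u) <= L" "bit_length (2 * u + of_bool c) <= L"
   by (rule bl[OF L]; use u in simp)+
  ultimately have c1: "acost (Add (Mul (Const 2) (Mem (radr (d + 2)))) (Mem (radr (d + 3)))) ?M1 <= 50 * L"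
   using b1 by simp
  have "acost (Mem (radr (d + 1))) ?M2 <= 5 * L"
   by (rule acost_reg[OF L]) (use b1 d Suc.prems in auto)
  moreover have "bit_length (Suc 0) <= L" "bit_length q <= L"
   by (rule bl[OF L]; use Suc.prems in simp)+
  ultimately have c2: "acost (Sub (Mem (radr (d + 1))) (Const 1)) ?M2 <= 50 * L"
   using b1 by simp
  have "big (Store (radr (d + 1)) (Sub (Mem (radr (d + 1))) (Const 1)) # [W]) ?M2 (D c)
   (60 * L + (q * (200 * L) + 10 * L))"
   by (rule big_StoreR[where M = ?M2, OF L b1(2) _ c2]) (use D(1)[of c] b1 d in \<open>simp_all del: fun_upd_apply\<close>)
  then show ?thesis
   by (intro big_StoreR[where M = ?M1, OF L b1(1) _ c1]) (use b1 d in \<open>simp_all del: fun_upd_apply\<close>)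
 qed
 have ad: "aval (radr (d + 3)) M = b + (d + 3)" using Suc.prems by simp
 have cf: "acost (radr (d + 3)) M <= 4 * L" by (rule acost_radr[OF L]) (use Suc.prems d in auto)
 have "big (Flip (radr (d + 3)) # (Store (radr (d + 2)) (Add (Mul (Const 2) (Mem (radr (d + 2)))) (Mem (radr (d + 3)))) #
   Store (radr (d + 1)) (Sub (Mem (radr (d + 1))) (Const 1)) # [W])) M
   (bind_pmf (bernoulli_pmf (1 / 2)) D) (5 * L + (60 * L + (60 * L + (q * (200 * L) + 10 * L))))"
 proof (rule big_Flip)
  show "big (Store (radr (d + 2)) (Add (Mul (Const 2) (Mem (radr (d + 2)))) (Mem (radr (d + 3)))) #
   Store (radr (d + 1)) (Sub (Mem (radr (d + 1))) (Const 1)) # [W])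
   (M(aval (radr (d + 3)) M := of_bool c)) (D c) (60 * L + (60 * L + (q * (200 * L) + 10 * L)))" for c
   unfolding ad by (rule st)
  show "acost (radr (d + 3)) M + 1 + (60 * L + (60 * L + (q * (200 * L) + 10 * L))) <=
   5 * L + (60 * L + (60 * L + (q * (200 * L) + 10 * L)))"
   using cf L_pos[OF L] by linarith
 qed
 then have "big [W] M (bind_pmf (bernoulli_pmf (1 / 2)) D) (Suc q * (200 * L) + 10 * L)"
  unfolding W_def
  by (intro big_While_True[where T = "5 * L + (60 * L + (60 * L + (q * (200 * L) + 10 * L)))"])
   (use c0 Suc.prems in auto)
 moreover have "map_pmf (%M'. M' (b + (d + 2))) (bind_pmf (bernoulli_pmf (1 / 2)) D) =
   map_pmf (%r. u * 2 ^ Suc q + r) (pmf_of_set {..<2 ^ Suc q})"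
  unfolding map_bind_pmf D(2) pmf_of_set_pow2_Suc map_bind_pmf map_pmf_comp
  by (intro bind_pmf_cong map_pmf_cong) (auto simp: algebra_simps)
 moreover have "same b \<Gamma> (d + 1) M M'" if "M' \<in> set_pmf (bind_pmf (bernoulli_pmf (1 / 2)) D)" for M'
 proof -
  obtain c where "M' \<in> set_pmf (D c)" using \<open>M' \<in> _\<close> by (auto simp del: fun_upd_apply)
  then have 1: "same b \<Gamma> (d + 1)
    (M(b + (d + 3) := of_bool c, b + (d + 2) := 2 * u + of_bool c, b + (d + 1) := q)) M'"
   by (rule D(3))
  have "same b \<Gamma> (d + 1) M (M(b + (d + 3) := of_bool c))" by (rule same_upd) (use d nG in auto)
  moreover have "same b \<Gamma> (d + 1) (M(b + (d + 3) := of_bool c))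
   (M(b + (d + 3) := of_bool c, b + (d + 2) := 2 * u + of_bool c))"
   by (rule same_upd) (use d nG in auto)
  moreover have "same b \<Gamma> (d + 1) (M(b + (d + 3) := of_bool c, b + (d + 2) := 2 * u + of_bool c))
   (M(b + (d + 3) := of_bool c, b + (d + 2) := 2 * u + of_bool c, b + (d + 1) := q))"
   by (rule same_upd) (use d nG in auto)
  ultimately show ?thesis using 1 same_trans by blast
 qed
 ultimately show ?case by blast
qed

text \<open>The distribution of memories is left existential and only its image under
  \<open>absm\<close> is determined, since the registers carry leftovers of the computation. Between
  consecutive commands \<open>exec_le_bound\<close> re-establishes the bounds on the arrays.\<close>

lemma ccomp_correct:
 assumes "M 0 = b" "0 < b" "wf_cmd \<Gamma> c d" "set \<Gamma> \<subseteq> {..<30}" "30 <= d"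
  "!!x. x \<in> set \<Gamma> ==> M (b + x) = \<rho> x" "!!a k. absm b M a k <= B a" "!!x. \<rho> x <= \<beta> x"
  "!!a. write_bd c B \<beta> a <= B a" "bit_length (b + 300 + 50 * vC c B \<beta>) <= L"
 shows "\<exists>D. big (ccomp c d) M D (tC c B \<beta> L) \<and> map_pmf (absm b) D = exec c \<rho> (absm b M) \<and>
  (\<forall>M'\<in>set_pmf D. kept b \<Gamma> d M M')"
 using assms
proof (induction c arbitrary: \<Gamma> d M \<rho> \<beta>)
 case (Wr a i e)
 note L = Wr.prems(10)
 let ?\<sigma> = "absm b M"
 have L1: "bit_length (b + 300 + 50 * vE i B \<beta>) <= L" "bit_length (b + 300 + 50 * vE e B \<beta>) <= L"
  by (rule bl[OF L]; simp)+
 have wf: "wf_exp \<Gamma> i d" "wf_exp \<Gamma> e (d + 1)" "d < 99" "0 < a" "a < 50" using Wr.prems(3) by auto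
 obtain M1 where M1: "big (comp i d) M (return_pmf M1) (tE i B \<beta> L)"
  "M1 (b + d) = eval i ?\<sigma> \<rho>" "same b \<Gamma> d M M1"
  using comp_correct[where M = M and \<rho> = \<rho> and B = B and \<beta> = \<beta>, OF Wr.prems(1,2) wf(1) Wr.prems(4-8) L1(1)] by blast
 have b1: "M1 0 = b" using same_base[OF M1(3) Wr.prems(2)] Wr.prems(1) by simp
 have a1: "absm b M1 = ?\<sigma>" using same_absm[OF M1(3) Wr.prems(2)] .
 have "!!x. x \<in> set \<Gamma> ==> M1 (b + x) = \<rho> x" using M1(3) Wr.prems(6) by (simp add: same_def)
 moreover have "!!a k. absm b M1 a k <= B a" using a1 Wr.prems(7) by simp
 moreover have "30 <= d + 1" using Wr.prems(5) by simp
 ultimately obtain M2 where M2: "big (comp e (d + 1)) M1 (return_pmf M2) (tE e B \<beta> L)"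
  "M2 (b + (d + 1)) = eval e ?\<sigma> \<rho>" "same b \<Gamma> (d + 1) M1 M2"
  using comp_correct[where M = M1 and \<rho> = \<rho> and B = B and \<beta> = \<beta>, OF b1 Wr.prems(2) wf(2) Wr.prems(4) _ _ _ Wr.prems(8) L1(2)] unfolding a1 by blast
 have b2: "M2 0 = b" using same_base[OF M2(3) Wr.prems(2)] b1 by simp
 have a2: "absm b M2 = ?\<sigma>" using same_absm[OF M2(3) Wr.prems(2)] a1 by simp
 have M2d: "M2 (b + d) = eval i ?\<sigma> \<rho>" using M2(3) M1(2) Wr.prems(5) by (simp add: same_def)
 have v: "eval i ?\<sigma> \<rho> <= vE i B \<beta>" "eval e ?\<sigma> \<rho> <= vE e B \<beta>"
  using eval_le_ebd[of ?\<sigma> B \<rho> \<beta>] Wr.prems(7,8) ebd_le_vE by (meson order.trans)+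
 have c1: "acost (Mem (radr d)) M2 <= 5 * L"
  by (rule acost_reg[OF L]) (use b2 wf M2d v in auto)
 have c2: "acost (Mem (radr (d + 1))) M2 <= 5 * L"
  by (rule acost_reg[OF L]) (use b2 wf M2(2) v in auto)
 have c3: "acost (aadr a (Mem (radr d))) M2 <= 20 * L"
  by (rule acost_aadr[OF L]) (use b2 wf M2d v c1 in auto)
 let ?M3 = "M2(adr b a (eval i ?\<sigma> \<rho>) := eval e ?\<sigma> \<rho>)"
 have ad: "aval (aadr a (Mem (radr d))) M2 = adr b a (eval i ?\<sigma> \<rho>)"
  "aval (Mem (radr (d + 1))) M2 = eval e ?\<sigma> \<rho>"
  using b2 M2d M2(2) by simp_all
 have "big [Store (aadr a (Mem (radr d))) (Mem (radr (d + 1)))] M2 (return_pmf ?M3) (60 * L)"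
  by (rule big_Store[where T = 0]) (use c2 c3 ad in \<open>auto intro: big_Nil simp del: fun_upd_apply acost.simps aval.simps\<close>)
 from big_append_det[OF M1(1) big_append_det[OF M2(1) this]]
 have "big (ccomp (Wr a i e) d) M (return_pmf ?M3) (tC (Wr a i e) B \<beta> L)"
  by (simp add: add.assoc del: fun_upd_apply)
 moreover have "absm b ?M3 = wr ?\<sigma> a (eval i ?\<sigma> \<rho>) (eval e ?\<sigma> \<rho>)"
  using absm_upd[OF wf(4,5) Wr.prems(2)] a2 by simp
 moreover have "kept b \<Gamma> d M ?M3"
 proof -
  have "kept b \<Gamma> d M M1" by (rule same_kept[OF M1(3)])
  moreover have "kept b \<Gamma> d M1 M2" by (rule same_kept, rule same_weaken[OF M2(3)]) auto
  moreover have "kept b \<Gamma> d M2 ?M3" by (rule kept_upd_adr) (use wf Wr.prems(4) in auto)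
  ultimately show ?thesis using kept_trans by blast
 qed
 ultimately show ?case by (intro exI[of _ "return_pmf ?M3"]) (simp del: fun_upd_apply)
next
 case (Rnd a i k)
 note L = Rnd.prems(10)
 let ?\<sigma> = "absm b M"
 have L1: "bit_length (b + 300 + 50 * vE i B \<beta>) <= L" "bit_length (b + 300 + 50 * vE k B \<beta>) <= L"
  by (rule bl[OF L]; simp)+
 have wf: "wf_exp \<Gamma> i d" "wf_exp \<Gamma> k (d + 1)" "d < 97" "0 < a" "a < 50" using Rnd.prems(3) by auto
 obtain M1 where M1: "big (comp i d) M (return_pmf M1) (tE i B \<beta> L)"
  "M1 (b + d) = eval i ?\<sigma> \<rho>" "same b \<Gamma> d M M1"
  using comp_correct[where M = M and \<rho> = \<rho> and B = B and \<beta> = \<beta>, OF Rnd.prems(1,2) wf(1) Rnd.prems(4-8) L1(1)] by blast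
 have b1: "M1 0 = b" using same_base[OF M1(3) Rnd.prems(2)] Rnd.prems(1) by simp
 have a1: "absm b M1 = ?\<sigma>" using same_absm[OF M1(3) Rnd.prems(2)] .
 have "!!x. x \<in> set \<Gamma> ==> M1 (b + x) = \<rho> x" using M1(3) Rnd.prems(6) by (simp add: same_def)
 moreover have "!!a k. absm b M1 a k <= B a" using a1 Rnd.prems(7) by simp
 moreover have "30 <= d + 1" using Rnd.prems(5) by simp
 ultimately obtain M2 where M2: "big (comp k (d + 1)) M1 (return_pmf M2) (tE k B \<beta> L)"
  "M2 (b + (d + 1)) = eval k ?\<sigma> \<rho>" "same b \<Gamma> (d + 1) M1 M2"
  using comp_correct[where M = M1 and \<rho> = \<rho> and B = B and \<beta> = \<beta>, OF b1 Rnd.prems(2) wf(2) Rnd.prems(4) _ _ _ Rnd.prems(8) L1(2)] unfolding a1 by blast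
 have b2: "M2 0 = b" using same_base[OF M2(3) Rnd.prems(2)] b1 by simp
 have a2: "absm b M2 = ?\<sigma>" using same_absm[OF M2(3) Rnd.prems(2)] a1 by simp
 have M2d: "M2 (b + d) = eval i ?\<sigma> \<rho>" using M2(3) M1(2) Rnd.prems(5) by (simp add: same_def)
 have kle: "eval k ?\<sigma> \<rho> <= ebd k B \<beta>" using eval_le_ebd[of ?\<sigma> B \<rho> \<beta>] Rnd.prems(7,8) by blast
 have v: "eval i ?\<sigma> \<rho> <= vE i B \<beta>" "eval k ?\<sigma> \<rho> <= vE k B \<beta>"
  using eval_le_ebd[of ?\<sigma> B \<rho> \<beta>] Rnd.prems(7,8) ebd_le_vE by (meson order.trans)+
 have pw: "(2::nat) ^ eval k ?\<sigma> \<rho> <= 2 ^ ebd k B \<beta>" using kle by (intro power_increasing) auto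
 define W where "W = While (Mem (radr (d + 1)))
    [Flip (radr (d + 3)),
     Store (radr (d + 2)) (Add (Mul (Const 2) (Mem (radr (d + 2)))) (Mem (radr (d + 3)))),
     Store (radr (d + 1)) (Sub (Mem (radr (d + 1))) (Const 1))]"
 define M3 where "M3 = M2(b + (d + 2) := 0)"
 have b3: "M3 0 = b" "M3 (b + (d + 1)) = eval k ?\<sigma> \<rho>" "M3 (b + (d + 2)) = 0" "M3 (b + d) = eval i ?\<sigma> \<rho>"
  using b2 Rnd.prems(2) M2(2) M2d by (auto simp: M3_def)
 have nG: "d + 2 \<notin> set \<Gamma>" using Rnd.prems(4,5) by auto
 have s3: "same b \<Gamma> (d + 1) M2 M3" unfolding M3_def by (rule same_upd) (use wf nG in auto)
 have a3: "absm b M3 = ?\<sigma>" using same_absm[OF s3 Rnd.prems(2)] a2 by simp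
 have "(0 + 1) * 2 ^ eval k ?\<sigma> \<rho> <= vC (Rnd a i k) B \<beta>" using pw by (simp del: power_increasing_iff)
 moreover have "eval k ?\<sigma> \<rho> <= vC (Rnd a i k) B \<beta>" using v by simp
 ultimately obtain D where D: "big [W] M3 D (eval k ?\<sigma> \<rho> * (200 * L) + 10 * L)"
  "map_pmf (%M'. M' (b + (d + 2))) D = map_pmf (%r. 0 * 2 ^ eval k ?\<sigma> \<rho> + r) (pmf_of_set {..<2 ^ eval k ?\<sigma> \<rho>})"
  "!!M'. M'\<in>set_pmf D ==> same b \<Gamma> (d + 1) M3 M'"
  using rnd_loop_correct[OF L Rnd.prems(2,5) wf(3) Rnd.prems(4), folded W_def, of M3, OF b3(1-3)] by blast
 have D2: "map_pmf (%M'. M' (b + (d + 2))) D = pmf_of_set {..<2 ^ eval k ?\<sigma> \<rho>}"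
  using D(2) by (simp add: map_pmf_ident)
 define F where "F M' = M'(adr b a (eval i ?\<sigma> \<rho>) := M' (b + (d + 2)))" for M' :: mem
 have st: "big [Store (aadr a (Mem (radr d))) (Mem (radr (d + 2)))] M' (return_pmf (F M')) (60 * L)"
  if M': "M' \<in> set_pmf D" for M'
 proof -
  have s: "same b \<Gamma> (d + 1) M3 M'" using D(3)[OF M'] .
  have b': "M' 0 = b" using same_base[OF s Rnd.prems(2)] b3 by simp
  have d': "M' (b + d) = eval i ?\<sigma> \<rho>" using s b3(4) Rnd.prems(5) by (simp add: same_def)
  have "M' (b + (d + 2)) \<in> set_pmf (map_pmf (%M'. M' (b + (d + 2))) D)" using M' by auto
  then have "M' (b + (d + 2)) < 2 ^ eval k ?\<sigma> \<rho>"
   unfolding D2 by (subst (asm) set_pmf_of_set[OF pow2_lessThan_ne]) auto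
  then have e': "M' (b + (d + 2)) <= vC (Rnd a i k) B \<beta>" using pw by (simp del: power_increasing_iff)
  have c1: "acost (Mem (radr d)) M' <= 5 * L"
   by (rule acost_reg[OF L]) (use b' wf d' v in auto)
  have c2: "acost (Mem (radr (d + 2))) M' <= 5 * L"
   by (rule acost_reg[OF L]) (use b' wf e' in auto)
  have c3: "acost (aadr a (Mem (radr d))) M' <= 20 * L"
   by (rule acost_aadr[OF L]) (use b' wf d' v c1 in auto)
  have ad: "aval (aadr a (Mem (radr d))) M' = adr b a (eval i ?\<sigma> \<rho>)"
   "aval (Mem (radr (d + 2))) M' = M' (b + (d + 2))"
   using b' d' by simp_all
  show ?thesis unfolding F_def
   by (rule big_Store[where T = 0]) (use c2 c3 ad in \<open>auto intro: big_Nil simp del: fun_upd_apply acost.simps aval.simps\<close>)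
 qed
 have c0: "acost (Const 0) M2 <= 50 * L" using bl[OF L, of 0] by simp
 have "big (Store (radr (d + 2)) (Const 0) # ([W] @ [Store (aadr a (Mem (radr d))) (Mem (radr (d + 2)))])) M2
   (bind_pmf D (%M'. return_pmf (F M'))) (60 * L + (eval k ?\<sigma> \<rho> * (200 * L) + 10 * L + 60 * L))"
  using big_append[OF D(1) st]
  by (intro big_StoreR[where M = M2, OF L b2 _ c0]) (use wf in \<open>simp_all del: fun_upd_apply add: M3_def\<close>)
 from big_append_det[OF M1(1) big_append_det[OF M2(1) this]]
 have "big (ccomp (Rnd a i k) d) M (map_pmf F D) (tE i B \<beta> L + (tE k B \<beta> L +
   (60 * L + (eval k ?\<sigma> \<rho> * (200 * L) + 10 * L + 60 * L))))"
  by (simp add: W_def map_pmf_def)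
 moreover have "eval k ?\<sigma> \<rho> * (200 * L) <= ebd k B \<beta> * (200 * L)" using kle by (rule mult_right_mono) simp
 ultimately have "big (ccomp (Rnd a i k) d) M (map_pmf F D) (tC (Rnd a i k) B \<beta> L)"
  by (elim big_mono) (unfold tC.simps, linarith)
 moreover have "map_pmf (absm b) (map_pmf F D) = exec (Rnd a i k) \<rho> ?\<sigma>"
 proof -
  have "map_pmf (absm b) (map_pmf F D) = map_pmf (%M'. wr ?\<sigma> a (eval i ?\<sigma> \<rho>) (M' (b + (d + 2)))) D"
   unfolding map_pmf_comp
  proof (rule map_pmf_cong[OF refl])
   fix M' assume "M' \<in> set_pmf D"
   then have "absm b M' = ?\<sigma>" using same_absm[OF D(3) Rnd.prems(2)] a3 by simp
   then show "absm b (F M') = wr ?\<sigma> a (eval i ?\<sigma> \<rho>) (M' (b + (d + 2)))"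
    unfolding F_def using absm_upd[OF wf(4,5) Rnd.prems(2)] by simp
  qed
  also have "\<dots> = exec (Rnd a i k) \<rho> ?\<sigma>" unfolding exec.simps D2[symmetric] map_pmf_comp ..
  finally show ?thesis .
 qed
 moreover have "kept b \<Gamma> d M M'" if M'F: "M' \<in> set_pmf (map_pmf F D)" for M'
 proof -
  obtain M4 where M4: "M4 \<in> set_pmf D" "M' = F M4" using M'F by auto
  have "kept b \<Gamma> d M M1" by (rule same_kept[OF M1(3)])
  moreover have "kept b \<Gamma> d M1 M2" by (rule same_kept, rule same_weaken[OF M2(3)]) auto
  moreover have "kept b \<Gamma> d M2 M3" by (rule same_kept, rule same_weaken[OF s3]) auto
  moreover have "kept b \<Gamma> d M3 M4" by (rule same_kept, rule same_weaken[OF D(3)[OF M4(1)]]) auto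
  moreover have "kept b \<Gamma> d M4 M'" unfolding M4(2) F_def
   by (rule kept_upd_adr) (use wf Rnd.prems(4) in auto)
  ultimately show ?thesis using kept_trans by blast
 qed
 ultimately show ?case by blast
next
 case (Seq p q)
 note L = Seq.prems(10)
 have L1: "bit_length (b + 300 + 50 * vC p B \<beta>) <= L" "bit_length (b + 300 + 50 * vC q B \<beta>) <= L"
  by (rule bl[OF L]; simp)+
 have wf: "wf_cmd \<Gamma> p d" "wf_cmd \<Gamma> q d" using Seq.prems(3) by auto
 have w: "!!a. write_bd p B \<beta> a <= B a" "!!a. write_bd q B \<beta> a <= B a"
  using Seq.prems(9) by (metis add_leD1 write_bd.simps(3), metis add_leD2 write_bd.simps(3))
 obtain D1 where D1: "big (ccomp p d) M D1 (tC p B \<beta> L)" "map_pmf (absm b) D1 = exec p \<rho> (absm b M)"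
  "!!M'. M'\<in>set_pmf D1 ==> kept b \<Gamma> d M M'"
  using Seq.IH(1)[of M \<Gamma> d \<rho> \<beta>, OF Seq.prems(1,2) wf(1) Seq.prems(4-8) w(1) L1(1)] by blast
 have "\<exists>D. big (ccomp q d) M' D (tC q B \<beta> L) \<and> map_pmf (absm b) D = exec q \<rho> (absm b M') \<and>
  (\<forall>M''\<in>set_pmf D. kept b \<Gamma> d M' M'')" if M': "M' \<in> set_pmf D1" for M'
 proof (rule Seq.IH(2)[of M' \<Gamma> d \<rho> \<beta>, OF _ Seq.prems(2) wf(2) Seq.prems(4,5) _ _ Seq.prems(8) w(2) L1(2)])
  show "M' 0 = b" using D1(3)[OF M'] Seq.prems(1,2) by (simp add: kept_def)
  show "!!x. x \<in> set \<Gamma> ==> M' (b + x) = \<rho> x" using D1(3)[OF M'] Seq.prems(6) by (simp add: kept_def)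
  have "absm b M' \<in> set_pmf (exec p \<rho> (absm b M))" using M' unfolding D1(2)[symmetric] by simp
  then show "!!a k. absm b M' a k <= B a"
   using exec_le_bound[where \<sigma> = "absm b M" and \<rho> = \<rho> and \<beta> = \<beta> and B = B, OF Seq.prems(7,8) w(1)] by blast
 qed
 then obtain D2 where D2: "!!M'. M' \<in> set_pmf D1 ==> big (ccomp q d) M' (D2 M') (tC q B \<beta> L)"
  "!!M'. M' \<in> set_pmf D1 ==> map_pmf (absm b) (D2 M') = exec q \<rho> (absm b M')"
  "!!M' M''. M' \<in> set_pmf D1 ==> M'' \<in> set_pmf (D2 M') ==> kept b \<Gamma> d M' M''"
  by metis
 have "big (ccomp (Seq p q) d) M (bind_pmf D1 D2) (tC (Seq p q) B \<beta> L)"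
  using big_append[OF D1(1) D2(1)] by simp
 moreover have "map_pmf (absm b) (bind_pmf D1 D2) = exec (Seq p q) \<rho> (absm b M)"
 proof -
  have "map_pmf (absm b) (bind_pmf D1 D2) = bind_pmf D1 (%M'. exec q \<rho> (absm b M'))"
   unfolding map_bind_pmf using D2(2) by (intro bind_pmf_cong) auto
  then show ?thesis by (simp add: D1(2)[symmetric] bind_map_pmf)
 qed
 moreover have "kept b \<Gamma> d M M''" if "M'' \<in> set_pmf (bind_pmf D1 D2)" for M''
  using that D1(3) D2(3) kept_trans unfolding set_bind_pmf by blast
 ultimately show ?case by blast
next
 case (For x n p)
 note L = For.prems(10)
 let ?\<sigma> = "absm b M"
 let ?\<beta> = "\<beta>(x := ebd n B \<beta>)"
 have L1: "bit_length (b + 300 + 50 * vE n B \<beta>) <= L" "bit_length (b + 300 + 50 * vC p B ?\<beta>) <= L"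
  by (rule bl[OF L]; simp)+
 have wf: "x \<notin> set \<Gamma>" "x < 30" "wf_exp \<Gamma> n d" "wf_cmd (x # \<Gamma>) p (d + 1)" "d < 98" "30 <= d"
  using For.prems(3,5) by auto
 obtain M1 where M1: "big (comp n d) M (return_pmf M1) (tE n B \<beta> L)"
  "M1 (b + d) = eval n ?\<sigma> \<rho>" "same b \<Gamma> d M M1"
  using comp_correct[where M = M and \<rho> = \<rho> and B = B and \<beta> = \<beta>, OF For.prems(1,2) wf(3) For.prems(4-8) L1(1)] by blast
 have b1: "M1 0 = b" using same_base[OF M1(3) For.prems(2)] For.prems(1) by simp
 define m where "m = eval n ?\<sigma> \<rho>"
 have mle: "m <= ebd n B \<beta>" unfolding m_def using eval_le_ebd[of ?\<sigma> B \<rho> \<beta>] For.prems(7,8) by blast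
 have mv: "m <= vE n B \<beta>" using mle ebd_le_vE order.trans by blast
 define W where "W = While (Sub (Mem (radr d)) (Mem (radr x)))
    (ccomp p (d + 1) @ [Store (radr x) (Add (Mem (radr x)) (Const 1))])"
 define f where "f v = exec p (\<rho>(x := v))" for v
 have wp: "!!a. write_bd p B ?\<beta> a <= B a" using For.prems(9) by simp
 have loop: "\<exists>D. big [W] Mi D ((m - i) * (tC p B ?\<beta> L + 80 * L) + 20 * L) \<and>
   map_pmf (absm b) D = for_loop f (m - i) i (absm b Mi) \<and> (\<forall>M'\<in>set_pmf D. kept b \<Gamma> d M M')"
  if "i <= m" "Mi (b + d) = m" "Mi (b + x) = i" "kept b \<Gamma> d M Mi" "!!a k. absm b Mi a k <= B a"
  for i Mi
  using that
 proof (induction "m - i" arbitrary: i Mi)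
  case 0
  then have im: "i = m" by simp
  have bi: "Mi 0 = b" using 0(5) For.prems(1,2) by (simp add: kept_def)
  have c1: "acost (Mem (radr d)) Mi <= 5 * L" "acost (Mem (radr x)) Mi <= 5 * L"
   by (rule acost_reg[OF L]; use bi wf 0(3,4) mv im in simp)+
  have "acost (Sub (Mem (radr d)) (Mem (radr x))) Mi <= 11 * L"
   using c1 0(3,4) bl[OF L, of 0] im bi by simp
  then have "big [W] Mi (return_pmf Mi) (20 * L)" unfolding W_def
   using 0(3,4) im bi by (intro big_While_False[where T = 0]) (auto intro: big_Nil)
  then show ?case using 0(5) im by (intro exI[of _ "return_pmf Mi"]) simp
 next
  case (Suc r)
  then have im: "i < m" by simp
  have bi: "Mi 0 = b" using Suc.prems(4) For.prems(1,2) by (simp add: kept_def)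
  have c1: "acost (Mem (radr d)) Mi <= 5 * L" "acost (Mem (radr x)) Mi <= 5 * L"
   by (rule acost_reg[OF L]; use bi wf Suc.prems(2,3) mv im in simp)+
  have c3: "acost (Sub (Mem (radr d)) (Mem (radr x))) Mi <= 11 * L"
  proof -
   have "bit_length (m - i) <= L" by (rule bl[OF L]) (use mv in simp)
   then show ?thesis using c1 Suc.prems(2,3) bi by simp
  qed
  have "\<exists>D. big (ccomp p (d + 1)) Mi D (tC p B ?\<beta> L) \<and>
   map_pmf (absm b) D = exec p (\<rho>(x := i)) (absm b Mi) \<and> (\<forall>M'\<in>set_pmf D. kept b (x # \<Gamma>) (d + 1) Mi M')"
  proof (rule For.IH[of Mi "x # \<Gamma>" "d + 1" "\<rho>(x := i)" ?\<beta>])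
   show "Mi (b + y) = (\<rho>(x := i)) y" if "y \<in> set (x # \<Gamma>)" for y
    using that Suc.prems(3,4) For.prems(6) wf(1) unfolding kept_def by auto
   show "(\<rho>(x := i)) y <= ?\<beta> y" for y using For.prems(8) mle im by auto
  qed (use bi For.prems(2,4) wf Suc.prems(5) wp L1 in \<open>auto simp del: fun_upd_apply\<close>)
  then obtain D1 where D1: "big (ccomp p (d + 1)) Mi D1 (tC p B ?\<beta> L)"
   "map_pmf (absm b) D1 = exec p (\<rho>(x := i)) (absm b Mi)"
   "!!M'. M'\<in>set_pmf D1 ==> kept b (x # \<Gamma>) (d + 1) Mi M'" by blast
  have "\<exists>D. big (Store (radr x) (Add (Mem (radr x)) (Const 1)) # [W]) M2 D
    (60 * L + ((m - Suc i) * (tC p B ?\<beta> L + 80 * L) + 20 * L)) \<and>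
   map_pmf (absm b) D = for_loop f (m - Suc i) (Suc i) (absm b M2) \<and>
   (\<forall>M'\<in>set_pmf D. kept b \<Gamma> d M M')" if M2: "M2 \<in> set_pmf D1" for M2
  proof -
   note k = D1(3)[OF M2]
   have b2: "M2 0 = b" using k bi For.prems(2) by (simp add: kept_def)
   have v2: "M2 (b + x) = i" "M2 (b + d) = m" using k Suc.prems(2,3) wf by (auto simp: kept_def)
   let ?M3 = "M2(b + x := Suc i)"
   have s3: "same b \<Gamma> d M2 ?M3" by (rule same_upd) (use wf in auto)
   have a3: "absm b ?M3 = absm b M2" using same_absm[OF s3 For.prems(2)] .
   have "\<exists>D. big [W] ?M3 D ((m - Suc i) * (tC p B ?\<beta> L + 80 * L) + 20 * L) \<and>
    map_pmf (absm b) D = for_loop f (m - Suc i) (Suc i) (absm b ?M3) \<and> (\<forall>M'\<in>set_pmf D. kept b \<Gamma> d M M')"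
   proof (rule Suc.hyps(1))
    show "r = m - Suc i" "Suc i <= m" using Suc.hyps(2) im by auto
    show "?M3 (b + d) = m" "?M3 (b + x) = Suc i" using v2 wf by auto
    have "kept b \<Gamma> d Mi M2" by (rule kept_weaken[OF k]) auto
    then show "kept b \<Gamma> d M ?M3" using Suc.prems(4) same_kept[OF s3] kept_trans by blast
    have "absm b M2 \<in> set_pmf (exec p (\<rho>(x := i)) (absm b Mi))"
     using M2 unfolding D1(2)[symmetric] by simp
    moreover have "(\<rho>(x := i)) y <= ?\<beta> y" for y using For.prems(8) mle im by auto
    ultimately show "absm b ?M3 a k <= B a" for a k
     unfolding a3 using exec_le_bound[where \<sigma> = "absm b Mi" and \<rho> = "\<rho>(x := i)" and \<beta> = ?\<beta> and B = B, OF Suc.prems(5) _ wp] by blast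
   qed
   then obtain D where D: "big [W] ?M3 D ((m - Suc i) * (tC p B ?\<beta> L + 80 * L) + 20 * L)"
    "map_pmf (absm b) D = for_loop f (m - Suc i) (Suc i) (absm b M2)"
    "\<forall>M'\<in>set_pmf D. kept b \<Gamma> d M M'" unfolding a3 by blast
   have c8: "acost (Mem (radr x)) M2 <= 5 * L"
    by (rule acost_reg[OF L]) (use b2 wf v2 mv im in auto)
   have d_x: "x < 100" using wf by simp
   have "bit_length (Suc i) <= L" by (rule bl[OF L]) (use mv im in simp)
   then have c9: "acost (Add (Mem (radr x)) (Const 1)) M2 <= 50 * L"
    by (rule acost_incr[where M = M2, OF L b2 v2(1) d_x c8])
   have "big (Store (radr x) (Add (Mem (radr x)) (Const 1)) # [W]) M2 D
    (60 * L + ((m - Suc i) * (tC p B ?\<beta> L + 80 * L) + 20 * L))"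
    by (rule big_StoreR[where M = M2, OF L b2 d_x c9]) (use D(1) b2 v2 in \<open>simp del: fun_upd_apply\<close>)
   then show ?thesis using D by blast
  qed
  then obtain D2 where D2: "!!M2. M2 \<in> set_pmf D1 ==>
    big (Store (radr x) (Add (Mem (radr x)) (Const 1)) # [W]) M2 (D2 M2)
    (60 * L + ((m - Suc i) * (tC p B ?\<beta> L + 80 * L) + 20 * L))"
   "!!M2. M2 \<in> set_pmf D1 ==> map_pmf (absm b) (D2 M2) = for_loop f (m - Suc i) (Suc i) (absm b M2)"
   "!!M2 M'. M2 \<in> set_pmf D1 ==> M' \<in> set_pmf (D2 M2) ==> kept b \<Gamma> d M M'"
   by metis
  have mi: "m - i = Suc (m - Suc i)" using im by simp
  have "big (ccomp p (d + 1) @ Store (radr x) (Add (Mem (radr x)) (Const 1)) # [W]) Mi (bind_pmf D1 D2)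
    (tC p B ?\<beta> L + (60 * L + ((m - Suc i) * (tC p B ?\<beta> L + 80 * L) + 20 * L)))"
   by (rule big_append[OF D1(1) D2(1)])
  then have "big [W] Mi (bind_pmf D1 D2)
    (11 * L + (tC p B ?\<beta> L + (60 * L + ((m - Suc i) * (tC p B ?\<beta> L + 80 * L) + 20 * L))))"
   unfolding W_def using c3 Suc.prems(2,3) im bi
   by (intro big_While_True[where T = "tC p B ?\<beta> L + (60 * L + ((m - Suc i) * (tC p B ?\<beta> L + 80 * L) + 20 * L))"]) simp_all
  then have "big [W] Mi (bind_pmf D1 D2) ((m - i) * (tC p B ?\<beta> L + 80 * L) + 20 * L)"
   by (rule big_mono) (simp add: mi)
  moreover have "map_pmf (absm b) (bind_pmf D1 D2) = for_loop f (m - i) i (absm b Mi)"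
  proof -
   have "map_pmf (absm b) (bind_pmf D1 D2) =
     bind_pmf D1 (%M2. for_loop f (m - Suc i) (Suc i) (absm b M2))"
    unfolding map_bind_pmf using D2(2) by (intro bind_pmf_cong) auto
   then show ?thesis by (simp add: mi f_def D1(2)[symmetric] bind_map_pmf)
  qed
  moreover have "kept b \<Gamma> d M M'" if "M' \<in> set_pmf (bind_pmf D1 D2)" for M'
   using that D2(3) unfolding set_bind_pmf by blast
  ultimately show ?case by blast
 qed
 let ?M2 = "M1(b + x := 0)"
 have s2: "same b \<Gamma> d M1 ?M2" by (rule same_upd) (use wf in auto)
 have a2: "absm b ?M2 = ?\<sigma>" using same_absm[OF s2 For.prems(2)] same_absm[OF M1(3) For.prems(2)] by simp
 have "\<exists>D. big [W] ?M2 D ((m - 0) * (tC p B ?\<beta> L + 80 * L) + 20 * L) \<and>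
   map_pmf (absm b) D = for_loop f (m - 0) 0 (absm b ?M2) \<and> (\<forall>M'\<in>set_pmf D. kept b \<Gamma> d M M')"
 proof (rule loop)
  show "?M2 (b + d) = m" "?M2 (b + x) = 0" using M1(2) wf by (auto simp: m_def)
  show "kept b \<Gamma> d M ?M2" using same_kept[OF M1(3)] same_kept[OF s2] kept_trans by blast
  show "absm b ?M2 a k <= B a" for a k unfolding a2 by (rule For.prems(7))
 qed simp
 then obtain D where D: "big [W] ?M2 D (m * (tC p B ?\<beta> L + 80 * L) + 20 * L)"
  "map_pmf (absm b) D = for_loop f m 0 ?\<sigma>" "\<forall>M'\<in>set_pmf D. kept b \<Gamma> d M M'"
  unfolding a2 by auto
 have c0: "acost (Const 0) M1 <= 50 * L" using bl[OF L, of 0] by simp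
 have dx: "x < 100" using wf by simp
 have "big (Store (radr x) (Const 0) # [W]) M1 D (60 * L + (m * (tC p B ?\<beta> L + 80 * L) + 20 * L))"
  by (rule big_StoreR[where M = M1, OF L b1 dx c0]) (use D(1) in \<open>simp del: fun_upd_apply\<close>)
 from big_append_det[OF M1(1) this]
 have "big (ccomp (For x n p) d) M D (tE n B \<beta> L + (60 * L + (m * (tC p B ?\<beta> L + 80 * L) + 20 * L)))"
  by (simp add: W_def)
 moreover have "m * (tC p B ?\<beta> L + 80 * L) <= ebd n B \<beta> * (tC p B ?\<beta> L + 80 * L)"
  using mle by (rule mult_right_mono) simp
 ultimately have "big (ccomp (For x n p) d) M D (tC (For x n p) B \<beta> L)"
  by (elim big_mono) (unfold tC.simps, linarith)
 moreover have "map_pmf (absm b) D = exec (For x n p) \<rho> ?\<sigma>"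
  using D(2) by (simp add: f_def[abs_def] m_def)
 ultimately show ?case using D(3) by blast
qed

section \<open>Growth classes: polynomial loop counts, exponential values\<close>

definition polyb :: "(nat => nat) => bool" where
 "polyb f \<longleftrightarrow> (\<exists>p :: nat poly. \<forall>n. f n <= poly p n)"

text \<open>Such values have polynomial bit length (\<open>polyb_bit_length\<close>), and this is
  all that the logarithmic cost criterion demands. Only loop counts and numbers of drawn bits must
  be polynomial themselves.\<close>

definition expb :: "(nat => nat) => bool" where
 "expb f \<longleftrightarrow> (\<exists>g. polyb g \<and> (\<forall>n. f n <= 2 ^ g n))"

lemma polyb_mono: "polyb g ==> (!!n. f n <= g n) ==> polyb f"
 unfolding polyb_def using order.trans by blast

lemma polyb_const [simp]: "polyb (%n. c)"
 unfolding polyb_def by (intro exI[of _ "[:c:]"]) simp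

lemma polyb_id [simp]: "polyb (%n. n)"
 unfolding polyb_def by (intro exI[of _ "[:0, 1:]"]) simp

lemma polyb_add: "polyb f ==> polyb g ==> polyb (%n. f n + g n)"
 unfolding polyb_def by (metis add_mono poly_add)

lemma polyb_mult: "polyb f ==> polyb g ==> polyb (%n. f n * g n)"
 unfolding polyb_def by (metis mult_le_mono poly_mult)

lemma expb_mono: "expb g ==> (!!n. f n <= g n) ==> expb f"
 unfolding expb_def using order.trans by blast

lemma polyb_expb: "polyb f ==> expb f"
 unfolding expb_def by (intro exI[of _ f]) (auto intro: less_imp_le)

lemma expb_pow2: "polyb f ==> expb (%n. 2 ^ f n)"
 unfolding expb_def by (intro exI[of _ f]) auto

lemma expb_mult: "expb f ==> expb g ==> expb (%n. f n * g n)"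
 unfolding expb_def
proof (elim exE conjE)
 fix a b assume "polyb a" "\<forall>n. f n <= 2 ^ a n" "polyb b" "\<forall>n. g n <= 2 ^ b n"
 then show "\<exists>ga. polyb ga \<and> (\<forall>n. f n * g n <= 2 ^ ga n)"
  by (intro exI[of _ "%n. a n + b n"]) (auto intro: polyb_add mult_le_mono simp: power_add)
qed

lemma expb_add: "expb f ==> expb g ==> expb (%n. f n + g n)"
proof (rule expb_mono[where g = "%n. (f n + 1) * (g n + 1)"])
 have *: "expb (%n. h n + 1)" if h: "expb h" for h
 proof -
  obtain a where a: "polyb a" "!!n. h n <= 2 ^ a n" using h unfolding expb_def by blast
  have "h n + 1 <= 2 ^ (a n + 1)" for n
  proof -
   have "1 <= (2::nat) ^ a n" by simp
   then have "h n + 1 <= 2 ^ a n + 2 ^ a n" using a(2)[of n] by (intro add_mono) auto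
   then show ?thesis by simp
  qed
  then show ?thesis unfolding expb_def using polyb_add[OF a(1) polyb_const] by blast
 qed
 show "expb f ==> expb g ==> expb (%n. (f n + 1) * (g n + 1))"
  by (intro expb_mult *)
qed auto

lemma expb_power: "expb f ==> polyb g ==> expb (%n. f n ^ g n)"
 unfolding expb_def
proof (elim exE conjE)
 fix a assume "polyb g" "polyb a" "\<forall>n. f n <= 2 ^ a n"
 then show "\<exists>ga. polyb ga \<and> (\<forall>n. f n ^ g n <= 2 ^ ga n)"
  by (intro exI[of _ "%n. a n * g n"]) (auto intro: polyb_mult power_mono simp: power_mult)
qed

lemma polyb_bit_length: "expb f ==> polyb (%n. bit_length (f n))"
proof -
 assume "expb f"
 then obtain g where g: "polyb g" "!!n. f n <= 2 ^ g n" unfolding expb_def by blast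
 have "bit_length (f n) <= g n + 1" for n
 proof -
  have "f n < 2 ^ (g n + 1)" using g(2)[of n] le_less_trans[of "f n" "2 ^ g n" "2 ^ (g n + 1)"] by simp
  then have "floorlog 2 (f n) <= g n + 1" by (simp add: floorlog_le_iff)
  then show ?thesis by (simp add: bit_length_def)
 qed
 then show ?thesis by (rule polyb_mono[OF polyb_add[OF g(1) polyb_const]])
qed

text \<open>A syntactic test for polynomial values that mirrors \<open>op_bd\<close> and
  \<open>it_bd\<close>: a product loop never passes, a search passes as soon as its range does, and
  the right operand of a difference or quotient may be anything.\<close>

primrec small_exp :: "(nat => bool) => exp => bool" where
 "small_exp sm (Num k) \<longleftrightarrow> True"
| "small_exp sm (Var x) \<longleftrightarrow> True"
| "small_exp sm (Rd a e) \<longleftrightarrow> sm a"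
| "small_exp sm (Op p a b) \<longleftrightarrow> small_exp sm a \<and> (p = MINUS \<or> p = DIVIDE \<or> small_exp sm b)"
| "small_exp sm (Iter k x n e) \<longleftrightarrow> small_exp sm n \<and> (k = IFind \<or> k = ISum \<and> small_exp sm e)"

primrec good_exp :: "(nat => bool) => exp => bool" where
 "good_exp sm (Num k) \<longleftrightarrow> True"
| "good_exp sm (Var x) \<longleftrightarrow> True"
| "good_exp sm (Rd a e) \<longleftrightarrow> good_exp sm e"
| "good_exp sm (Op p a b) \<longleftrightarrow> good_exp sm a \<and> good_exp sm b"
| "good_exp sm (Iter k x n e) \<longleftrightarrow> small_exp sm n \<and> good_exp sm n \<and> good_exp sm e"

primrec good_cmd :: "(nat => bool) => cmd => bool" where
 "good_cmd sm (Wr a i e) \<longleftrightarrow> good_exp sm i \<and> good_exp sm e \<and> (sm a \<longrightarrow> small_exp sm e)"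
| "good_cmd sm (Rnd a i k) \<longleftrightarrow> good_exp sm i \<and> good_exp sm k \<and> small_exp sm k \<and> \<not> sm a"
| "good_cmd sm (Seq p q) \<longleftrightarrow> good_cmd sm p \<and> good_cmd sm q"
| "good_cmd sm (For x n p) \<longleftrightarrow> small_exp sm n \<and> good_exp sm n \<and> good_cmd sm p"

context
 fixes sm :: "nat => bool" and B :: "nat => nat => nat"
 assumes sm: "!!a. sm a ==> polyb (%n. B n a)" and ex: "!!a. expb (%n. B n a)"
begin

lemma polyb_env_upd:
 "(!!y. polyb (%n. \<beta> n y)) ==> polyb f ==> polyb (%n. ((\<beta> n)(x := f n)) y)"
 by (cases "y = x") auto

lemma polyb_ebd:
 "small_exp sm e ==> (!!y. polyb (%n. \<beta> n y)) ==> polyb (%n. ebd e (B n) (\<beta> n))"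
proof (induction e arbitrary: \<beta>)
 case (Op p a b)
 then show ?case by (cases p) (auto intro: polyb_add polyb_mult)
next
 case (Iter k x n e)
 have n: "polyb (%m. ebd n (B m) (\<beta> m))" using Iter by auto
 have "polyb (%m. ebd e (B m) ((\<beta> m)(x := ebd n (B m) (\<beta> m))))" if "small_exp sm e"
  using that by (intro Iter.IH(2) polyb_env_upd n Iter.prems)
 then show ?case using n Iter.prems by (cases k) (auto intro: polyb_mult)
qed (auto intro: sm)

lemma expb_ebd:
 "good_exp sm e ==> (!!y. polyb (%n. \<beta> n y)) ==> expb (%n. ebd e (B n) (\<beta> n))"
proof (induction e arbitrary: \<beta>)
 case (Op p a b)
 then show ?case by (cases p) (auto intro: expb_add expb_mult)
next
 case (Iter k x n e)
 have n: "polyb (%m. ebd n (B m) (\<beta> m))" using Iter by (auto intro: polyb_ebd)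
 have e: "expb (%m. ebd e (B m) ((\<beta> m)(x := ebd n (B m) (\<beta> m))))"
  using Iter.prems by (intro Iter.IH(2) polyb_env_upd n) auto
 have "expb (%m. ebd e (B m) ((\<beta> m)(x := ebd n (B m) (\<beta> m))) + 1)"
  by (rule expb_add[OF e polyb_expb]) simp
 from expb_power[OF this n] show ?case
  using n e by (cases k) (auto intro: expb_mult polyb_expb)
qed (auto intro: ex polyb_expb)

lemma expb_vE:
 "good_exp sm e ==> (!!y. polyb (%n. \<beta> n y)) ==> expb (%n. vE e (B n) (\<beta> n))"
proof (induction e arbitrary: \<beta>)
 case (Rd a e)
 then show ?case by (auto intro: expb_add ex)
next
 case (Op p a b)
 have "expb (%n. ebd (Op p a b) (B n) (\<beta> n))" using Op.prems by (rule expb_ebd)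
 then show ?case using Op by (auto intro!: expb_add)
next
 case (Iter k x n e)
 have n: "polyb (%m. ebd n (B m) (\<beta> m))" using Iter.prems by (auto intro: polyb_ebd)
 have e: "expb (%m. vE e (B m) ((\<beta> m)(x := ebd n (B m) (\<beta> m))))"
  using Iter.prems by (intro Iter.IH(2) polyb_env_upd n) auto
 have "expb (%m. ebd (Iter k x n e) (B m) (\<beta> m))" using Iter.prems by (rule expb_ebd)
 then show ?case
  unfolding vE.simps ebd.simps
  using Iter.IH(1)[OF _ Iter.prems(2)] Iter.prems(1) e polyb_expb[OF polyb_const[of 1]]
  by (intro expb_add) auto
qed (auto intro: polyb_expb)

lemma polyb_tE:
 "good_exp sm e ==> (!!y. polyb (%n. \<beta> n y)) ==> polyb L ==>
  polyb (%n. tE e (B n) (\<beta> n) (L n))"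
proof (induction e arbitrary: \<beta>)
 case (Iter k x n e)
 have n: "polyb (%m. ebd n (B m) (\<beta> m))" using Iter.prems by (auto intro: polyb_ebd)
 have e: "polyb (%m. tE e (B m) ((\<beta> m)(x := ebd n (B m) (\<beta> m))) (L m))"
  using Iter.prems by (intro Iter.IH(2) polyb_env_upd n) auto
 show ?case unfolding tE.simps using Iter.IH(1)[OF _ Iter.prems(2,3)] Iter.prems(1,3) e n
  by (intro polyb_add polyb_mult) auto
qed (auto intro!: polyb_add polyb_mult)

lemma expb_vC:
 "good_cmd sm c ==> (!!y. polyb (%n. \<beta> n y)) ==> expb (%n. vC c (B n) (\<beta> n))"
proof (induction c arbitrary: \<beta>)
 case (For x n p)
 have n: "polyb (%m. ebd n (B m) (\<beta> m))" using For.prems by (auto intro: polyb_ebd)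
 have "expb (%m. vC p (B m) ((\<beta> m)(x := ebd n (B m) (\<beta> m))))"
  using For.prems by (intro For.IH polyb_env_upd n) auto
 then show ?case unfolding vC.simps using For.prems polyb_expb[OF polyb_const[of 1]]
  by (intro expb_add expb_vE) auto
qed (auto intro!: expb_add expb_vE expb_pow2 polyb_ebd)

lemma polyb_tC:
 "good_cmd sm c ==> (!!y. polyb (%n. \<beta> n y)) ==> polyb L ==>
  polyb (%n. tC c (B n) (\<beta> n) (L n))"
proof (induction c arbitrary: \<beta>)
 case (For x n p)
 have n: "polyb (%m. ebd n (B m) (\<beta> m))" using For.prems by (auto intro: polyb_ebd)
 have "polyb (%m. tC p (B m) ((\<beta> m)(x := ebd n (B m) (\<beta> m))) (L m))"
  using For.prems by (intro For.IH polyb_env_upd n) auto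
 then show ?case unfolding tC.simps using For.prems n
  by (intro polyb_add polyb_mult polyb_tE) auto
qed (auto intro!: polyb_add polyb_mult polyb_tE polyb_ebd)

lemma expb_write_bd:
 "good_cmd sm c ==> (!!y. polyb (%n. \<beta> n y)) ==> expb (%n. write_bd c (B n) (\<beta> n) a)"
proof (induction c arbitrary: \<beta>)
 case (For x n p)
 have n: "polyb (%m. ebd n (B m) (\<beta> m))" using For.prems by (auto intro: polyb_ebd)
 show ?case unfolding write_bd.simps
  using For.prems by (intro For.IH polyb_env_upd n) auto
next
 case (Wr a' i e)
 then show ?case using polyb_expb[OF polyb_const[of 0]] by (cases "a = a'") (auto intro: expb_ebd)
next
 case (Rnd a' i k)
 then have "polyb (%n. ebd k (B n) (\<beta> n))" by (intro polyb_ebd) auto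
 then have "expb (%n. 2 ^ ebd k (B n) (\<beta> n))" by (rule expb_pow2)
 then show ?case using polyb_expb[OF polyb_const[of 0]] by (cases "a = a'") simp_all
qed (auto intro!: expb_add)

lemma polyb_write_bd:
 "good_cmd sm c ==> sm a ==> (!!y. polyb (%n. \<beta> n y)) ==> polyb (%n. write_bd c (B n) (\<beta> n) a)"
proof (induction c arbitrary: \<beta>)
 case (For x n p)
 have n: "polyb (%m. ebd n (B m) (\<beta> m))" using For.prems by (auto intro: polyb_ebd)
 show ?case unfolding write_bd.simps
  using For.prems by (intro For.IH polyb_env_upd n) auto
next
 case (Wr a' i e)
 then show ?case by (cases "a = a'") (auto intro: polyb_ebd)
next
 case (Rnd a' i k)
 then show ?case by (cases "a = a'") auto
qed (auto intro!: polyb_add)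

end

section \<open>Bounds for all arrays, by stratification of the program\<close>

text \<open>Ensures that the value of \<open>ebd\<close> depends only on bounds of arrays with
  number below \<open>A\<close> (\<open>ebd_cong_low\<close>). Operands that \<open>op_bd\<close>
  ignores and bodies of searches may read any array; in this way a command may use what its own
  array held before.\<close>

primrec low_exp :: "nat => exp => bool" where
 "low_exp A (Num k) \<longleftrightarrow> True"
| "low_exp A (Var x) \<longleftrightarrow> True"
| "low_exp A (Rd a e) \<longleftrightarrow> a < A"
| "low_exp A (Op p a b) \<longleftrightarrow> low_exp A a \<and> (p = MINUS \<or> p = DIVIDE \<or> low_exp A b)"
| "low_exp A (Iter k x n e) \<longleftrightarrow> low_exp A n \<and> (k = IFind \<or> low_exp A e)"

text \<open>The list \<open>cs\<close> collects the counts of the enclosing loops: they bound the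
  loop variables and so enter the bounds of written values.\<close>

primrec low_cmd :: "exp list => cmd => bool" where
 "low_cmd cs (Wr a i e) \<longleftrightarrow> low_exp a e \<and> (\<forall>c\<in>set cs. low_exp a c)"
| "low_cmd cs (Rnd a i k) \<longleftrightarrow> low_exp a k \<and> (\<forall>c\<in>set cs. low_exp a c)"
| "low_cmd cs (Seq p q) \<longleftrightarrow> low_cmd cs p \<and> low_cmd cs q"
| "low_cmd cs (For x n p) \<longleftrightarrow> low_cmd (n # cs) p"

primrec writes :: "cmd => nat => bool" where
 "writes (Wr a i e) a' \<longleftrightarrow> a' = a"
| "writes (Rnd a i k) a' \<longleftrightarrow> a' = a"
| "writes (Seq p q) a' \<longleftrightarrow> writes p a' \<or> writes q a'"
| "writes (For x n p) a' \<longleftrightarrow> writes p a'"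

lemma ebd_cong_low:
 "low_exp A e ==> (!!a. a < A ==> B a = B' a) ==> ebd e B \<beta> = ebd e B' \<beta>"
proof (induction e arbitrary: \<beta>)
 case (Op p a b)
 then show ?case by (cases p) auto
next
 case (Iter k x n e)
 then show ?case by (cases k) auto
qed auto

lemma low_cmd_counts: "low_cmd cs c ==> writes c a ==> e \<in> set cs ==> low_exp a e"
 by (induction c arbitrary: cs) auto

lemma write_bd_0: "\<not> writes c a ==> write_bd c B \<beta> a = 0"
 by (induction c arbitrary: \<beta>) auto

lemma write_bd_cong_low:
 "low_cmd cs c ==> (!!a'. a' < a ==> B a' = B' a') ==> write_bd c B \<beta> a = write_bd c B' \<beta> a"
proof (induction c arbitrary: \<beta> cs)
 case (For x n p)
 show ?case
 proof (cases "writes p a")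
  case True
  then have "low_exp a n" using For.prems(1) low_cmd_counts[of "n # cs" p a n] by simp
  then have "ebd n B \<beta> = ebd n B' \<beta>" using For.prems(2) by (rule ebd_cong_low)
  then show ?thesis using For.IH[of "n # cs"] For.prems by simp
 qed (simp add: write_bd_0)
next
 case (Seq p q)
 then show ?case by (metis low_cmd.simps(3) write_bd.simps(3))
qed (auto simp: ebd_cong_low[of a _ B B'])

lemma wf_cmd_writes: "wf_cmd \<Gamma> c d ==> writes c a ==> 0 < a \<and> a < 50"
 by (induction c arbitrary: \<Gamma> d) auto

lemma exec_unwritten: "\<not> writes c a ==> \<sigma>' \<in> set_pmf (exec c \<rho> \<sigma>) ==> \<sigma>' a = \<sigma> a"
proof (induction c arbitrary: \<rho> \<sigma> \<sigma>')
 case (For x n p)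
 show ?case
 proof (rule for_loop_inv[where P = "%\<tau>. \<tau> a = \<sigma> a"])
  show "\<sigma>' \<in> set_pmf (for_loop (%v. exec p (\<rho>(x := v))) (eval n \<sigma> \<rho>) 0 \<sigma>)"
   using For.prems by simp
  fix v \<tau> \<tau>' assume "\<tau> a = \<sigma> a" "\<tau>' \<in> set_pmf (exec p (\<rho>(x := v)) \<tau>)"
  then show "\<tau>' a = \<sigma> a" using For.IH[of \<tau>' "\<rho>(x := v)" \<tau>] For.prems
   by (simp del: fun_upd_apply)
 qed simp
next
 case (Seq p q)
 then show ?case by fastforce
qed (auto simp: wr_def)

definition init_bd :: "nat => nat => nat" where
 "init_bd n a = (if a = 0 then 2 ^ n else if a = 1 then n else 0)"

text \<open>Array \<open>A\<close> receives its bound when those of all smaller numbers are final.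
  The initial bound is added because old contents survive until they are overwritten.\<close>

primrec bd_seq :: "cmd => nat => nat => nat => nat" where
 "bd_seq c n 0 = init_bd n"
| "bd_seq c n (Suc A) =
   (bd_seq c n A)(A := init_bd n A + write_bd c (bd_seq c n A) (%_. 0) A)"

lemma bd_seq_stable: "a < A ==> A <= A' ==> bd_seq c n A' a = bd_seq c n A a"
 by (induction A') (auto simp: le_Suc_eq)

text \<open>Stratification turns the inequality between \<open>B\<close> and its
  \<open>write_bd\<close> into a recursion on array numbers. Fifty rounds reach all arrays that a
  well-formed program writes, and each round stays in its growth class.\<close>

lemma array_bounds_exist:
 assumes wf: "wf_cmd [] c 30" and good: "good_cmd sm c" and low: "low_cmd [] c" and sm0: "\<not> sm 0"
 obtains B where "!!n a. init_bd n a <= B n a" "!!n a. write_bd c (B n) (%_. 0) a <= B n a"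
  "!!a. sm a ==> polyb (%n. B n a)" "!!a. expb (%n. B n a)"
proof
 let ?B = "%n. bd_seq c n 50"
 have B_eq: "?B n a = init_bd n a + write_bd c (?B n) (%_. 0) a" for n a
 proof (cases "a < 50")
  case True
  have "?B n a = bd_seq c n (Suc a) a" using True by (intro bd_seq_stable) auto
  also have "\<dots> = init_bd n a + write_bd c (bd_seq c n a) (%_. 0) a" by simp
  also have "write_bd c (bd_seq c n a) (%_. 0) a = write_bd c (?B n) (%_. 0) a"
   using True bd_seq_stable[of _ a 50 c n] by (intro write_bd_cong_low[OF low]) auto
  finally show ?thesis .
 next
  case False
  then have "\<not> writes c a" using wf_cmd_writes[OF wf] by blast
  moreover have "bd_seq c n A a = init_bd n a" if "A <= 50" for A
   using that False by (induction A) auto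
  ultimately show ?thesis by (simp add: write_bd_0)
 qed
 show "init_bd n a <= ?B n a" "write_bd c (?B n) (%_. 0) a <= ?B n a" for n a
  using B_eq[of n a] by linarith+
 have i: "expb (%n. init_bd n a)" "sm a ==> polyb (%n. init_bd n a)" for a
 proof -
  consider "a = 0" | "a = 1" | "a \<noteq> 0" "a \<noteq> 1" by blast
  then have "expb (%n. init_bd n a) \<and> (sm a \<longrightarrow> polyb (%n. init_bd n a))"
   by cases (use sm0 expb_pow2[OF polyb_id] polyb_expb[OF polyb_id] polyb_expb[OF polyb_const[of 0]]
     in \<open>simp_all add: init_bd_def\<close>)
  then show "expb (%n. init_bd n a)" "sm a ==> polyb (%n. init_bd n a)" by auto
 qed
 have "(\<forall>a. expb (%n. bd_seq c n A a)) \<and> (\<forall>a. sm a \<longrightarrow> polyb (%n. bd_seq c n A a))" for A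
 proof (induction A)
  case (Suc A)
  then have s: "!!a. sm a ==> polyb (%n. bd_seq c n A a)" "!!a. expb (%n. bd_seq c n A a)" by auto
  have "expb (%n. init_bd n A + write_bd c (bd_seq c n A) (%_. 0) A)"
   by (intro expb_add i expb_write_bd[OF s good]) auto
  moreover have "polyb (%n. init_bd n A + write_bd c (bd_seq c n A) (%_. 0) A)" if "sm A"
   using that by (intro polyb_add i polyb_write_bd[OF s good]) auto
  ultimately have "expb (%n. bd_seq c n (Suc A) a) \<and>
   (sm a \<longrightarrow> polyb (%n. bd_seq c n (Suc A) a))" for a
   using s by (cases "a = A") simp_all
  then show ?case by blast
 qed (use i in auto)
 then show "sm a ==> polyb (%n. ?B n a)" "expb (%n. ?B n a)" for a by auto
qed

section \<open>Reading the input, writing the output, and the complete machine program\<close>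

text \<open>The length of the encoded input, computed from its two leading entries while these are
  still in cells 0 and 1.\<close>

definition len_aexp :: aexp where
 "len_aexp = Add (Add (Const 2) (Mul (Const 2) (Mem (Const 0))))
   (Add (Mul (Const 2) (Mul (Mem (Const 0)) (Mem (Const 1)))) (Mem (Const 1)))"

text \<open>Cell 0 is turned into the base pointer; the two dimensions move to array 1.\<close>

definition prelude :: "com list" where
 "prelude = [Store (Add len_aexp (Const 101)) (Mem (Const 0)),
   Store (Add len_aexp (Const 151)) (Mem (Const 1)), Store (Const 0) len_aexp]"

text \<open>The counter is decremented before copying and the loop stops at 1. Cell 0, through which
  every array is addressed, is thereby left to the last store.\<close>

definition copy_loop :: "nat => com" where
 "copy_loop oid = While (Sub (Mem (radr 30)) (Const 1))
   [Store (radr 30) (Sub (Mem (radr 30)) (Const 1)),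
   Store (Mem (radr 30)) (Mem (aadr oid (Mem (radr 30))))]"

text \<open>The output is copied downwards, so that the base pointer is overwritten last.\<close>

definition postlude :: "nat => com list" where
 "postlude oid = [Store (radr 30) (Add (Mem (aadr 1 (Const 0))) (Mul (Mem (aadr 1 (Const 0))) (Mem (aadr 1 (Const 1))))),
   copy_loop oid, Store (Const 0) (Mem (aadr oid (Const 0)))]"

text \<open>The array view after \<open>prelude\<close>: cell 0 of the input now holds the base
  pointer, which is the length, and indices beyond the input are clipped to its last entry.\<close>

definition init_state :: "nat list => st" where
 "init_state xs = (%a k.
   if a = 0 then (if min k (length xs - 1) = 0 then length xs else xs ! min k (length xs - 1))
   else if a = 1 then (if k = 0 then xs ! 0 else if k = 1 then xs ! 1 else 0) else 0)"

lemma length_le_input_size: "length xs <= input_size xs"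
proof (induction xs)
 case (Cons x xs)
 then show ?case using bit_length_pos[of x] by (simp add: input_size_def)
qed simp

lemma nth_less_pow2_input_size: "k < length xs ==> xs ! k < 2 ^ input_size xs"
proof -
 assume k: "k < length xs"
 have "floorlog 2 (xs ! k) <= bit_length (xs ! k)" by (simp add: bit_length_def)
 then have "xs ! k < 2 ^ bit_length (xs ! k)" by (simp add: floorlog_le_iff)
 also have "bit_length (xs ! k) <= input_size xs" unfolding input_size_def
  using k by (intro member_le_sum_list) auto
 then have "(2::nat) ^ bit_length (xs ! k) <= 2 ^ input_size xs" by (rule power_increasing) simp
 finally show ?thesis .
qed

lemma prelude_correct:
 assumes len: "length xs = 2 + 2 * ns + 2 * ns * nc + nc" and xs: "xs ! 0 = ns" "xs ! 1 = nc"
  and L: "bit_length (length xs + 300 + 50 * v) <= L" and v: "!!k. k < length xs ==> xs ! k <= v"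
 obtains M where "big prelude (load xs) (return_pmf M) (200 * L)" "M 0 = length xs"
  "absm (length xs) M = init_state xs"
proof -
 let ?b = "length xs" and ?M = "load xs"
 have b2: "2 <= ?b" using len by simp
 have m: "?M 0 = ns" "?M (Suc 0) = nc" using xs b2 by (auto simp: load_def)
 define M1 where "M1 = ?M(?b + 101 := ns)"
 define M2 where "M2 = M1(?b + 151 := nc)"
 define M3 where "M3 = M2(0 := ?b)"
 have m1: "M1 0 = ns" "M1 (Suc 0) = nc" "M2 0 = ns" "M2 (Suc 0) = nc"
  using m b2 by (auto simp: M1_def M2_def)
 have cst: "acost len_aexp M <= 20 * L \<and> aval len_aexp M = ?b" if "M 0 = ns" "M (Suc 0) = nc" for M
 proof -
  have "bit_length 0 <= L" "bit_length (Suc 0) <= L" "bit_length 2 <= L" "bit_length ns <= L"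
   "bit_length nc <= L" "bit_length (2 * ns) <= L" "bit_length (2 + 2 * ns) <= L"
   "bit_length (ns * nc) <= L" "bit_length (2 * (ns * nc)) <= L" "bit_length (2 * (ns * nc) + nc) <= L"
   "bit_length (2 + 2 * ns + (2 * (ns * nc) + nc)) <= L"
   by (rule bl[OF L]; use len in simp)+
  then show ?thesis using that len by (simp add: len_aexp_def)
 qed
 have bls: "bit_length 0 <= L" "bit_length (Suc 0) <= L" "bit_length 101 <= L" "bit_length 151 <= L"
  "bit_length (?b + 101) <= L" "bit_length (?b + 151) <= L" "bit_length ns <= L" "bit_length nc <= L"
  by (rule bl[OF L]; use len in simp)+
 have "big [Store (Const 0) len_aexp] M2 (return_pmf M3) (30 * L)"
  by (rule big_Store[where T = 0]) (use cst[of M2] m1 bls in \<open>auto intro: big_Nil simp: M3_def simp del: fun_upd_apply\<close>)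
 moreover have "big (Store (Add len_aexp (Const 151)) (Mem (Const 1)) # [Store (Const 0) len_aexp]) M1 (return_pmf M3) (60 * L)"
  by (rule big_Store[where T = "30 * L"])
   (use calculation cst[of M1] m1 bls in \<open>auto simp: M2_def[symmetric] simp del: fun_upd_apply\<close>)
 moreover have "big prelude ?M (return_pmf M3) (200 * L)" unfolding prelude_def
  by (rule big_Store[where T = "60 * L"])
   (use calculation cst[of ?M] m bls in \<open>auto simp: M1_def[symmetric] simp del: fun_upd_apply\<close>)
 moreover have "M3 0 = ?b" by (simp add: M3_def)
 moreover have "absm ?b M3 = init_state xs"
 proof (intro ext)
  fix a k
  have M3: "M3 c = (if c = 0 then ?b else if c = ?b + 151 then nc else if c = ?b + 101 then ns
    else if c < ?b then xs ! c else 0)" for c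
   by (simp add: M3_def M2_def M1_def load_def)
  show "absm ?b M3 a k = init_state xs a k"
  proof (cases "a = 0")
   case True
   have "min k (?b - 1) < ?b" using b2 by linarith
   then show ?thesis using True by (auto simp: absm_def adr_def M3 init_state_def)
  next
   case False
   have "a < 50 ==> ?b + (100 + a + 50 * k) = ?b + 101 \<longleftrightarrow> a = 1 \<and> k = 0"
    "a < 50 ==> ?b + (100 + a + 50 * k) = ?b + 151 \<longleftrightarrow> a = 1 \<and> k = 1"
   proof -
    have "0 < ?b" using b2 by linarith
    then show "a < 50 ==> ?b + (100 + a + 50 * k) = ?b + 101 \<longleftrightarrow> a = 1 \<and> k = 0"
     "a < 50 ==> ?b + (100 + a + 50 * k) = ?b + 151 \<longleftrightarrow> a = 1 \<and> k = 1"
     using False adr_eq_iff[of 1 a ?b k 0] adr_eq_iff[of 1 a ?b k 1] by (simp_all add: adr_def)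
   qed
   then show ?thesis using False xs by (auto simp: absm_def adr_def M3 init_state_def)
  qed
 qed
 ultimately show ?thesis using that by blast
qed

text \<open>The output has \<open>ns + ns * nc\<close> entries, fewer than the \<open>b\<close>
  cells of the input. Writing it to the initial segment therefore destroys no register and no array
  cell that is still to be read.\<close>

lemma postlude_correct:
 assumes b: "0 < b" "M 0 = b" and oid: "0 < oid" "oid < 50" and ns: "absm b M 1 0 = ns" "absm b M 1 1 = nc"
  and cnt: "ns + ns * nc < b" "nc < b" and L: "bit_length (b + 300 + 50 * v) <= L"
  and v: "!!k. absm b M oid k <= v" "b <= v"
 shows "\<exists>M'. big (postlude oid) M (return_pmf M') (b * (200 * L) + 200 * L) \<and>
  (\<forall>k<ns + ns * nc. M' k = absm b M oid k)"
proof -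
 let ?c = "ns + ns * nc"
 have M1: "M (adr b 1 0) = ns" "M (adr b 1 (Suc 0)) = nc" using ns by (simp_all add: absm_def)
 have loop: "\<exists>M'. big (copy_loop oid # [Store (Const 0) (Mem (aadr oid (Const 0)))]) Mi (return_pmf M')
   (i * (200 * L) + 100 * L) \<and> (\<forall>k<?c. M' k = absm b M oid k)"
  if "i <= ?c" "Mi 0 = b" "Mi (b + 30) = i" "!!k. i <= k ==> 0 < k ==> k < ?c ==> Mi k = absm b M oid k"
   "!!k. Mi (adr b oid k) = absm b M oid k" for i Mi
  using that
 proof (induction i arbitrary: Mi)
  case 0
  have c1: "acost (Mem (radr 30)) Mi <= 5 * L" by (rule acost_reg[OF L]) (use 0 in auto)
  have "acost (aadr oid (Const 0)) Mi <= 20 * L"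
   by (rule acost_aadr[OF L]) (use 0 oid bl[OF L, of 0] in auto)
  moreover have "bit_length 0 <= L" "bit_length (Suc 0) <= L" by (rule bl[OF L]; simp)+
  moreover have "bit_length (absm b M oid 0) <= L" by (rule bl[OF L]) (use v(1)[of 0] in simp)
  ultimately have s: "big [Store (Const 0) (Mem (aadr oid (Const 0)))] Mi (return_pmf (Mi(0 := absm b M oid 0))) (50 * L)"
   by (intro big_Store[where T = 0]) (use 0 in \<open>auto intro: big_Nil simp del: fun_upd_apply\<close>)
  have "big (copy_loop oid # [Store (Const 0) (Mem (aadr oid (Const 0)))]) Mi
    (return_pmf (Mi(0 := absm b M oid 0))) (0 * (200 * L) + 100 * L)"
   unfolding copy_loop_def
   by (rule big_While_False[OF _ s]) (use 0 c1 bl[OF L, of 0] bl[OF L, of "Suc 0"] in auto)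
  moreover have "\<forall>k<?c. (Mi(0 := absm b M oid 0)) k = absm b M oid k" using 0 by simp
  ultimately show ?case by blast
 next
  case (Suc i)
  have c1: "acost (Mem (radr 30)) Mi <= 5 * L" by (rule acost_reg[OF L]) (use Suc.prems v cnt in auto)
  have bls: "bit_length 0 <= L" "bit_length (Suc 0) <= L" "bit_length i <= L"
   by (rule bl[OF L]; use Suc.prems cnt in simp)+
  show ?case
  proof (cases "i = 0")
   case True
   have "acost (aadr oid (Const 0)) Mi <= 20 * L"
    by (rule acost_aadr[OF L]) (use Suc.prems oid bl[OF L, of 0] in auto)
   moreover have "bit_length (absm b M oid 0) <= L" by (rule bl[OF L]) (use v(1)[of 0] in simp)
   ultimately have s: "big [Store (Const 0) (Mem (aadr oid (Const 0)))] Mi (return_pmf (Mi(0 := absm b M oid 0))) (50 * L)"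
    by (intro big_Store[where T = 0]) (use Suc.prems bls in \<open>auto intro: big_Nil simp del: fun_upd_apply\<close>)
   have "big (copy_loop oid # [Store (Const 0) (Mem (aadr oid (Const 0)))]) Mi
     (return_pmf (Mi(0 := absm b M oid 0))) (Suc i * (200 * L) + 100 * L)"
    unfolding copy_loop_def
    by (rule big_While_False[OF _ s]) (use Suc.prems c1 bls True in auto)
   moreover have "\<forall>k<?c. (Mi(0 := absm b M oid 0)) k = absm b M oid k"
    using Suc.prems(4) True by simp
   ultimately show ?thesis by blast
  next
   case False
   define M1 where "M1 = Mi(b + 30 := i)"
   define M2 where "M2 = M1(i := absm b M oid i)"
   have i: "i < ?c" "i < b" using Suc.prems cnt by auto
   have ad: "adr b oid k \<ge> b + 100" for k using oid by (simp add: adr_def)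
   have m1: "M1 0 = b" "M1 (b + 30) = i" using Suc.prems b by (auto simp: M1_def)
   have m1o: "!!k. M1 (adr b oid k) = absm b M oid k"
   proof -
    fix k
    have "adr b oid k \<noteq> b + 30" using ad[of k] by linarith
    then show "M1 (adr b oid k) = absm b M oid k" using Suc.prems by (simp add: M1_def)
   qed
   have "\<exists>M'. big (copy_loop oid # [Store (Const 0) (Mem (aadr oid (Const 0)))]) M2 (return_pmf M')
    (i * (200 * L) + 100 * L) \<and> (\<forall>k<?c. M' k = absm b M oid k)"
   proof (rule Suc.IH)
    show "M2 0 = b" "M2 (b + 30) = i" using m1 False i by (auto simp: M2_def)
    show "M2 k = absm b M oid k" if "i <= k" "0 < k" "k < ?c" for k
     using Suc.prems(4)[of k] that cnt by (auto simp: M2_def M1_def)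
    show "M2 (adr b oid k) = absm b M oid k" for k
    proof -
     have "adr b oid k \<noteq> i" using ad[of k] i by linarith
     then show ?thesis using m1o by (simp add: M2_def)
    qed
   qed (use i in simp)
   then obtain M' where M': "big (copy_loop oid # [Store (Const 0) (Mem (aadr oid (Const 0)))]) M2 (return_pmf M')
    (i * (200 * L) + 100 * L)" "\<forall>k<?c. M' k = absm b M oid k" by blast
   have c2: "acost (Mem (radr 30)) M1 <= 5 * L" by (rule acost_reg[OF L]) (use m1 i v in auto)
   have "acost (aadr oid (Mem (radr 30))) M1 <= 20 * L"
    by (rule acost_aadr[OF L]) (use m1 i v oid c2 in auto)
   moreover have "bit_length (absm b M oid i) <= L" by (rule bl[OF L]) (use v(1)[of i] in simp)
   ultimately have "big (Store (Mem (radr 30)) (Mem (aadr oid (Mem (radr 30)))) # copy_loop oid # [Store (Const 0) (Mem (aadr oid (Const 0)))])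
     M1 (return_pmf M') (30 * L + (i * (200 * L) + 100 * L))"
    by (intro big_Store[where T = "i * (200 * L) + 100 * L"])
     (use M'(1) m1 m1o c2 in \<open>auto simp: M2_def[symmetric] simp del: fun_upd_apply\<close>)
   then have "big (Store (radr 30) (Sub (Mem (radr 30)) (Const 1)) # Store (Mem (radr 30)) (Mem (aadr oid (Mem (radr 30)))) # copy_loop oid # [Store (Const 0) (Mem (aadr oid (Const 0)))])
     Mi (return_pmf M') (60 * L + (30 * L + (i * (200 * L) + 100 * L)))"
    by (intro big_StoreR[where M = Mi, OF L Suc.prems(2)])
     (use c1 bls Suc.prems in \<open>auto simp: M1_def simp del: fun_upd_apply\<close>)
   then have "big (copy_loop oid # [Store (Const 0) (Mem (aadr oid (Const 0)))]) Mi (return_pmf M')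
     (Suc i * (200 * L) + 100 * L)"
    unfolding copy_loop_def
    by (intro big_While_True[where T = "60 * L + (30 * L + (i * (200 * L) + 100 * L))"])
     (use c1 bls Suc.prems False in auto)
   then show ?thesis using M'(2) by blast
  qed
 qed
 define M2 where "M2 = M(b + 30 := ?c)"
 have ad: "adr b oid k \<noteq> b + 30" for k using oid by (simp add: adr_def)
 have "\<exists>M'. big (copy_loop oid # [Store (Const 0) (Mem (aadr oid (Const 0)))]) M2 (return_pmf M')
   (?c * (200 * L) + 100 * L) \<and> (\<forall>k<?c. M' k = absm b M oid k)"
  by (rule loop) (use b ad oid in \<open>auto simp: M2_def absm_def\<close>)
 then obtain M' where M': "big (copy_loop oid # [Store (Const 0) (Mem (aadr oid (Const 0)))]) M2 (return_pmf M')
   (?c * (200 * L) + 100 * L)" "\<forall>k<?c. M' k = absm b M oid k" by blast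
 have "acost (aadr 1 (Const 0)) M <= 20 * L" "acost (aadr 1 (Const 1)) M <= 20 * L"
  by (rule acost_aadr[OF L]; use b v bl[OF L, of 0] bl[OF L, of "Suc 0"] in simp)+
 moreover have "bit_length ns <= L" "bit_length nc <= L" "bit_length (ns * nc) <= L" "bit_length ?c <= L"
  by (rule bl[OF L]; use cnt in simp)+
 ultimately have "acost (Mem (aadr 1 (Const 0))) M <= 21 * L" "acost (Mem (aadr 1 (Const 1))) M <= 21 * L"
  "bit_length (ns * nc) <= L" "bit_length ?c <= L"
  using M1 b by auto
 then have "acost (Add (Mem (aadr 1 (Const 0))) (Mul (Mem (aadr 1 (Const 0))) (Mem (aadr 1 (Const 1))))) M <= 65 * L"
  using M1[folded One_nat_def] b by (simp del: One_nat_def)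
 then have "big (postlude oid) M (return_pmf M') (69 * L + (?c * (200 * L) + 100 * L))"
  unfolding postlude_def
  by (intro big_Store[where T = "?c * (200 * L) + 100 * L"])
   (use M'(1) b M1 acost_radr[OF L, of M 30] in \<open>auto simp: M2_def simp del: fun_upd_apply\<close>)
 moreover have "?c * (200 * L) <= b * (200 * L)" using cnt by (intro mult_right_mono) auto
 ultimately have "big (postlude oid) M (return_pmf M') (b * (200 * L) + 200 * L)"
  by (elim big_mono) linarith
 then show ?thesis using M'(2) by blast
qed

text \<open>The interface between machine and algorithm: syntactic checks on \<open>c\<close> yield
  one polynomial for the running time, and afterwards only \<open>exec\<close> matters. Memory is
  compared on the output cells only, as the other cells hold leftovers.\<close>

theorem program_correct:
 assumes wf: "wf_cmd [] c 30" and good: "good_cmd sm c" and low: "low_cmd [] c" and sm0: "\<not> sm 0"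
  and w1: "\<not> writes c 1" and oid: "0 < oid" "oid < 50"
 obtains P :: "com list" and p :: "nat poly" where
  "!!xs ns nc R. length xs = 2 + 2 * ns + 2 * ns * nc + nc ==> xs ! 0 = ns ==> xs ! 1 = nc ==>
   R = run (poly p (input_size xs)) (P, load xs, 0) ==>
   (\<forall>(K, M, t)\<in>set_pmf R. K = [] \<and> t <= poly p (input_size xs)) \<and>
   map_pmf (%(K, M, t). %k. if k < ns + ns * nc then M k else 0) R =
   map_pmf (%\<sigma> k. if k < ns + ns * nc then \<sigma> oid k else 0) (exec c (%_. 0) (init_state xs))"
proof -
 obtain B where B: "!!n a. init_bd n a <= B n a" "!!n a. write_bd c (B n) (%_. 0) a <= B n a"
  "!!a. sm a ==> polyb (%n. B n a)" "!!a. expb (%n. B n a)"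
  using array_bounds_exist[OF wf good low sm0] by blast
 \<comment> \<open>Large enough for all three stages: intermediate values of the body, the output
   array, and the entries and the length of the input.\<close>
 define v where "v n = vC c (B n) (%_. 0) + (B n oid + (B n 0 + n))" for n
 define L where "L n = bit_length (n + (300 + 50 * v n))" for n
 define T where "T n = 200 * L n + (tC c (B n) (%_. 0) (L n) + (n * (200 * L n) + 200 * L n))" for n
 define P where "P = prelude @ (ccomp c 30 @ postlude oid)"
 have "expb v" unfolding v_def
  by (intro expb_add expb_vC[OF B(3,4) good] B(4) polyb_expb polyb_const polyb_id)
 then have "expb (%n. n + (300 + 50 * v n))"
  by (intro expb_add expb_mult polyb_expb[OF polyb_const] polyb_expb[OF polyb_id])
 then have Lp: "polyb L" unfolding L_def by (rule polyb_bit_length)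
 then have "polyb T" unfolding T_def
  by (intro polyb_add polyb_mult polyb_tC[OF B(3,4) good] polyb_const polyb_id)
 then obtain p :: "nat poly" where p: "!!n. T n <= poly p n" unfolding polyb_def by blast
 show ?thesis
 proof (rule that[of p P])
  fix xs :: "nat list" and ns nc :: nat and R
  assume len: "length xs = 2 + 2 * ns + 2 * ns * nc + nc" and xs: "xs ! 0 = ns" "xs ! 1 = nc"
   and R: "R = run (poly p (input_size xs)) (P, load xs, 0)"
  let ?n = "input_size xs" and ?b = "length xs"
  have bn: "?b <= ?n" by (rule length_le_input_size)
  have Lb: "bit_length (?b + 300 + 50 * w) <= L ?n" if "w <= v ?n" for w
   unfolding L_def by (rule bit_length_mono) (use that bn in simp)
  have xv: "xs ! k <= B ?n 0" if "k < ?b" for k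
   using nth_less_pow2_input_size[OF that] B(1)[of ?n 0] by (simp add: init_bd_def)
  have xvn: "xs ! k <= v ?n" if "k < ?b" for k using xv[OF that] by (simp add: v_def)
  obtain M where M: "big prelude (load xs) (return_pmf M) (200 * L ?n)" "M 0 = ?b"
   "absm ?b M = init_state xs"
   by (rule prelude_correct[OF len xs Lb[of "v ?n"]]) (use xvn in auto)
  have b0: "0 < ?b" using len by simp
  have s0: "init_state xs a k <= B ?n a" for a k
  proof -
   have "min k (?b - 1) < ?b" using b0 by linarith
   then have "xs ! min k (?b - 1) <= B ?n 0" by (rule xv)
   moreover have "?b <= B ?n 0"
   proof -
    have "?n < 2 ^ ?n" by (rule less_exp)
    moreover have "2 ^ ?n <= B ?n 0" using B(1)[of ?n 0] by (simp add: init_bd_def)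
    ultimately show ?thesis using bn by linarith
   qed
   moreover have "ns <= ?n" "nc <= ?n" using len bn by auto
   moreover have "?n <= B ?n 1" using B(1)[of ?n 1] by (simp add: init_bd_def)
   ultimately show ?thesis using xs by (auto simp: init_state_def)
  qed
  have "\<exists>D. big (ccomp c 30) M D (tC c (B ?n) (%_. 0) (L ?n)) \<and>
    map_pmf (absm ?b) D = exec c (%_. 0) (absm ?b M) \<and> (\<forall>M'\<in>set_pmf D. kept ?b [] 30 M M')"
   by (rule ccomp_correct[where M = M and \<rho> = "%_. 0" and \<beta> = "%_. 0" and B = "B ?n" and b = ?b])
    (use M b0 wf s0 B(2) Lb[of "vC c (B ?n) (%_. 0)"] in \<open>auto simp: v_def\<close>)
  then obtain D where D: "big (ccomp c 30) M D (tC c (B ?n) (%_. 0) (L ?n))"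
   "map_pmf (absm ?b) D = exec c (%_. 0) (init_state xs)" "!!M'. M'\<in>set_pmf D ==> kept ?b [] 30 M M'"
   unfolding M(3) by blast
  have "\<exists>M''. big (postlude oid) M' (return_pmf M'') (?b * (200 * L ?n) + 200 * L ?n) \<and>
    (\<forall>k<ns + ns * nc. M'' k = absm ?b M' oid k)" if M': "M' \<in> set_pmf D" for M'
  proof -
   have st: "absm ?b M' \<in> set_pmf (exec c (%_. 0) (init_state xs))" unfolding D(2)[symmetric] using M' by simp
   have a1: "absm ?b M' 1 = init_state xs 1" using exec_unwritten[OF w1 st] .
   have bd: "absm ?b M' a k <= B ?n a" for a k
    by (rule exec_le_bound[OF s0 _ B(2) st]) simp
   show ?thesis
   proof (rule postlude_correct[OF b0 _ oid _ _ _ _ Lb[of "v ?n"]])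
    show "M' 0 = ?b" using D(3)[OF M'] M(2) b0 by (simp add: kept_def)
    show "absm ?b M' 1 0 = ns" "absm ?b M' 1 1 = nc" using a1 xs by (simp_all add: init_state_def)
    show "ns + ns * nc < ?b" "nc < ?b" using len by auto
    show "absm ?b M' oid k <= v ?n" for k using bd[of oid k] by (simp add: v_def)
    show "?b <= v ?n" using bn by (simp add: v_def)
   qed simp
  qed
  then obtain F where F: "!!M'. M' \<in> set_pmf D ==>
    big (postlude oid) M' (return_pmf (F M')) (?b * (200 * L ?n) + 200 * L ?n)"
   "!!M' k. M' \<in> set_pmf D ==> k < ns + ns * nc ==> F M' k = absm ?b M' oid k" by metis
  have "big P (load xs) (bind_pmf D (%M'. return_pmf (F M')))
    (200 * L ?n + (tC c (B ?n) (%_. 0) (L ?n) + (?b * (200 * L ?n) + 200 * L ?n)))"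
   unfolding P_def by (rule big_append_det[OF M(1) big_append[OF D(1) F(1)]])
  then have bigP: "big P (load xs) (map_pmf F D) (T ?n)"
   unfolding map_pmf_def by (rule big_mono) (use bn in \<open>auto simp: T_def intro: mult_right_mono\<close>)
  note r = big_run[OF bigP p, of 0, folded R]
  have "map_pmf (%(K, M, t). %k. if k < ns + ns * nc then M k else 0) R =
    map_pmf (%M k. if k < ns + ns * nc then M k else 0) (map_pmf (%(K, M, t). M) R)"
   unfolding map_pmf_comp by (rule map_pmf_cong) auto
  also have "\<dots> = map_pmf (%M' k. if k < ns + ns * nc then F M' k else 0) D"
   using r by (simp add: map_pmf_comp)
  also have "\<dots> = map_pmf (%M' k. if k < ns + ns * nc then absm ?b M' oid k else 0) D"
   by (rule map_pmf_cong) (auto simp: F(2))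
  also have "\<dots> = map_pmf (%\<sigma> k. if k < ns + ns * nc then \<sigma> oid k else 0) (map_pmf (absm ?b) D)"
   by (simp add: map_pmf_comp)
  finally have "map_pmf (%(K, M, t). %k. if k < ns + ns * nc then M k else 0) R =
   map_pmf (%\<sigma> k. if k < ns + ns * nc then \<sigma> oid k else 0) (exec c (%_. 0) (init_state xs))"
   unfolding D(2) .
  moreover have "\<forall>(K, M, t)\<in>set_pmf R. K = [] \<and> t <= poly p ?n"
   using r p[of ?n] by fastforce
  ultimately show "(\<forall>(K, M, t)\<in>set_pmf R. K = [] \<and> t <= poly p ?n) \<and>
   map_pmf (%(K, M, t). %k. if k < ns + ns * nc then M k else 0) R =
   map_pmf (%\<sigma> k. if k < ns + ns * nc then \<sigma> oid k else 0) (exec c (%_. 0) (init_state xs))" by blast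
 qed
qed

section \<open>Random opening of pieces, organised in groups\<close>

abbreviation unif_fun :: "nat set => nat => (nat => nat) pmf" where
 "unif_fun J n \<equiv> Pi_pmf J 0 (%_. pmf_of_set {..<n})"

lemma prod_of_bool: "finite J ==> (\<Prod>g\<in>J. of_bool (P g)) = (of_bool (\<forall>g\<in>J. P g) :: real)"
 by (induction J rule: finite_induct) auto

lemma set_pmf_lessThan: "0 < n ==> set_pmf (pmf_of_set {..<n}) = {..<n :: nat}"
 by (rule set_pmf_of_set) (auto simp: lessThan_empty_iff)

lemma finite_unif_fun: "finite J ==> 0 < n ==> finite (set_pmf (unif_fun J n))"
 by (rule finite_subset[OF set_Pi_pmf_subset'])
  (auto intro!: finite_PiE_dflt simp: set_pmf_lessThan)

lemma unif_fun_box: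
 assumes J: "finite J" and n: "0 < n"
 shows "measure_pmf.expectation (unif_fun J n) (%U. of_bool (\<forall>g\<in>J. U g \<in> A g) :: real) =
  (\<Prod>g\<in>J. real (card (A g \<inter> {..<n})) / real n)"
proof -
 have ne: "{..<n} \<noteq> {}" using n by (auto simp: lessThan_empty_iff)
 have "measure_pmf.expectation (unif_fun J n) (%U. of_bool (\<forall>g\<in>J. U g \<in> A g)) =
  measure_pmf.expectation (unif_fun J n) (%U. \<Prod>g\<in>J. of_bool (U g \<in> A g) :: real)"
  by (simp add: prod_of_bool[OF J])
 also have "\<dots> = (\<Prod>g\<in>J. measure_pmf.expectation (pmf_of_set {..<n}) (%u. of_bool (u \<in> A g)))"
  using J n by (intro expectation_prod_Pi_pmf) (auto intro!: integrable_measure_pmf_finite simp: set_pmf_lessThan)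
 also have "\<dots> = (\<Prod>g\<in>J. real (card (A g \<inter> {..<n})) / real n)"
 proof (rule prod.cong[OF refl])
  fix g
  have "(\<Sum>u<n. of_bool (u \<in> A g)) = (\<Sum>u\<in>A g \<inter> {..<n}. (1::real))"
   by (intro sum.mono_neutral_cong_right) auto
  then show "measure_pmf.expectation (pmf_of_set {..<n}) (%u. of_bool (u \<in> A g)) =
   real (card (A g \<inter> {..<n})) / real n"
   using ne by (subst integral_pmf_of_set) auto
 qed
 finally show ?thesis .
qed

text \<open>Each group draws one number below \<open>n\<close> and opens the piece at that position.
  A group with \<open>n\<close> pieces thus opens exactly one of them, a group with a single piece
  opens it with probability \<open>1 / n\<close>, and different groups are independent.\<close>

locale piece_groups =
 fixes J :: "nat set" and n :: nat and grp pos :: "nat => nat" and V :: "nat set"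
 assumes J: "finite J" and n: "0 < n" and V: "finite V"
  and grp: "p \<in> V ==> grp p \<in> J" and pos: "p \<in> V ==> pos p < n"
  and inj: "inj_on (%p. (grp p, pos p)) V"
begin

definition opened :: "(nat => nat) => nat => bool" where
 "opened U p \<longleftrightarrow> U (grp p) = pos p"

abbreviation expect :: "((nat => nat) => real) => real" where
 "expect f \<equiv> measure_pmf.expectation (unif_fun J n) f"

lemma integrable [simp]: "integrable (measure_pmf (unif_fun J n)) (f :: _ => real)"
 by (rule integrable_measure_pmf_finite) (rule finite_unif_fun[OF J n])

lemma none_opened_iff:
 assumes "X \<subseteq> V"
 shows "(\<forall>p\<in>X. \<not> opened U p) \<longleftrightarrow> (\<forall>g\<in>J. U g \<in> - (pos ` {p \<in> X. grp p = g}))"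
 using assms grp by (fastforce simp: opened_def)

lemma card_free:
 assumes "X \<subseteq> V"
 shows "real (card (- (pos ` {p \<in> X. grp p = g}) \<inter> {..<n})) / real n = 1 - real (card {p \<in> X. grp p = g}) / real n"
proof -
 let ?X = "{p \<in> X. grp p = g}"
 have fin: "finite ?X" using assms V finite_subset by fastforce
 have sub: "pos ` ?X \<subseteq> {..<n}" using pos assms by auto
 have ii: "inj_on pos ?X"
 proof (rule inj_onI)
  fix x y assume "x \<in> ?X" "y \<in> ?X" "pos x = pos y"
  then show "x = y" using inj_onD[OF inj, of x y] assms by auto
 qed
 have "- (pos ` ?X) \<inter> {..<n} = {..<n} - pos ` ?X" by auto
 then have "card (- (pos ` ?X) \<inter> {..<n}) = n - card ?X"
  using card_Diff_subset[OF finite_imageI[OF fin] sub] card_image[OF ii] by simp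
 moreover have "card ?X <= n" using card_mono[OF _ sub] card_image[OF ii] by simp
 ultimately show ?thesis using n by (simp add: of_nat_diff field_simps)
qed

text \<open>Openings inside a group exclude each other, so the chance that \<open>m\<close> given
  pieces of one group stay closed is \<open>1 - m / n\<close>, at most
  \<open>(1 - 1 / n) ^ m\<close> by Bernoulli's inequality. Clustering can only help in comparison
  with independent openings.\<close>

lemma prob_none_opened:
 assumes X: "X \<subseteq> V"
 shows "expect (%U. of_bool (\<forall>p\<in>X. \<not> opened U p)) <= (1 - 1 / real n) ^ card X"
proof -
 let ?X = "%g. {p \<in> X. grp p = g}"
 have fin: "finite X" using X V finite_subset by blast
 have "expect (%U. of_bool (\<forall>p\<in>X. \<not> opened U p)) = (\<Prod>g\<in>J. 1 - real (card (?X g)) / real n)"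
  unfolding none_opened_iff[OF X] unif_fun_box[OF J n] card_free[OF X] ..
 also have "\<dots> <= (\<Prod>g\<in>J. (1 - 1 / real n) ^ card (?X g))"
 proof (rule prod_mono)
  fix g
  have "0 <= real (card (- (pos ` ?X g) \<inter> {..<n})) / real n" by simp
  then have "0 <= 1 - real (card (?X g)) / real n" unfolding card_free[OF X] .
  moreover have "1 + real (card (?X g)) * (- 1 / real n) <= (1 + (- 1 / real n)) ^ card (?X g)"
   using n by (intro Bernoulli_inequality) (auto simp: field_simps)
  ultimately show "0 <= 1 - real (card (?X g)) / real n \<and>
   1 - real (card (?X g)) / real n <= (1 - 1 / real n) ^ card (?X g)" by simp
 qed
 also have "\<dots> = (1 - 1 / real n) ^ (\<Sum>g\<in>J. card (?X g))" by (rule power_sum[symmetric])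
 also have "(\<Sum>g\<in>J. card (?X g)) = card X"
 proof -
  have "card (\<Union>g\<in>J. ?X g) = (\<Sum>g\<in>J. card (?X g))"
   using fin J by (intro card_UN_disjoint) auto
  moreover have "(\<Union>g\<in>J. ?X g) = X" using grp X by auto
  ultimately show ?thesis by simp
 qed
 finally show ?thesis .
qed

lemma expect_opened: "p \<in> V ==> expect (%U. of_bool (opened U p)) = 1 / real n"
proof -
 assume p: "p \<in> V"
 let ?A = "%g. if g = grp p then {pos p} else UNIV"
 have "(%U. of_bool (opened U p) :: real) = (%U. of_bool (\<forall>g\<in>J. U g \<in> ?A g))"
  using grp[OF p] by (auto simp: opened_def fun_eq_iff)
 then have "expect (%U. of_bool (opened U p)) = (\<Prod>g\<in>J. real (card (?A g \<inter> {..<n})) / real n)"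
  by (simp only: unif_fun_box[OF J n])
 also have "\<dots> = (\<Prod>g\<in>J. if g = grp p then 1 / real n else 1)"
  using n pos[OF p] by (intro prod.cong) auto
 also have "\<dots> = 1 / real n" using J grp[OF p] by (simp add: prod.delta)
 finally show ?thesis .
qed

text \<open>The factor \<open>q\<close> is the same for all members of the group \<open>\<kappa>\<close>.\<close>

lemma expect_opened_none:
 assumes X: "X \<subseteq> V" "!!p. p \<in> X ==> grp p \<noteq> \<kappa>"
 obtains q where "0 <= q" "!!p. p \<in> V ==> grp p = \<kappa> ==>
  expect (%U. of_bool (opened U p \<and> (\<forall>p'\<in>X. \<not> opened U p'))) = q"
proof
 let ?q = "(1 / real n) * (\<Prod>g\<in>J - {\<kappa>}. 1 - real (card {p \<in> X. grp p = g}) / real n)"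
 show "0 <= ?q"
  unfolding card_free[OF X(1), symmetric] by (intro mult_nonneg_nonneg prod_nonneg) auto
 fix p assume p: "p \<in> V" "grp p = \<kappa>"
 let ?A = "%g. if g = \<kappa> then {pos p} else - (pos ` {p \<in> X. grp p = g})"
 have "(%U. of_bool (opened U p \<and> (\<forall>p'\<in>X. \<not> opened U p')) :: real) = (%U. of_bool (\<forall>g\<in>J. U g \<in> ?A g))"
 proof (intro ext arg_cong[where f = of_bool])
  fix U
  have "{p \<in> X. grp p = \<kappa>} = {}" using X(2) by auto
  then show "(opened U p \<and> (\<forall>p'\<in>X. \<not> opened U p')) = (\<forall>g\<in>J. U g \<in> ?A g)"
   unfolding none_opened_iff[OF X(1)] using grp[OF p(1)] p(2) by (auto simp: opened_def)
 qed
 then have "expect (%U. of_bool (opened U p \<and> (\<forall>p'\<in>X. \<not> opened U p'))) =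
   (\<Prod>g\<in>J. real (card (?A g \<inter> {..<n})) / real n)"
  by (simp only: unif_fun_box[OF J n])
 also have "\<dots> = (real (card (?A \<kappa> \<inter> {..<n})) / real n) * (\<Prod>g\<in>J - {\<kappa>}. real (card (?A g \<inter> {..<n})) / real n)"
  using grp[OF p(1)] p(2) J by (intro prod.remove) auto
 also have "real (card (?A \<kappa> \<inter> {..<n})) / real n = 1 / real n" using pos[OF p(1)] by simp
 also have "(\<Prod>g\<in>J - {\<kappa>}. real (card (?A g \<inter> {..<n})) / real n) =
   (\<Prod>g\<in>J - {\<kappa>}. 1 - real (card {p \<in> X. grp p = g}) / real n)"
  by (intro prod.cong refl) (auto simp: card_free[OF X(1)])
 finally show "expect (%U. of_bool (opened U p \<and> (\<forall>p'\<in>X. \<not> opened U p'))) = ?q" .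
qed

end

section \<open>The expected distance from one unit of demand to its nearest open piece\<close>

lemma sorted_enumeration:
 fixes d :: "'a => real"
 assumes "finite A"
 obtains f where "bij_betw f {..<card A} A" "!!i j. i <= j ==> j < card A ==> d (f i) <= d (f j)"
proof -
 obtain ys where ys: "set ys = A" "distinct ys" using finite_distinct_list[OF assms] by blast
 define xs where "xs = sort_key d ys"
 have xs: "set xs = A" "distinct xs" "sorted (map d xs)" using ys by (simp_all add: xs_def)
 have len: "length xs = card A" using xs distinct_card by metis
 show ?thesis
 proof (rule that[of "(!) xs"])
  show "bij_betw ((!) xs) {..<card A} A" using bij_betw_nth[OF xs(2)] xs(1) len by simp
  show "d (xs ! i) <= d (xs ! j)" if "i <= j" "j < card A" for i j
   using sorted_nth_mono[OF xs(3) that(1)] that len by simp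
 qed
qed

text \<open>Summation by parts: on the left an expectation computed from the tails
  \<open>s ^ Suc k\<close>, on the right the same expectation computed from point masses.\<close>

lemma abel_geometric:
 fixes a :: "nat => real"
 shows "a 0 + (\<Sum>k<N. (a (Suc k) - a k) * s ^ Suc k) = (\<Sum>k<N. a k * (s ^ k - s ^ Suc k)) + a N * s ^ N"
 by (induction N) (auto simp: algebra_simps)

text \<open>The geometric masses decrease while \<open>a\<close> increases, so by Chebyshev's sum
  inequality replacing \<open>a\<close> by its average over the block does not decrease the
  sum.\<close>

lemma chebyshev_geometric:
 fixes a :: "nat => real"
 assumes s: "0 <= s" "s <= 1" and a: "!!i j. i <= j ==> j < m ==> a i <= a j"
 shows "real m * (\<Sum>k<m. a k * (s ^ (l + k) - s ^ Suc (l + k))) <= (\<Sum>k<m. a k) * (s ^ l - s ^ (l + m))"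
proof -
 have "real m * (\<Sum>k=0..<m. a k * (s ^ (l + k) - s ^ Suc (l + k))) <=
   (\<Sum>k=0..<m. a k) * (\<Sum>k=0..<m. s ^ (l + k) - s ^ Suc (l + k))"
 proof (rule Chebyshev_sum_upper[OF a])
  fix i j :: nat assume "i <= j"
  then have "s ^ (l + j) * (1 - s) <= s ^ (l + i) * (1 - s)"
   using s by (intro mult_right_mono power_decreasing) auto
  then show "s ^ (l + j) - s ^ Suc (l + j) <= s ^ (l + i) - s ^ Suc (l + i)" by (simp add: algebra_simps)
 qed auto
 moreover have "(\<Sum>k=0..<m. s ^ (l + k) - s ^ Suc (l + k)) = s ^ l - s ^ (l + m)"
  by (induction m) auto
 ultimately show ?thesis by (simp add: lessThan_atLeast0)
qed

text \<open>\<open>S\<close> is the cluster on which a unit falls back if its own pieces fail;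
  \<open>d\<close> and \<open>e\<close> are distances from the client of the unit and from the
  founder of the cluster, and \<Delta> is the distance of these two. If \<Delta> is at most
  \<open>D + K\<close>, each piece of \<open>S\<close> obeys the bound separately. Otherwise the
  removed pieces \<open>Q\<close>, near to the unit on the whole, are far from the founder, so that
  their removal limits the average of \<open>e\<close> over the rest.\<close>

lemma far_average:
 fixes d e :: "nat => real" and C D K cm km \<Delta> :: real
 assumes fin: "finite Ns" "finite S" and sub: "Cs \<subseteq> Ns" "Q \<subseteq> S \<inter> Ns"
  and card: "card Cs = n" "card S = n" "card Ns = N" "n < N" "N <= 2 * n"
  and tri: "!!p. p \<in> S ==> d p <= \<Delta> + e p" "!!p. p \<in> S ==> \<Delta> <= d p + e p"
  and cm: "!!p. p \<in> Cs ==> d p <= cm" "!!p. p \<in> Ns - Cs ==> cm <= d p"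
  and km: "!!p. p \<in> S ==> e p <= km"
  and avg: "sum d (Ns - Cs) = (real N - real n) * D" "sum e S = real n * K"
  and order: "K + km <= C + cm" and meet: "\<Delta> <= cm + km"
 shows "(\<Sum>p\<in>S - Q. d p - (C + 2 * D)) <= 0"
proof -
 have QS: "Q \<subseteq> S" using sub(2) by blast
 have finC: "finite Cs" "finite (Ns - Cs)" "finite Q"
  using finite_subset[OF sub(1) fin(1)] fin(1) finite_subset[OF QS fin(2)] by simp_all
 have far: "card (Ns - Cs) = N - n" using card_Diff_subset[OF finC(1) sub(1)] card by simp
 have "real (card (Ns - Cs)) * cm <= sum d (Ns - Cs)" using cm(2) by (intro sum_bounded_below) auto
 then have "(real N - real n) * cm <= (real N - real n) * D" using far avg card by (simp add: of_nat_diff)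
 then have cD: "cm <= D" using card by simp
 show ?thesis
 proof (cases "\<Delta> <= D + K")
  case True
  have "d p - (C + 2 * D) <= 0" if "p \<in> S" for p
   using tri(1)[OF that] km[OF that] True order cD by linarith
  then show ?thesis by (intro sum_nonpos) auto
 next
  case False
  define r c1 q where "r = real (card (S - Q))" and "c1 = real (card (Q \<inter> Cs))" and "q = real (card (Q - Cs))"
  have nr: "real n = r + (c1 + q)"
  proof -
   have "card (S - Q) = card S - card Q" "card Q <= card S"
    using card_Diff_subset[OF finC(3) QS] card_mono[OF fin(2) QS] by simp_all
   moreover have "card Q = card (Q \<inter> Cs) + card (Q - Cs)" by (rule card_Int_Diff[OF finC(3)])
   ultimately show ?thesis using card by (simp add: r_def c1_def q_def)
  qed
  have e1: "c1 * (\<Delta> - cm) <= sum e (Q \<inter> Cs)" unfolding c1_def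
  proof (rule sum_bounded_below)
   fix p assume "p \<in> Q \<inter> Cs"
   then have "p \<in> S" "p \<in> Cs" using sub by auto
   then show "\<Delta> - cm <= e p" using tri(2)[of p] cm(1)[of p] by linarith
  qed
  have "q * \<Delta> <= (\<Sum>p\<in>Q - Cs. d p + e p)" unfolding q_def
   by (rule sum_bounded_below) (use tri(2) QS in blast)
  then have e2: "q * \<Delta> - sum d (Q - Cs) <= sum e (Q - Cs)" by (simp add: sum.distrib)
  have sq: "Q - Cs \<subseteq> Ns - Cs" using sub by auto
  have fq: "finite (Q - Cs)" using finC by simp
  \<comment> \<open>Each far piece outside \<open>Q\<close> has distance at least \<open>cm\<close>.
    This caps the share of the total \<open>(N - n) * D\<close> that is left for the far pieces in
    \<open>Q\<close>.\<close>
  have "real (card ((Ns - Cs) - (Q - Cs))) * cm <= sum d ((Ns - Cs) - (Q - Cs))"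
   using cm(2) by (intro sum_bounded_below) auto
  moreover have "real (card ((Ns - Cs) - (Q - Cs))) = real N - real n - q"
   using card_Diff_subset[OF fq sq] card_mono[OF finC(2) sq] far card by (simp add: q_def of_nat_diff)
  moreover have "sum d ((Ns - Cs) - (Q - Cs)) = (real N - real n) * D - sum d (Q - Cs)"
   using sum_diff[OF finC(2) sq, of d] avg by simp
  ultimately have e3: "sum d (Q - Cs) <= (real N - real n) * D - (real N - real n - q) * cm" by simp
  have "sum e Q = sum e (Q \<inter> Cs) + sum e (Q - Cs)" by (rule sum.Int_Diff[OF finC(3)])
  moreover have "sum e (S - Q) = real n * K - sum e Q"
   using sum_diff[OF fin(2) QS, of e] avg(2) by simp
  ultimately have "sum e (S - Q) <= real n * K - c1 * (\<Delta> - cm) - (q * \<Delta> - ((real N - real n) * D - (real N - real n - q) * cm))"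
   using e1 e2 e3 by linarith
  also have "\<dots> = real n * K - (c1 + q) * (\<Delta> - cm) + (real N - real n) * (D - cm)" by (simp add: algebra_simps)
  also have "\<dots> <= real n * K - (c1 + q) * (D - cm + K) + (real N - real n) * (D - cm)"
  proof -
   have "(c1 + q) * (D - cm + K) <= (c1 + q) * (\<Delta> - cm)"
    using False by (intro mult_left_mono) (auto simp: c1_def q_def)
   then show ?thesis by linarith
  qed
  also have "\<dots> = r * K + (r - (2 * real n - real N)) * (D - cm)" unfolding nr by (simp add: algebra_simps)
  \<comment> \<open>Here \<open>N <= 2 * n\<close> enters: the coefficient
    \<open>r - (2 * n - N)\<close> is at most \<open>r\<close>, and \<open>D - cm\<close> is
    nonnegative.\<close>
  also have "\<dots> <= r * K + r * (D - cm)"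
   using cD card by (intro add_left_mono mult_right_mono) auto
  finally have eS: "sum e (S - Q) <= r * K + r * (D - cm)" .
  have "(\<Sum>p\<in>S - Q. d p - (C + 2 * D)) <= (\<Sum>p\<in>S - Q. (\<Delta> - (C + 2 * D)) + e p)"
  proof (rule sum_mono)
   fix p assume "p \<in> S - Q"
   then show "d p - (C + 2 * D) <= (\<Delta> - (C + 2 * D)) + e p" using tri(1)[of p] by simp
  qed
  also have "\<dots> = r * (\<Delta> - (C + 2 * D)) + sum e (S - Q)" by (simp add: sum.distrib r_def)
  also have "\<dots> <= r * (\<Delta> - (C + 2 * D)) + (r * K + r * (D - cm))" using eS by simp
  also have "\<dots> = r * (\<Delta> - C - D + K - cm)" by (simp add: algebra_simps)
  also have "\<dots> <= 0"
   using meet order cD by (intro mult_nonneg_nonpos) (auto simp: r_def)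
  finally show ?thesis .
 qed
qed

lemma sum_lessThan_split: "(\<Sum>k<n + m. f k) = (\<Sum>k<n. f k) + (\<Sum>k<m. f (n + k))"
 for f :: "nat => real"
 by (induction m) (auto simp: add.assoc)

context piece_groups
begin

text \<open>The distance to the nearest open piece is dominated by \<open>X U\<close>. Its first
  part telescopes the sorted own distances, capped at \<open>T\<close>, over the events that the
  first pieces are all closed; these have probability at most a power of \<open>s\<close>. Its
  second part \<open>Y U\<close> corrects the cap when the unit falls back on the cluster, and has
  nonpositive expectation by \<open>far_average\<close>.\<close>

lemma expected_connection:
 fixes d e :: "nat => real"
 assumes sub: "Ns \<subseteq> V" "S \<subseteq> V" "Cs \<subseteq> Ns"
  and grpS: "!!p. p \<in> S ==> grp p = \<kappa>" "!!p. p \<in> Ns ==> grp p = \<kappa> ==> p \<in> S"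
  and card: "card Cs = n" "card S = n" "card Ns = N" "n < N" "N <= 2 * n"
  and d0: "!!p. 0 <= d p"
  and tri: "!!p. p \<in> S ==> d p <= \<Delta> + e p" "!!p. p \<in> S ==> \<Delta> <= d p + e p"
  and cm: "!!p. p \<in> Cs ==> d p <= cm" "!!p. p \<in> Ns - Cs ==> cm <= d p"
  and km: "!!p. p \<in> S ==> e p <= km"
  and order: "sum e S + real n * km <= sum d Cs + real n * cm" and meet: "\<Delta> <= cm + km"
  and num: "(1 - 1 / real n) ^ n + (1 - 1 / real n) ^ N <= real N / real n - 1"
 shows "expect (%U. Min (d ` {p \<in> Ns \<union> S. opened U p})) <= sum d Ns / real n"
proof -
 define s where "s = 1 - 1 / real n"
 have s: "0 <= s" "s <= 1" using n by (auto simp: s_def)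
 have fin: "finite Ns" "finite S" using finite_subset[OF _ V] sub by simp_all
 have fin: "finite Ns" "finite S" "finite Cs" "finite (Ns - Cs)"
  using fin finite_subset[OF sub(3)] by simp_all
 have far: "card (Ns - Cs) = N - n" using card_Diff_subset[OF fin(3) sub(3)] card by simp
 define C where "C = sum d Cs / real n"
 define D where "D = sum d (Ns - Cs) / (real N - real n)"
 define K where "K = sum e S / real n"
 \<comment> \<open>The average bound of \<open>far_average\<close> for the fallback. An own piece
   farther away than \<open>T\<close> may be treated as closed, because falling back is on average
   at most as expensive.\<close>
 define T where "T = C + 2 * D"
 have C: "sum d Cs = real n * C" using n by (simp add: C_def)
 have D: "sum d (Ns - Cs) = (real N - real n) * D" using card by (simp add: D_def)
 have K: "sum e S = real n * K" using n by (simp add: K_def)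
 have CD0: "0 <= C" "0 <= D" using d0 card by (auto simp: C_def D_def intro!: divide_nonneg_nonneg sum_nonneg)
 have ord: "K + km <= C + cm"
 proof -
  have "real n * (K + km) <= real n * (C + cm)" using order C K by (simp add: algebra_simps)
  then show ?thesis using n by simp
 qed
 define N' where "N' = {p \<in> Ns. d p <= T}"
 define Q where "Q = S \<inter> N'"
 have Qs: "Q \<subseteq> S \<inter> Ns" by (auto simp: Q_def N'_def)
 have avg: "(\<Sum>p\<in>S - Q. d p - (C + 2 * D)) <= 0"
  by (rule far_average[where d = d and e = e, OF fin(1,2) sub(3) Qs card tri cm km D K ord meet])
 obtain f1 where f1: "bij_betw f1 {..<card Cs} Cs" "!!i j. i <= j ==> j < card Cs ==> d (f1 i) <= d (f1 j)"
  using sorted_enumeration[OF fin(3), of d] by blast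
 obtain f2 where f2: "bij_betw f2 {..<card (Ns - Cs)} (Ns - Cs)"
  "!!i j. i <= j ==> j < card (Ns - Cs) ==> d (f2 i) <= d (f2 j)"
  using sorted_enumeration[OF fin(4), of d] by blast
 \<comment> \<open>Close pieces first, then far ones, each part sorted; \<open>cm\<close> separates
   the two ranges of distances, so the concatenation is sorted.\<close>
 define f where "f k = (if k < n then f1 k else f2 (k - n))" for k
 have fC: "f k \<in> Cs" if "k < n" for k
  using that bij_betwE[OF f1(1)] card by (auto simp: f_def)
 have fF: "f k \<in> Ns - Cs" if "n <= k" "k < N" for k
 proof -
  have "k - n < card (Ns - Cs)" using that far by simp
  then have "f2 (k - n) \<in> Ns - Cs" using bij_betwE[OF f2(1)] by blast
  then show ?thesis using that by (simp add: f_def)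
 qed
 have mono: "d (f i) <= d (f j)" if "i <= j" "j < N" for i j
 proof -
  consider "j < n" | "i < n" "n <= j" | "n <= i" using that by linarith
  then show ?thesis
  proof cases
   case 1 then show ?thesis using that f1(2)[of i j] card by (simp add: f_def)
  next
   case 2 then show ?thesis using cm(1)[OF fC[of i]] cm(2)[OF fF[of j]] that by linarith
  next
   case 3
   then have "i - n <= j - n" "j - n < card (Ns - Cs)" using that far by auto
   then show ?thesis using f2(2)[of "i - n" "j - n"] 3 that by (simp add: f_def)
  qed
 qed
 have fN: "f k \<in> Ns" if "k < N" for k using fC[of k] fF[of k] that sub by (cases "k < n") auto
 have injf: "inj_on f {..<N}"
 proof (rule inj_onI)
  fix i j assume ij: "i \<in> {..<N}" "j \<in> {..<N}" "f i = f j"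
  consider "i < n" "j < n" | "n <= i" "n <= j" | "i < n" "n <= j" | "n <= i" "j < n" by linarith
  then show "i = j"
  proof cases
   case 1
   then show ?thesis using ij inj_onD[OF bij_betw_imp_inj_on[OF f1(1)], of i j] card by (simp add: f_def)
  next
   case 2
   then have "i - n < card (Ns - Cs)" "j - n < card (Ns - Cs)" using ij far by auto
   then have "i - n = j - n"
    using ij 2 inj_onD[OF bij_betw_imp_inj_on[OF f2(1)], of "i - n" "j - n"] by (simp add: f_def)
   then show ?thesis using 2 by simp
  next
   case 3 then show ?thesis using fC[of i] fF[of j] ij by auto
  next
   case 4 then show ?thesis using fC[of j] fF[of i] ij by auto
  qed
 qed
 have imf: "f ` {..<N} = Ns"
 proof (rule card_subset_eq[OF fin(1)])
  show "f ` {..<N} \<subseteq> Ns" using fN by auto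
  show "card (f ` {..<N}) = card Ns" using card_image[OF injf] card by simp
 qed
 define d' where "d' k = (if k < N then min (d (f k)) T else T)" for k
 have d'mono: "d' i <= d' j" if "i <= j" for i j
  using that mono[of i j] by (auto simp: d'_def)
 define none where "none k U \<longleftrightarrow> (\<forall>p\<in>f ` {..<k}. \<not> opened U p)" for k U
 \<comment> \<open>The condition mentions pieces outside the group \<kappa> only, so it is
   independent of the draw for \<kappa> and all pieces of \<open>S\<close> get the same factor
   \<open>q\<close>. That the other pieces of \<open>S\<close> are closed needs no mention, as a
   group opens just one.\<close>
 define Y where "Y U = (\<Sum>p\<in>S - Q. (d p - T) * of_bool (opened U p \<and> (\<forall>p'\<in>N' - S. \<not> opened U p')))" for U
 define X where "X U = d' 0 + (\<Sum>k<N. (d' (Suc k) - d' k) * of_bool (none (Suc k) U)) + Y U" for U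
 have posS: "pos ` S = {..<n}"
 proof (rule card_subset_eq)
  show "pos ` S \<subseteq> {..<n}" using pos sub by auto
  have "inj_on pos S"
  proof (rule inj_onI)
   fix x y assume "x \<in> S" "y \<in> S" "pos x = pos y"
   then show "x = y" using inj_onD[OF inj, of x y] sub grpS(1) by auto
  qed
  then show "card (pos ` S) = card {..<n}" using card by (simp add: card_image)
 qed simp
 have uniq: "p = p'" if "p \<in> S" "p' \<in> S" "opened U p" "opened U p'" for p p' U
  using inj_onD[OF inj, of p p'] that sub grpS(1) by (auto simp: opened_def)
 have "S \<noteq> {}" using card(2) n by auto
 then obtain p0 where p0: "p0 \<in> S" by blast
 have \<kappa>J: "\<kappa> \<in> J" using grp[of p0] p0 sub(2) grpS(1)[OF p0] by auto
 have pointwise: "Min (d ` {p \<in> Ns \<union> S. opened U p}) <= X U" if U: "U \<in> set_pmf (unif_fun J n)" for U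
 proof -
  have "U \<kappa> < n"
  proof -
   have "U \<in> PiE_dflt J 0 (set_pmf \<circ> (%_. pmf_of_set {..<n}))" using U unfolding set_Pi_pmf[OF J] .
   then have "U \<kappa> \<in> set_pmf (pmf_of_set {..<n})" using \<kappa>J by (simp add: PiE_dflt_def)
   then show ?thesis using n by (simp add: set_pmf_lessThan)
  qed
  then have "U \<kappa> \<in> pos ` S" using posS by simp
  then obtain \<phi> where "\<phi> \<in> S" "U \<kappa> = pos \<phi>" by blast
  then have \<phi>: "\<phi> \<in> S" "opened U \<phi>" using grpS(1) by (simp_all add: opened_def)
  have le: "Min (d ` {p \<in> Ns \<union> S. opened U p}) <= d p" if "p \<in> Ns \<union> S" "opened U p" for p
  proof (rule Min_le)
   show "finite (d ` {p \<in> Ns \<union> S. opened U p})" using fin(1,2) by simp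
   show "d p \<in> d ` {p \<in> Ns \<union> S. opened U p}" using that by blast
  qed
  define k where "k = (LEAST k. k = N \<or> opened U (f k))"
  have k: "k = N \<or> opened U (f k)" unfolding k_def by (rule LeastI[of _ N]) simp
  have kN: "k <= N" unfolding k_def by (rule Least_le) simp
  have kl: "\<not> opened U (f i)" if "i < k" for i using not_less_Least[of i] that unfolding k_def by blast
  have nk: "none j U \<longleftrightarrow> j <= k" if "j <= N" for j
  proof
   assume "none j U"
   then have "\<not> opened U (f i)" if "i < j" for i using that by (auto simp: none_def)
   then show "j <= k" using k that not_le by blast
  next
   assume "j <= k" then show "none j U" using kl by (auto simp: none_def)
  qed
  have "(\<Sum>i<N. (d' (Suc i) - d' i) * of_bool (none (Suc i) U)) = (\<Sum>i<k. d' (Suc i) - d' i)"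
  proof -
   have "(d' (Suc i) - d' i) * of_bool (none (Suc i) U) = (if i < k then d' (Suc i) - d' i else 0)"
    if "i < N" for i
    using nk[of "Suc i"] that by (simp add: Suc_le_eq)
   then have "(\<Sum>i<N. (d' (Suc i) - d' i) * of_bool (none (Suc i) U)) =
     (\<Sum>i<N. if i < k then d' (Suc i) - d' i else 0)"
    by (intro sum.cong) simp_all
   also have "\<dots> = (\<Sum>i\<in>{..<N} \<inter> {i. i < k}. d' (Suc i) - d' i)" by (simp add: sum.inter_restrict)
   also have "{..<N} \<inter> {i. i < k} = {..<k}" using kN by auto
   finally show ?thesis .
  qed
  then have tel: "X U = d' k + Y U" unfolding X_def by (simp add: sum_lessThan_telescope)
  show ?thesis
  proof (cases "\<exists>p\<in>N'. opened U p")
   case True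
   then obtain p where p: "p \<in> N'" "opened U p" by blast
   then obtain j where j: "j < N" "p = f j" using imf by (auto simp: N'_def)
   have "k <= j" unfolding k_def by (rule Least_le) (use j p in simp)
   then have kk: "k < N" "d (f k) <= T" using j mono[of k j] p by (auto simp: N'_def)
   have "Y U = 0" unfolding Y_def
   proof (rule sum.neutral, rule ballI)
    fix x assume x: "x \<in> S - Q"
    have "\<not> (opened U x \<and> (\<forall>p'\<in>N' - S. \<not> opened U p'))"
    proof
     assume o: "opened U x \<and> (\<forall>p'\<in>N' - S. \<not> opened U p')"
     then have "p \<in> S" using p by blast
     then have "x = p" using uniq[of x p U] x o p by blast
     then show False using x p \<open>p \<in> S\<close> by (auto simp: Q_def)
    qed
    then show "(d x - T) * of_bool (opened U x \<and> (\<forall>p'\<in>N' - S. \<not> opened U p')) = 0" by simp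
   qed
   then have "X U = d (f k)" using tel kk by (simp add: d'_def)
   moreover have "Min (d ` {p \<in> Ns \<union> S. opened U p}) <= d (f k)"
    using k kk fN[of k] by (intro le) auto
   ultimately show ?thesis by simp
  next
   case False
   have \<phi>Q: "\<phi> \<in> S - Q" using \<phi> False by (auto simp: Q_def)
   have "Y U = (\<Sum>p\<in>S - Q. if p = \<phi> then d \<phi> - T else 0)" unfolding Y_def
   proof (rule sum.cong[OF refl])
    fix p assume p: "p \<in> S - Q"
    show "(d p - T) * of_bool (opened U p \<and> (\<forall>p'\<in>N' - S. \<not> opened U p')) =
     (if p = \<phi> then d \<phi> - T else 0)"
    proof (cases "p = \<phi>")
     case True
     moreover have "\<forall>p'\<in>N' - S. \<not> opened U p'" using False by blast
     ultimately show ?thesis using \<phi>(2) by simp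
    next
     case ne: False
     then have "\<not> opened U p" using uniq[of p \<phi> U] p \<phi> by blast
     then show ?thesis using ne by simp
    qed
   qed
   then have Y: "Y U = d \<phi> - T" using \<phi>Q fin by simp
   have "d' k = T"
   proof (cases "k = N")
    case True then show ?thesis by (simp add: d'_def)
   next
    case kn: False
    then have "k < N" "opened U (f k)" using k kN by auto
    then have "f k \<notin> N'" using False by blast
    then have "T < d (f k)" using fN[OF \<open>k < N\<close>] by (auto simp: N'_def)
    then show ?thesis by (simp add: d'_def)
   qed
   then show ?thesis using tel Y le[of \<phi>] \<phi> by simp
  qed
 qed
 have EY: "expect Y <= 0"
 proof -
  have 1: "N' - S \<subseteq> V" "!!p. p \<in> N' - S ==> grp p \<noteq> \<kappa>" using sub grpS(2) by (auto simp: N'_def)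
  obtain q where q: "0 <= q" "!!p. p \<in> V ==> grp p = \<kappa> ==>
    expect (%U. of_bool (opened U p \<and> (\<forall>p'\<in>N' - S. \<not> opened U p'))) = q"
   using expect_opened_none[of "N' - S" \<kappa>] 1 by blast
  have "expect Y = (\<Sum>p\<in>S - Q. (d p - T) * expect (%U. of_bool (opened U p \<and> (\<forall>p'\<in>N' - S. \<not> opened U p'))))"
   unfolding Y_def by (subst Bochner_Integration.integral_sum) auto
  also have "\<dots> = (\<Sum>p\<in>S - Q. (d p - T) * q)" using q(2) sub grpS(1) by (intro sum.cong) auto
  also have "\<dots> = (\<Sum>p\<in>S - Q. d p - T) * q" by (simp add: sum_distrib_right)
  also have "\<dots> <= 0" using avg q(1) unfolding T_def by (rule mult_nonpos_nonneg)
  finally show ?thesis .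
 qed
 have "expect (%U. Min (d ` {p \<in> Ns \<union> S. opened U p})) <= expect X"
  using pointwise by (intro integral_mono_AE) (auto intro!: AE_pmfI)
 also have "expect X = d' 0 + (\<Sum>k<N. (d' (Suc k) - d' k) * expect (%U. of_bool (none (Suc k) U))) + expect Y"
  unfolding X_def by (simp add: Bochner_Integration.integral_sum del: sum_mult_of_bool_eq)
 also have "\<dots> <= d' 0 + (\<Sum>k<N. (d' (Suc k) - d' k) * s ^ Suc k) + 0"
 proof (intro add_mono EY order.refl sum_mono mult_left_mono)
  fix k assume "k \<in> {..<N}"
  then have k: "Suc k <= N" by simp
  have "f ` {..<Suc k} \<subseteq> V"
  proof (rule image_subsetI)
   fix i assume "i \<in> {..<Suc k}"
   then have "f i \<in> Ns" using k by (intro fN) simp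
   then show "f i \<in> V" using sub(1) by blast
  qed
  moreover have "card (f ` {..<Suc k}) = Suc k"
   using k by (subst card_image[OF inj_on_subset[OF injf]]) auto
  ultimately show "expect (%U. of_bool (none (Suc k) U)) <= s ^ Suc k"
   unfolding none_def s_def using prob_none_opened[of "f ` {..<Suc k}"] by simp
  show "0 <= d' (Suc k) - d' k" using d'mono[of k "Suc k"] by simp
 qed
 also have "\<dots> = (\<Sum>k<N. d' k * (s ^ k - s ^ Suc k)) + T * s ^ N"
  using abel_geometric[where a = d' and N = N and s = s] by (simp add: d'_def)
 also have "(\<Sum>k<N. d' k * (s ^ k - s ^ Suc k)) =
   (\<Sum>k<n. d' k * (s ^ k - s ^ Suc k)) + (\<Sum>k<N - n. d' (n + k) * (s ^ (n + k) - s ^ Suc (n + k)))"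
  using sum_lessThan_split[where f = "%k. d' k * (s ^ k - s ^ Suc k)" and n = n and m = "N - n"] card by simp
 also have "\<dots> + T * s ^ N <= C * (1 - s ^ n) + D * (s ^ n - s ^ N) + T * s ^ N"
 proof (intro add_right_mono add_mono)
  have "real n * (\<Sum>k<n. d' k * (s ^ (0 + k) - s ^ Suc (0 + k))) <= (\<Sum>k<n. d' k) * (s ^ 0 - s ^ (0 + n))"
   by (rule chebyshev_geometric[OF s]) (rule d'mono)
  also have "\<dots> <= (\<Sum>k<n. d (f1 k)) * (s ^ 0 - s ^ (0 + n))"
   using card s power_le_one[OF s, of n] by (intro mult_right_mono sum_mono) (auto simp: d'_def f_def)
  also have "(\<Sum>k<n. d (f1 k)) = sum d Cs"
   using sum.reindex_bij_betw[OF f1(1), of d] card by simp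
  finally have "real n * (\<Sum>k<n. d' k * (s ^ k - s ^ Suc k)) <= real n * (C * (1 - s ^ n))"
   using C by simp
  then show "(\<Sum>k<n. d' k * (s ^ k - s ^ Suc k)) <= C * (1 - s ^ n)" using n by simp
  have "real (N - n) * (\<Sum>k<N - n. d' (n + k) * (s ^ (n + k) - s ^ Suc (n + k))) <=
    (\<Sum>k<N - n. d' (n + k)) * (s ^ n - s ^ (n + (N - n)))"
   by (rule chebyshev_geometric[OF s]) (rule d'mono, simp)
  also have "\<dots> <= (\<Sum>k<N - n. d (f2 k)) * (s ^ n - s ^ (n + (N - n)))"
   using card s power_decreasing[of n N s] by (intro mult_right_mono sum_mono) (auto simp: d'_def f_def)
  also have "(\<Sum>k<N - n. d (f2 k)) = sum d (Ns - Cs)"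
   using sum.reindex_bij_betw[OF f2(1), of d] far by simp
  finally have "real (N - n) * (\<Sum>k<N - n. d' (n + k) * (s ^ (n + k) - s ^ Suc (n + k))) <=
    real (N - n) * (D * (s ^ n - s ^ N))"
   using D card by (simp add: of_nat_diff)
  then show "(\<Sum>k<N - n. d' (n + k) * (s ^ (n + k) - s ^ Suc (n + k))) <= D * (s ^ n - s ^ N)"
   using card by simp
 qed
 \<comment> \<open>With \<open>T = C + 2 * D\<close> the coefficient of \<open>D\<close> becomes
   \<open>s ^ n + s ^ N\<close>, in the limit exp (-1) + exp (- N / n). To end at
   \<open>C + D * (N / n - 1)\<close> it must be at most \<open>N / n - 1\<close>; this is the
   origin of the equation for the ratio.\<close>
 also have "C * (1 - s ^ n) + D * (s ^ n - s ^ N) + T * s ^ N =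
   C * (1 - (s ^ n - s ^ N)) + D * (s ^ n + s ^ N)"
  unfolding T_def by (simp add: algebra_simps)
 also have "\<dots> <= C * 1 + D * (real N / real n - 1)"
  using CD0 num power_decreasing[of n N s] s card by (intro add_mono mult_left_mono) (auto simp: s_def)
 also have "\<dots> = sum d Ns / real n"
 proof -
  have "sum d Ns = sum d Cs + sum d (Ns - Cs)" using sum.subset_diff[OF sub(3) fin(1), of d] by simp
  then show ?thesis unfolding C D using n by (simp add: field_simps)
 qed
 finally show ?thesis by simp
qed

end

section \<open>The star of best ratio, compared with the linear program\<close>

text \<open>Linear programming duality. If \<rho> is the best ratio of weight to cost, then the
  numbers \<open>max 0 (w j - \<rho> * d i j)\<close> add up to at most \<open>\<rho> * f i\<close>
  at each site, so they are feasible for the dual, and weak duality gives the claim. Stars of the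
  form \<open>A i j\<close> suffice: the clients with positive contribution at site \<open>i\<close>
  are exactly those whose quotient of distance and weight is at most a certain maximum.\<close>

lemma star_oracle:
 fixes w r f y :: "nat => real" and d x :: "nat => nat => real"
 assumes fin: "finite Ac" and w: "!!j. j \<in> Ac ==> 0 < w j"
  and f: "!!i. i < ns ==> 0 <= f i" and d: "!!i j. i < ns ==> j \<in> Ac ==> 0 <= d i j"
  and A: "!!i j. A i j = {j'\<in>Ac. w j * d i j' <= w j' * d i j}"
  and best: "i0 < ns" "j0 \<in> Ac"
   "!!i j. i < ns ==> j \<in> Ac ==>
    sum w (A i j) * (f i0 + sum (d i0) (A i0 j0)) <= sum w (A i0 j0) * (f i + sum (d i) (A i j))"
  and lp: "!!i. i < ns ==> 0 <= y i" "!!i j. i < ns ==> j \<in> Ac ==> 0 <= x i j \<and> x i j <= y i"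
   "!!j. j \<in> Ac ==> r j <= (\<Sum>i<ns. x i j)"
 shows "(\<Sum>j\<in>Ac. w j * r j) * (f i0 + sum (d i0) (A i0 j0)) <=
  sum w (A i0 j0) * ((\<Sum>i<ns. f i * y i) + (\<Sum>i<ns. \<Sum>j\<in>Ac. d i j * x i j))"
proof -
 have finA: "finite (A i j)" for i j using fin by (simp add: A)
 have j0A: "j0 \<in> A i0 j0" using best by (simp add: A)
 have W: "0 < sum w (A i0 j0)"
 proof (rule sum_pos)
  show "A i0 j0 \<noteq> {}" using j0A by blast
  show "0 < w j" if "j \<in> A i0 j0" for j using that w by (simp add: A)
 qed (rule finA)
 define c where "c = f i0 + sum (d i0) (A i0 j0)"
 have c0: "0 <= c" unfolding c_def
  using f[OF best(1)] d[OF best(1)] by (intro add_nonneg_nonneg sum_nonneg) (auto simp: A)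
 have lp0: "0 <= (\<Sum>i<ns. f i * y i) + (\<Sum>i<ns. \<Sum>j\<in>Ac. d i j * x i j)"
  by (intro add_nonneg_nonneg sum_nonneg mult_nonneg_nonneg) (use f d lp in auto)
 show ?thesis
 proof (cases "c = 0")
  case True
  then show ?thesis using W lp0 unfolding c_def[symmetric] by simp
 next
  case False
  then have cp: "0 < c" using c0 by simp
  define \<rho> where "\<rho> = sum w (A i0 j0) / c"
  have \<rho>: "0 < \<rho>" using W cp by (simp add: \<rho>_def)
  have pack: "(\<Sum>j\<in>Ac. max 0 (w j - \<rho> * d i j)) <= \<rho> * f i" if i: "i < ns" for i
  proof -
   define B where "B = {j\<in>Ac. \<rho> * d i j < w j}"
   have finB: "finite B" using fin by (simp add: B_def)
   have eq: "(\<Sum>j\<in>Ac. max 0 (w j - \<rho> * d i j)) = (\<Sum>j\<in>B. w j - \<rho> * d i j)"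
    using fin by (intro sum.mono_neutral_cong_right) (auto simp: B_def max_def)
   show ?thesis
   proof (cases "B = {}")
    case True
    then show ?thesis unfolding eq using \<rho> f[OF i] by simp
   next
    case ne: False
    have "Max ((%j. d i j / w j) ` B) \<in> (%j. d i j / w j) ` B" using finB ne by (intro Max_in) auto
    then obtain j1 where j1: "j1 \<in> B" "d i j1 / w j1 = Max ((%j. d i j / w j) ` B)" by auto
    have j1w: "0 < w j1" "\<rho> * d i j1 < w j1" "j1 \<in> Ac" using j1 w by (auto simp: B_def)
    have "A i j1 = B"
    proof (intro equalityI subsetI)
     fix j assume j: "j \<in> B"
     then have "d i j / w j <= d i j1 / w j1" unfolding j1(2) using finB by (intro Max_ge) auto
     moreover have "0 < w j" using j w by (simp add: B_def)
     ultimately have "w j1 * d i j <= w j * d i j1" using j1w by (simp add: field_simps)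
     then show "j \<in> A i j1" using j by (simp add: A B_def)
    next
     fix j assume "j \<in> A i j1"
     then have j: "j \<in> Ac" "w j1 * d i j <= w j * d i j1" by (auto simp: A)
     have "\<rho> * (w j1 * d i j) <= \<rho> * (w j * d i j1)" using j(2) \<rho> by simp
     also have "\<dots> = w j * (\<rho> * d i j1)" by simp
     also have "\<dots> < w j * w j1" using w[OF j(1)] j1w by simp
     finally have "w j1 * (\<rho> * d i j) < w j1 * w j" by (simp add: algebra_simps)
     then show "j \<in> B" using j j1w by (simp add: B_def)
    qed
    then have "sum w B * c <= sum w (A i0 j0) * (f i + sum (d i) B)"
     using best(3)[OF i j1w(3)] by (simp add: c_def)
    then have "sum w B <= \<rho> * (f i + sum (d i) B)" using cp by (simp add: \<rho>_def field_simps)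
    then show ?thesis unfolding eq by (simp add: sum_subtractf sum_distrib_left algebra_simps)
   qed
  qed
  have "(\<Sum>j\<in>Ac. w j * r j) <= (\<Sum>j\<in>Ac. w j * (\<Sum>i<ns. x i j))"
   using w lp(3) by (intro sum_mono mult_left_mono) (auto intro: less_imp_le)
  also have "\<dots> = (\<Sum>i<ns. \<Sum>j\<in>Ac. w j * x i j)" by (simp add: sum_distrib_left sum.swap[of _ Ac])
  also have "\<dots> <= (\<Sum>i<ns. \<Sum>j\<in>Ac. max 0 (w j - \<rho> * d i j) * y i + \<rho> * (d i j * x i j))"
  proof (intro sum_mono)
   fix i j assume ij: "i \<in> {..<ns}" "j \<in> Ac"
   have "(w j - \<rho> * d i j) * x i j <= max 0 (w j - \<rho> * d i j) * x i j"
    using lp(2)[of i j] ij by (intro mult_right_mono) auto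
   also have "\<dots> <= max 0 (w j - \<rho> * d i j) * y i"
    using lp(2)[of i j] ij by (intro mult_left_mono) auto
   finally show "w j * x i j <= max 0 (w j - \<rho> * d i j) * y i + \<rho> * (d i j * x i j)"
    by (simp add: algebra_simps)
  qed
  also have "\<dots> = (\<Sum>i<ns. (\<Sum>j\<in>Ac. max 0 (w j - \<rho> * d i j)) * y i) + \<rho> * (\<Sum>i<ns. \<Sum>j\<in>Ac. d i j * x i j)"
   by (simp add: sum.distrib sum_distrib_left sum_distrib_right)
  also have "\<dots> <= (\<Sum>i<ns. (\<rho> * f i) * y i) + \<rho> * (\<Sum>i<ns. \<Sum>j\<in>Ac. d i j * x i j)"
   using pack lp(1) by (intro add_right_mono sum_mono mult_right_mono) auto
  also have "\<dots> = \<rho> * ((\<Sum>i<ns. f i * y i) + (\<Sum>i<ns. \<Sum>j\<in>Ac. d i j * x i j))"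
   by (simp add: sum_distrib_left algebra_simps)
  finally have "(\<Sum>j\<in>Ac. w j * r j) * c <=
    (\<rho> * ((\<Sum>i<ns. f i * y i) + (\<Sum>i<ns. \<Sum>j\<in>Ac. d i j * x i j))) * c"
   using c0 by (rule mult_right_mono)
  also have "\<dots> = sum w (A i0 j0) * ((\<Sum>i<ns. f i * y i) + (\<Sum>i<ns. \<Sum>j\<in>Ac. d i j * x i j))"
   using cp by (simp add: \<rho>_def)
  finally show ?thesis unfolding c_def .
 qed
qed

section \<open>Multiplicative weights: covering every demand \<open>N\<close> times\<close>

text \<open>Round \<open>t\<close> opens the star with members \<open>A t\<close> in multiplicity
  \<open>th t\<close>. The weight of a member drops by the factor
  \<open>1 - th t / (D * r j)\<close>, so \<open>1 / D\<close> is the largest relative drop in a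
  single round.\<close>

locale mult_weights =
 fixes nc N D :: nat and r :: "nat => nat" and A :: "nat => nat => bool" and th :: "nat => nat"
 assumes r: "!!j. j < nc ==> 0 < r j" and D: "2 <= D"
begin

definition cov :: "nat => nat => nat" where
 "cov t j = (\<Sum>t'<t. of_bool (A t' j) * th t')"

definition act :: "nat => nat set" where
 "act t = {j. j < nc \<and> cov t j < N * r j}"

definition om :: "nat => nat => real" where
 "om t j = (\<Prod>t'<t. 1 - of_bool (A t' j) * real (th t') / (real D * real (r j)))"

lemma cov_Suc: "cov (Suc t) j = cov t j + of_bool (A t j) * th t"
 by (simp add: cov_def)

lemma om_Suc: "om (Suc t) j = om t j * (1 - of_bool (A t j) * real (th t) / (real D * real (r j)))"
 by (simp add: om_def)

lemma act_Suc: "act (Suc t) \<subseteq> act t"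
 by (auto simp: act_def cov_Suc)

lemma finite_act [simp]: "finite (act t)"
 by (simp add: act_def)

end

text \<open>\<open>tight\<close> reflects the choice of the multiplicity as the least demand in the
  star. \<open>star\<close> is the guarantee of \<open>star_oracle\<close> for the weights
  \<open>om t j / r j\<close>, with \<open>L\<close> an upper bound on the cost of a fractional
  solution.\<close>

locale mult_weights_run = mult_weights +
 fixes c :: "nat => real" and L :: real and T :: nat
 assumes L: "0 < L" and c0: "!!t. 0 <= c t"
  and sub: "!!t j. A t j ==> j \<in> act t \<and> th t <= r j"
  and tight: "!!t. t < T ==> act t \<noteq> {} ==> \<exists>j. A t j \<and> th t = r j"
  and idle: "!!t. t < T ==> act t = {} ==> c t = 0"
  and star: "!!t. t < T ==> act t \<noteq> {} ==>
   (\<Sum>j\<in>act t. om t j) * c t <= (\<Sum>j | A t j. om t j / real (r j)) * L"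
begin

text \<open>A tight client gains a full multiple of its demand, and no client can gain more than
  \<open>N\<close> multiples while it is active. Hence \<open>nc * N\<close> rounds suffice whatever
  the size of the demands.\<close>

lemma all_covered:
 assumes T: "nc * N <= T"
 shows "act T = {}"
proof -
 define m where "m t = (\<Sum>j<nc. min N (cov t j div r j))" for t
 have le: "t <= m t" if "act t \<noteq> {}" "t <= T" for t
  using that
 proof (induction t)
  case (Suc t)
  then have act: "act t \<noteq> {}" using act_Suc by blast
  then obtain j where j: "A t j" "th t = r j" using tight[of t] Suc.prems by auto
  then have ja: "j < nc" "cov t j < N * r j" using sub by (auto simp: act_def)
  have "cov (Suc t) j div r j = cov t j div r j + 1" using j r[OF ja(1)] by (simp add: cov_Suc)
  moreover have "cov t j div r j < N" using ja by (simp add: less_mult_imp_div_less)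
  ultimately have "min N (cov t j div r j) < min N (cov (Suc t) j div r j)" by simp
  moreover have "\<forall>j\<in>{..<nc}. min N (cov t j div r j) <= min N (cov (Suc t) j div r j)"
   by (intro ballI min.mono div_le_mono) (auto simp: cov_Suc)
  ultimately have "m t < m (Suc t)" unfolding m_def
   using ja by (intro sum_strict_mono_ex1) auto
  then show ?case using Suc.IH[OF act] Suc.prems by simp
 qed simp
 show ?thesis
 proof (rule ccontr)
  assume ne: "act T \<noteq> {}"
  then obtain j where j: "j < nc" "cov T j < N * r j" by (auto simp: act_def)
  then have "min N (cov T j div r j) < N" by (simp add: less_mult_imp_div_less)
  then have "m T < (\<Sum>j<nc. N)" unfolding m_def
   using j by (intro sum_strict_mono_ex1) auto
  then show False using le[OF ne order.refl] T by simp
 qed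
qed

lemma ratio_le:
 assumes "A t j"
 shows "0 <= real (th t) / (real D * real (r j))" "real (th t) / (real D * real (r j)) <= 1 / real D"
proof -
 have "j < nc" "th t <= r j" using sub[OF assms] by (auto simp: act_def)
 then have "0 < r j" "real (th t) <= real (r j)" using r by auto
 then show "0 <= real (th t) / (real D * real (r j))" "real (th t) / (real D * real (r j)) <= 1 / real D"
  using D by (auto simp: field_simps)
qed

lemma om_pos: "0 < om t j"
 unfolding om_def
proof (rule prod_pos)
 fix t'
 have "1 / real D <= 1 / 2" using D by (simp add: field_simps)
 then show "0 < 1 - of_bool (A t' j) * real (th t') / (real D * real (r j))"
  using ratio_le(2)[of t' j] by (cases "A t' j") auto
qed

text \<open>An active client has coverage below \<open>N * r j\<close>, so its weight cannot have
  decayed too far. The factor \<open>1 + 2 / D\<close> comes from ln (1 - x) being at least - x - 2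
  x^2, with x at most \<open>1 / D\<close>.\<close>

lemma om_ge:
 assumes j: "j \<in> act t"
 shows "exp (- (1 + 2 / real D) * real N / real D) <= om t j"
proof -
 have jn: "j < nc" "cov t j < N * r j" using j by (auto simp: act_def)
 have rj: "0 < r j" using r jn by simp
 have "exp (- (1 + 2 / real D) * (of_bool (A t' j) * real (th t')) / (real D * real (r j))) <=
   1 - of_bool (A t' j) * real (th t') / (real D * real (r j))" for t'
 proof (cases "A t' j")
  case True
  define x where "x = real (th t') / (real D * real (r j))"
  have x: "0 <= x" "x <= 1 / real D" using ratio_le[OF True] by (auto simp: x_def)
  moreover have "1 / real D <= 1 / 2" using D by (simp add: field_simps)
  ultimately have "- x - 2 * x\<^sup>2 <= ln (1 - x)" by (intro ln_one_minus_pos_lower_bound) auto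
  moreover have "x * x <= x * (1 / real D)" using x by (intro mult_left_mono)
  moreover have "- (1 + 2 / real D) * x = - x - 2 * (x * (1 / real D))" by (simp add: algebra_simps)
  ultimately have "- (1 + 2 / real D) * x <= ln (1 - x)" unfolding power2_eq_square by linarith
  moreover have "0 < 1 - x" using x \<open>1 / real D <= 1 / 2\<close> by linarith
  ultimately have "exp (- (1 + 2 / real D) * x) <= 1 - x" by (metis exp_le_cancel_iff exp_ln)
  then show ?thesis using True by (simp add: x_def)
 qed simp
 then have "(\<Prod>t'<t. exp (- (1 + 2 / real D) * (of_bool (A t' j) * real (th t')) / (real D * real (r j)))) <= om t j"
  unfolding om_def by (intro prod_mono) auto
 also have "(\<Prod>t'<t. exp (- (1 + 2 / real D) * (of_bool (A t' j) * real (th t')) / (real D * real (r j)))) =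
   exp (\<Sum>t'<t. - (1 + 2 / real D) * (of_bool (A t' j) * real (th t')) / (real D * real (r j)))"
  by (simp add: exp_sum)
 also have "(\<Sum>t'<t. - (1 + 2 / real D) * (of_bool (A t' j) * real (th t')) / (real D * real (r j))) =
   - (1 + 2 / real D) * real (cov t j) / (real D * real (r j))"
  by (simp add: cov_def sum_distrib_left sum_divide_distrib del: sum_mult_of_bool_eq sum_of_bool_mult_eq)
 finally have 1: "exp (- (1 + 2 / real D) * real (cov t j) / (real D * real (r j))) <= om t j" .
 have "real (cov t j) <= real N * real (r j)" using jn by (metis less_imp_le of_nat_le_iff of_nat_mult)
 then have "real (cov t j) / real (r j) <= real N" using rj by (simp add: field_simps)
 then have 2: "a / real D * (real (cov t j) / real (r j)) <= a / real D * real N" if "0 <= a" for a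
  using that by (intro mult_left_mono) auto
 have "- a * real N / real D <= - a * real (cov t j) / (real D * real (r j))" if "0 <= a" for a
  using 2[OF that] by simp
 from this[of "1 + 2 / real D"]
 have "- (1 + 2 / real D) * real N / real D <= - (1 + 2 / real D) * real (cov t j) / (real D * real (r j))"
  by (simp del: minus_add_distrib)
 then show ?thesis using 1 exp_le_cancel_iff order.trans by blast
qed

lemma finite_A: "finite {j. A t j}"
 by (rule finite_subset[of _ "act t"]) (use sub in auto)

lemma step_cost:
 assumes "act t \<noteq> {}" and t: "t < T"
 shows "real (th t) * c t <= L"
proof -
 have P: "0 < (\<Sum>j\<in>act t. om t j)" using assms om_pos by (intro sum_pos) auto
 have "real (th t) * (\<Sum>j | A t j. om t j / real (r j)) <= (\<Sum>j | A t j. om t j)"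
  unfolding sum_distrib_left
 proof (rule sum_mono)
  fix j assume "j \<in> {j. A t j}"
  then have j: "A t j" by simp
  then have "j < nc" "th t <= r j" using sub by (auto simp: act_def)
  then have "0 < r j" "real (th t) / real (r j) <= 1" using r by auto
  then have "om t j * (real (th t) / real (r j)) <= om t j * 1"
   using om_pos[of t j] by (intro mult_left_mono) auto
  then show "real (th t) * (om t j / real (r j)) <= om t j" by (simp add: mult.commute)
 qed
 also have "\<dots> <= (\<Sum>j\<in>act t. om t j)"
  using sub om_pos by (intro sum_mono2) (auto intro: less_imp_le)
 finally have le: "real (th t) * (\<Sum>j | A t j. om t j / real (r j)) <= (\<Sum>j\<in>act t. om t j)" .
 have "(\<Sum>j\<in>act t. om t j) * (real (th t) * c t) = real (th t) * ((\<Sum>j\<in>act t. om t j) * c t)" by simp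
 also have "\<dots> <= real (th t) * ((\<Sum>j | A t j. om t j / real (r j)) * L)"
  using star[OF t assms(1)] by (intro mult_left_mono) auto
 also have "\<dots> <= (\<Sum>j\<in>act t. om t j) * L" using mult_right_mono[OF le, of L] L by (simp add: mult.assoc)
 finally show ?thesis using P by simp
qed

text \<open>By \<open>star\<close>, a round that spends \<open>th t * c t\<close> removes at least
  the fraction \<open>th t * c t / (D * L)\<close> of the active weight; clients that become
  inactive only lower the sum. The total weight thus decays exponentially in the money
  spent.\<close>

lemma potential:
 assumes "act t \<noteq> {}" "t <= T"
 shows "(\<Sum>j\<in>act t. om t j) <= real nc * exp (- (\<Sum>t'<t. real (th t') * c t') / (real D * L))"
 using assms
proof (induction t)
 case 0
 have "act 0 \<subseteq> {..<nc}" by (auto simp: act_def)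
 then have "card (act 0) <= nc" using card_mono[of "{..<nc}" "act 0"] by simp
 then show ?case by (simp add: om_def)
next
 case (Suc t)
 then have act: "act t \<noteq> {}" using act_Suc by blast
 let ?P = "\<Sum>j\<in>act t. om t j" and ?w = "\<Sum>j | A t j. om t j / real (r j)"
 have DL: "0 < real D * L" using D L by simp
 have "(\<Sum>j\<in>act (Suc t). om (Suc t) j) <= (\<Sum>j\<in>act t. om (Suc t) j)"
  using act_Suc om_pos by (intro sum_mono2) (auto intro: less_imp_le)
 also have "\<dots> = (\<Sum>j\<in>act t. om t j - (if A t j then real (th t) / real D * (om t j / real (r j)) else 0))"
  by (intro sum.cong) (auto simp: om_Suc algebra_simps)
 also have "\<dots> = ?P - (\<Sum>j\<in>act t. if A t j then real (th t) / real D * (om t j / real (r j)) else 0)"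
  by (simp add: sum_subtractf)
 also have "(\<Sum>j\<in>act t. if A t j then real (th t) / real D * (om t j / real (r j)) else 0) =
   (\<Sum>j\<in>act t \<inter> {j. A t j}. real (th t) / real D * (om t j / real (r j)))"
  using sum.inter_restrict[OF finite_act[of t], of "%j. real (th t) / real D * (om t j / real (r j))" "{j. A t j}"]
  by simp
 also have "act t \<inter> {j. A t j} = {j. A t j}" using sub by auto
 also have "(\<Sum>j | A t j. real (th t) / real D * (om t j / real (r j))) = real (th t) / real D * ?w"
  by (simp add: sum_distrib_left)
 also have "?P - real (th t) / real D * ?w <= ?P * (1 - real (th t) * c t / (real D * L))"
 proof -
  have "real (th t) * (?P * c t) <= real (th t) * (?w * L)"
   using star[OF _ act] Suc.prems by (intro mult_left_mono) auto
  then have "?P * (real (th t) * c t / (real D * L)) <= real (th t) / real D * ?w"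
   using D L by (simp add: field_simps)
  then show ?thesis by (simp add: algebra_simps)
 qed
 also have "\<dots> <= ?P * exp (- (real (th t) * c t) / (real D * L))"
 proof (rule mult_left_mono)
  show "1 - real (th t) * c t / (real D * L) <= exp (- (real (th t) * c t) / (real D * L))"
   using exp_ge_add_one_self[of "- (real (th t) * c t) / (real D * L)"] by simp
  show "0 <= ?P" using om_pos by (intro sum_nonneg) (auto intro: less_imp_le)
 qed
 also have "\<dots> <= real nc * exp (- (\<Sum>t'<t. real (th t') * c t') / (real D * L)) *
   exp (- (real (th t) * c t) / (real D * L))"
  using Suc.IH[OF act] Suc.prems by (intro mult_right_mono) auto
 also have "\<dots> = real nc * exp (- (\<Sum>t'<Suc t. real (th t') * c t') / (real D * L))"
  by (simp add: exp_add[symmetric] add_divide_distrib diff_divide_distrib)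
 finally show ?case .
qed

text \<open>A single active weight (\<open>om_ge\<close>) is at most the total weight
  (\<open>potential\<close>). Taking logarithms bounds the money spent.\<close>

lemma cost_active:
 assumes ne: "act t \<noteq> {}" "t <= T"
 shows "(\<Sum>t'<t. real (th t') * c t') <= L * (real D * real nc + (1 + 2 / real D) * real N)"
proof -
 let ?S = "\<Sum>t'<t. real (th t') * c t'"
 have DL: "0 < real D * L" using D L by simp
 obtain j where j: "j \<in> act t" using ne(1) by blast
 then have nc: "0 < nc" by (auto simp: act_def)
 have "exp (- (1 + 2 / real D) * real N / real D) <= om t j" by (rule om_ge[OF j])
 also have "\<dots> <= (\<Sum>j\<in>act t. om t j)"
  using j om_pos by (intro member_le_sum) (auto intro: less_imp_le)
 also have "\<dots> <= real nc * exp (- ?S / (real D * L))" by (rule potential[OF ne])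
 \<comment> \<open>A crude substitute for the logarithm of \<open>nc\<close>; it suffices because
   \<open>N\<close> will be a large multiple of a number not below \<open>nc\<close>.\<close>
 also have "\<dots> <= exp (real nc) * exp (- ?S / (real D * L))"
 proof (rule mult_right_mono)
  show "real nc <= exp (real nc)" using exp_ge_add_one_self[of "real nc"] by linarith
 qed simp
 finally have "- (1 + 2 / real D) * real N / real D <= real nc - ?S / (real D * L)"
  by (simp add: exp_add[symmetric])
 moreover have "- a * real N / real D = - (a * real N / real D)" for a :: real by simp
 moreover have "?S / (real D * L) <= real nc + a * real N / real D"
  if "- a * real N / real D <= real nc - ?S / (real D * L)" for a using that by simp
 ultimately have "?S / (real D * L) <= real nc + (1 + 2 / real D) * real N / real D" by blast
 then have "?S <= (real nc + (1 + 2 / real D) * real N / real D) * (real D * L)"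
  using DL by (simp add: pos_divide_le_eq)
 also have "\<dots> = L * (real D * real nc + (1 + 2 / real D) * real N)"
 proof -
  have "(real nc + a * real N / real D) * (real D * L) = L * (real D * real nc + a * real N)" for a
   using D by (simp add: field_simps)
  then show ?thesis .
 qed
 finally show ?thesis .
qed

text \<open>\<open>cost_active\<close> only speaks of the rounds before a round that still has
  active clients. The last such round is paid by \<open>step_cost\<close>, whence the additional
  1.\<close>

lemma total_cost: "m <= T ==> (\<Sum>t<m. real (th t) * c t) <= L * (real D * real nc + (1 + 2 / real D) * real N + 1)"
proof (induction m)
 case 0
 show ?case using L by simp
next
 case (Suc m)
 show ?case
 proof (cases "act m = {}")
  case True
  then show ?thesis using Suc idle by simp
 next
  case False
  then show ?thesis using cost_active[OF False] step_cost[OF False] Suc.prems by (simp add: algebra_simps)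
 qed
qed

end

section \<open>Distribution of the pieces among units of demand and clusters\<close>

text \<open>Taking the elements of rank below \<open>m\<close> selects the \<open>m\<close> smallest
  ones without sorting; a program obtains the rank by counting.\<close>

definition rk :: "(nat => nat => bool) => nat set => nat => nat" where
 "rk lt A p = card {q \<in> A. lt q p}"

locale strict_total =
 fixes lt :: "nat => nat => bool"
 assumes irrefl: "\<not> lt p p" and trans: "lt p q ==> lt q s ==> lt p s"
  and total: "p \<noteq> q ==> lt p q \<or> lt q p"
begin

lemma rk_less: "finite A ==> p \<in> A ==> lt p q ==> rk lt A p < rk lt A q"
 unfolding rk_def
proof (rule psubset_card_mono)
 assume A: "finite A" "p \<in> A" "lt p q"
 show "finite {s \<in> A. lt s q}" using A by simp
 have "{s \<in> A. lt s p} \<subseteq> {s \<in> A. lt s q}" using trans A(3) by auto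
 moreover have "p \<in> {s \<in> A. lt s q}" "p \<notin> {s \<in> A. lt s p}" using A irrefl by auto
 ultimately show "{s \<in> A. lt s p} \<subset> {s \<in> A. lt s q}" by auto
qed

lemma rk_bij: "finite A ==> bij_betw (rk lt A) A {..<card A}"
proof -
 assume A: "finite A"
 have inj: "inj_on (rk lt A) A"
 proof (rule inj_onI)
  fix p q assume pq: "p \<in> A" "q \<in> A" "rk lt A p = rk lt A q"
  show "p = q"
  proof (rule ccontr)
   assume "p \<noteq> q"
   then show False using total[of p q] rk_less[OF A pq(1), of q] rk_less[OF A pq(2), of p] pq(3) by auto
  qed
 qed
 have "rk lt A p < card A" if "p \<in> A" for p unfolding rk_def
 proof (rule psubset_card_mono[OF A])
  have "p \<notin> {q \<in> A. lt q p}" using irrefl by simp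
  then show "{q \<in> A. lt q p} \<subset> A" using that by auto
 qed
 then have sub: "rk lt A ` A \<subseteq> {..<card A}" by auto
 have "rk lt A ` A = {..<card A}"
  by (rule card_subset_eq[OF _ sub]) (simp_all add: card_image[OF inj])
 then show ?thesis using inj by (simp add: bij_betw_def)
qed

lemma card_rk_less:
 assumes A: "finite A" and m: "m <= card A"
 shows "card {p \<in> A. rk lt A p < m} = m"
proof -
 note b = rk_bij[OF A]
 have im: "rk lt A ` {p \<in> A. rk lt A p < m} = {..<m}"
 proof (intro equalityI subsetI)
  fix k assume k: "k \<in> {..<m}"
  then have "k \<in> rk lt A ` A" using m bij_betw_imp_surj_on[OF b] by auto
  then obtain p where "p \<in> A" "k = rk lt A p" by blast
  then show "k \<in> rk lt A ` {p \<in> A. rk lt A p < m}" using k by auto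
 qed auto
 have "inj_on (rk lt A) {p \<in> A. rk lt A p < m}"
  by (rule inj_on_subset[OF bij_betw_imp_inj_on[OF b]]) simp
 from card_image[OF this] im show ?thesis by simp
qed

end

text \<open>At time \<open>t\<close> a unit of demand of client \<open>sel t\<close> is created and
  attached to cluster \<open>clu t\<close>, where a cluster is named by the unit that founds it.
  \<open>P j\<close> are the pieces of client \<open>j\<close>, \<open>tk t\<close> those that unit
  \<open>t\<close> claims through its cluster, and \<open>fl t\<close> those that later fill it up
  to \<open>N\<close>.\<close>

locale partition =
 fixes nc H n N :: nat and rd :: "nat => nat" and P :: "nat => nat set" and d :: "nat => nat => nat"
  and sel clu :: "nat => nat" and tk fl :: "nat => nat set"
begin

definition lt :: "nat => nat => nat => bool" where
 "lt j q p \<longleftrightarrow> d j q < d j p \<or> d j q = d j p \<and> q < p"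

definition pool :: "nat => nat => nat set" where
 "pool t j = {p \<in> P j. \<not> (\<exists>t'<t. sel t' = j \<and> p \<in> tk t')}"

definition chunk :: "nat => nat set => nat set" where
 "chunk j A = {p \<in> A. rk (lt j) A p < n}"

text \<open>A sum over the single piece of rank \<open>n - 1\<close>, the farthest of the chunk; in
  this form a summation loop computes it.\<close>

definition top :: "nat => nat set => nat" where
 "top j A = (\<Sum>p | p \<in> A \<and> rk (lt j) A p = n - 1. d j p)"

text \<open>The \<open>n\<close>-fold of average plus maximum, which is an integer.\<close>

definition val :: "nat => nat set => nat" where
 "val j A = sum (d j) (chunk j A) + n * top j A"

definition cnt :: "nat => nat => nat" where
 "cnt t j = card {t'. t' < t \<and> sel t' = j}"

definition free :: "nat => nat set" where
 "free t = {p \<in> P (sel t). \<not> (\<exists>t'<H. sel t' = sel t \<and> p \<in> tk t') \<and> \<not> (\<exists>t'<t. sel t' = sel t \<and> p \<in> fl t')}"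

definition nbr :: "nat => nat set" where
 "nbr t = tk t \<union> fl t"

lemma cnt_Suc: "cnt (Suc t) j = cnt t j + of_bool (sel t = j)"
proof -
 have "{t'. t' < Suc t \<and> sel t' = j} = {t'. t' < t \<and> sel t' = j} \<union> (if sel t = j then {t} else {})"
  by (auto simp: less_Suc_eq)
 then show ?thesis unfolding cnt_def by (auto simp: card_insert_if)
qed

lemma sum_cnt_le: "(\<Sum>j<nc. cnt t j) <= t"
proof (induction t)
 case (Suc t)
 have "(\<Sum>j<nc. of_bool (sel t = j)) <= (1::nat)"
  by (cases "sel t < nc") (auto simp: of_bool_def sum.delta)
 then show ?case using Suc by (simp add: cnt_Suc sum.distrib)
qed (simp add: cnt_def)

lemma unsatisfied_ex: "t < (\<Sum>j<nc. rd j) ==> \<exists>j<nc. cnt t j < rd j"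
proof (rule ccontr)
 assume t: "t < (\<Sum>j<nc. rd j)" and "\<not> (\<exists>j<nc. cnt t j < rd j)"
 then have "(\<Sum>j<nc. rd j) <= (\<Sum>j<nc. cnt t j)" by (intro sum_mono) (metis lessThan_iff not_le)
 then show False using sum_cnt_le[of t] t by simp
qed

end

sublocale partition \<subseteq> lt: strict_total "lt j" for j
 by unfold_locales (auto simp: lt_def)

interpretation nat_lt: strict_total "(<)"
 by unfold_locales auto

text \<open>A unit founds a cluster exactly if its \<open>n\<close> nearest remaining pieces meet no
  earlier cluster. Otherwise it joins one that they meet and claims every remaining piece of its
  client there, so that no later unit of this client can meet that cluster again.\<close>

locale partition_run = partition +
 assumes finP: "!!j. j < nc ==> finite (P j)" and cardP: "!!j. j < nc ==> card (P j) = N * rd j"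
  and n: "0 < n" "n <= N" and H: "H = (\<Sum>j<nc. rd j)"
  and sel: "!!t. t < H ==> \<exists>j<nc. cnt t j < rd j ==> sel t < nc \<and> cnt t (sel t) < rd (sel t) \<and>
   (\<forall>j<nc. cnt t j < rd j \<longrightarrow> val (sel t) (pool t (sel t)) <= val j (pool t j))"
  and clu_le: "!!t. t < H ==> clu t <= t"
  and clu_old: "!!t. t < H ==> clu t < t ==> clu (clu t) = clu t \<and>
   chunk (sel t) (pool t (sel t)) \<inter> tk (clu t) \<noteq> {}"
  and clu_new: "!!t \<kappa>. t < H ==> clu t = t ==> \<kappa> < t ==> clu \<kappa> = \<kappa> ==>
   chunk (sel t) (pool t (sel t)) \<inter> tk \<kappa> = {}"
  and tk: "!!t. t < H ==> tk t = (if clu t = t then chunk (sel t) (pool t (sel t))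
   else pool t (sel t) \<inter> tk (clu t))"
  and fl: "!!t. t < H ==> fl t = {p \<in> free t. rk (<) (free t) p + card (tk t) < N}"
begin

lemma cnt_mono: "t <= t' ==> cnt t j <= cnt t' j"
 unfolding cnt_def by (rule card_mono) auto

lemma unsatisfied: "t < H ==> \<exists>j<nc. cnt t j < rd j"
 using unsatisfied_ex[of t] H by simp

lemma selD: "t < H ==> sel t < nc" "t < H ==> cnt t (sel t) < rd (sel t)"
 "t < H ==> j < nc ==> cnt t j < rd j ==> val (sel t) (pool t (sel t)) <= val j (pool t j)"
 using sel unsatisfied by auto

lemma cnt_H: "j < nc ==> cnt H j = rd j"
proof -
 assume j: "j < nc"
 have le: "t <= H ==> cnt t j <= rd j" for t j
 proof (induction t)
  case (Suc t)
  then have "t < H" "cnt t j <= rd j" by simp_all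
  then show ?case using selD(2)[of t] by (cases "sel t = j") (simp_all add: cnt_Suc)
 qed (simp add: cnt_def)
 have "t <= H ==> (\<Sum>j<nc. cnt t j) = t" for t
 proof (induction t)
  case (Suc t)
  have "(\<Sum>j<nc. of_bool (sel t = j)) = (1::nat)"
   using selD(1)[of t] Suc.prems by (simp add: of_bool_def)
  then show ?case using Suc by (simp add: cnt_Suc sum.distrib)
 qed (simp add: cnt_def)
 then have s: "(\<Sum>j<nc. cnt H j) = (\<Sum>j<nc. rd j)" using H by simp
 show ?thesis
 proof (rule ccontr)
  assume "cnt H j \<noteq> rd j"
  then have "cnt H j < rd j" using le[of H j] by simp
  then have "\<exists>j\<in>{..<nc}. cnt H j < rd j" using j by (intro bexI[of _ j]) simp_all
  moreover have "\<forall>j\<in>{..<nc}. cnt H j <= rd j" by (simp add: le)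
  ultimately have "(\<Sum>j<nc. cnt H j) < (\<Sum>j<nc. rd j)" by (intro sum_strict_mono_ex1) simp_all
  then show False using s by simp
 qed
qed

lemma finite_pool: "j < nc ==> finite (pool t j)"
 using finP[of j] by (simp add: pool_def)

lemma pool_antimono: "t <= t' ==> pool t' j \<subseteq> pool t j"
 by (auto simp: pool_def)

lemma chunk_sub: "chunk j A \<subseteq> A"
 by (auto simp: chunk_def)

lemma card_chunk: "finite A ==> n <= card A ==> card (chunk j A) = n"
 unfolding chunk_def by (rule lt.card_rk_less)

lemma chunk_le:
 assumes "finite A" "p \<in> chunk j A" "q \<in> A" "q \<notin> chunk j A"
 shows "d j p <= d j q"
proof (rule ccontr)
 assume "\<not> d j p <= d j q"
 then have "lt j q p" by (simp add: lt_def)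
 then have "rk (lt j) A q < rk (lt j) A p" by (rule lt.rk_less[OF assms(1,3)])
 moreover have "rk (lt j) A p < n" "\<not> rk (lt j) A q < n" using assms(2-4) by (simp_all add: chunk_def)
 ultimately show False by simp
qed

lemma top_unique:
 assumes A: "finite A" "n <= card A"
 obtains p where "p \<in> A" "rk (lt j) A p = n - 1" "top j A = d j p"
proof -
 note b = lt.rk_bij[OF A(1), of j]
 have "n - 1 \<in> {..<card A}" using A(2) n by simp
 then have "n - 1 \<in> rk (lt j) A ` A" unfolding bij_betw_imp_surj_on[OF b] .
 then obtain p where p: "p \<in> A" "rk (lt j) A p = n - 1" by (metis imageE)
 have "{q. q \<in> A \<and> rk (lt j) A q = n - 1} = {p}"
 proof (intro equalityI subsetI)
  fix q assume q: "q \<in> {q. q \<in> A \<and> rk (lt j) A q = n - 1}"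
  have "q = p" by (rule inj_onD[OF bij_betw_imp_inj_on[OF b]]) (use p q in simp_all)
  then show "q \<in> {p}" by simp
 qed (use p in simp)
 then have "top j A = d j p" by (simp add: top_def)
 then show ?thesis using that p by blast
qed

lemma top_eq:
 assumes A: "finite A" "n <= card A"
 obtains p where "p \<in> chunk j A" "top j A = d j p"
proof -
 obtain p where p: "p \<in> A" "rk (lt j) A p = n - 1" "top j A = d j p" by (rule top_unique[OF A])
 have "p \<in> chunk j A" using p n by (simp add: chunk_def)
 then show ?thesis using that p(3) by blast
qed

lemma top_ge:
 assumes A: "finite A" "n <= card A" and q: "q \<in> chunk j A"
 shows "d j q <= top j A"
proof (rule ccontr)
 assume less: "\<not> d j q <= top j A"
 obtain p where p: "p \<in> A" "rk (lt j) A p = n - 1" "top j A = d j p" by (rule top_unique[OF A])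
 have "lt j p q" using less p(3) by (simp add: lt_def)
 then have "rk (lt j) A p < rk (lt j) A q" by (rule lt.rk_less[OF A(1) p(1)])
 moreover have "rk (lt j) A q < n" using q by (simp add: chunk_def)
 ultimately show False using p(2) by linarith
qed

text \<open>The \<open>n\<close> nearest pieces minimise sum and maximum simultaneously among all
  sets of \<open>n\<close> pieces; the proof exchanges \<open>?C - B\<close> against
  \<open>B - ?C\<close>, which have equal size.\<close>

lemma val_le:
 assumes A: "finite A" and B: "B \<subseteq> A" "card B = n" and m: "!!p. p \<in> B ==> d j p <= m"
 shows "val j A <= sum (d j) B + n * m"
proof -
 have fB: "finite B" using finite_subset[OF B(1) A] .
 have nA: "n <= card A" using card_mono[OF A B(1)] B(2) by simp
 let ?C = "chunk j A"
 have fC: "finite ?C" using finite_subset[OF chunk_sub A] .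
 have cC: "card ?C = n" by (rule card_chunk[OF A nA])
 have eq: "card (?C - B) = card (B - ?C)"
  using card_Int_Diff[OF fC, of B] card_Int_Diff[OF fB, of ?C] cC B(2) by (simp add: Int_commute)
 have le: "d j p <= d j q" if "p \<in> ?C" "q \<in> B - ?C" for p q
  using chunk_le[OF A that(1), of q] that(2) B(1) by blast
 have "sum (d j) (?C - B) <= sum (d j) (B - ?C)"
 proof (cases "B - ?C = {}")
  case True
  then have "card (?C - B) = 0" using eq by (simp only: card.empty)
  then have "?C - B = {}" using fC by (simp only: card_eq_0_iff finite_Diff simp_thms)
  then show ?thesis by (simp only: sum.empty le0)
 next
  case False
  define s where "s = Min (d j ` (B - ?C))"
  have "s \<in> d j ` (B - ?C)" unfolding s_def using False fB by (intro Min_in) auto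
  then obtain q where q: "q \<in> B - ?C" "s = d j q" by blast
  have "sum (d j) (?C - B) <= of_nat (card (?C - B)) * s"
   by (rule sum_bounded_above) (use le q in auto)
  also have "\<dots> = of_nat (card (B - ?C)) * s" using eq by simp
  also have "\<dots> <= sum (d j) (B - ?C)"
   by (rule sum_bounded_below) (use fB in \<open>auto simp: s_def\<close>)
  finally show ?thesis .
 qed
 then have 1: "sum (d j) ?C <= sum (d j) B"
  using sum.Int_Diff[OF fC, of "d j" B] sum.Int_Diff[OF fB, of "d j" ?C] by (simp add: Int_commute)
 have "top j A <= m"
 proof -
  obtain p where p: "p \<in> ?C" "top j A = d j p" using top_eq[OF A nA] by blast
  show ?thesis
  proof (cases "p \<in> B")
   case True
   then show ?thesis using m p by simp
  next
   case False
   then have "card (?C - B) \<noteq> 0" using p fC by auto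
   then have "B - ?C \<noteq> {}" using eq by (metis card.empty)
   then obtain q where "q \<in> B - ?C" by blast
   then show ?thesis using le[OF p(1), of q] m[of q] p(2) by simp
  qed
 qed
 then show ?thesis using 1 unfolding val_def by (intro add_mono mult_left_mono) auto
qed

lemma tk_sub: "t < H ==> tk t \<subseteq> pool t (sel t)"
 using tk[of t] chunk_sub by auto

lemma clu_clu: "t < H ==> clu (clu t) = clu t"
 using clu_old[of t] clu_le[of t] by (cases "clu t = t") auto

lemma clu_less_H: "t < H ==> clu t < H"
 using clu_le[of t] by simp

lemma card_tk_le: "t < H ==> card (tk t) <= n"
proof -
 have base: "card (tk t) <= n" if t: "t < H" "clu t = t" for t
 proof (cases "n <= card (pool t (sel t))")
  case True
  then show ?thesis using tk[OF t(1)] t(2) card_chunk[OF finite_pool[OF selD(1)[OF t(1)]]] by simp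
 next
  case False
  have "card (chunk (sel t) (pool t (sel t))) <= card (pool t (sel t))"
   by (rule card_mono[OF finite_pool[OF selD(1)[OF t(1)]] chunk_sub])
  then show ?thesis using tk[OF t(1)] t(2) False by simp
 qed
 assume t: "t < H"
 show "card (tk t) <= n"
 proof (cases "clu t = t")
  case False
  let ?k = "clu t"
  have k: "?k < H" "clu ?k = ?k" using t clu_less_H clu_clu by auto
  have "tk t \<subseteq> tk ?k" using tk[OF t] False by auto
  moreover have "finite (tk ?k)"
   by (rule finite_subset[OF tk_sub[OF k(1)] finite_pool[OF selD(1)[OF k(1)]]])
  ultimately have "card (tk t) <= card (tk ?k)" by (intro card_mono)
  then show ?thesis using base[OF k] by simp
 qed (use base t in blast)
qed

lemma finite_tk: "t < H ==> finite (tk t)"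
 by (rule finite_subset[OF tk_sub finite_pool[OF selD(1)]])

text \<open>Of the \<open>N * rd j\<close> pieces each earlier unit of the client has claimed at
  most \<open>n\<close>, hence at most \<open>N\<close>; while a unit is still missing, at least
  \<open>N\<close> remain.\<close>

lemma card_pool: "t < H ==> j < nc ==> cnt t j < rd j ==> N <= card (pool t j)"
proof -
 assume t: "t < H" and j: "j < nc" "cnt t j < rd j"
 let ?T = "{t'. t' < t \<and> sel t' = j}"
 have "card (\<Union>(tk ` ?T)) <= (\<Sum>t'\<in>?T. card (tk t'))" by (rule card_UN_le) simp
 also have "\<dots> <= (\<Sum>t'\<in>?T. n)" using card_tk_le t by (intro sum_mono) simp
 also have "\<dots> = card ?T * n" by simp
 also have "\<dots> <= cnt t j * N" unfolding cnt_def using n by simp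
 finally have u: "card (\<Union>(tk ` ?T)) <= cnt t j * N" .
 have pe: "pool t j = P j - \<Union>(tk ` ?T)" by (auto simp: pool_def)
 have "card (P j) - card (\<Union>(tk ` ?T)) <= card (pool t j)"
  unfolding pe by (rule diff_card_le_card_Diff) (use t finite_tk in auto)
 moreover have "(cnt t j + 1) * N <= rd j * N" using j by (intro mult_right_mono) auto
 ultimately show ?thesis using cardP[OF j(1)] u by (simp add: mult.commute)
qed

lemma pool_big: "t < H ==> n <= card (pool t (sel t))"
 using card_pool[of t "sel t"] selD[of t] n by auto

lemma card_cluster: "k < H ==> clu k = k ==> card (tk k) = n"
 using tk[of k] card_chunk[OF finite_pool[OF selD(1)] pool_big] by simp

lemma cluster_disjoint_less: "k < k' ==> k' < H ==> clu k = k ==> clu k' = k' ==> tk k \<inter> tk k' = {}"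
 using clu_new[of k' k] tk[of k'] by (simp add: Int_commute)

lemma cluster_disjoint: "k < H ==> k' < H ==> clu k = k ==> clu k' = k' ==> k \<noteq> k' ==> tk k \<inter> tk k' = {}"
 using cluster_disjoint_less[of k k'] cluster_disjoint_less[of k' k] by (cases k k' rule: linorder_cases) (auto simp: Int_commute)

lemma tk_eq: "t < H ==> tk t = pool t (sel t) \<inter> tk (clu t)"
 using tk[of t] chunk_sub[of "sel t" "pool t (sel t)"] by (cases "clu t = t") auto

lemma sib_tk_less: "t < t' ==> t' < H ==> sel t = sel t' ==> tk t \<inter> tk t' = {}"
 using tk_sub[of t'] by (auto simp: pool_def)

lemma sib_tk: "t < H ==> t' < H ==> t \<noteq> t' ==> sel t = sel t' ==> tk t \<inter> tk t' = {}"
 using sib_tk_less[of t t'] sib_tk_less[of t' t] by (cases t t' rule: linorder_cases) (auto simp: Int_commute)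

lemma meets_cluster: "t < H ==> chunk (sel t) (pool t (sel t)) \<inter> tk (clu t) \<noteq> {}"
proof -
 assume t: "t < H"
 show ?thesis
 proof (cases "clu t = t")
  case True
  have "card (tk t) = n" by (rule card_cluster[OF t True])
  then have "tk t \<noteq> {}" using n by auto
  then show ?thesis using tk[OF t] True by simp
 next
  case False
  then show ?thesis using clu_old[OF t] clu_le[OF t] by simp
 qed
qed

text \<open>A piece in the later chunk and in the common cluster was already in the pool at the
  earlier time. The earlier unit would have claimed it, because it takes the whole intersection of
  its pool with the cluster.\<close>

lemma sib_clu_less: "t < t' ==> t' < H ==> sel t = sel t' ==> clu t \<noteq> clu t'"
proof
 assume a: "t < t'" "t' < H" "sel t = sel t'" "clu t = clu t'"
 obtain p where p: "p \<in> chunk (sel t') (pool t' (sel t'))" "p \<in> tk (clu t')"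
  using meets_cluster[OF a(2)] by auto
 have p': "p \<in> pool t' (sel t')" using p(1) chunk_sub by blast
 then have "p \<in> pool t (sel t)" using pool_antimono[of t t' "sel t'"] a by auto
 then have "p \<in> tk t" using tk_eq[of t] p(2) a by auto
 then show False using p' a by (auto simp: pool_def)
qed

lemma sib_clu: "t < H ==> t' < H ==> t \<noteq> t' ==> sel t = sel t' ==> clu t \<noteq> clu t'"
 using sib_clu_less[of t t'] sib_clu_less[of t' t] by (cases t t' rule: linorder_cases) auto

lemma fl_sub: "t < H ==> fl t \<subseteq> free t"
 by (subst fl, assumption) (rule Collect_restrict)

lemma freeD: "p \<in> free t ==> p \<in> P (sel t)"
 "p \<in> free t ==> t' < H ==> sel t' = sel t ==> p \<notin> tk t'"
 "p \<in> free t ==> t' < t ==> sel t' = sel t ==> p \<notin> fl t'"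
 unfolding free_def by blast+

lemma finite_free: "t < H ==> finite (free t)"
 using finP[OF selD(1)[of t]] by (simp add: free_def)

lemma finite_fl: "t < H ==> finite (fl t)"
 by (rule finite_subset[OF fl_sub finite_free])

lemma tk_fl_disjoint: "t < H ==> t' < H ==> sel t' = sel t ==> tk t' \<inter> fl t = {}"
proof (rule ccontr)
 assume a: "t < H" "t' < H" "sel t' = sel t" and "tk t' \<inter> fl t \<noteq> {}"
 then obtain p where p: "p \<in> tk t'" "p \<in> fl t" by blast
 have "p \<in> free t" by (rule subsetD[OF fl_sub[OF a(1)] p(2)])
 then show False using freeD(2)[of p t t'] a p by blast
qed

lemma fl_rk: "t < H ==> fl t = {p \<in> free t. rk (<) (free t) p < N - card (tk t)}"
 by (subst fl, assumption) (intro Collect_cong conj_cong refl, linarith)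

lemma card_fl_tk_le: "t < H ==> card (fl t) + card (tk t) <= N"
proof -
 assume t: "t < H"
 let ?m = "N - card (tk t)"
 have e: "fl t = {p \<in> free t. rk (<) (free t) p < ?m}" by (rule fl_rk[OF t])
 have "card (fl t) <= ?m"
 proof (cases "?m <= card (free t)")
  case True
  then show ?thesis unfolding e using nat_lt.card_rk_less[OF finite_free[OF t] True] by simp
 next
  case False
  have "card (fl t) <= card (free t)" by (rule card_mono[OF finite_free[OF t] fl_sub[OF t]])
  then show ?thesis using False by simp
 qed
 then show ?thesis using card_tk_le[OF t] n by simp
qed

text \<open>Counting again: all other units of the client hold at most \<open>N\<close> pieces each
  out of \<open>N * rd j\<close>, so enough free pieces are left to fill unit \<open>t\<close> up to
  exactly \<open>N\<close>.\<close>

lemma card_nbr: "t < H ==> card (nbr t) = N"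
proof -
 assume t: "t < H"
 let ?j = "sel t"
 let ?S = "{t'. t' < H \<and> sel t' = ?j}" and ?E = "{t'. t' < t \<and> sel t' = ?j}"
 have jn: "?j < nc" by (rule selD(1)[OF t])
 have E: "?E \<subseteq> ?S - {t}" using t by auto
 have tS: "t \<in> ?S" using t by simp
 have finS: "finite ?S" by simp
 have cS: "card ?S = rd ?j" using cnt_H[OF jn] by (simp add: cnt_def)
 have fe: "free t = P ?j - ((\<Union>(tk ` ?S)) \<union> (\<Union>(fl ` ?E)))" by (auto simp: free_def)
 have "card ((\<Union>(tk ` ?S)) \<union> (\<Union>(fl ` ?E))) <= card (\<Union>(tk ` ?S)) + card (\<Union>(fl ` ?E))" by (rule card_Un_le)
 also have "\<dots> <= (\<Sum>t'\<in>?S. card (tk t')) + (\<Sum>t'\<in>?E. card (fl t'))"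
  by (intro add_mono card_UN_le) auto
 also have "(\<Sum>t'\<in>?S. card (tk t')) = card (tk t) + (\<Sum>t'\<in>?S - {t}. card (tk t'))"
  by (rule sum.remove[OF finS tS])
 also have "(\<Sum>t'\<in>?E. card (fl t')) <= (\<Sum>t'\<in>?S - {t}. card (fl t'))" by (rule sum_mono2[OF _ E]) auto
 also have "card (tk t) + (\<Sum>t'\<in>?S - {t}. card (tk t')) + (\<Sum>t'\<in>?S - {t}. card (fl t')) =
   card (tk t) + (\<Sum>t'\<in>?S - {t}. card (fl t') + card (tk t'))" by (simp add: sum.distrib)
 also have "\<dots> <= card (tk t) + (\<Sum>t'\<in>?S - {t}. N)"
  using card_fl_tk_le by (intro add_left_mono sum_mono) auto
 also have "\<dots> = card (tk t) + (rd ?j - 1) * N" using cS tS by simp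
 finally have u: "card ((\<Union>(tk ` ?S)) \<union> (\<Union>(fl ` ?E))) <= card (tk t) + (rd ?j - 1) * N" by simp
 have "card (P ?j) - card ((\<Union>(tk ` ?S)) \<union> (\<Union>(fl ` ?E))) <= card (free t)"
  unfolding fe by (rule diff_card_le_card_Diff) (use t finite_tk finite_fl in auto)
 moreover have "card (P ?j) = N + (rd ?j - 1) * N"
  using cardP[OF jn] selD(2)[OF t] by (cases "rd ?j") auto
 ultimately have m: "N - card (tk t) <= card (free t)" using u by simp
 have e: "fl t = {p \<in> free t. rk (<) (free t) p < N - card (tk t)}" by (rule fl_rk[OF t])
 have "card (fl t) = N - card (tk t)"
  unfolding e by (rule nat_lt.card_rk_less[OF finite_free[OF t] m])
 moreover have "card (nbr t) = card (tk t) + card (fl t)" unfolding nbr_def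
  by (rule card_Un_disjoint[OF finite_tk[OF t] finite_fl[OF t] tk_fl_disjoint[OF t t refl]])
 ultimately show ?thesis using card_tk_le[OF t] n by simp
qed

lemma nbr_pool: "t < H ==> nbr t \<subseteq> pool t (sel t)"
proof
 fix p assume t: "t < H" and "p \<in> nbr t"
 then consider "p \<in> tk t" | "p \<in> free t" unfolding nbr_def using subsetD[OF fl_sub[OF t]] by blast
 then show "p \<in> pool t (sel t)"
 proof cases
  case 1 then show ?thesis using tk_sub[OF t] by auto
 next
  case 2
  have "\<not> (\<exists>t'<t. sel t' = sel t \<and> p \<in> tk t')" using freeD(2)[OF 2] t less_trans by blast
  then show ?thesis using freeD(1)[OF 2] by (simp add: pool_def)
 qed
qed

lemma nbr_P: "t < H ==> nbr t \<subseteq> P (sel t)"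
 using nbr_pool[of t] by (auto simp: pool_def)

lemma finite_nbr: "t < H ==> finite (nbr t)"
 using finite_tk finite_fl by (simp add: nbr_def)

lemma sib_fl_less: "t < t' ==> t' < H ==> sel t = sel t' ==> fl t \<inter> fl t' = {}"
proof (rule ccontr)
 assume a: "t < t'" "t' < H" "sel t = sel t'" and "fl t \<inter> fl t' \<noteq> {}"
 then obtain p where p: "p \<in> fl t" "p \<in> fl t'" by blast
 have "p \<in> free t'" by (rule subsetD[OF fl_sub[OF a(2)] p(2)])
 then show False using freeD(3)[of p t' t] a p by blast
qed

lemma sib_nbr: "t < H ==> t' < H ==> t \<noteq> t' ==> sel t = sel t' ==> nbr t \<inter> nbr t' = {}"
proof -
 assume a: "t < H" "t' < H" "t \<noteq> t'" "sel t = sel t'"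
 have "fl t \<inter> fl t' = {}"
  using sib_fl_less[of t t'] sib_fl_less[of t' t] a by (cases t t' rule: linorder_cases) (auto simp: Int_commute)
 moreover have "tk t \<inter> tk t' = {}" by (rule sib_tk[OF a])
 moreover have "tk t \<inter> fl t' = {}" "tk t' \<inter> fl t = {}"
  using tk_fl_disjoint[of t' t] tk_fl_disjoint[of t t'] a by auto
 ultimately show ?thesis unfolding nbr_def by blast
qed

text \<open>A unit may also be served by pieces of its cluster that are not its own; there it must
  not collide with another unit of its client. A common piece would lie either in two different
  clusters, or among the free pieces although unit \<open>t\<close> was bound to claim it.\<close>

lemma cluster_sib_nbr: "t < H ==> t' < H ==> t \<noteq> t' ==> sel t = sel t' ==> tk (clu t) \<inter> nbr t' = {}"
proof (rule ccontr)
 assume a: "t < H" "t' < H" "t \<noteq> t'" "sel t = sel t'" and "tk (clu t) \<inter> nbr t' \<noteq> {}"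
 then obtain p where p: "p \<in> tk (clu t)" "p \<in> nbr t'" by auto
 then consider "p \<in> tk t'" | "p \<in> free t'" unfolding nbr_def using subsetD[OF fl_sub[OF a(2)]] by blast
 then show False
 proof cases
  case 1
  then have "p \<in> tk (clu t')" using tk_eq[OF a(2)] by auto
  moreover have "tk (clu t) \<inter> tk (clu t') = {}"
   using clu_less_H clu_clu sib_clu a by (intro cluster_disjoint) auto
  ultimately show False using p by auto
 next
  case 2
  have "\<not> (\<exists>s<t. sel s = sel t \<and> p \<in> tk s)" using freeD(2)[OF 2] a less_trans by metis
  then have "p \<in> pool t (sel t)" using freeD(1)[OF 2] a(4) by (simp add: pool_def)
  then have "p \<in> tk t" using tk_eq[OF a(1)] p(1) by blast
  then show False using freeD(2)[OF 2 a(1)] a(4) by blast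
 qed
qed

text \<open>The units divide the pieces of their client exactly, as the sets are disjoint and the
  cardinalities match. Therefore bounds per unit by the average of its own pieces add up to the
  right total, and the fill-up pieces may be chosen by number regardless of distance.\<close>

lemma sum_nbr:
 fixes f :: "nat => real"
 assumes j: "j < nc"
 shows "(\<Sum>t | t < H \<and> sel t = j. sum f (nbr t)) = sum f (P j)"
proof -
 let ?S = "{t. t < H \<and> sel t = j}"
 have "sum f (\<Union>(nbr ` ?S)) = (\<Sum>t\<in>?S. sum f (nbr t))"
  by (rule sum.UNION_disjoint) (use finite_nbr sib_nbr in auto)
 moreover have "\<Union>(nbr ` ?S) = P j"
 proof (rule card_subset_eq[OF finP[OF j]])
  show "\<Union>(nbr ` ?S) \<subseteq> P j" using nbr_P by auto
  have "card (\<Union>(nbr ` ?S)) = (\<Sum>t\<in>?S. card (nbr t))"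
   by (rule card_UN_disjoint) (use finite_nbr sib_nbr in auto)
  also have "\<dots> = (\<Sum>t\<in>?S. N)" using card_nbr by (intro sum.cong) auto
  also have "\<dots> = card (P j)" using cnt_H[OF j] cardP[OF j] by (simp add: cnt_def)
  finally show "card (\<Union>(nbr ` ?S)) = card (P j)" .
 qed
 ultimately show ?thesis by simp
qed

text \<open>Provides what \<open>expected_connection\<close> assumes. The cluster was founded no
  later than \<open>t\<close>; at that time its founder had the least \<open>val\<close>, the client
  of \<open>t\<close> was still a candidate, and the set \<open>Cs\<close> was contained in its
  pool. The common piece \<open>p\<close> will bound the distance between the two clients.\<close>

lemma demand_geometry:
 assumes t: "t < H"
 obtains Cs cm km p where "Cs \<subseteq> nbr t" "card Cs = n" "!!q. q \<in> Cs ==> d (sel t) q <= cm"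
  "!!q. q \<in> nbr t - Cs ==> cm <= d (sel t) q" "!!q. q \<in> tk (clu t) ==> d (sel (clu t)) q <= km"
  "sum (d (sel (clu t))) (tk (clu t)) + n * km <= sum (d (sel t)) Cs + n * cm"
  "p \<in> Cs" "p \<in> tk (clu t)"
proof -
 let ?j = "sel t" and ?k = "clu t"
 let ?Cs = "chunk ?j (nbr t)"
 have k: "?k < H" "clu ?k = ?k" "?k <= t" using clu_less_H[OF t] clu_clu[OF t] clu_le[OF t] by auto
 have fin: "finite (nbr t)" by (rule finite_nbr[OF t])
 have big: "n <= card (nbr t)" using card_nbr[OF t] n by simp
 have cC: "card ?Cs = n" by (rule card_chunk[OF fin big])
 have finp: "finite (pool ?k (sel ?k))" "n <= card (pool ?k (sel ?k))"
  using finite_pool[OF selD(1)[OF k(1)]] pool_big[OF k(1)] by auto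
 have tkk: "tk ?k = chunk (sel ?k) (pool ?k (sel ?k))" using tk[OF k(1)] k(2) by simp
 obtain p where p: "p \<in> chunk ?j (pool t ?j)" "p \<in> tk ?k" using meets_cluster[OF t] by auto
 have "p \<in> tk t" using tk_eq[OF t] p chunk_sub[of ?j "pool t ?j"] by auto
 then have pn: "p \<in> nbr t" by (simp add: nbr_def)
 \<comment> \<open>Passing from the pool to a subset cannot raise a rank, so the piece in which the
   unit meets its cluster is also among the \<open>n\<close> nearest of
   \<open>nbr t\<close>.\<close>
 have "rk (lt ?j) (nbr t) p <= rk (lt ?j) (pool t ?j) p" unfolding rk_def
  by (rule card_mono) (use finite_pool[OF selD(1)[OF t]] nbr_pool[OF t] in auto)
 then have pC: "p \<in> ?Cs" using p(1) pn by (simp add: chunk_def)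
 have "val (sel ?k) (pool ?k (sel ?k)) <= val ?j (pool ?k ?j)"
  using selD(3)[OF k(1) selD(1)[OF t]] cnt_mono[OF k(3), of ?j] selD(2)[OF t] by simp
 also have "\<dots> <= sum (d ?j) ?Cs + n * top ?j (nbr t)"
 proof (rule val_le)
  show "finite (pool ?k ?j)" by (rule finite_pool[OF selD(1)[OF t]])
  show "?Cs \<subseteq> pool ?k ?j"
   using chunk_sub[of ?j "nbr t"] nbr_pool[OF t] pool_antimono[OF k(3), of ?j] by auto
 qed (use cC top_ge[OF fin big] in auto)
 finally have ord: "sum (d (sel ?k)) (tk ?k) + n * top (sel ?k) (pool ?k (sel ?k)) <=
   sum (d ?j) ?Cs + n * top ?j (nbr t)" unfolding val_def tkk .
 show ?thesis
 proof (rule that[of ?Cs "top ?j (nbr t)" "top (sel ?k) (pool ?k (sel ?k))" p])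
  show "top ?j (nbr t) <= d ?j q" if "q \<in> nbr t - ?Cs" for q
  proof -
   obtain s where "s \<in> ?Cs" "top ?j (nbr t) = d ?j s" using top_eq[OF fin big] by blast
   then show ?thesis using chunk_le[OF fin, of s ?j q] that by auto
  qed
  show "d (sel ?k) q <= top (sel ?k) (pool ?k (sel ?k))" if "q \<in> tk ?k" for q
   using that top_ge[OF finp] unfolding tkk by blast
 qed (use chunk_sub cC top_ge[OF fin big] ord pC p in auto)
qed

end

section \<open>Numerical constants\<close>

lemma exp_ge_taylor: "0 <= x ==> (\<Sum>k<m. x ^ k / fact k) <= exp (x :: real)"
proof -
 assume x: "0 <= x"
 have "(\<Sum>k<m. x ^ k /\<^sub>R fact k) <= (\<Sum>k. x ^ k /\<^sub>R fact k)"
  using x by (intro sum_le_suminf summable_exp_generic) auto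
 then show ?thesis unfolding exp_def by (simp add: divide_inverse mult.commute)
qed

text \<open>\<open>15749 / 10000\<close> is a round number slightly below \<open>gG / gQ\<close>.
  The two bounds add up to 0.57491, while \<open>gG / gQ - 1\<close> is 0.57492...\<close>

lemma exp_neg_bounds: "exp (- 1 :: real) <= 36788 / 100000" "exp (- (15749 / 10000) :: real) <= 20703 / 100000"
proof -
 have "exp 1 \<ge> (\<Sum>k<10. 1 ^ k / fact k :: real)" by (rule exp_ge_taylor) simp
 then have "exp 1 \<ge> (100000 / 36788 :: real)" by (simp add: lessThan_nat_numeral fact_numeral)
 then show "exp (- 1 :: real) <= 36788 / 100000" by (simp add: exp_minus field_simps)
 have "exp (15749 / 10000) \<ge> (\<Sum>k<13. (15749 / 10000) ^ k / fact k :: real)" by (rule exp_ge_taylor) simp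
 moreover have "(\<Sum>k<13. (15749 / 10000) ^ k / fact k :: real) \<ge> 100000 / 20703"
  by (simp add: lessThan_nat_numeral fact_numeral power_divide)
 ultimately have "exp (15749 / 10000) \<ge> (100000 / 20703 :: real)" by linarith
 then show "exp (- (15749 / 10000) :: real) <= 20703 / 100000" by (simp add: exp_minus field_simps)
qed

lemma pow_le_exp: "0 < n ==> (1 - 1 / real n) ^ m <= exp (- (real m / real n))"
proof -
 assume n: "0 < n"
 have "1 - 1 / real n <= exp (- 1 / real n)" using exp_ge_add_one_self[of "- 1 / real n"] by simp
 then have "(1 - 1 / real n) ^ m <= exp (- 1 / real n) ^ m" using n by (intro power_mono) auto
 also have "\<dots> = exp (- (real m / real n))" by (simp add: exp_of_nat_mult[symmetric])
 finally show ?thesis .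
qed

text \<open>The ratio \<open>gG / gQ\<close> equals 51607 / 32768 = 1.57492..., just above the
  critical value. What is left up to 1.575 absorbs the relative loss \<open>2 / gD\<close> and the
  additive loss of about \<open>gD / gQ\<close> of the multiplicative weights. \<open>gQ\<close> is
  a power of two because positions are drawn bit by bit.\<close>

definition gG :: nat where "gG = 51607 * 2 ^ 20"
definition gS :: nat where "gS = 35"
definition gQ :: nat where "gQ = 2 ^ gS"
definition gD :: nat where "gD = 2 ^ 16"

lemma gamma: "0 < P ==> real (gG * P) / real (gQ * P) = 51607 / 32768"
 by (simp add: gG_def gQ_def gS_def)

lemma rounding_numeric:
 assumes "0 < P"
 shows "(1 - 1 / real (gQ * P)) ^ (gQ * P) + (1 - 1 / real (gQ * P)) ^ (gG * P) <=
  real (gG * P) / real (gQ * P) - 1"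
proof -
 have q: "0 < gQ * P" using assms by (simp add: gQ_def)
 have "(1 - 1 / real (gQ * P)) ^ (gQ * P) <= exp (- (real (gQ * P) / real (gQ * P)))" by (rule pow_le_exp[OF q])
 also have "real (gQ * P) / real (gQ * P) = 1" using q by simp
 finally have 1: "(1 - 1 / real (gQ * P)) ^ (gQ * P) <= 36788 / 100000" using exp_neg_bounds(1) by simp
 have "(1 - 1 / real (gQ * P)) ^ (gG * P) <= exp (- (real (gG * P) / real (gQ * P)))" by (rule pow_le_exp[OF q])
 also have "\<dots> <= exp (- (15749 / 10000))" unfolding gamma[OF assms] by simp
 finally have 2: "(1 - 1 / real (gQ * P)) ^ (gG * P) <= 20703 / 100000" using exp_neg_bounds(2) by simp
 show ?thesis using 1 2 unfolding gamma[OF assms] by simp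
qed

lemma ratio_numeric:
 assumes "0 < P" "nc <= P"
 shows "(real gD * real nc + (1 + 2 / real gD) * real (gG * P) + 1) / real (gQ * P) <= 1.575"
proof -
 have P: "1 <= real P" "real nc <= real P" using assms by auto
 have "real gD * real nc + (1 + 2 / real gD) * real (gG * P) + 1 <=
   real gD * real P + (1 + 2 / real gD) * (real gG * real P) + 1 * real P"
  using P by (intro add_mono mult_left_mono) auto
 also have "\<dots> = (real gD + (1 + 2 / real gD) * real gG + 1) * real P" by (simp add: algebra_simps)
 also have "\<dots> <= (1.575 * real gQ) * real P"
  using P by (intro mult_right_mono) (auto simp: gD_def gG_def gQ_def gS_def)
 finally show ?thesis using assms by (simp add: gQ_def field_simps)
qed

section \<open>Derived expressions and the deterministic semantics\<close>

abbreviation ePlus (infixl "\<oplus>" 65) where "a \<oplus> b \<equiv> Op PLUS a b"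
abbreviation eMinus (infixl "\<ominus>" 65) where "a \<ominus> b \<equiv> Op MINUS a b"
abbreviation eTimes (infixl "\<otimes>" 70) where "a \<otimes> b \<equiv> Op TIMES a b"
abbreviation eDiv (infixl "\<oslash>" 70) where "a \<oslash> b \<equiv> Op DIVIDE a b"
abbreviation "eSum \<equiv> Iter ISum"
abbreviation "eProd \<equiv> Iter IProd"
abbreviation "eFind \<equiv> Iter IFind"

text \<open>Tests are built from subtractions from 1, so their syntactic bound is 1 no matter what
  they read. In \<open>eMin\<close> it is the second argument that supplies the bound.\<close>

definition "eLe a b = Num 1 \<ominus> (a \<ominus> b)"
definition "eLt a b = Num 1 \<ominus> (Num 1 \<ominus> (b \<ominus> a))"
definition "eEq a b = eLe a b \<otimes> eLe b a"
definition "eNot a = Num 1 \<ominus> a"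
definition "eOr a b = eLt (Num 0) (a \<oplus> b)"
definition "eMin a c = c \<ominus> (c \<ominus> a)"
definition "eEx x m c = eLt (Num 0) (eSum x m c)"
definition "eAll x m c = eNot (eSum x m (eNot c))"
definition "eIte c a b = c \<otimes> a \<oplus> eNot c \<otimes> b"

lemmas sugar_defs = eLe_def eLt_def eEq_def eNot_def eOr_def eMin_def eEx_def eAll_def eIte_def

lemma eval_eLe [simp]: "eval (eLe a b) \<sigma> \<rho> = of_bool (eval a \<sigma> \<rho> <= eval b \<sigma> \<rho>)"
 by (auto simp: eLe_def)

lemma eval_eLt [simp]: "eval (eLt a b) \<sigma> \<rho> = of_bool (eval a \<sigma> \<rho> < eval b \<sigma> \<rho>)"
 by (auto simp: eLt_def)

lemma eval_eEq [simp]: "eval (eEq a b) \<sigma> \<rho> = of_bool (eval a \<sigma> \<rho> = eval b \<sigma> \<rho>)"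
 by (auto simp: eEq_def)

lemma eval_eNot [simp]: "eval (eNot a) \<sigma> \<rho> = of_bool (eval a \<sigma> \<rho> = 0)"
 by (auto simp: eNot_def)

lemma eval_eOr [simp]: "eval (eOr a b) \<sigma> \<rho> = of_bool (eval a \<sigma> \<rho> \<noteq> 0 \<or> eval b \<sigma> \<rho> \<noteq> 0)"
 by (auto simp: eOr_def)

lemma eval_eMin [simp]: "eval (eMin a b) \<sigma> \<rho> = min (eval a \<sigma> \<rho>) (eval b \<sigma> \<rho>)"
 by (auto simp: eMin_def)

lemma eval_eEx [simp]:
 "eval (eEx x m c) \<sigma> \<rho> = of_bool (\<exists>v<eval m \<sigma> \<rho>. eval c \<sigma> (\<rho>(x := v)) \<noteq> 0)"
 by (auto simp: eEx_def)

lemma eval_eAll [simp]: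
 "eval (eAll x m c) \<sigma> \<rho> = of_bool (\<forall>v<eval m \<sigma> \<rho>. eval c \<sigma> (\<rho>(x := v)) \<noteq> 0)"
 by (auto simp: eAll_def)

lemma eval_eIte [simp]:
 "eval c \<sigma> \<rho> <= 1 ==> eval (eIte c a b) \<sigma> \<rho> = (if eval c \<sigma> \<rho> \<noteq> 0 then eval a \<sigma> \<rho> else eval b \<sigma> \<rho>)"
 by (cases "eval c \<sigma> \<rho>") (auto simp: eIte_def)

lemma of_bool_mult_nat [simp]: "of_bool P * of_bool Q = (of_bool (P \<and> Q) :: nat)"
 by simp

definition find_idx :: "nat => (nat => bool) => nat" where
 "find_idx m Q = (if \<exists>v<m. Q v then LEAST v. Q v else m)"

lemma eval_eFind [simp]:
 "eval (eFind x m c) \<sigma> \<rho> = find_idx (eval m \<sigma> \<rho>) (%v. eval c \<sigma> (\<rho>(x := v)) \<noteq> 0)"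
 by (simp only: eval.simps it_val_IFind find_idx_def)

declare it_val_IFind [simp del]

lemma find_idx_found: "v < m ==> Q v ==> find_idx m Q < m \<and> Q (find_idx m Q)"
proof -
 assume v: "v < m" "Q v"
 have "(LEAST v. Q v) <= v" using v by (intro Least_le)
 moreover have "Q (LEAST v. Q v)" using v by (rule_tac LeastI)
 ultimately show ?thesis using v by (auto simp: find_idx_def)
qed

lemma find_idx_none: "(!!v. v < m ==> \<not> Q v) ==> find_idx m Q = m"
 by (auto simp: find_idx_def)

lemma find_idx_cases: "find_idx m Q < m \<and> Q (find_idx m Q) \<or> find_idx m Q = m \<and> (\<forall>v<m. \<not> Q v)"
 using find_idx_found[of _ m Q] find_idx_none[of m Q] by blast

lemma find_idx_cong: "m = m' ==> (!!v. v < m' ==> Q v = Q' v) ==> find_idx m Q = find_idx m' Q'"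
proof -
 assume m: "m = m'" and Q: "!!v. v < m' ==> Q v = Q' v"
 show ?thesis
 proof (cases "\<exists>v<m'. Q v")
  case True
  then obtain v where v: "v < m'" "Q v" by blast
  have a: "find_idx m' Q < m'" "Q (find_idx m' Q)" "find_idx m' Q' < m'" "Q' (find_idx m' Q')"
   using find_idx_found[of v m' Q] find_idx_found[of v m' Q'] v Q by auto
  have "find_idx m' Q = (LEAST v. Q v)" "find_idx m' Q' = (LEAST v. Q' v)"
   using v Q by (auto simp: find_idx_def)
  then have "find_idx m' Q <= find_idx m' Q'" "find_idx m' Q' <= find_idx m' Q"
   using a Q Least_le[of Q] Least_le[of Q'] by metis+
  then show ?thesis using m by simp
 next
  case False
  then show ?thesis using m Q by (auto simp: find_idx_def)
 qed
qed

primrec det_loop :: "(nat => st => st) => nat => nat => st => st" where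
 "det_loop f 0 i \<sigma> = \<sigma>"
| "det_loop f (Suc k) i \<sigma> = det_loop f k (Suc i) (f i \<sigma>)"

text \<open>Agrees with \<open>exec\<close> on commands without random draws
  (\<open>exec_det\<close>). Only one stage of the algorithm draws bits; the stages before and after
  it are treated by equations between states.\<close>

primrec dexec :: "cmd => env => st => st" where
 "dexec (Wr a i e) \<rho> \<sigma> = wr \<sigma> a (eval i \<sigma> \<rho>) (eval e \<sigma> \<rho>)"
| "dexec (Rnd a i k) \<rho> \<sigma> = \<sigma>"
| "dexec (Seq p q) \<rho> \<sigma> = dexec q \<rho> (dexec p \<rho> \<sigma>)"
| "dexec (For x n p) \<rho> \<sigma> = det_loop (%v. dexec p (\<rho>(x := v))) (eval n \<sigma> \<rho>) 0 \<sigma>"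

primrec det :: "cmd => bool" where
 "det (Wr a i e) \<longleftrightarrow> True"
| "det (Rnd a i k) \<longleftrightarrow> False"
| "det (Seq p q) \<longleftrightarrow> det p \<and> det q"
| "det (For x n p) \<longleftrightarrow> det p"

lemma exec_det: "det c ==> exec c \<rho> \<sigma> = return_pmf (dexec c \<rho> \<sigma>)"
proof (induction c arbitrary: \<rho> \<sigma>)
 case (For x n p)
 have "for_loop (%v. exec p (\<rho>(x := v))) k i \<sigma> = return_pmf (det_loop (%v. dexec p (\<rho>(x := v))) k i \<sigma>)" for k i \<sigma>
  using For by (induction k arbitrary: i \<sigma>) (auto simp: bind_return_pmf)
 then show ?case by simp
qed (auto simp: bind_return_pmf)

lemma det_loop_Suc: "det_loop f (Suc k) i \<sigma> = f (i + k) (det_loop f k i \<sigma>)"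
 by (induction k arbitrary: i \<sigma>) auto

lemma det_loop_inv:
 assumes "Q 0 \<sigma>" "!!v \<sigma>. v < k ==> Q v \<sigma> ==> Q (Suc v) (f v \<sigma>)"
 shows "Q k (det_loop f k 0 \<sigma>)"
proof -
 have "m <= k ==> Q m (det_loop f m 0 \<sigma>)" for m
 proof (induction m)
  case (Suc m)
  then show ?case using assms(2)[of m] unfolding det_loop_Suc by simp
 qed (simp add: assms(1))
 then show ?thesis by simp
qed

lemma dexec_unwritten: "\<not> writes c a ==> dexec c \<rho> \<sigma> a = \<sigma> a"
proof (induction c arbitrary: \<rho> \<sigma>)
 case (For x n p)
 show ?case unfolding dexec.simps
  by (rule det_loop_inv[where Q = "%_ \<tau>. \<tau> a = \<sigma> a"]) (use For in auto)
qed (auto simp: wr_def)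

primrec reads :: "nat => exp => bool" where
 "reads a (Num k) \<longleftrightarrow> False"
| "reads a (Var x) \<longleftrightarrow> False"
| "reads a (Rd a' e) \<longleftrightarrow> a = a' \<or> reads a e"
| "reads a (Op p e1 e2) \<longleftrightarrow> reads a e1 \<or> reads a e2"
| "reads a (Iter k x n e) \<longleftrightarrow> reads a n \<or> reads a e"

primrec uses :: "nat => exp => bool" where
 "uses x (Num k) \<longleftrightarrow> False"
| "uses x (Var y) \<longleftrightarrow> x = y"
| "uses x (Rd a' e) \<longleftrightarrow> uses x e"
| "uses x (Op p e1 e2) \<longleftrightarrow> uses x e1 \<or> uses x e2"
| "uses x (Iter k y n e) \<longleftrightarrow> uses x n \<or> uses x e"

lemma eval_noread: "\<not> reads a e ==> eval e (\<sigma>(a := g)) \<rho> = eval e \<sigma> \<rho>"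
 by (induction e arbitrary: \<rho>) auto

lemma eval_nouse: "\<not> uses x e ==> eval e \<sigma> (\<rho>(x := v)) = eval e \<sigma> \<rho>"
proof (induction e arbitrary: \<rho>)
 case (Iter k y n e)
 have "(\<rho>(x := v))(y := w) = (if x = y then \<rho>(y := w) else (\<rho>(y := w))(x := v))" for w by auto
 then have "eval e \<sigma> ((\<rho>(x := v))(y := w)) = eval e \<sigma> (\<rho>(y := w))" for w
  using Iter.IH(2) Iter.prems by (cases "x = y") (auto simp del: fun_upd_apply)
 then show ?case using Iter.IH(1) Iter.prems by (simp del: fun_upd_apply)
qed auto

text \<open>As the right-hand side does not read the array being filled, the loop amounts to a
  simultaneous assignment to a slice. \<open>dexec_table\<close> is the analogue for two nested
  loops and a matrix with rows of length \<open>M\<close>.\<close>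

lemma dexec_fill:
 assumes "\<not> reads a e" "\<not> reads a off" "\<not> uses x off"
 shows "dexec (For x m (Wr a (off \<oplus> Var x) e)) \<rho> \<sigma> = \<sigma>(a := (%k.
  if eval off \<sigma> \<rho> <= k \<and> k < eval off \<sigma> \<rho> + eval m \<sigma> \<rho> then eval e \<sigma> (\<rho>(x := k - eval off \<sigma> \<rho>)) else \<sigma> a k))"
proof -
 let ?o = "eval off \<sigma> \<rho>"
 have "det_loop (%v. dexec (Wr a (off \<oplus> Var x) e) (\<rho>(x := v))) j 0 \<sigma> = \<sigma>(a := (%k.
  if ?o <= k \<and> k < ?o + j then eval e \<sigma> (\<rho>(x := k - ?o)) else \<sigma> a k))" for j
 proof (induction j)
  case (Suc j)
  let ?g = "%k. if ?o <= k \<and> k < ?o + j then eval e \<sigma> (\<rho>(x := k - ?o)) else \<sigma> a k"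
  have o: "eval off (\<sigma>(a := ?g)) (\<rho>(x := j)) = ?o"
   unfolding eval_noread[OF assms(2)] eval_nouse[OF assms(3)] ..
  have "det_loop (%v. dexec (Wr a (off \<oplus> Var x) e) (\<rho>(x := v))) (Suc j) 0 \<sigma> =
    wr (\<sigma>(a := ?g)) a (?o + j) (eval e \<sigma> (\<rho>(x := j)))"
   unfolding det_loop_Suc Suc dexec.simps by (simp add: o eval_noread[OF assms(1)] del: fun_upd_apply) simp
  also have "\<dots> = \<sigma>(a := (%k. if ?o <= k \<and> k < ?o + Suc j then eval e \<sigma> (\<rho>(x := k - ?o)) else \<sigma> a k))"
   by (auto simp: wr_def fun_eq_iff)
  finally show ?case .
 qed (auto simp: fun_eq_iff)
 then show ?thesis by simp
qed

lemma dexec_fill0: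
 assumes "\<not> reads a e"
 shows "dexec (For x m (Wr a (Var x) e)) \<rho> \<sigma> = \<sigma>(a := (%k.
  if k < eval m \<sigma> \<rho> then eval e \<sigma> (\<rho>(x := k)) else \<sigma> a k))"
proof -
 have "det_loop (%v. dexec (Wr a (Var x) e) (\<rho>(x := v))) j 0 \<sigma> = \<sigma>(a := (%k.
  if k < j then eval e \<sigma> (\<rho>(x := k)) else \<sigma> a k))" for j
 proof (induction j)
  case (Suc j)
  show ?case unfolding det_loop_Suc Suc
   by (simp add: wr_def eval_noread[OF assms(1)]) (auto simp: fun_eq_iff)
 qed (auto simp: fun_eq_iff)
 then show ?thesis by simp
qed

lemma dexec_table:
 assumes ne: "\<not> reads a e" and nm: "\<not> reads a m" "\<not> uses x m" "\<not> uses y m" and xy: "x \<noteq> y"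
  and M: "M = eval m \<sigma> \<rho>"
 shows "dexec (For x l (For y m (Wr a (Var x \<otimes> m \<oplus> Var y) e))) \<rho> \<sigma> = \<sigma>(a := (%k.
  if k < eval l \<sigma> \<rho> * M then eval e \<sigma> (\<rho>(x := k div M, y := k mod M)) else \<sigma> a k))"
proof -
 have "det_loop (%v. dexec (For y m (Wr a (Var x \<otimes> m \<oplus> Var y) e)) (\<rho>(x := v))) j 0 \<sigma> = \<sigma>(a := (%k.
  if k < j * M then eval e \<sigma> (\<rho>(x := k div M, y := k mod M)) else \<sigma> a k))" for j
 proof (induction j)
  case (Suc j)
  let ?\<tau> = "\<sigma>(a := (%k. if k < j * M then eval e \<sigma> (\<rho>(x := k div M, y := k mod M)) else \<sigma> a k))"
  have m: "eval m ?\<tau> (\<rho>(x := j)) = M" unfolding eval_noread[OF nm(1)] eval_nouse[OF nm(2)] M ..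
  have o: "eval (Var x \<otimes> m) ?\<tau> (\<rho>(x := j)) = j * M" using m by (simp del: fun_upd_apply) simp
  have "dexec (For y m (Wr a (Var x \<otimes> m \<oplus> Var y) e)) (\<rho>(x := j)) ?\<tau> = ?\<tau>(a := (%k.
    if j * M <= k \<and> k < j * M + M then eval e ?\<tau> (\<rho>(x := j, y := k - j * M)) else ?\<tau> a k))"
   using dexec_fill[of a e "Var x \<otimes> m" y m "\<rho>(x := j)" ?\<tau>] ne nm xy unfolding o m
   by (simp del: fun_upd_apply dexec.simps eval.simps)
  also have "\<dots> = \<sigma>(a := (%k. if k < Suc j * M then eval e \<sigma> (\<rho>(x := k div M, y := k mod M)) else \<sigma> a k))"
  proof -
   have "(if j * M <= k \<and> k < j * M + M then eval e ?\<tau> (\<rho>(x := j, y := k - j * M)) else ?\<tau> a k) =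
    (if k < Suc j * M then eval e \<sigma> (\<rho>(x := k div M, y := k mod M)) else \<sigma> a k)" for k
   proof (cases "j * M <= k \<and> k < j * M + M")
    case True
    then have "k div M = j" "k mod M = k - j * M"
    proof -
     show d: "k div M = j" by (rule div_nat_eqI) (use True in \<open>simp_all add: mult.commute\<close>)
     show "k mod M = k - j * M" using minus_div_mult_eq_mod[of k M] d by simp
    qed
    then show ?thesis using True eval_noread[OF ne] by (simp add: add.commute del: fun_upd_apply)
   next
    case False
    then show ?thesis by auto
   qed
   then show ?thesis by (simp del: fun_upd_apply)
  qed
  finally show ?case unfolding det_loop_Suc Suc by simp
 qed (auto simp: fun_eq_iff)
 then show ?thesis by simp
qed

section \<open>The text of the program\<close>

definition "eMod a b = a \<ominus> (a \<oslash> b) \<otimes> b"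

lemma eval_eMod [simp]: "eval (eMod a b) \<sigma> \<rho> = eval a \<sigma> \<rho> mod eval b \<sigma> \<rho>"
 by (simp add: eMod_def minus_div_mult_eq_mod)

abbreviation "vT \<equiv> Var 0"
abbreviation "vT' \<equiv> Var 1"
abbreviation "vJ \<equiv> Var 2"
abbreviation "vJ' \<equiv> Var 3"
abbreviation "vP \<equiv> Var 4"
abbreviation "vP' \<equiv> Var 5"
abbreviation "vV \<equiv> Var 6"
abbreviation "vV' \<equiv> Var 7"
abbreviation "vI \<equiv> Var 8"
abbreviation "vK \<equiv> Var 9"

abbreviation seq (infixr ";;" 60) where "p ;; q \<equiv> Seq p q"

text \<open>Use of the arrays: 1 dimensions; 2 common denominator; 3 scaled costs; 4, 5 the exponent
  and the power of two \<open>P\<close>; 6 weights; 7, 8 weight and cost of all stars; 9 to 11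
  chosen star, its members, its multiplicity; 12, 13 the accumulated solution; 14, 15 its
  deterministic part; 16 to 18 residual demands, facilities, connections; 19 number of units; 20
  pieces of each client; 21 to 23 pools, ranks, values; 24, 25 client and cluster of a unit; 27, 28
  free and fill-up pieces; 29 random numbers; 30 open pieces; 31 piece used by a unit; 33 cluster of
  a piece; 32, 34 the two parts of the output; 35 a buffer for rows of 36; 36 claimed pieces; 37
  output.\<close>

abbreviation "eNS \<equiv> Rd 1 (Num 0)"
abbreviation "eNC \<equiv> Rd 1 (Num 1)"
abbreviation "eNN \<equiv> Num gG \<otimes> Rd 5 (Num 0)"
abbreviation "enn \<equiv> Num gQ \<otimes> Rd 5 (Num 0)"
abbreviation "ePP \<equiv> eNS \<otimes> (Num 2 \<otimes> eNN)"
abbreviation "eHH \<equiv> Rd 19 (Num 0)"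
abbreviation "eR j \<equiv> Rd 0 (Num 2 \<oplus> Num 2 \<otimes> (eNS \<oplus> eNS \<otimes> eNC) \<oplus> j)"
abbreviation "eD i j \<equiv> Rd 3 (eNS \<oplus> (i \<otimes> eNC \<oplus> j))"
abbreviation "eSite p \<equiv> p \<oslash> (Num 2 \<otimes> eNN)"
abbreviation "eDP j p \<equiv> eD (eSite p) j"

text \<open>The product of all denominators is used instead of their least common multiple; its bit
  length is still at most the sum of theirs.\<close>

definition "c_den = Wr 2 (Num 0) (eProd 6 (eNS \<oplus> eNS \<otimes> eNC) (Rd 0 (Num 3 \<oplus> Num 2 \<otimes> vV)))"
definition "c_cost = For 6 (eNS \<oplus> eNS \<otimes> eNC)
 (Wr 3 vV (Rd 0 (Num 2 \<oplus> Num 2 \<otimes> vV) \<otimes> (Rd 2 (Num 0) \<oslash> Rd 0 (Num 3 \<oplus> Num 2 \<otimes> vV))))"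
definition "c_exp = Wr 4 (Num 0) (eFind 6 eNC (eLe eNC (eProd 7 vV (Num 2))))"
text \<open>The power lies between \<open>nc\<close> and \<open>2 * nc + 2\<close> by the choice of
  the exponent, so the minimum keeps its value. The purpose of the minimum is that the syntactic
  check accepts array 5 as small although the first argument is a product loop.\<close>

definition "c_pow = Wr 5 (Num 0) (eMin (eProd 6 (Rd 4 (Num 0)) (Num 2)) (Num 2 \<otimes> eNC \<oplus> Num 2))"

definition "e_rbar j = eProd 3 eNC (eIte (eEq vJ' j) (Num 1) (eR vJ'))"
definition "e_act j = eLt (eSum 1 vT (Rd 10 (vT' \<otimes> eNC \<oplus> j) \<otimes> Rd 11 vT')) (eNN \<otimes> eR j)"
text \<open>Candidate \<open>v\<close> stands for site \<open>v div nc\<close> and client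
  \<open>v mod nc\<close>. Its star contains the active clients whose quotient of distance and
  weight is at most that of this client, compared by cross multiplication; weight 0 marks an
  inactive client.\<close>

definition "e_in v j = eLt (Num 0) (Rd 6 j) \<otimes>
 eLe (Rd 6 (eMod v eNC) \<otimes> eD (v \<oslash> eNC) j) (Rd 6 j \<otimes> eD (v \<oslash> eNC) (eMod v eNC))"

text \<open>The weights are recomputed from the history in arrays 10 and 11 in every round. These
  arrays occur only to the right of subtractions, so the bound of array 6 does not depend on them
  although they are in turn computed from the weights.\<close>

definition "c_w = For 2 eNC (Wr 6 vJ (e_act vJ \<otimes> (e_rbar vJ \<otimes>
 eProd 1 vT ((Num gD \<otimes> eR vJ \<ominus> Rd 10 (vT' \<otimes> eNC \<oplus> vJ) \<otimes> Rd 11 vT') \<otimes> e_rbar vJ))))"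
definition "c_cw = For 6 (eNS \<otimes> eNC) (Wr 7 vV (eSum 3 eNC (e_in vV vJ' \<otimes> Rd 6 vJ')))"
definition "c_cc = For 6 (eNS \<otimes> eNC)
 (Wr 8 vV (Rd 3 (vV \<oslash> eNC) \<oplus> eSum 3 eNC (e_in vV vJ' \<otimes> eD (vV \<oslash> eNC) vJ')))"
definition "c_bv = Wr 9 vT (eFind 6 (eNS \<otimes> eNC) (eLt (Num 0) (Rd 6 (eMod vV eNC)) \<otimes>
 eAll 7 (eNS \<otimes> eNC) (eOr (eEq (Rd 6 (eMod vV' eNC)) (Num 0)) (eLe (Rd 7 vV' \<otimes> Rd 8 vV) (Rd 7 vV \<otimes> Rd 8 vV')))))"
definition "c_a = For 2 eNC (Wr 10 (vT \<otimes> eNC \<oplus> vJ) (e_in (Rd 9 vT) vJ))"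
definition "c_th = Wr 11 vT (eR (eFind 2 eNC (Rd 10 (vT \<otimes> eNC \<oplus> vJ) \<otimes>
 eAll 3 eNC (eOr (eEq (Rd 10 (vT \<otimes> eNC \<oplus> vJ')) (Num 0)) (eLe (eR vJ) (eR vJ'))))))"
definition "c_mw = For 0 (eNC \<otimes> eNN) (c_w ;; c_cw ;; c_cc ;; c_bv ;; c_a ;; c_th)"

definition "c_y = For 8 eNS (Wr 12 vI (eSum 0 (eNC \<otimes> eNN) (eEq (Rd 9 vT \<oslash> eNC) vI \<otimes> Rd 11 vT)))"
definition "c_x = For 8 eNS (For 2 eNC (Wr 13 (vI \<otimes> eNC \<oplus> vJ)
 (eSum 0 (eNC \<otimes> eNN) (eEq (Rd 9 vT \<oslash> eNC) vI \<otimes> (Rd 10 (vT \<otimes> eNC \<oplus> vJ) \<otimes> Rd 11 vT)))))"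
definition "c_q = For 8 eNS (Wr 14 vI (Rd 12 vI \<oslash> eNN \<ominus> Num 1))"
definition "c_xh = For 8 eNS (For 2 eNC (Wr 15 (vI \<otimes> eNC \<oplus> vJ)
 (eMin (Rd 13 (vI \<otimes> eNC \<oplus> vJ) \<oslash> eNN) (Rd 14 vI))))"
text \<open>The cap \<open>2 * ns\<close> does not change the residual demand
  (\<open>prep_arith\<close>), but it makes array 16 small, and with it the number of units in array
  19, which is a loop count.\<close>

definition "c_r = For 2 eNC (Wr 16 vJ (eMin (eR vJ \<ominus> eSum 8 eNS (Rd 15 (vI \<otimes> eNC \<oplus> vJ))) (Num 2 \<otimes> eNS)))"
definition "c_yr = For 8 eNS (Wr 17 vI (Rd 12 vI \<ominus> eNN \<otimes> Rd 14 vI))"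
definition "c_xr = For 8 eNS (For 2 eNC (Wr 18 (vI \<otimes> eNC \<oplus> vJ)
 (eMin (Rd 13 (vI \<otimes> eNC \<oplus> vJ) \<ominus> eNN \<otimes> Rd 15 (vI \<otimes> eNC \<oplus> vJ))
  (eNN \<otimes> Rd 16 vJ \<ominus> eSum 9 vI (Rd 13 (vK \<otimes> eNC \<oplus> vJ) \<ominus> eNN \<otimes> Rd 15 (vK \<otimes> eNC \<oplus> vJ))))))"
definition "c_h = Wr 19 (Num 0) (eSum 2 eNC (Rd 16 vJ))"
text \<open>Piece \<open>p\<close> has number \<open>p mod (2 * N)\<close> at site
  \<open>p div (2 * N)\<close>. At each site a client owns an initial segment of the pieces, so
  different clients share pieces and the segments are nested.\<close>

definition "c_inp = For 2 eNC (For 4 ePP (Wr 20 (vJ \<otimes> ePP \<oplus> vP)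
 (eLt (eMod vP (Num 2 \<otimes> eNN)) (Rd 18 (eSite vP \<otimes> eNC \<oplus> vJ)))))"

abbreviation "e_tk t p \<equiv> Rd 36 (t \<otimes> ePP \<oplus> p)"
abbreviation "e_fl t p \<equiv> Rd 28 (t \<otimes> ePP \<oplus> p)"

definition "c_pool = For 2 eNC (For 4 ePP (Wr 21 (vJ \<otimes> ePP \<oplus> vP)
 (eLt (Num 0) (Rd 20 (vJ \<otimes> ePP \<oplus> vP)) \<otimes> eNot (eEx 1 vT (eEq (Rd 24 vT') vJ \<otimes> e_tk vT' vP)))))"
definition "c_rk = For 2 eNC (For 4 ePP (Wr 22 (vJ \<otimes> ePP \<oplus> vP)
 (eSum 5 ePP (Rd 21 (vJ \<otimes> ePP \<oplus> vP') \<otimes>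
  eOr (eLt (eDP vJ vP') (eDP vJ vP)) (eEq (eDP vJ vP') (eDP vJ vP) \<otimes> eLt vP' vP)))))"
definition "c_val = For 2 eNC (Wr 23 vJ
 (eSum 4 ePP (Rd 21 (vJ \<otimes> ePP \<oplus> vP) \<otimes> eLt (Rd 22 (vJ \<otimes> ePP \<oplus> vP)) enn \<otimes> eDP vJ vP) \<oplus>
  enn \<otimes> eSum 4 ePP (Rd 21 (vJ \<otimes> ePP \<oplus> vP) \<otimes> eEq (Rd 22 (vJ \<otimes> ePP \<oplus> vP)) (enn \<ominus> Num 1) \<otimes> eDP vJ vP)))"
definition "e_uns j = eLt (eSum 1 vT (eEq (Rd 24 vT') j)) (Rd 16 j)"
definition "c_sel = Wr 24 vT (eFind 2 eNC (e_uns vJ \<otimes>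
 eAll 3 eNC (eOr (eNot (e_uns vJ')) (eLe (Rd 23 vJ) (Rd 23 vJ')))))"
definition "c_clu = Wr 25 vT (eFind 1 vT (eEq (Rd 25 vT') vT' \<otimes>
 eEx 4 ePP (Rd 21 (Rd 24 vT \<otimes> ePP \<oplus> vP) \<otimes> eLt (Rd 22 (Rd 24 vT \<otimes> ePP \<oplus> vP)) enn \<otimes> e_tk vT' vP)))"
text \<open>A new row of array 36 depends on earlier rows of the same array. The buffer 35 contains
  test values, bounded by 1 whatever they read; this breaks the cycle in the bounds and keeps both
  loops simultaneous assignments.\<close>

definition "c_tmp = For 4 ePP (Wr 35 vP (eLt (Num 0) (Rd 21 (Rd 24 vT \<otimes> ePP \<oplus> vP) \<otimes>
 eIte (eEq (Rd 25 vT) vT) (eLt (Rd 22 (Rd 24 vT \<otimes> ePP \<oplus> vP)) enn) (e_tk (Rd 25 vT) vP))))"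
definition "c_tk = For 4 ePP (Wr 36 (vT \<otimes> ePP \<oplus> vP) (Rd 35 vP))"
definition "c_part = For 0 eHH (c_pool ;; c_rk ;; c_val ;; c_sel ;; c_clu ;; c_tmp ;; c_tk)"

definition "c_free = For 4 ePP (Wr 27 vP (eLt (Num 0) (Rd 20 (Rd 24 vT \<otimes> ePP \<oplus> vP)) \<otimes>
 (eNot (eEx 1 eHH (eEq (Rd 24 vT') (Rd 24 vT) \<otimes> e_tk vT' vP)) \<otimes>
  eNot (eEx 1 vT (eEq (Rd 24 vT') (Rd 24 vT) \<otimes> e_fl vT' vP)))))"
definition "c_fl = For 4 ePP (Wr 28 (vT \<otimes> ePP \<oplus> vP) (Rd 27 vP \<otimes>
 eLt (eSum 5 vP (Rd 27 vP') \<oplus> eSum 5 ePP (e_tk vT vP')) eNN))"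
definition "c_fill = For 0 eHH (c_free ;; c_fl)"

text \<open>One position per unit, for the case that it founded a cluster, followed by one per
  piece, for the case that it belongs to no cluster.\<close>

definition "c_rnd = For 10 (eHH \<oplus> ePP) (Rnd 29 (Var 10) (Num gS \<oplus> Rd 4 (Num 0)))"

definition "c_kp = For 4 ePP (Wr 33 vP (eFind 1 eHH (eEq (Rd 25 vT') vT' \<otimes> e_tk vT' vP)))"
definition "c_op = For 4 ePP (Wr 30 vP (eLt (eMod vP (Num 2 \<otimes> eNN)) (Rd 17 (eSite vP)) \<otimes>
 eIte (eLt (Rd 33 vP) eHH) (eEq (Rd 29 (Rd 33 vP)) (eSum 5 vP (e_tk (Rd 33 vP) vP')))
  (eEq (Rd 29 (eHH \<oplus> vP)) (Num 0))))"
definition "e_cand p = Rd 30 p \<otimes> eOr (e_tk vT p) (eOr (e_fl vT p) (e_tk (Rd 25 vT) p))"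
definition "c_cp = For 0 eHH (Wr 31 vT (eFind 4 ePP (e_cand vP \<otimes>
 eAll 5 ePP (eOr (eNot (e_cand vP')) (eLe (eDP (Rd 24 vT) vP) (eDP (Rd 24 vT) vP'))))))"
definition "c_outy = For 8 eNS (Wr 32 vI (Rd 14 vI \<oplus> eSum 4 ePP (eEq (eSite vP) vI \<otimes> Rd 30 vP)))"
definition "c_xo = For 8 eNS (For 2 eNC (Wr 34 (vI \<otimes> eNC \<oplus> vJ)
 (Rd 15 (vI \<otimes> eNC \<oplus> vJ) \<oplus> eSum 0 eHH (eEq (Rd 24 vT) vJ \<otimes> eEq (eSite (Rd 31 vT)) vI))))"
definition "c_outx = For 6 (eNS \<otimes> eNC) (Wr 37 (eNS \<oplus> vV) (Rd 34 vV))"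
definition "c_outy2 = For 6 eNS (Wr 37 vV (Rd 32 vV))"

definition "c_pre = c_den ;; c_cost ;; c_exp ;; c_pow ;; c_mw ;; c_y ;; c_x ;; c_q ;; c_xh ;; c_r ;; c_yr ;;
 c_xr ;; c_h ;; c_inp ;; c_part ;; c_fill"
definition "c_post = c_kp ;; c_op ;; c_cp ;; c_outy ;; c_xo ;; c_outx ;; c_outy2"
definition "prog = c_pre ;; c_rnd ;; c_post"

lemmas cmd_defs = c_den_def c_cost_def c_exp_def c_pow_def c_w_def c_cw_def c_cc_def c_bv_def c_a_def c_th_def
 c_mw_def c_y_def c_x_def c_q_def c_xh_def c_r_def c_yr_def c_xr_def c_h_def c_inp_def c_pool_def c_rk_def
 c_val_def c_sel_def c_clu_def c_tmp_def c_tk_def c_part_def c_free_def c_fl_def c_fill_def c_rnd_def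
 c_kp_def c_op_def c_cp_def c_outy_def c_xo_def c_outx_def c_outy2_def c_pre_def c_post_def prog_def
lemmas exp_defs = e_rbar_def e_act_def e_in_def e_uns_def e_cand_def eMod_def sugar_defs

text \<open>The arrays from which loop counts and numbers of random bits are computed, directly or,
  for the residual demands, through their sum.\<close>

definition small_arr :: "nat => bool" where
 "small_arr a \<longleftrightarrow> a = 1 \<or> a = 4 \<or> a = 5 \<or> a = 16 \<or> a = 19"

lemma wf_prog: "wf_cmd [] prog 30"
 by (simp add: cmd_defs exp_defs)

lemma good_prog: "good_cmd small_arr prog"
 by (simp add: cmd_defs exp_defs small_arr_def)

lemma low_prog: "low_cmd [] prog"
 by (simp add: cmd_defs exp_defs)

lemma writes_prog: "\<not> writes prog 1"
 by (simp add: cmd_defs)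

lemma det_pre: "det c_pre" and det_post: "det c_post"
 by (simp_all add: cmd_defs)

declare eval.simps(5) [simp del]

lemma eval_eSum [simp]: "eval (eSum x m e) \<sigma> \<rho> = (\<Sum>v<eval m \<sigma> \<rho>. eval e \<sigma> (\<rho>(x := v)))"
 by (simp add: eval.simps(5))

lemma eval_eProd [simp]: "eval (eProd x m e) \<sigma> \<rho> = (\<Prod>v<eval m \<sigma> \<rho>. eval e \<sigma> (\<rho>(x := v)))"
 by (simp add: eval.simps(5))

section \<open>The multiplicative weights phase as computed by the program\<close>

locale inst =
 fixes inp cst :: "nat => nat" and ns nc P :: nat
begin

abbreviation "N \<equiv> gG * P"
abbreviation "n \<equiv> gQ * P"
abbreviation "T \<equiv> nc * N"
abbreviation "PP \<equiv> ns * (2 * N)"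

definition "r j = inp (2 + 2 * (ns + ns * nc) + j)"
definition "d i j = cst (ns + (i * nc + j))"

definition base :: "st => bool" where
 "base \<sigma> \<longleftrightarrow> \<sigma> 0 = inp \<and> \<sigma> (Suc 0) 0 = ns \<and> \<sigma> (Suc 0) (Suc 0) = nc \<and> \<sigma> 3 = cst \<and> \<sigma> 5 0 = P"

lemma baseD:
 assumes "base \<sigma>"
 shows "\<sigma> 0 = inp" "\<sigma> (Suc 0) 0 = ns" "\<sigma> (Suc 0) (Suc 0) = nc" "\<sigma> 3 = cst" "\<sigma> 5 0 = P"
 using assms by (simp_all add: base_def)

lemma base_upd: "base \<sigma> ==> a \<notin> {0, 1, 3, 5} ==> base (\<sigma>(a := g))"
 by (simp add: base_def)

definition "rbar j = (\<Prod>j'<nc. if j' = j then 1 else r j')"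
definition "covf A th t j = (\<Sum>t'<t. A t' j * th t')" for A :: "nat => nat => nat" and th :: "nat => nat"
text \<open>The weights without fractions. With \<open>R\<close> the product of all demands,
  \<open>rbar j\<close> is \<open>R / r j\<close>, and each factor of the product equals
  \<open>gD * R\<close> times the factor of \<open>om\<close>. So \<open>wgt\<close> is
  \<open>om t j / r j\<close> times \<open>R * (gD * R) ^ t\<close>, a scale common to all active
  clients of the round.\<close>

definition "wgt A th t j = (if covf A th t j < N * r j
 then rbar j * (\<Prod>t'<t. (gD * r j - A t' j * th t') * rbar j) else 0)"
definition "inA W v j \<longleftrightarrow> 0 < W j \<and> W (v mod nc) * d (v div nc) j <= W j * d (v div nc) (v mod nc)"
 for W :: "nat => nat"
definition "cw W v = (\<Sum>j<nc. of_bool (inA W v j) * W j)"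
definition "cc W v = cst (v div nc) + (\<Sum>j<nc. of_bool (inA W v j) * d (v div nc) j)"
text \<open>Ratios of weight to cost are compared by cross multiplication. If no client is active
  the search returns \<open>ns * nc\<close>, whose site \<open>ns\<close> does not exist; the
  remaining idle rounds are thus counted at no site.\<close>

definition "best W = find_idx (ns * nc) (%v. 0 < W (v mod nc) \<and>
 (\<forall>v'<ns * nc. W (v' mod nc) = 0 \<or> cw W v' * cc W v <= cw W v * cc W v'))"
definition "thf A = r (find_idx nc (%j. A j \<noteq> 0 \<and> (\<forall>j'<nc. A j' = 0 \<or> r j <= r j')))" for A :: "nat => nat"

text \<open>Row \<open>t\<close> of the history is what the earlier rows prescribe. Since only rows
  up to \<open>t\<close> matter (\<open>mw_ok_cong\<close>), the property survives all later rounds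
  and serves as loop invariant.\<close>

definition "mw_ok A th bv t \<longleftrightarrow> bv t = best (wgt A th t) \<and>
 (\<forall>j<nc. A t j = of_bool (inA (wgt A th t) (bv t) j)) \<and> th t = thf (A t)"

lemma covf_cong: "(!!t'. t' < t ==> A t' j = A' t' j \<and> th t' = th' t') ==> covf A th t j = covf A' th' t j"
 unfolding covf_def by (intro sum.cong) auto

lemma wgt_cong: "(!!t'. t' < t ==> A t' j = A' t' j \<and> th t' = th' t') ==> wgt A th t j = wgt A' th' t j"
proof -
 assume *: "!!t'. t' < t ==> A t' j = A' t' j \<and> th t' = th' t'"
 have p: "(\<Prod>t'<t. (gD * r j - A t' j * th t') * rbar j) = (\<Prod>t'<t. (gD * r j - A' t' j * th' t') * rbar j)"
  using * by (intro prod.cong) auto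
 have c: "covf A th t j = covf A' th' t j" by (rule covf_cong) (rule *)
 show ?thesis unfolding wgt_def by (simp only: c p)
qed

lemma inA_cong: "(!!j. j < nc ==> W j = W' j) ==> j < nc ==> inA W v j = inA W' v j"
proof -
 assume W: "!!j. j < nc ==> W j = W' j" and j: "j < nc"
 have "v mod nc < nc" using j by (intro mod_less_divisor) auto
 then show ?thesis unfolding inA_def using W j by simp
qed

lemma cw_cong: "(!!j. j < nc ==> W j = W' j) ==> cw W v = cw W' v"
 unfolding cw_def by (intro sum.cong) (auto simp: inA_cong[of W W'])

lemma cc_cong: "(!!j. j < nc ==> W j = W' j) ==> cc W v = cc W' v"
 unfolding cc_def by (intro arg_cong2[where f = "(+)"] sum.cong) (auto simp: inA_cong[of W W'])

lemma best_cong: "(!!j. j < nc ==> W j = W' j) ==> best W = best W'"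
proof -
 assume W: "!!j. j < nc ==> W j = W' j"
 have m: "W (v mod nc) = W' (v mod nc)" if "v < ns * nc" for v
 proof (rule W)
  have "0 < nc" using that by (cases nc) auto
  then show "v mod nc < nc" by simp
 qed
 show ?thesis unfolding best_def
  by (intro find_idx_cong refl) (simp add: m cw_cong[of W W', OF W] cc_cong[of W W', OF W] cong: conj_cong imp_cong)
qed

lemma thf_cong: "(!!j. j < nc ==> A j = A' j) ==> thf A = thf A'"
 unfolding thf_def by (intro arg_cong[where f = r] find_idx_cong refl) auto

lemma mw_ok_cong:
 assumes "!!t' j. t' <= t ==> j < nc ==> A t' j = A' t' j" "!!t'. t' <= t ==> th t' = th' t'" "bv t = bv' t"
 shows "mw_ok A th bv t = mw_ok A' th' bv' t"
proof -
 have w: "wgt A th t j = wgt A' th' t j" if "j < nc" for j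
  using assms that by (intro wgt_cong) auto
 have "best (wgt A th t) = best (wgt A' th' t)" by (rule best_cong) (rule w)
 moreover have "inA (wgt A th t) v j = inA (wgt A' th' t) v j" if "j < nc" for v j
  by (rule inA_cong[OF w that])
 moreover have "thf (A t) = thf (A' t)" by (rule thf_cong) (simp add: assms)
 ultimately show ?thesis using assms unfolding mw_ok_def by auto
qed

lemma eval_rbar:
 assumes b: "base \<sigma>" and j: "\<not> uses 3 j"
 shows "eval (e_rbar j) \<sigma> \<rho> = rbar (eval j \<sigma> \<rho>)"
 by (simp add: e_rbar_def baseD[OF b] rbar_def r_def eval_nouse[OF j] cong: if_cong)

lemma eval_e_in:
 assumes b: "base \<sigma>"
 shows "eval (e_in v j) \<sigma> \<rho> = of_bool (inA (\<sigma> 6) (eval v \<sigma> \<rho>) (eval j \<sigma> \<rho>))"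
 by (simp add: e_in_def baseD[OF b] inA_def d_def)

lemma c_w_eff:
 assumes b: "base \<sigma>"
 shows "dexec c_w \<rho> \<sigma> = \<sigma>(6 := (%j. if j < nc then wgt (%t j. \<sigma> 10 (t * nc + j)) (\<sigma> 11) (\<rho> 0) j else \<sigma> 6 j))"
 unfolding c_w_def
 by (subst dexec_fill0, simp add: exp_defs)
  (rule arg_cong[where f = "%g. \<sigma>(6 := g)"], rule ext,
   simp add: baseD[OF b] eval_rbar[OF b] e_act_def wgt_def covf_def r_def)

lemma c_cw_eff:
 assumes b: "base \<sigma>"
 shows "dexec c_cw \<rho> \<sigma> = \<sigma>(7 := (%v. if v < ns * nc then cw (\<sigma> 6) v else \<sigma> 7 v))"
 unfolding c_cw_def
 by (subst dexec_fill0, simp add: exp_defs) (simp add: baseD[OF b] eval_e_in[OF b] cw_def cong: if_cong)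

lemma c_cc_eff:
 assumes b: "base \<sigma>"
 shows "dexec c_cc \<rho> \<sigma> = \<sigma>(8 := (%v. if v < ns * nc then cc (\<sigma> 6) v else \<sigma> 8 v))"
 unfolding c_cc_def
 by (subst dexec_fill0, simp add: exp_defs) (simp add: baseD[OF b] eval_e_in[OF b] cc_def d_def cong: if_cong)

lemma c_bv_eff:
 assumes b: "base \<sigma>" and c: "!!v. v < ns * nc ==> \<sigma> 7 v = cw (\<sigma> 6) v \<and> \<sigma> 8 v = cc (\<sigma> 6) v"
 shows "dexec c_bv \<rho> \<sigma> = \<sigma>(9 := (\<sigma> 9)(\<rho> 0 := best (\<sigma> 6)))"
proof -
 have "find_idx (ns * nc) (%v. 0 < \<sigma> 6 (v mod nc) \<and>
   (\<forall>v'<ns * nc. \<sigma> 6 (v' mod nc) = 0 \<or> \<sigma> 7 v' * \<sigma> 8 v <= \<sigma> 7 v * \<sigma> 8 v')) = best (\<sigma> 6)"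
  unfolding best_def by (intro find_idx_cong refl) (simp add: c cong: imp_cong)
 then show ?thesis by (simp add: c_bv_def wr_def baseD[OF b])
qed

lemma c_a_eff:
 assumes b: "base \<sigma>"
 shows "dexec c_a \<rho> \<sigma> = \<sigma>(10 := (%k. if \<rho> 0 * nc <= k \<and> k < \<rho> 0 * nc + nc
  then of_bool (inA (\<sigma> 6) (\<sigma> 9 (\<rho> 0)) (k - \<rho> 0 * nc)) else \<sigma> 10 k))"
 unfolding c_a_def
 by (subst dexec_fill, simp add: exp_defs, simp, simp) (simp add: baseD[OF b] eval_e_in[OF b] cong: if_cong)

lemma c_th_eff:
 assumes b: "base \<sigma>"
 shows "dexec c_th \<rho> \<sigma> = \<sigma>(11 := (\<sigma> 11)(\<rho> 0 := thf (%j. \<sigma> 10 (\<rho> 0 * nc + j))))"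
proof -
 have "find_idx nc (%j. 0 < \<sigma> 10 (\<rho> 0 * nc + j) \<and>
   (\<forall>j'<nc. \<sigma> 10 (\<rho> 0 * nc + j') = 0 \<or> r j <= r j')) =
  find_idx nc (%j. \<sigma> 10 (\<rho> 0 * nc + j) \<noteq> 0 \<and> (\<forall>j'<nc. \<sigma> 10 (\<rho> 0 * nc + j') = 0 \<or> r j <= r j'))"
  by (intro find_idx_cong) auto
 then show ?thesis by (simp add: c_th_def wr_def baseD[OF b] thf_def r_def)
qed

abbreviation "rowA \<sigma> \<equiv> (%t j. \<sigma> 10 (t * nc + j))" for \<sigma> :: st

lemma mw_loop:
 assumes b: "base \<sigma>"
 shows "base (dexec c_mw \<rho> \<sigma>) \<and> (\<forall>t<T. mw_ok (rowA (dexec c_mw \<rho> \<sigma>)) (dexec c_mw \<rho> \<sigma> 11) (dexec c_mw \<rho> \<sigma> 9) t)"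
proof -
 let ?body = "c_w ;; c_cw ;; c_cc ;; c_bv ;; c_a ;; c_th"
 have "eval (eNC \<otimes> eNN) \<sigma> \<rho> = T" using b by (simp add: base_def)
 then have eq: "dexec c_mw \<rho> \<sigma> = det_loop (%v. dexec ?body (\<rho>(0 := v))) T 0 \<sigma>"
  unfolding c_mw_def dexec.simps(4) by (simp only:)
 show ?thesis unfolding eq
 proof (rule det_loop_inv[where Q = "%m \<tau>. base \<tau> \<and> (\<forall>t<m. mw_ok (rowA \<tau>) (\<tau> 11) (\<tau> 9) t)"])
  show "base \<sigma> \<and> (\<forall>t<0. mw_ok (rowA \<sigma>) (\<sigma> 11) (\<sigma> 9) t)" using b by simp
  fix t \<tau> assume "base \<tau> \<and> (\<forall>t'<t. mw_ok (rowA \<tau>) (\<tau> 11) (\<tau> 9) t')"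
  then have b0: "base \<tau>" and ok: "!!t'. t' < t ==> mw_ok (rowA \<tau>) (\<tau> 11) (\<tau> 9) t'" by auto
  let ?\<rho> = "\<rho>(0 := t)"
  define W where "W j = (if j < nc then wgt (rowA \<tau>) (\<tau> 11) t j else \<tau> 6 j)" for j
  define \<tau>1 where "\<tau>1 = \<tau>(6 := W)"
  have 1: "dexec c_w ?\<rho> \<tau> = \<tau>1" unfolding c_w_eff[OF b0] \<tau>1_def W_def fun_upd_same ..
  have b1: "base \<tau>1" unfolding \<tau>1_def by (rule base_upd[OF b0]) simp
  define \<tau>2 where "\<tau>2 = \<tau>1(7 := (%v. if v < ns * nc then cw W v else \<tau>1 7 v))"
  have 2: "dexec c_cw ?\<rho> \<tau>1 = \<tau>2" unfolding c_cw_eff[OF b1] \<tau>2_def by (simp add: \<tau>1_def cong: if_cong)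
  have b2: "base \<tau>2" unfolding \<tau>2_def by (rule base_upd[OF b1]) simp
  define \<tau>3 where "\<tau>3 = \<tau>2(8 := (%v. if v < ns * nc then cc W v else \<tau>2 8 v))"
  have 3: "dexec c_cc ?\<rho> \<tau>2 = \<tau>3" unfolding c_cc_eff[OF b2] \<tau>3_def by (simp add: \<tau>1_def \<tau>2_def cong: if_cong)
  have b3: "base \<tau>3" unfolding \<tau>3_def by (rule base_upd[OF b2]) simp
  define \<tau>4 where "\<tau>4 = \<tau>3(9 := (\<tau> 9)(t := best W))"
  have 4: "dexec c_bv ?\<rho> \<tau>3 = \<tau>4"
   by (subst c_bv_eff[OF b3]) (simp_all add: \<tau>1_def \<tau>2_def \<tau>3_def \<tau>4_def)
  have b4: "base \<tau>4" unfolding \<tau>4_def by (rule base_upd[OF b3]) simp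
  define \<tau>5 where "\<tau>5 = \<tau>4(10 := (%k. if t * nc <= k \<and> k < t * nc + nc
   then of_bool (inA W (best W) (k - t * nc)) else \<tau> 10 k))"
  have 5: "dexec c_a ?\<rho> \<tau>4 = \<tau>5"
   unfolding c_a_eff[OF b4] by (simp add: \<tau>1_def \<tau>2_def \<tau>3_def \<tau>4_def \<tau>5_def cong: if_cong)
  have b5: "base \<tau>5" unfolding \<tau>5_def by (rule base_upd[OF b4]) simp
  define \<tau>6 where "\<tau>6 = \<tau>5(11 := (\<tau> 11)(t := thf (%j. \<tau>5 10 (t * nc + j))))"
  have 6: "dexec c_th ?\<rho> \<tau>5 = \<tau>6"
   unfolding c_th_eff[OF b5] by (simp add: \<tau>1_def \<tau>2_def \<tau>3_def \<tau>4_def \<tau>5_def \<tau>6_def)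
  have b6: "base \<tau>6" unfolding \<tau>6_def by (rule base_upd[OF b5]) simp
  have body: "dexec ?body ?\<rho> \<tau> = \<tau>6" by (simp only: dexec.simps(3) 1 2 3 4 5 6)
  have A: "rowA \<tau>6 t' j = (if t' = t then of_bool (inA W (best W) j) else rowA \<tau> t' j)"
   if "t' <= t" "j < nc" for t' j
  proof (cases "t' = t")
   case True
   then show ?thesis using that by (simp add: \<tau>6_def \<tau>5_def)
  next
   case False
   then have "Suc t' * nc <= t * nc" using that by (intro mult_right_mono) auto
   then have "t' * nc + j < t * nc" using that by simp
   then show ?thesis using False by (simp add: \<tau>6_def \<tau>5_def)
  qed
  have th: "\<tau>6 11 t' = \<tau> 11 t'" if "t' < t" for t' using that by (simp add: \<tau>6_def)
  have bv: "\<tau>6 9 t' = (if t' = t then best W else \<tau> 9 t')" for t'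
   by (simp add: \<tau>6_def \<tau>5_def \<tau>4_def)
  have old: "mw_ok (rowA \<tau>6) (\<tau>6 11) (\<tau>6 9) t'" if "t' < t" for t'
   using ok[OF that] that A th bv by (subst mw_ok_cong[where A' = "rowA \<tau>" and th' = "\<tau> 11" and bv' = "\<tau> 9"]) auto
  have Ww: "W j = wgt (rowA \<tau>6) (\<tau>6 11) t j" if "j < nc" for j
  proof -
   have "wgt (rowA \<tau>) (\<tau> 11) t j = wgt (rowA \<tau>6) (\<tau>6 11) t j"
    by (rule wgt_cong) (use A th that in auto)
   then show ?thesis using that by (simp add: W_def)
  qed
  have new: "mw_ok (rowA \<tau>6) (\<tau>6 11) (\<tau>6 9) t"
   unfolding mw_ok_def
  proof (intro conjI allI impI)
   show "\<tau>6 9 t = best (wgt (rowA \<tau>6) (\<tau>6 11) t)" unfolding bv using best_cong[OF Ww] by simp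
   show "rowA \<tau>6 t j = of_bool (inA (wgt (rowA \<tau>6) (\<tau>6 11) t) (\<tau>6 9 t) j)" if "j < nc" for j
    using A[of t j] that inA_cong[OF Ww that] bv by simp
   have "(%j. \<tau>6 10 (t * nc + j)) = (%j. \<tau>5 10 (t * nc + j))" by (simp add: \<tau>6_def)
   then show "\<tau>6 11 t = thf (rowA \<tau>6 t)" by (simp add: \<tau>6_def)
  qed
  show "base (dexec ?body ?\<rho> \<tau>) \<and>
   (\<forall>t'<Suc t. mw_ok (rowA (dexec ?body ?\<rho> \<tau>)) (dexec ?body ?\<rho> \<tau> 11) (dexec ?body ?\<rho> \<tau> 9) t')"
   unfolding body using b6 old new less_Suc_eq by metis
 qed
qed

end

section \<open>From the integer weights in memory to the analysis of the method\<close>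

lemma sum_of_bool_index:
 fixes g :: "nat => 'a :: semiring_1"
 shows "(\<Sum>i<m. of_bool (k = i) * g i) = (if k < m then g k else 0)"
proof -
 have "(\<Sum>i<m. of_bool (k = i) * g i) = (\<Sum>i<m. if i = k then g i else 0)" by (intro sum.cong) auto
 then show ?thesis by simp
qed

context inst
begin

definition "Yf bv th i = (\<Sum>t<T. of_bool (bv t div nc = i) * th t)" for bv th :: "nat => nat"
definition "Xf A bv th i j = (\<Sum>t<T. of_bool (bv t div nc = i) * (A t j * th t))"
 for A :: "nat => nat => nat" and bv th :: "nat => nat"

lemma rbar_mult: "j < nc ==> r j * rbar j = (\<Prod>j'<nc. r j')"
proof -
 assume j: "j < nc"
 have "(\<Prod>j'<nc. r j') = r j * (\<Prod>j'\<in>{..<nc} - {j}. r j')" using j by (intro prod.remove) auto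
 moreover have "rbar j = 1 * (\<Prod>j'\<in>{..<nc} - {j}. if j' = j then 1 else r j')"
  unfolding rbar_def using j by (subst prod.remove[of _ j]) auto
 moreover have "(\<Prod>j'\<in>{..<nc} - {j}. if j' = j then 1 else r j') = (\<Prod>j'\<in>{..<nc} - {j}. r j')"
  by (intro prod.cong) auto
 ultimately show ?thesis by simp
qed

text \<open>The program compares integers, the analysis uses real weights; the common factor
  \<open>Z t\<close> cancels in all comparisons. The fractional solution and \<open>L\<close> occur
  in the analysis only, so the result may be applied to every feasible fractional solution.\<close>

lemma mw_result:
 fixes A :: "nat => nat => nat" and th bv :: "nat => nat" and L :: real
 assumes ok: "!!t. t < T ==> mw_ok A th bv t" and r: "!!j. j < nc ==> 0 < r j"
  and ns: "0 < nc ==> 0 < ns" and L: "0 < L"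
  and lp: "!!i. i < ns ==> 0 <= y i" "!!i j. i < ns ==> j < nc ==> 0 <= x i j \<and> x i j <= y i"
   "!!j. j < nc ==> real (r j) <= (\<Sum>i<ns. x i j)"
   "(\<Sum>i<ns. real (cst i) * y i) + (\<Sum>i<ns. \<Sum>j<nc. real (d i j) * x i j) <= L"
 shows "!!j. j < nc ==> N * r j <= (\<Sum>i<ns. Xf A bv th i j)"
  and "(\<Sum>i<ns. real (cst i) * real (Yf bv th i)) + (\<Sum>i<ns. \<Sum>j<nc. real (d i j) * real (Xf A bv th i j)) <=
   L * (real gD * real nc + (1 + 2 / real gD) * real N + 1)"
proof -
 define A' where "A' t j \<longleftrightarrow> t < T \<and> j < nc \<and> A t j \<noteq> 0" for t j
 have A01: "A t j = of_bool (A' t j)" if "t < T" "j < nc" for t j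
  using ok[OF that(1)] that by (auto simp: mw_ok_def A'_def)
 interpret mw: mult_weights nc N gD r A' th
  by unfold_locales (use r in \<open>auto simp: gD_def\<close>)
 let ?W = "wgt A th"
 have cov: "covf A th t j = mw.cov t j" if "t <= T" "j < nc" for t j
  unfolding covf_def mw.cov_def using that A01 by (intro sum.cong) auto
 have actW: "j \<in> mw.act t \<longleftrightarrow> j < nc \<and> covf A th t j < N * r j" if "t <= T" for t j
  using cov[OF that] by (auto simp: mw.act_def)
 define R where "R = (\<Prod>j<nc. r j)"
 have R0: "0 < R" unfolding R_def using r by (intro prod_pos) auto
 define Z where "Z t = real R * (real gD * real R) ^ t" for t
 have Z0: "0 < Z t" for t using R0 by (simp add: Z_def gD_def)
 have thle: "A' t j ==> th t <= r j" and tight0: "(\<exists>j. A' t j) ==> \<exists>j. A' t j \<and> th t = r j" for t j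
 proof -
  let ?Q = "%j. A t j \<noteq> 0 \<and> (\<forall>j'<nc. A t j' = 0 \<or> r j <= r j')"
  have *: "\<exists>j1<nc. ?Q j1 \<and> th t = r j1" if a: "A' t j0" for j0
  proof -
   have t: "t < T" using a by (simp add: A'_def)
   define S where "S = {j. j < nc \<and> A t j \<noteq> 0}"
   have "j0 \<in> S" "finite S" using a by (auto simp: S_def A'_def)
   then have "Min (r ` S) \<in> r ` S" by (intro Min_in) auto
   then obtain j2 where j2: "j2 \<in> S" "r j2 = Min (r ` S)" by auto
   have "r j2 <= r j'" if "j' < nc" "A t j' \<noteq> 0" for j'
    unfolding j2(2) using that \<open>finite S\<close> by (intro Min_le) (auto simp: S_def)
   then have "?Q j2" using j2(1) by (auto simp: S_def)
   then have "find_idx nc ?Q < nc \<and> ?Q (find_idx nc ?Q)"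
    using j2(1) by (intro find_idx_found[of j2]) (auto simp: S_def)
   moreover have "th t = r (find_idx nc ?Q)" using ok[OF t] by (simp add: mw_ok_def thf_def)
   ultimately show ?thesis by blast
  qed
  show "th t <= r j" if a: "A' t j"
  proof -
   obtain j1 where j1: "j1 < nc" "?Q j1" "th t = r j1" using *[OF a] by blast
   have "j < nc" "A t j \<noteq> 0" using a by (auto simp: A'_def)
   then show ?thesis using j1 by auto
  qed
  show "\<exists>j. A' t j \<and> th t = r j" if "\<exists>j. A' t j"
  proof -
   obtain j0 where j0: "A' t j0" using \<open>\<exists>j. A' t j\<close> by blast
   obtain j1 where j1: "j1 < nc" "?Q j1" "th t = r j1" using *[OF j0] by blast
   then have "A' t j1" using j0 by (simp add: A'_def)
   then show ?thesis using j1 by blast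
  qed
 qed
 have Weq: "real (?W t j) = Z t * (mw.om t j / real (r j))" if t: "t <= T" and j: "j \<in> mw.act t" for t j
 proof -
  have jn: "j < nc" using j by (simp add: mw.act_def)
  have rj: "0 < real (r j)" using r[OF jn] by simp
  have rb: "real (rbar j) = real R / real (r j)"
   using rbar_mult[OF jn] rj unfolding R_def[symmetric] by (simp add: field_simps flip: of_nat_mult)
  have fac: "real ((gD * r j - A t' j * th t') * rbar j) =
    (real gD * real R) * (1 - of_bool (A' t' j) * real (th t') / (real gD * real (r j)))" if "t' < t" for t'
  proof -
   have "A t' j * th t' <= gD * r j"
   proof (cases "A' t' j")
    case True
    then show ?thesis using A01[of t' j] that t jn thle[OF True] by (simp add: gD_def)
   next
    case False
    then show ?thesis using A01[of t' j] that t jn by simp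
   qed
   moreover have "A t' j = of_bool (A' t' j)" using A01[of t' j] that t jn by simp
   moreover have "real gD \<noteq> 0" by (simp add: gD_def)
   ultimately show ?thesis using rj unfolding of_nat_mult rb by (simp add: of_nat_diff field_simps)
  qed
  have "real (?W t j) = real (rbar j) * (\<Prod>t'<t. real ((gD * r j - A t' j * th t') * rbar j))"
   using j actW[OF t] by (simp add: wgt_def)
  also have "(\<Prod>t'<t. real ((gD * r j - A t' j * th t') * rbar j)) =
    (\<Prod>t'<t. (real gD * real R) * (1 - of_bool (A' t' j) * real (th t') / (real gD * real (r j))))"
   using fac by (intro prod.cong) auto
  also have "\<dots> = (real gD * real R) ^ t * mw.om t j"
   by (simp add: prod.distrib mw.om_def)
  finally show ?thesis unfolding rb Z_def by simp
 qed
 have ompos: "0 < mw.om t j" if "t <= T" "j \<in> mw.act t" for t j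
  unfolding mw.om_def
 proof (rule prod_pos)
  fix t' assume "t' \<in> {..<t}"
  have jn: "j < nc" using that by (simp add: mw.act_def)
  have "real (th t') <= real (r j)" if "A' t' j" using thle[OF that] by simp
  moreover have "0 < real (r j)" using r[OF jn] by simp
  ultimately have "of_bool (A' t' j) * real (th t') / (real gD * real (r j)) <= 1 / real gD"
   by (cases "A' t' j") (auto simp: field_simps gD_def)
  also have "\<dots> < 1" by (simp add: gD_def)
  finally show "0 < 1 - of_bool (A' t' j) * real (th t') / (real gD * real (r j))" by simp
 qed
 have W0: "0 < ?W t j \<longleftrightarrow> j \<in> mw.act t" if "t <= T" "j < nc" for t j
 proof
  assume "0 < ?W t j" then show "j \<in> mw.act t" using actW[OF that(1)] that by (simp add: wgt_def split: if_splits)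
 next
  assume j: "j \<in> mw.act t"
  then have "0 < real (?W t j)" unfolding Weq[OF that(1) j] using Z0 ompos[OF that(1) j] r[OF that(2)] by simp
  then show "0 < ?W t j" by simp
 qed
 have step: "bv t < ns * nc \<and> bv t mod nc \<in> mw.act t \<and> {j. A' t j} = {j \<in> mw.act t. inA (?W t) (bv t) j} \<and>
   A' t (bv t mod nc) \<and>
   (\<forall>v<ns * nc. v mod nc \<in> mw.act t \<longrightarrow> cw (?W t) v * cc (?W t) (bv t) <= cw (?W t) (bv t) * cc (?W t) v)"
  if t: "t < T" and ne: "mw.act t \<noteq> {}" for t
 proof -
  have tT: "t <= T" using t by simp
  let ?Q = "%v. 0 < ?W t (v mod nc) \<and>
   (\<forall>v'<ns * nc. ?W t (v' mod nc) = 0 \<or> cw (?W t) v' * cc (?W t) v <= cw (?W t) v * cc (?W t) v')"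
  have nc0: "0 < nc" using ne by (auto simp: mw.act_def)
  define S where "S = {v. v < ns * nc \<and> v mod nc \<in> mw.act t}"
  obtain j0 where j0: "j0 \<in> mw.act t" using ne by blast
  then have j0n: "j0 < nc" by (simp add: mw.act_def)
  have "j0 < ns * nc" using j0n ns[OF nc0] by (cases ns) auto
  then have S: "finite S" "S \<noteq> {}" using j0 j0n by (auto simp: S_def)
  have cwpos: "0 < cw (?W t) v" if "v \<in> S" for v
  proof -
   have v: "v mod nc < nc" "0 < ?W t (v mod nc)" using that nc0 W0[OF tT] by (auto simp: S_def)
   have "0 < of_bool (inA (?W t) v (v mod nc)) * ?W t (v mod nc)" using v by (simp add: inA_def)
   also have "\<dots> <= cw (?W t) v" unfolding cw_def using v by (intro member_le_sum) auto
   finally show ?thesis .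
  qed
  \<comment> \<open>A star with least cost per weight passes the test of \<open>best\<close>; the
    quotient makes sense because the star of an active client has positive weight.\<close>
  have "Min ((%v. real (cc (?W t) v) / real (cw (?W t) v)) ` S) \<in> (%v. real (cc (?W t) v) / real (cw (?W t) v)) ` S"
   using S by (intro Min_in) auto
  then obtain v where v: "v \<in> S" "real (cc (?W t) v) / real (cw (?W t) v) =
    Min ((%v. real (cc (?W t) v) / real (cw (?W t) v)) ` S)" by auto
  have "?Q v"
  proof (intro conjI allI impI)
   show "0 < ?W t (v mod nc)" using v nc0 W0[OF tT] by (auto simp: S_def)
   fix v' assume v': "v' < ns * nc"
   show "?W t (v' mod nc) = 0 \<or> cw (?W t) v' * cc (?W t) v <= cw (?W t) v * cc (?W t) v'"
   proof (cases "v' \<in> S")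
    case True
    have "real (cc (?W t) v) / real (cw (?W t) v) <= real (cc (?W t) v') / real (cw (?W t) v')"
     unfolding v(2) using S True by (intro Min_le) auto
    then have "real (cw (?W t) v' * cc (?W t) v) <= real (cw (?W t) v * cc (?W t) v')"
     using cwpos[OF True] cwpos[OF v(1)] by (simp add: field_simps)
    then show ?thesis by linarith
   next
    case False
    then have "v' mod nc \<notin> mw.act t" using v' by (simp add: S_def)
    then show ?thesis using W0[OF tT, of "v' mod nc"] nc0 by simp
   qed
  qed
  then have f: "find_idx (ns * nc) ?Q < ns * nc \<and> ?Q (find_idx (ns * nc) ?Q)"
   using v(1) by (intro find_idx_found[of v]) (auto simp: S_def)
  have bv: "bv t = find_idx (ns * nc) ?Q" using ok[OF t] by (simp add: mw_ok_def best_def)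
  have b: "bv t < ns * nc" "?Q (bv t)" using f unfolding bv by auto
  have ba: "bv t mod nc \<in> mw.act t" using b(2) W0[OF tT, of "bv t mod nc"] nc0 by simp
  have rows: "A' t j \<longleftrightarrow> j < nc \<and> inA (?W t) (bv t) j" for j
   using ok[OF t] t by (auto simp: mw_ok_def A'_def)
  have "{j. A' t j} = {j \<in> mw.act t. inA (?W t) (bv t) j}"
   using rows W0[OF tT] by (auto simp: inA_def mw.act_def)
  moreover have "A' t (bv t mod nc)" unfolding rows using nc0 b(2) by (simp add: inA_def)
  moreover have "cw (?W t) v * cc (?W t) (bv t) <= cw (?W t) (bv t) * cc (?W t) v"
   if "v < ns * nc" "v mod nc \<in> mw.act t" for v
   using b(2) that W0[OF tT, of "v mod nc"] nc0 by auto
  ultimately show ?thesis using b ba by blast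
 qed
 have idle0: "\<not> A' t j \<and> bv t = ns * nc" if t: "t < T" and e: "mw.act t = {}" for t j
 proof -
  have tT: "t <= T" using t by simp
  have z: "\<not> 0 < ?W t j" if "j < nc" for j using W0[OF tT that] e by simp
  have "bv t = ns * nc" using ok[OF t] unfolding mw_ok_def best_def
  proof (elim conjE)
   assume "bv t = find_idx (ns * nc) (%v. 0 < ?W t (v mod nc) \<and>
    (\<forall>v'<ns * nc. ?W t (v' mod nc) = 0 \<or> cw (?W t) v' * cc (?W t) v <= cw (?W t) v * cc (?W t) v'))"
   also have "\<dots> = ns * nc"
   proof (rule find_idx_none)
    fix v assume "v < ns * nc"
    then have "0 < nc" by (cases nc) auto
    then show "\<not> (0 < ?W t (v mod nc) \<and>
     (\<forall>v'<ns * nc. ?W t (v' mod nc) = 0 \<or> cw (?W t) v' * cc (?W t) v <= cw (?W t) v * cc (?W t) v'))"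
     using z[of "v mod nc"] by simp
   qed
   finally show ?thesis .
  qed
  moreover have "\<not> A' t j" using ok[OF t] z[of j] by (auto simp: mw_ok_def A'_def inA_def)
  ultimately show ?thesis by simp
 qed
 define c where "c t = (if t < T \<and> mw.act t \<noteq> {} then real (cc (?W t) (bv t)) else 0)" for t
 have sumA: "(\<Sum>j<nc. of_bool (inA (?W t) v j) * g j) = (\<Sum>j | j \<in> mw.act t \<and> inA (?W t) v j. g j)"
  if "t <= T" for t v and g :: "nat => nat"
 proof -
  have "(\<Sum>j<nc. of_bool (inA (?W t) v j) * g j) = (\<Sum>j\<in>{..<nc} \<inter> {j. inA (?W t) v j}. g j)"
   by simp
  also have "{..<nc} \<inter> {j. inA (?W t) v j} = {j. j \<in> mw.act t \<and> inA (?W t) v j}"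
   using W0[OF that] by (auto simp: inA_def mw.act_def)
  finally show ?thesis .
 qed
 have star: "(\<Sum>j\<in>mw.act t. mw.om t j) * c t <= (\<Sum>j | A' t j. mw.om t j / real (r j)) * L"
  if t: "t < T" and ne: "mw.act t \<noteq> {}" for t
 proof -
  have tT: "t <= T" using t by simp
  note s = step[OF t ne]
  let ?w = "%j. mw.om t j / real (r j)"
  let ?A = "%i j. {j' \<in> mw.act t. ?w j * real (d i j') <= ?w j' * real (d i j)}"
  let ?i0 = "bv t div nc" and ?j0 = "bv t mod nc"
  have an: "j < nc" if "j \<in> mw.act t" for j using that by (simp add: mw.act_def)
  have wpos: "0 < ?w j" if "j \<in> mw.act t" for j using ompos[OF tT that] r[OF an[OF that]] by simp
  have AA: "?A i j = {j'. j' \<in> mw.act t \<and> inA (?W t) (i * nc + j) j'}" if j: "j \<in> mw.act t" for i j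
  proof -
   have dm: "(i * nc + j) div nc = i" "(i * nc + j) mod nc = j" using an[OF j] by auto
   have "?w j * real (d i j') <= ?w j' * real (d i j) \<longleftrightarrow> inA (?W t) (i * nc + j) j'" if j': "j' \<in> mw.act t" for j'
   proof -
    have "inA (?W t) (i * nc + j) j' \<longleftrightarrow> real (?W t j * d i j') <= real (?W t j' * d i j)"
     unfolding inA_def dm of_nat_le_iff using W0[OF tT an[OF j']] j' by simp
    also have "\<dots> \<longleftrightarrow> Z t * (?w j * real (d i j')) <= Z t * (?w j' * real (d i j))"
     unfolding of_nat_mult Weq[OF tT j] Weq[OF tT j'] by (simp add: mult.assoc)
    also have "\<dots> \<longleftrightarrow> ?w j * real (d i j') <= ?w j' * real (d i j)" by (rule mult_le_cancel_left_pos[OF Z0])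
    finally show ?thesis by simp
   qed
   then show ?thesis by blast
  qed
  have cwE: "real (cw (?W t) (i * nc + j)) = Z t * sum ?w (?A i j)" if j: "j \<in> mw.act t" for i j
  proof -
   have "real (cw (?W t) (i * nc + j)) = (\<Sum>j'\<in>?A i j. real (?W t j'))"
    unfolding cw_def sumA[OF tT] AA[OF j] by simp
   also have "\<dots> = (\<Sum>j'\<in>?A i j. Z t * ?w j')" using Weq[OF tT] by (intro sum.cong) auto
   finally show ?thesis by (simp add: sum_distrib_left)
  qed
  have ccE: "real (cc (?W t) (i * nc + j)) = real (cst i) + (\<Sum>j'\<in>?A i j. real (d i j'))" if j: "j \<in> mw.act t" for i j
  proof -
   have dm: "(i * nc + j) div nc = i" using an[OF j] by auto
   show ?thesis unfolding cc_def sumA[OF tT] AA[OF j] dm by simp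
  qed
  have bvd: "bv t = ?i0 * nc + ?j0" by simp
  have i0: "?i0 < ns" using s by (simp add: less_mult_imp_div_less)
  have j0: "?j0 \<in> mw.act t" using s by blast
  have "(\<Sum>j\<in>mw.act t. ?w j * real (r j)) * (real (cst ?i0) + (\<Sum>j'\<in>?A ?i0 ?j0. real (d ?i0 j'))) <=
   sum ?w (?A ?i0 ?j0) * ((\<Sum>i<ns. real (cst i) * y i) + (\<Sum>i<ns. \<Sum>j\<in>mw.act t. real (d i j) * x i j))"
  proof (rule star_oracle[where A = ?A and w = ?w and d = "%i j. real (d i j)" and f = "%i. real (cst i)"])
   fix i j assume ij: "i < ns" "j \<in> mw.act t"
   have jn: "j < nc" by (rule an[OF ij(2)])
   have "Suc i * nc <= ns * nc" using ij by (intro mult_right_mono) auto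
   then have vlt: "i * nc + j < ns * nc" using jn by simp
   have vm: "(i * nc + j) mod nc \<in> mw.act t" using ij jn by simp
   have "cw (?W t) (i * nc + j) * cc (?W t) (bv t) <= cw (?W t) (bv t) * cc (?W t) (i * nc + j)"
    using s vlt vm by blast
   then have "real (cw (?W t) (i * nc + j)) * real (cc (?W t) (bv t)) <=
     real (cw (?W t) (bv t)) * real (cc (?W t) (i * nc + j))" by (simp flip: of_nat_mult)
   then have "Z t * (sum ?w (?A i j) * real (cc (?W t) (bv t))) <=
     Z t * (sum ?w (?A ?i0 ?j0) * (real (cst i) + (\<Sum>j'\<in>?A i j. real (d i j'))))"
    unfolding cwE[OF ij(2)] cwE[OF j0, of ?i0, folded bvd] ccE[OF ij(2)] by (simp only: mult.assoc)
   then show "sum ?w (?A i j) * (real (cst ?i0) + (\<Sum>j'\<in>?A ?i0 ?j0. real (d ?i0 j'))) <=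
     sum ?w (?A ?i0 ?j0) * (real (cst i) + (\<Sum>j'\<in>?A i j. real (d i j')))"
    unfolding mult_le_cancel_left_pos[OF Z0] using ccE[OF j0, of ?i0] bvd by simp
  qed (use i0 j0 wpos lp an in auto)
  moreover have "(\<Sum>i<ns. real (cst i) * y i) + (\<Sum>i<ns. \<Sum>j\<in>mw.act t. real (d i j) * x i j) <= L"
  proof -
   have "(\<Sum>j\<in>mw.act t. real (d i j) * x i j) <= (\<Sum>j<nc. real (d i j) * x i j)" if "i < ns" for i
    using lp(2)[OF that] an by (intro sum_mono2) auto
   then have "(\<Sum>i<ns. \<Sum>j\<in>mw.act t. real (d i j) * x i j) <= (\<Sum>i<ns. \<Sum>j<nc. real (d i j) * x i j)"
    by (intro sum_mono) simp
   then show ?thesis using lp(4) by linarith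
  qed
  moreover have "0 <= sum ?w (?A ?i0 ?j0)" using wpos by (intro sum_nonneg) (auto intro: less_imp_le)
  ultimately have "(\<Sum>j\<in>mw.act t. ?w j * real (r j)) * (real (cst ?i0) + (\<Sum>j'\<in>?A ?i0 ?j0. real (d ?i0 j'))) <=
   sum ?w (?A ?i0 ?j0) * L" using mult_left_mono order.trans by blast
  moreover have "(\<Sum>j\<in>mw.act t. ?w j * real (r j)) = (\<Sum>j\<in>mw.act t. mw.om t j)"
  proof (rule sum.cong[OF refl])
   fix j assume "j \<in> mw.act t"
   then have "0 < r j" using r an by blast
   then show "?w j * real (r j) = mw.om t j" by simp
  qed
  moreover have "c t = real (cst ?i0) + (\<Sum>j'\<in>?A ?i0 ?j0. real (d ?i0 j'))"
   using ccE[OF j0, of ?i0] bvd t ne by (simp add: c_def)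
  moreover have "?A ?i0 ?j0 = {j. A' t j}"
   using AA[OF j0, of ?i0] s bvd by simp
  ultimately show ?thesis by simp
 qed
 interpret run: mult_weights_run nc N gD r A' th c L T
 proof unfold_locales
  show "j \<in> mw.act t \<and> th t <= r j" if a: "A' t j" for t j
  proof -
   have t: "t < T" using a by (simp add: A'_def)
   have "mw.act t \<noteq> {}" using idle0[OF t, of j] a by blast
   then have "{j. A' t j} = {j \<in> mw.act t. inA (?W t) (bv t) j}" using step[OF t] by blast
   then show ?thesis using a thle[OF a] by auto
  qed
  show "\<exists>j. A' t j \<and> th t = r j" if "t < T" "mw.act t \<noteq> {}" for t
   using step[OF that] tight0 by blast
 qed (use L star in \<open>auto simp: c_def\<close>)
 have siteT: "bv t div nc < ns \<or> (\<forall>j. \<not> A' t j)" if "t < T" for t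
  using step[OF that] idle0[OF that] by (cases "mw.act t = {}") (auto simp: less_mult_imp_div_less)
 have sumsite: "(\<Sum>i<ns. of_bool (bv t div nc = i) * g i) = (if bv t div nc < ns then g (bv t div nc) else 0)"
  for t and g :: "nat => real"
  by (rule sum_of_bool_index)
 show "N * r j <= (\<Sum>i<ns. Xf A bv th i j)" if j: "j < nc" for j
 proof -
  have "mw.act T = {}" by (rule run.all_covered) simp
  then have "j \<notin> mw.act T" by simp
  then have "N * r j <= mw.cov T j" using j by (simp add: mw.act_def)
  also have "mw.cov T j = (\<Sum>t<T. \<Sum>i<ns. of_bool (bv t div nc = i) * (A t j * th t))"
   unfolding mw.cov_def
  proof (rule sum.cong[OF refl])
   fix t assume t: "t \<in> {..<T}"
   have "(\<Sum>i<ns. of_bool (bv t div nc = i) * (A t j * th t)) =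
     (if bv t div nc < ns then A t j * th t else 0)"
    by (rule sum_of_bool_index)
   then show "of_bool (A' t j) * th t = (\<Sum>i<ns. of_bool (bv t div nc = i) * (A t j * th t))"
    using siteT[of t] t A01[of t j] j by auto
  qed
  also have "\<dots> = (\<Sum>i<ns. Xf A bv th i j)" unfolding Xf_def by (rule sum.swap)
  finally show ?thesis .
 qed
 have "(\<Sum>i<ns. real (cst i) * real (Yf bv th i)) + (\<Sum>i<ns. \<Sum>j<nc. real (d i j) * real (Xf A bv th i j)) =
   (\<Sum>t<T. real (th t) * c t)"
 proof -
  have "(\<Sum>i<ns. real (cst i) * real (Yf bv th i)) = (\<Sum>t<T. \<Sum>i<ns. of_bool (bv t div nc = i) * (real (cst i) * real (th t)))"
   unfolding Yf_def of_nat_sum sum_distrib_left by (subst sum.swap) (intro sum.cong, auto)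
  moreover have "(\<Sum>i<ns. \<Sum>j<nc. real (d i j) * real (Xf A bv th i j)) =
    (\<Sum>t<T. \<Sum>i<ns. of_bool (bv t div nc = i) * (\<Sum>j<nc. real (d i j) * (real (A t j) * real (th t))))"
  proof -
   have "(\<Sum>j<nc. real (d i j) * real (Xf A bv th i j)) =
     (\<Sum>t<T. of_bool (bv t div nc = i) * (\<Sum>j<nc. real (d i j) * (real (A t j) * real (th t))))" for i
   proof -
    have "(\<Sum>j<nc. real (d i j) * real (Xf A bv th i j)) =
      (\<Sum>j<nc. \<Sum>t<T. real (d i j) * (of_bool (bv t div nc = i) * (real (A t j) * real (th t))))"
     unfolding Xf_def of_nat_sum sum_distrib_left by (intro sum.cong refl) auto
    also have "\<dots> = (\<Sum>t<T. \<Sum>j<nc. real (d i j) * (of_bool (bv t div nc = i) * (real (A t j) * real (th t))))"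
     by (rule sum.swap)
    also have "\<dots> = (\<Sum>t<T. of_bool (bv t div nc = i) * (\<Sum>j<nc. real (d i j) * (real (A t j) * real (th t))))"
     unfolding sum_distrib_left by (intro sum.cong refl) (simp add: mult.left_commute)
    finally show ?thesis .
   qed
   then show ?thesis by (simp only:) (rule sum.swap)
  qed
  ultimately have "(\<Sum>i<ns. real (cst i) * real (Yf bv th i)) + (\<Sum>i<ns. \<Sum>j<nc. real (d i j) * real (Xf A bv th i j)) =
   (\<Sum>t<T. (\<Sum>i<ns. of_bool (bv t div nc = i) * (real (cst i) * real (th t))) +
    (\<Sum>i<ns. of_bool (bv t div nc = i) * (\<Sum>j<nc. real (d i j) * (real (A t j) * real (th t)))))"
   by (simp only: sum.distrib)
  also have "\<dots> = (\<Sum>t<T. real (th t) * c t)"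
  proof (rule sum.cong[OF refl])
   fix t assume "t \<in> {..<T}"
   then have t: "t < T" by simp
   let ?i = "bv t div nc"
   show "(\<Sum>i<ns. of_bool (bv t div nc = i) * (real (cst i) * real (th t))) +
    (\<Sum>i<ns. of_bool (bv t div nc = i) * (\<Sum>j<nc. real (d i j) * (real (A t j) * real (th t)))) = real (th t) * c t"
   proof (cases "mw.act t = {}")
    case True
    have "bv t = ns * nc" using idle0[OF t True] by blast
    moreover have "0 < nc" using t by (cases nc) auto
    ultimately have "\<not> ?i < ns" by simp
    then show ?thesis unfolding sumsite using True by (simp add: c_def)
   next
    case False
    have i: "?i < ns" using step[OF t False] by (simp add: less_mult_imp_div_less)
    have A: "A t j = of_bool (inA (?W t) (bv t) j)" if "j < nc" for j using ok[OF t] that by (simp add: mw_ok_def)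
    have "(\<Sum>j<nc. real (d ?i j) * (real (A t j) * real (th t))) =
      real (th t) * (\<Sum>j<nc. real (of_bool (inA (?W t) (bv t) j) * d ?i j))"
     unfolding sum_distrib_left using A by (intro sum.cong refl) auto
    then show ?thesis unfolding sumsite using i t False by (simp add: c_def cc_def algebra_simps)
   qed
  qed
  finally show ?thesis .
 qed
 then show "(\<Sum>i<ns. real (cst i) * real (Yf bv th i)) + (\<Sum>i<ns. \<Sum>j<nc. real (d i j) * real (Xf A bv th i j)) <=
   L * (real gD * real nc + (1 + 2 / real gD) * real N + 1)"
  using run.total_cost[of T] by simp
qed

lemma X_le_Y: "(!!t. t < T ==> mw_ok A th bv t) ==> j < nc ==> Xf A bv th i j <= Yf bv th i"
 unfolding Xf_def Yf_def by (intro sum_mono) (auto simp: mw_ok_def)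

end

lemma sum_if_set: "(\<Sum>v<(m::nat). if Q v then g v else (0::nat)) = (\<Sum>v | v < m \<and> Q v. g v)"
 by (rule sum.mono_neutral_cong_right) auto

lemma sum_bool_card: "(!!v. v < (m::nat) ==> g v <= (1::nat)) ==> (\<Sum>v<m. g v) = card {v. v < m \<and> g v \<noteq> 0}"
proof -
 assume g: "!!v. v < m ==> g v <= 1"
 have "(\<Sum>v<m. g v) = (\<Sum>v<m. if g v \<noteq> 0 then 1 else 0)"
 proof (intro sum.cong refl)
  fix v assume "v \<in> {..<m}"
  then have "g v <= 1" by (intro g) simp
  then show "g v = (if g v \<noteq> 0 then 1 else 0)" by (cases "g v = 0") simp_all
 qed
 also have "\<dots> = card {v. v < m \<and> g v \<noteq> 0}" unfolding sum_if_set card_eq_sum ..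
 finally show ?thesis .
qed

lemma row_index: "p < M ==> (j * M + p) div M = j \<and> (j * M + p) mod M = (p::nat)"
 by (cases "M = 0") auto

section \<open>The partition phase as computed by the program\<close>

locale inst2 = inst inp cst ns nc P for inp cst :: "nat => nat" and ns nc P :: nat +
 fixes RR INP :: "nat => nat" and H :: nat
begin

definition base2 :: "st => bool" where
 "base2 \<sigma> \<longleftrightarrow> base \<sigma> \<and> \<sigma> 16 = RR \<and> \<sigma> 19 0 = H \<and> \<sigma> 20 = INP"

lemma base2D:
 assumes "base2 \<sigma>"
 shows "base \<sigma>" "\<sigma> 16 = RR" "\<sigma> 19 0 = H" "\<sigma> 20 = INP"
  "\<sigma> 0 = inp" "\<sigma> (Suc 0) 0 = ns" "\<sigma> (Suc 0) (Suc 0) = nc" "\<sigma> 3 = cst" "\<sigma> 5 0 = P"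
 using assms baseD[of \<sigma>] by (simp_all add: base2_def)

lemma base2_upd: "base2 \<sigma> ==> a \<notin> {0, 1, 3, 5, 16, 19, 20} ==> base2 (\<sigma>(a := g))"
 by (simp add: base2_def base_upd)

definition "Pset j = {p. p < PP \<and> INP (j * PP + p) \<noteq> 0}"
definition "dp j p = d (p div (2 * N)) j"
definition row :: "st => nat => nat => nat set" where
 "row \<sigma> a t = {p. p < PP \<and> \<sigma> a (t * PP + p) \<noteq> 0}"

abbreviation "pool sel tk \<equiv> partition.pool Pset sel tk"
abbreviation "chunk \<equiv> partition.chunk n dp"
abbreviation "val \<equiv> partition.val n dp"
abbreviation "cnt sel \<equiv> partition.cnt sel"
abbreviation "free sel tk fl \<equiv> partition.free H Pset sel tk fl"
abbreviation "plt \<equiv> partition.lt dp"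

text \<open>The counterpart of \<open>mw_ok\<close> for one unit. The search for a cluster returns
  \<open>t\<close> itself if no earlier cluster is met, which is exactly the case in which unit
  \<open>t\<close> founds one.\<close>

definition "part_ok sel clu tk t \<longleftrightarrow>
 sel t = find_idx nc (%j. cnt sel t j < RR j \<and>
  (\<forall>j'<nc. \<not> cnt sel t j' < RR j' \<or> val j (pool sel tk t j) <= val j' (pool sel tk t j'))) \<and>
 (sel t < nc \<longrightarrow>
  clu t = find_idx t (%\<kappa>. clu \<kappa> = \<kappa> \<and> chunk (sel t) (pool sel tk t (sel t)) \<inter> tk \<kappa> \<noteq> {}) \<and>
  tk t = (if clu t = t then chunk (sel t) (pool sel tk t (sel t)) else pool sel tk t (sel t) \<inter> tk (clu t)))"
 for sel clu :: "nat => nat"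

lemma pool_cong: "(!!t'. t' < t ==> sel t' = sel' t' \<and> tk t' = tk' t') ==> pool sel tk t j = pool sel' tk' t j"
 unfolding partition.pool_def by (intro Collect_cong) auto

lemma cnt_cong: "(!!t'. t' < t ==> sel t' = sel' t') ==> cnt sel t j = cnt sel' t j"
 unfolding partition.cnt_def by (intro arg_cong[where f = card] Collect_cong) auto

lemma part_ok_cong:
 assumes "!!t'. t' <= t ==> sel t' = sel' t' \<and> clu t' = clu' t' \<and> tk t' = tk' t'"
 shows "part_ok sel clu tk t = part_ok sel' clu' tk' t"
proof -
 have p: "pool sel tk t j = pool sel' tk' t j" for j by (rule pool_cong) (use assms in auto)
 have c: "cnt sel t j = cnt sel' t j" for j by (rule cnt_cong) (use assms in auto)
 have f: "find_idx t (%\<kappa>. clu \<kappa> = \<kappa> \<and> X \<inter> tk \<kappa> \<noteq> {}) = find_idx t (%\<kappa>. clu' \<kappa> = \<kappa> \<and> X \<inter> tk' \<kappa> \<noteq> {})" for X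
  by (rule find_idx_cong) (use assms in auto)
 have le: "find_idx t Q <= t" for Q using find_idx_cases[of t Q] by auto
 show ?thesis
 proof (cases "sel' t < nc \<and> clu' t = find_idx t (%\<kappa>. clu' \<kappa> = \<kappa> \<and> chunk (sel' t) (pool sel' tk' t (sel' t)) \<inter> tk' \<kappa> \<noteq> {})")
  case True
  then have "clu' t <= t" by (rule ord_eq_le_trans[OF conjunct2 le])
  then show ?thesis unfolding part_ok_def p c f using assms[of t] assms[of "clu' t"] by simp
 next
  case False
  then show ?thesis unfolding part_ok_def p c f using assms[of t] by auto
 qed
qed

lemma idx: "j < m ==> p < PP ==> j * PP + p < m * PP" "p < PP ==> (j * PP + p) div PP = j"
 "p < PP ==> (j * PP + p) mod PP = p"
proof -
 assume "j < m" "p < PP"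
 moreover from this have "Suc j * PP <= m * PP" by (intro mult_right_mono) auto
 ultimately show "j * PP + p < m * PP" by simp
qed (use row_index in blast)+

lemma c_pool_eff:
 assumes b: "base2 \<sigma>"
 obtains g where "dexec c_pool \<rho> \<sigma> = \<sigma>(21 := g)"
  "!!j p. j < nc ==> p < PP ==> g (j * PP + p) = of_bool (p \<in> pool (\<sigma> 24) (row \<sigma> 36) (\<rho> 0) j)"
proof -
 define g where "g k = (if k < nc * PP then of_bool (k mod PP \<in> pool (\<sigma> 24) (row \<sigma> 36) (\<rho> 0) (k div PP)) else \<sigma> 21 k)" for k
 have "dexec c_pool \<rho> \<sigma> = \<sigma>(21 := g)"
  unfolding c_pool_def
 proof (subst dexec_table[where M = PP])
  show "PP = eval ePP \<sigma> \<rho>" by (simp add: base2D[OF b])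
  show "\<sigma>(21 := %k. if k < eval eNC \<sigma> \<rho> * PP
    then eval (eLt (Num 0) (Rd 20 (vJ \<otimes> ePP \<oplus> vP)) \<otimes> eNot (eEx 1 vT (eEq (Rd 24 vT') vJ \<otimes> e_tk vT' vP)))
     \<sigma> (\<rho>(2 := k div PP, 4 := k mod PP)) else \<sigma> 21 k) = \<sigma>(21 := g)"
  proof (rule arg_cong[where f = "%g. \<sigma>(21 := g)"], rule ext)
   fix k
   have "0 < PP" if "k < nc * PP" using that by (cases "PP = 0") auto
   then have "k mod PP < PP" if "k < nc * PP" using that by simp
   then show "(if k < eval eNC \<sigma> \<rho> * PP
    then eval (eLt (Num 0) (Rd 20 (vJ \<otimes> ePP \<oplus> vP)) \<otimes> eNot (eEx 1 vT (eEq (Rd 24 vT') vJ \<otimes> e_tk vT' vP)))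
     \<sigma> (\<rho>(2 := k div PP, 4 := k mod PP)) else \<sigma> 21 k) = g k"
    unfolding g_def partition.pool_def Pset_def row_def by (simp add: base2D[OF b])
  qed
 qed (simp_all add: exp_defs)
 then show ?thesis
  by (rule that) (use idx in \<open>simp add: g_def\<close>)
qed

lemma c_rk_eff:
 assumes b: "base2 \<sigma>" and g: "!!j p. j < nc ==> p < PP ==> \<sigma> 21 (j * PP + p) = of_bool (p \<in> S j)"
  and S: "!!j. S j \<subseteq> {..<PP}"
 obtains g where "dexec c_rk \<rho> \<sigma> = \<sigma>(22 := g)"
  "!!j p. j < nc ==> p < PP ==> g (j * PP + p) = rk (plt j) (S j) p"
proof -
 define g where "g k = (if k < nc * PP then rk (plt (k div PP)) (S (k div PP)) (k mod PP) else \<sigma> 22 k)" for k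
 have "dexec c_rk \<rho> \<sigma> = \<sigma>(22 := g)"
  unfolding c_rk_def
 proof (subst dexec_table[where M = PP])
  show "PP = eval ePP \<sigma> \<rho>" by (simp add: base2D[OF b])
  show "\<sigma>(22 := %k. if k < eval eNC \<sigma> \<rho> * PP
    then eval (eSum 5 ePP (Rd 21 (vJ \<otimes> ePP \<oplus> vP') \<otimes>
     eOr (eLt (eDP vJ vP') (eDP vJ vP)) (eEq (eDP vJ vP') (eDP vJ vP) \<otimes> eLt vP' vP)))
     \<sigma> (\<rho>(2 := k div PP, 4 := k mod PP)) else \<sigma> 22 k) = \<sigma>(22 := g)"
  proof (rule arg_cong[where f = "%g. \<sigma>(22 := g)"], rule ext)
   fix k
   show "(if k < eval eNC \<sigma> \<rho> * PP
    then eval (eSum 5 ePP (Rd 21 (vJ \<otimes> ePP \<oplus> vP') \<otimes>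
     eOr (eLt (eDP vJ vP') (eDP vJ vP)) (eEq (eDP vJ vP') (eDP vJ vP) \<otimes> eLt vP' vP)))
     \<sigma> (\<rho>(2 := k div PP, 4 := k mod PP)) else \<sigma> 22 k) = g k"
   proof (cases "k < nc * PP")
    case True
    let ?j = "k div PP" and ?p = "k mod PP"
    have j: "?j < nc" using True by (simp add: less_mult_imp_div_less)
    have "eval (eSum 5 ePP (Rd 21 (vJ \<otimes> ePP \<oplus> vP') \<otimes>
     eOr (eLt (eDP vJ vP') (eDP vJ vP)) (eEq (eDP vJ vP') (eDP vJ vP) \<otimes> eLt vP' vP)))
     \<sigma> (\<rho>(2 := ?j, 4 := ?p)) = (\<Sum>v<PP. \<sigma> 21 (?j * PP + v) * of_bool (plt ?j v ?p))"
     by (simp add: base2D[OF b] partition.lt_def dp_def d_def)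
    also have "\<dots> = (\<Sum>v<PP. of_bool (v \<in> S ?j \<and> plt ?j v ?p))"
     using g[OF j] by (intro sum.cong) auto
    also have "\<dots> = card {v. v < PP \<and> of_bool (v \<in> S ?j \<and> plt ?j v ?p) \<noteq> (0::nat)}"
     by (rule sum_bool_card) simp
    also have "{v. v < PP \<and> of_bool (v \<in> S ?j \<and> plt ?j v ?p) \<noteq> (0::nat)} = {v \<in> S ?j. plt ?j v ?p}"
     using S[of ?j] by auto
    finally show ?thesis using True by (simp add: g_def rk_def base2D[OF b])
   qed (simp add: g_def base2D[OF b])
  qed
 qed (simp_all add: exp_defs)
 then show ?thesis
  by (rule that) (use idx in \<open>simp add: g_def\<close>)
qed

lemma c_val_eff:
 assumes b: "base2 \<sigma>" and g: "!!j p. j < nc ==> p < PP ==> \<sigma> 21 (j * PP + p) = of_bool (p \<in> S j)"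
  and S: "!!j. S j \<subseteq> {..<PP}" and h: "!!j p. j < nc ==> p < PP ==> \<sigma> 22 (j * PP + p) = rk (plt j) (S j) p"
 obtains g where "dexec c_val \<rho> \<sigma> = \<sigma>(23 := g)" "!!j. j < nc ==> g j = val j (S j)"
proof -
 define g where "g j = (if j < nc then val j (S j) else \<sigma> 23 j)" for j
 have "dexec c_val \<rho> \<sigma> = \<sigma>(23 := g)"
  unfolding c_val_def
 proof (subst dexec_fill0)
  show "\<sigma>(23 := %k. if k < eval eNC \<sigma> \<rho> then eval
   (eSum 4 ePP (Rd 21 (vJ \<otimes> ePP \<oplus> vP) \<otimes> eLt (Rd 22 (vJ \<otimes> ePP \<oplus> vP)) enn \<otimes> eDP vJ vP) \<oplus>
    enn \<otimes> eSum 4 ePP (Rd 21 (vJ \<otimes> ePP \<oplus> vP) \<otimes> eEq (Rd 22 (vJ \<otimes> ePP \<oplus> vP)) (enn \<ominus> Num 1) \<otimes> eDP vJ vP))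
   \<sigma> (\<rho>(2 := k)) else \<sigma> 23 k) = \<sigma>(23 := g)"
  proof (rule arg_cong[where f = "%g. \<sigma>(23 := g)"], rule ext)
   fix j
   have "eval (eSum 4 ePP (Rd 21 (vJ \<otimes> ePP \<oplus> vP) \<otimes> eLt (Rd 22 (vJ \<otimes> ePP \<oplus> vP)) enn \<otimes> eDP vJ vP) \<oplus>
    enn \<otimes> eSum 4 ePP (Rd 21 (vJ \<otimes> ePP \<oplus> vP) \<otimes> eEq (Rd 22 (vJ \<otimes> ePP \<oplus> vP)) (enn \<ominus> Num 1) \<otimes> eDP vJ vP))
    \<sigma> (\<rho>(2 := j)) = val j (S j)" if j: "j < nc"
   proof -
    have 1: "\<sigma> 21 (j * PP + v) * of_bool (\<sigma> 22 (j * PP + v) < n) * dp j v = (if v \<in> chunk j (S j) then dp j v else 0)"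
     "\<sigma> 21 (j * PP + v) * of_bool (\<sigma> 22 (j * PP + v) = n - 1) * dp j v =
      (if v \<in> S j \<and> rk (plt j) (S j) v = n - 1 then dp j v else 0)" if "v < PP" for v
     using g[OF j that] h[OF j that] by (auto simp: partition.chunk_def)
    have "(\<Sum>v<PP. \<sigma> 21 (j * PP + v) * of_bool (\<sigma> 22 (j * PP + v) < n) * dp j v) =
      (\<Sum>v<PP. if v \<in> chunk j (S j) then dp j v else 0)" by (intro sum.cong refl 1) simp
    also have "\<dots> = sum (dp j) (chunk j (S j))" unfolding sum_if_set
     using S[of j] by (intro sum.cong) (auto simp: partition.chunk_def)
    finally have 2: "(\<Sum>v<PP. \<sigma> 21 (j * PP + v) * of_bool (\<sigma> 22 (j * PP + v) < n) * dp j v) = sum (dp j) (chunk j (S j))" .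
    have "(\<Sum>v<PP. \<sigma> 21 (j * PP + v) * of_bool (\<sigma> 22 (j * PP + v) = n - 1) * dp j v) =
      (\<Sum>v<PP. if v \<in> S j \<and> rk (plt j) (S j) v = n - 1 then dp j v else 0)" by (intro sum.cong refl 1) simp
    also have "\<dots> = partition.top n dp j (S j)" unfolding sum_if_set partition.top_def
     using S[of j] by (intro sum.cong) auto
    finally show ?thesis using 2 by (simp add: base2D[OF b] partition.val_def dp_def d_def)
   qed
   then show "(if j < eval eNC \<sigma> \<rho> then eval
    (eSum 4 ePP (Rd 21 (vJ \<otimes> ePP \<oplus> vP) \<otimes> eLt (Rd 22 (vJ \<otimes> ePP \<oplus> vP)) enn \<otimes> eDP vJ vP) \<oplus>
     enn \<otimes> eSum 4 ePP (Rd 21 (vJ \<otimes> ePP \<oplus> vP) \<otimes> eEq (Rd 22 (vJ \<otimes> ePP \<oplus> vP)) (enn \<ominus> Num 1) \<otimes> eDP vJ vP))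
    \<sigma> (\<rho>(2 := j)) else \<sigma> 23 j) = g j"
    unfolding g_def by (simp add: base2D[OF b] del: eval_eSum)
  qed
 qed (simp add: exp_defs)
 then show ?thesis by (rule that) (simp add: g_def)
qed

end

lemma find_idx_le: "find_idx m Q <= m"
 using find_idx_cases[of m Q] by auto

context inst2
begin

lemma eval_uns:
 assumes b: "base2 \<sigma>" and j: "\<not> uses 1 j"
 shows "eval (e_uns j) \<sigma> \<rho> = of_bool (cnt (\<sigma> 24) (\<rho> 0) (eval j \<sigma> \<rho>) < RR (eval j \<sigma> \<rho>))"
proof -
 have "(\<Sum>v<\<rho> 0. of_bool (\<sigma> 24 v = eval j \<sigma> \<rho>)) = cnt (\<sigma> 24) (\<rho> 0) (eval j \<sigma> \<rho>)"
  unfolding partition.cnt_def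
  by (subst sum_bool_card) (auto intro: arg_cong[where f = card])
 then show ?thesis by (simp add: e_uns_def base2D[OF b] eval_nouse[OF j, unfolded One_nat_def] del: sum_of_bool_eq)
qed

lemma c_sel_eff:
 assumes b: "base2 \<sigma>" and v: "!!j. j < nc ==> \<sigma> 23 j = V j"
 shows "dexec c_sel \<rho> \<sigma> = \<sigma>(24 := (\<sigma> 24)(\<rho> 0 := find_idx nc (%j. cnt (\<sigma> 24) (\<rho> 0) j < RR j \<and>
  (\<forall>j'<nc. \<not> cnt (\<sigma> 24) (\<rho> 0) j' < RR j' \<or> V j <= V j'))))"
proof -
 have "eval (eFind 2 eNC (e_uns vJ \<otimes>
   eAll 3 eNC (eOr (eNot (e_uns vJ')) (eLe (Rd 23 vJ) (Rd 23 vJ'))))) \<sigma> \<rho> =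
  find_idx nc (%j. cnt (\<sigma> 24) (\<rho> 0) j < RR j \<and>
   (\<forall>j'<nc. \<not> cnt (\<sigma> 24) (\<rho> 0) j' < RR j' \<or> V j <= V j'))"
  by (simp add: base2D[OF b] eval_uns[OF b], intro find_idx_cong refl) (auto simp: v)
 then show ?thesis by (simp add: c_sel_def wr_def del: eval_eFind)
qed

lemma c_clu_eff:
 assumes b: "base2 \<sigma>" and g: "!!j p. j < nc ==> p < PP ==> \<sigma> 21 (j * PP + p) = of_bool (p \<in> S j)"
  and S: "!!j. S j \<subseteq> {..<PP}" and h: "!!j p. j < nc ==> p < PP ==> \<sigma> 22 (j * PP + p) = rk (plt j) (S j) p"
 obtains K where "dexec c_clu \<rho> \<sigma> = \<sigma>(25 := (\<sigma> 25)(\<rho> 0 := K))"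
  "\<sigma> 24 (\<rho> 0) < nc \<longrightarrow> K = find_idx (\<rho> 0) (%\<kappa>. \<sigma> 25 \<kappa> = \<kappa> \<and> chunk (\<sigma> 24 (\<rho> 0)) (S (\<sigma> 24 (\<rho> 0))) \<inter> row \<sigma> 36 \<kappa> \<noteq> {})"
proof -
 let ?s = "\<sigma> 24 (\<rho> 0)"
 let ?K = "find_idx (\<rho> 0) (%\<kappa>. \<sigma> 25 \<kappa> = \<kappa> \<and>
  (\<exists>p<PP. \<sigma> 21 (?s * PP + p) \<noteq> 0 \<and> \<sigma> 22 (?s * PP + p) < n \<and> \<sigma> 36 (\<kappa> * PP + p) \<noteq> 0))"
 have "eval (eFind 1 vT (eEq (Rd 25 vT') vT' \<otimes>
   eEx 4 ePP (Rd 21 (Rd 24 vT \<otimes> ePP \<oplus> vP) \<otimes> eLt (Rd 22 (Rd 24 vT \<otimes> ePP \<oplus> vP)) enn \<otimes> e_tk vT' vP))) \<sigma> \<rho> = ?K"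
  by (simp add: base2D[OF b], intro find_idx_cong refl) auto
 then have "dexec c_clu \<rho> \<sigma> = \<sigma>(25 := (\<sigma> 25)(\<rho> 0 := ?K))"
  by (simp add: c_clu_def wr_def del: eval_eFind)
 moreover have "?K = find_idx (\<rho> 0) (%\<kappa>. \<sigma> 25 \<kappa> = \<kappa> \<and> chunk ?s (S ?s) \<inter> row \<sigma> 36 \<kappa> \<noteq> {})" if s: "?s < nc"
 proof (intro find_idx_cong refl conj_cong)
  fix \<kappa>
  have "(\<sigma> 21 (?s * PP + p) \<noteq> 0 \<and> \<sigma> 22 (?s * PP + p) < n) \<longleftrightarrow> p \<in> chunk ?s (S ?s)" if "p < PP" for p
   using g[OF s that] h[OF s that] by (auto simp: partition.chunk_def)
  then show "(\<exists>p<PP. \<sigma> 21 (?s * PP + p) \<noteq> 0 \<and> \<sigma> 22 (?s * PP + p) < n \<and> \<sigma> 36 (\<kappa> * PP + p) \<noteq> 0) =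
   (chunk ?s (S ?s) \<inter> row \<sigma> 36 \<kappa> \<noteq> {})"
   unfolding row_def by blast
 qed
 ultimately show ?thesis by (rule that[OF _ impI])
qed

lemma c_tmp_eff:
 assumes b: "base2 \<sigma>" and g: "!!j p. j < nc ==> p < PP ==> \<sigma> 21 (j * PP + p) = of_bool (p \<in> S j)"
  and h: "!!j p. j < nc ==> p < PP ==> \<sigma> 22 (j * PP + p) = rk (plt j) (S j) p"
 obtains f where "dexec c_tmp \<rho> \<sigma> = \<sigma>(35 := f)" "!!p. p < PP ==> f p <= 1"
  "!!p. \<sigma> 24 (\<rho> 0) < nc ==> p < PP ==> f p \<noteq> 0 \<longleftrightarrow> p \<in> S (\<sigma> 24 (\<rho> 0)) \<and>
   (if \<sigma> 25 (\<rho> 0) = \<rho> 0 then p \<in> chunk (\<sigma> 24 (\<rho> 0)) (S (\<sigma> 24 (\<rho> 0))) else p \<in> row \<sigma> 36 (\<sigma> 25 (\<rho> 0)))"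
proof -
 let ?s = "\<sigma> 24 (\<rho> 0)"
 define f where "f p = (if p < PP then of_bool (\<sigma> 21 (?s * PP + p) \<noteq> 0 \<and>
  (if \<sigma> 25 (\<rho> 0) = \<rho> 0 then \<sigma> 22 (?s * PP + p) < n else \<sigma> 36 (\<sigma> 25 (\<rho> 0) * PP + p) \<noteq> 0)) else \<sigma> 35 p)" for p
 have "dexec c_tmp \<rho> \<sigma> = \<sigma>(35 := f)"
  unfolding c_tmp_def
  by (subst dexec_fill0, simp add: exp_defs)
   (rule arg_cong[where f = "%g. \<sigma>(35 := g)"], rule ext, simp add: base2D[OF b] f_def)
 then show ?thesis
 proof (rule that)
  show "f p <= 1" if "p < PP" for p using that by (simp add: f_def)
  show "f p \<noteq> 0 \<longleftrightarrow> p \<in> S ?s \<and> (if \<sigma> 25 (\<rho> 0) = \<rho> 0 then p \<in> chunk ?s (S ?s) else p \<in> row \<sigma> 36 (\<sigma> 25 (\<rho> 0)))"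
   if "?s < nc" "p < PP" for p
   using g[OF that] h[OF that] that(2) by (auto simp: f_def partition.chunk_def row_def)
 qed
qed

lemma c_tk_eff:
 assumes b: "base2 \<sigma>"
 shows "dexec c_tk \<rho> \<sigma> = \<sigma>(36 := (%k. if \<rho> 0 * PP <= k \<and> k < \<rho> 0 * PP + PP then \<sigma> 35 (k - \<rho> 0 * PP) else \<sigma> 36 k))"
 unfolding c_tk_def
 by (subst dexec_fill, simp, simp, simp) (simp add: base2D[OF b] cong: if_cong)

lemma row_disjoint: "t' < t ==> p < PP ==> t' * PP + p < t * PP"
 by (rule idx(1))

text \<open>The last conjunct is for the later stages: entries bounded by 1 let them count
  \<open>tk t\<close>, and ranks in it, by plain summation.\<close>

lemma part_loop:
 fixes \<rho> :: env
 assumes b: "base2 \<sigma>"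
 defines "\<tau> \<equiv> dexec c_part \<rho> \<sigma>"
 shows "base2 \<tau> \<and> (\<forall>t<H. part_ok (\<tau> 24) (\<tau> 25) (row \<tau> 36) t) \<and> (\<forall>t<H. \<forall>p<PP. \<tau> 36 (t * PP + p) <= 1)"
proof -
 let ?body = "c_pool ;; c_rk ;; c_val ;; c_sel ;; c_clu ;; c_tmp ;; c_tk"
 have "eval eHH \<sigma> \<rho> = H" by (simp add: base2D[OF b])
 then have eq: "\<tau> = det_loop (%v. dexec ?body (\<rho>(0 := v))) H 0 \<sigma>"
  unfolding \<tau>_def c_part_def dexec.simps(4) by (simp only:)
 show ?thesis unfolding eq
 proof (rule det_loop_inv[where Q = "%m \<tau>. base2 \<tau> \<and> (\<forall>t<m. part_ok (\<tau> 24) (\<tau> 25) (row \<tau> 36) t) \<and>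
   (\<forall>t<m. \<forall>p<PP. \<tau> 36 (t * PP + p) <= 1)"])
  fix t \<tau> assume "base2 \<tau> \<and> (\<forall>t'<t. part_ok (\<tau> 24) (\<tau> 25) (row \<tau> 36) t') \<and> (\<forall>t'<t. \<forall>p<PP. \<tau> 36 (t' * PP + p) <= 1)"
  then have b0: "base2 \<tau>" and ok: "!!t'. t' < t ==> part_ok (\<tau> 24) (\<tau> 25) (row \<tau> 36) t'"
   and le1: "!!t' p. t' < t ==> p < PP ==> \<tau> 36 (t' * PP + p) <= 1" by auto
  let ?\<rho> = "\<rho>(0 := t)"
  define S where "S = pool (\<tau> 24) (row \<tau> 36) t"
  have Ssub: "S j \<subseteq> {..<PP}" for j by (auto simp: S_def partition.pool_def Pset_def)
  obtain g1 where g1: "dexec c_pool ?\<rho> \<tau> = \<tau>(21 := g1)"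
   "!!j p. j < nc ==> p < PP ==> g1 (j * PP + p) = of_bool (p \<in> S j)"
   using c_pool_eff[OF b0, of ?\<rho>] unfolding S_def fun_upd_same by metis
  define \<tau>1 where "\<tau>1 = \<tau>(21 := g1)"
  have b1: "base2 \<tau>1" unfolding \<tau>1_def by (rule base2_upd[OF b0]) simp
  have h1: "\<tau>1 21 (j * PP + p) = of_bool (p \<in> S j)" if "j < nc" "p < PP" for j p
   using g1(2)[OF that] by (simp add: \<tau>1_def)
  obtain g2 where g2: "dexec c_rk ?\<rho> \<tau>1 = \<tau>1(22 := g2)"
   "!!j p. j < nc ==> p < PP ==> g2 (j * PP + p) = rk (plt j) (S j) p"
   using c_rk_eff[OF b1 h1 Ssub] by metis
  define \<tau>2 where "\<tau>2 = \<tau>1(22 := g2)"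
  have b2: "base2 \<tau>2" unfolding \<tau>2_def by (rule base2_upd[OF b1]) simp
  have h2: "\<tau>2 21 (j * PP + p) = of_bool (p \<in> S j)" "\<tau>2 22 (j * PP + p) = rk (plt j) (S j) p"
   if "j < nc" "p < PP" for j p
   using h1[OF that] g2(2)[OF that] by (simp_all add: \<tau>2_def)
  obtain g3 where g3: "dexec c_val ?\<rho> \<tau>2 = \<tau>2(23 := g3)" "!!j. j < nc ==> g3 j = val j (S j)"
   using c_val_eff[OF b2 h2(1) Ssub h2(2)] by metis
  define \<tau>3 where "\<tau>3 = \<tau>2(23 := g3)"
  have b3: "base2 \<tau>3" unfolding \<tau>3_def by (rule base2_upd[OF b2]) simp
  define s where "s = find_idx nc (%j. cnt (\<tau> 24) t j < RR j \<and>
   (\<forall>j'<nc. \<not> cnt (\<tau> 24) t j' < RR j' \<or> val j (S j) <= val j' (S j')))"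
  define \<tau>4 where "\<tau>4 = \<tau>3(24 := (\<tau> 24)(t := s))"
  have 4: "dexec c_sel ?\<rho> \<tau>3 = \<tau>4"
  proof -
   have v: "\<tau>3 23 j = val j (S j)" if "j < nc" for j using g3(2)[OF that] by (simp add: \<tau>3_def)
   have "\<tau>3 24 = \<tau> 24" by (simp add: \<tau>1_def \<tau>2_def \<tau>3_def)
   then show ?thesis
    using c_sel_eff[OF b3, where V = "%j. val j (S j)" and \<rho> = ?\<rho>, OF v] unfolding \<tau>4_def s_def fun_upd_same by (simp only:)
  qed
  have b4: "base2 \<tau>4" unfolding \<tau>4_def by (rule base2_upd[OF b3]) simp
  have h4: "\<tau>4 21 (j * PP + p) = of_bool (p \<in> S j)" "\<tau>4 22 (j * PP + p) = rk (plt j) (S j) p"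
   if "j < nc" "p < PP" for j p
   using h2[OF that] by (simp_all add: \<tau>3_def \<tau>4_def)
  have s4: "\<tau>4 24 (?\<rho> 0) = s" "\<tau>4 25 = \<tau> 25" "row \<tau>4 36 = row \<tau> 36"
   by (auto simp: \<tau>4_def \<tau>3_def \<tau>2_def \<tau>1_def row_def fun_eq_iff)
  obtain K where K: "dexec c_clu ?\<rho> \<tau>4 = \<tau>4(25 := (\<tau>4 25)(?\<rho> 0 := K))"
   "\<tau>4 24 (?\<rho> 0) < nc \<longrightarrow> K = find_idx (?\<rho> 0) (%\<kappa>. \<tau>4 25 \<kappa> = \<kappa> \<and> chunk (\<tau>4 24 (?\<rho> 0)) (S (\<tau>4 24 (?\<rho> 0))) \<inter> row \<tau>4 36 \<kappa> \<noteq> {})"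
   by (rule c_clu_eff[OF b4 h4(1) Ssub h4(2), of ?\<rho>])
  have K': "s < nc ==> K = find_idx t (%\<kappa>. \<tau> 25 \<kappa> = \<kappa> \<and> chunk s (S s) \<inter> row \<tau> 36 \<kappa> \<noteq> {})"
   using K(2) unfolding fun_upd_same s4[unfolded fun_upd_same] by (rule mp)
  define \<tau>5 where "\<tau>5 = \<tau>4(25 := (\<tau> 25)(t := K))"
  have 5: "dexec c_clu ?\<rho> \<tau>4 = \<tau>5" using K(1) unfolding s4 fun_upd_same \<tau>5_def .
  have b5: "base2 \<tau>5" unfolding \<tau>5_def by (rule base2_upd[OF b4]) simp
  have h5: "\<tau>5 21 (j * PP + p) = of_bool (p \<in> S j)" "\<tau>5 22 (j * PP + p) = rk (plt j) (S j) p"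
   if "j < nc" "p < PP" for j p
   using h4[OF that] by (simp_all add: \<tau>5_def)
  have s5: "\<tau>5 24 (?\<rho> 0) = s" "\<tau>5 25 (?\<rho> 0) = K" "row \<tau>5 36 = row \<tau> 36"
   by (auto simp: \<tau>5_def \<tau>4_def \<tau>3_def \<tau>2_def \<tau>1_def row_def fun_eq_iff)
  obtain f where f: "dexec c_tmp ?\<rho> \<tau>5 = \<tau>5(35 := f)" "!!p. p < PP ==> f p <= 1"
   "!!p. \<tau>5 24 (?\<rho> 0) < nc ==> p < PP ==> f p \<noteq> 0 \<longleftrightarrow> p \<in> S (\<tau>5 24 (?\<rho> 0)) \<and>
   (if \<tau>5 25 (?\<rho> 0) = ?\<rho> 0 then p \<in> chunk (\<tau>5 24 (?\<rho> 0)) (S (\<tau>5 24 (?\<rho> 0))) else p \<in> row \<tau>5 36 (\<tau>5 25 (?\<rho> 0)))"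
   using c_tmp_eff[OF b5 h5, of ?\<rho>] by metis
  have f': "f p \<noteq> 0 \<longleftrightarrow> p \<in> S s \<and> (if K = t then p \<in> chunk s (S s) else p \<in> row \<tau> 36 K)" if "s < nc" "p < PP" for p
   using f(3) that unfolding fun_upd_same s5[unfolded fun_upd_same] by blast
  define \<tau>6 where "\<tau>6 = \<tau>5(35 := f)"
  have b6: "base2 \<tau>6" unfolding \<tau>6_def by (rule base2_upd[OF b5]) simp
  define \<tau>7 where "\<tau>7 = \<tau>6(36 := (%k. if t * PP <= k \<and> k < t * PP + PP then f (k - t * PP) else \<tau> 36 k))"
  have 7: "dexec c_tk ?\<rho> \<tau>6 = \<tau>7"
   unfolding c_tk_eff[OF b6] \<tau>7_def
   by (simp add: \<tau>6_def \<tau>5_def \<tau>4_def \<tau>3_def \<tau>2_def \<tau>1_def cong: if_cong)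
  have b7: "base2 \<tau>7" unfolding \<tau>7_def by (rule base2_upd[OF b6]) simp
  have body: "dexec ?body ?\<rho> \<tau> = \<tau>7"
   by (simp only: dexec.simps(3) g1(1) \<tau>1_def[symmetric] g2(1) \<tau>2_def[symmetric] g3(1) \<tau>3_def[symmetric]
     4 5 f(1) \<tau>6_def[symmetric] 7)
  have old36: "\<tau>7 36 (t' * PP + p) = \<tau> 36 (t' * PP + p)" if "t' < t" "p < PP" for t' p
   using row_disjoint[OF that] by (simp add: \<tau>7_def)
  have new36: "\<tau>7 36 (t * PP + p) = f p" if "p < PP" for p using that by (simp add: \<tau>7_def)
  have r: "row \<tau>7 36 t' = row \<tau> 36 t'" if "t' < t" for t'
   unfolding row_def using old36[OF that] by auto
  have s7: "\<tau>7 24 = (\<tau> 24)(t := s)" "\<tau>7 25 = (\<tau> 25)(t := K)"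
   by (simp_all add: \<tau>7_def \<tau>6_def \<tau>5_def \<tau>4_def)
  have old: "part_ok (\<tau>7 24) (\<tau>7 25) (row \<tau>7 36) t'" if "t' < t" for t'
   using ok[OF that] that r s7 by (subst part_ok_cong[where sel' = "\<tau> 24" and clu' = "\<tau> 25" and tk' = "row \<tau> 36"]) auto
  have pS: "pool (\<tau>7 24) (row \<tau>7 36) t j = S j" for j
   unfolding S_def by (rule pool_cong) (use r s7 in auto)
  have cS: "cnt (\<tau>7 24) t j = cnt (\<tau> 24) t j" for j by (rule cnt_cong) (use s7 in auto)
  have new: "part_ok (\<tau>7 24) (\<tau>7 25) (row \<tau>7 36) t"
   unfolding part_ok_def pS cS
  proof (intro conjI impI)
   show "\<tau>7 24 t = find_idx nc (%j. cnt (\<tau> 24) t j < RR j \<and>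
    (\<forall>j'<nc. \<not> cnt (\<tau> 24) t j' < RR j' \<or> val j (S j) <= val j' (S j')))" by (simp add: s7 s_def)
   assume "\<tau>7 24 t < nc"
   then have s: "s < nc" "\<tau>7 24 t = s" "\<tau>7 25 t = K" by (simp_all add: s7)
   have "find_idx t (%\<kappa>. \<tau>7 25 \<kappa> = \<kappa> \<and> chunk s (S s) \<inter> row \<tau>7 36 \<kappa> \<noteq> {}) =
    find_idx t (%\<kappa>. \<tau> 25 \<kappa> = \<kappa> \<and> chunk s (S s) \<inter> row \<tau> 36 \<kappa> \<noteq> {})"
    by (intro find_idx_cong refl) (simp add: s7 r)
   then show clu: "\<tau>7 25 t = find_idx t (%\<kappa>. \<tau>7 25 \<kappa> = \<kappa> \<and> chunk (\<tau>7 24 t) (S (\<tau>7 24 t)) \<inter> row \<tau>7 36 \<kappa> \<noteq> {})"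
    using K'[OF s(1)] s by simp
   have Kt: "K <= t" unfolding K'[OF s(1)] by (rule find_idx_le)
   have "row \<tau>7 36 t = {p. p < PP \<and> f p \<noteq> 0}" unfolding row_def using new36 by auto
   also have "\<dots> = (if K = t then chunk s (S s) else S s \<inter> row \<tau>7 36 K)"
   proof (cases "K = t")
    case True
    then show ?thesis using f'[OF s(1)] Ssub[of s] by (auto simp: partition.chunk_def)
   next
    case False
    then have "row \<tau>7 36 K = row \<tau> 36 K" using Kt by (intro r) simp
    then show ?thesis using False f'[OF s(1)] Ssub[of s] by auto
   qed
   finally show "row \<tau>7 36 t = (if \<tau>7 25 t = t then chunk (\<tau>7 24 t) (S (\<tau>7 24 t))
    else S (\<tau>7 24 t) \<inter> row \<tau>7 36 (\<tau>7 25 t))" using s by simp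
  qed
  have "\<tau>7 36 (t' * PP + p) <= 1" if "t' < Suc t" "p < PP" for t' p
   using that old36[of t' p] new36[of p] le1[of t' p] f(2)[of p] by (cases "t' = t") auto
  then show "base2 (dexec ?body ?\<rho> \<tau>) \<and>
   (\<forall>t'<Suc t. part_ok (dexec ?body ?\<rho> \<tau> 24) (dexec ?body ?\<rho> \<tau> 25) (row (dexec ?body ?\<rho> \<tau>) 36) t') \<and>
   (\<forall>t'<Suc t. \<forall>p<PP. dexec ?body ?\<rho> \<tau> 36 (t' * PP + p) <= 1)"
   unfolding body using b7 old new less_Suc_eq by metis
 qed (use b in simp)
qed

definition "fill_ok sel tk fl t \<longleftrightarrow>
 fl t = {p \<in> free sel tk fl t. rk (<) (free sel tk fl t) p + card (tk t) < N}"

lemma free_cong: "(!!t'. t' < t ==> fl t' = fl' t') ==> free sel tk fl t = free sel tk fl' t"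
 unfolding partition.free_def by (intro Collect_cong) auto

lemma fill_loop:
 fixes \<rho> :: env
 assumes b: "base2 \<sigma>" and le1: "!!t p. t < H ==> p < PP ==> \<sigma> 36 (t * PP + p) <= 1"
 defines "\<tau> \<equiv> dexec c_fill \<rho> \<sigma>"
 shows "\<forall>t<H. fill_ok (\<tau> 24) (row \<tau> 36) (row \<tau> 28) t"
proof -
 let ?body = "c_free ;; c_fl"
 have "eval eHH \<sigma> \<rho> = H" by (simp add: base2D[OF b])
 then have eq: "\<tau> = det_loop (%v. dexec ?body (\<rho>(0 := v))) H 0 \<sigma>"
  unfolding \<tau>_def c_fill_def dexec.simps(4) by (simp only:)
 let ?sel = "\<sigma> 24" and ?tk = "row \<sigma> 36"
 have "base2 \<tau> \<and> \<tau> 24 = ?sel \<and> \<tau> 36 = \<sigma> 36 \<and> (\<forall>t<H. fill_ok ?sel ?tk (row \<tau> 28) t)"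
  unfolding eq
 proof (rule det_loop_inv[where Q = "%m \<tau>. base2 \<tau> \<and> \<tau> 24 = ?sel \<and> \<tau> 36 = \<sigma> 36 \<and>
   (\<forall>t<m. fill_ok ?sel ?tk (row \<tau> 28) t)"])
  fix t \<tau> assume tH: "t < H" and "base2 \<tau> \<and> \<tau> 24 = ?sel \<and> \<tau> 36 = \<sigma> 36 \<and> (\<forall>t'<t. fill_ok ?sel ?tk (row \<tau> 28) t')"
  then have b0: "base2 \<tau>" and e: "\<tau> 24 = ?sel" "\<tau> 36 = \<sigma> 36"
   and ok: "!!t'. t' < t ==> fill_ok ?sel ?tk (row \<tau> 28) t'" by auto
  let ?\<rho> = "\<rho>(0 := t)"
  define F where "F = free ?sel ?tk (row \<tau> 28) t"
  have Fsub: "F \<subseteq> {..<PP}" by (auto simp: F_def partition.free_def Pset_def)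
  define g where "g p = (if p < PP then of_bool (p \<in> F) else \<tau> 27 p)" for p
  define \<tau>1 where "\<tau>1 = \<tau>(27 := g)"
  have 1: "dexec c_free ?\<rho> \<tau> = \<tau>1"
   unfolding c_free_def \<tau>1_def
   by (subst dexec_fill0, simp add: exp_defs)
    (rule arg_cong[where f = "%g. \<tau>(27 := g)"], rule ext,
     simp add: base2D[OF b0] e g_def F_def partition.free_def Pset_def row_def)
  have b1: "base2 \<tau>1" unfolding \<tau>1_def by (rule base2_upd[OF b0]) simp
  define h where "h p = (of_bool (p \<in> F \<and> rk (<) F p + card (?tk t) < N) :: nat)" for p
  define \<tau>2 where "\<tau>2 = \<tau>1(28 := (%k. if t * PP <= k \<and> k < t * PP + PP then h (k - t * PP) else \<tau> 28 k))"
  have hv: "g p * of_bool ((\<Sum>p'<p. g p') + (\<Sum>p'<PP. \<sigma> 36 (t * PP + p')) < N) = h p" if p: "p < PP" for p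
  proof -
   have "(\<Sum>p'<p. g p') = card {v. v < p \<and> g v \<noteq> 0}" by (rule sum_bool_card) (use p in \<open>simp add: g_def\<close>)
   also have "{v. v < p \<and> g v \<noteq> 0} = {v \<in> F. v < p}" using p Fsub by (auto simp: g_def)
   finally have 1: "(\<Sum>p'<p. g p') = rk (<) F p" by (simp add: rk_def)
   have 2: "(\<Sum>p'<PP. \<sigma> 36 (t * PP + p')) = card (?tk t)"
    unfolding row_def by (rule sum_bool_card) (rule le1[OF tH])
   show ?thesis unfolding 1 2 h_def using p by (simp add: g_def)
  qed
  have 2: "dexec c_fl ?\<rho> \<tau>1 = \<tau>2"
   unfolding c_fl_def \<tau>2_def
  proof (subst dexec_fill)
   show "\<tau>1(28 := %k. if eval (vT \<otimes> ePP) \<tau>1 ?\<rho> <= k \<and> k < eval (vT \<otimes> ePP) \<tau>1 ?\<rho> + eval ePP \<tau>1 ?\<rho>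
     then eval (Rd 27 vP \<otimes> eLt (eSum 5 vP (Rd 27 vP') \<oplus> eSum 5 ePP (e_tk vT vP')) eNN) \<tau>1 (?\<rho>(4 := k - eval (vT \<otimes> ePP) \<tau>1 ?\<rho>))
     else \<tau>1 28 k) =
    \<tau>1(28 := %k. if t * PP <= k \<and> k < t * PP + PP then h (k - t * PP) else \<tau> 28 k)"
   proof (rule arg_cong[where f = "%g. \<tau>1(28 := g)"], rule ext)
    fix k
    have "\<tau>1 36 = \<sigma> 36" "\<tau>1 27 = g" "\<tau>1 28 = \<tau> 28" using e by (simp_all add: \<tau>1_def)
    note u = this
    have ev: "eval (vT \<otimes> ePP) \<tau>1 ?\<rho> = t * PP" "eval ePP \<tau>1 ?\<rho> = PP" by (simp_all add: base2D[OF b1])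
    have bd: "eval (Rd 27 vP \<otimes> eLt (eSum 5 vP (Rd 27 vP') \<oplus> eSum 5 ePP (e_tk vT vP')) eNN) \<tau>1 (?\<rho>(4 := p)) =
     g p * of_bool ((\<Sum>p'<p. g p') + (\<Sum>p'<PP. \<sigma> 36 (t * PP + p')) < N)" for p
     by (simp add: base2D[OF b1] u)
    show "(if eval (vT \<otimes> ePP) \<tau>1 ?\<rho> <= k \<and> k < eval (vT \<otimes> ePP) \<tau>1 ?\<rho> + eval ePP \<tau>1 ?\<rho>
     then eval (Rd 27 vP \<otimes> eLt (eSum 5 vP (Rd 27 vP') \<oplus> eSum 5 ePP (e_tk vT vP')) eNN) \<tau>1 (?\<rho>(4 := k - eval (vT \<otimes> ePP) \<tau>1 ?\<rho>))
     else \<tau>1 28 k) = (if t * PP <= k \<and> k < t * PP + PP then h (k - t * PP) else \<tau> 28 k)"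
    proof (cases "t * PP <= k \<and> k < t * PP + PP")
     case True
     then have "k - t * PP < PP" by linarith
     from hv[OF this] show ?thesis unfolding ev bd if_P[OF True] .
    next
     case False
     show ?thesis unfolding ev if_not_P[OF False] by (rule fun_cong[OF u(3)])
    qed
   qed
  qed (simp_all add: exp_defs)
  have b2: "base2 \<tau>2" unfolding \<tau>2_def by (rule base2_upd[OF b1]) simp
  have body: "dexec ?body ?\<rho> \<tau> = \<tau>2" by (simp only: dexec.simps(3) 1 2)
  have r: "row \<tau>2 28 t' = row \<tau> 28 t'" if "t' < t" for t'
  proof -
   have "\<tau>2 28 (t' * PP + p) = \<tau> 28 (t' * PP + p)" if "p < PP" for p
    using row_disjoint[OF \<open>t' < t\<close> that] by (simp add: \<tau>2_def)
   then show ?thesis unfolding row_def by auto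
  qed
  have fr: "free ?sel ?tk (row \<tau>2 28) t' = free ?sel ?tk (row \<tau> 28) t'" if "t' <= t" for t'
   by (rule free_cong) (use r that in auto)
  have old: "fill_ok ?sel ?tk (row \<tau>2 28) t'" if "t' < t" for t'
   using ok[OF that] fr[of t'] r[OF that] that by (simp add: fill_ok_def)
  have "row \<tau>2 28 t = {p. p < PP \<and> h p \<noteq> 0}"
  proof -
   have "\<tau>2 28 (t * PP + p) = h p" if "p < PP" for p using that by (simp add: \<tau>2_def)
   then show ?thesis unfolding row_def by auto
  qed
  also have "\<dots> = {p \<in> F. rk (<) F p + card (?tk t) < N}" using Fsub by (auto simp: h_def)
  finally have new: "fill_ok ?sel ?tk (row \<tau>2 28) t" unfolding fill_ok_def fr[OF order.refl] F_def .
  have "\<tau>2 24 = ?sel" "\<tau>2 36 = \<sigma> 36" using e by (simp_all add: \<tau>2_def \<tau>1_def)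
  then show "base2 (dexec ?body ?\<rho> \<tau>) \<and> dexec ?body ?\<rho> \<tau> 24 = ?sel \<and> dexec ?body ?\<rho> \<tau> 36 = \<sigma> 36 \<and>
   (\<forall>t'<Suc t. fill_ok ?sel ?tk (row (dexec ?body ?\<rho> \<tau>) 28) t')"
   unfolding body using b2 old new less_Suc_eq by metis
 qed (use b in simp)
 then have e: "\<tau> 24 = ?sel" "\<tau> 36 = \<sigma> 36" and ok: "\<forall>t<H. fill_ok ?sel ?tk (row \<tau> 28) t" by blast+
 have "row \<tau> 36 = ?tk" using e(2) by (simp add: row_def fun_eq_iff)
 then show ?thesis using ok e(1) by simp
qed

end

section \<open>Deterministic rounding of the large part of the solution\<close>

lemma fill_table0:
 assumes "\<not> reads a e" "eval m \<sigma> \<rho> = M" "!!k. k < M ==> eval e \<sigma> (\<rho>(x := k)) = f k"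
 shows "\<exists>g. dexec (For x m (Wr a (Var x) e)) \<rho> \<sigma> = \<sigma>(a := g) \<and> (\<forall>k<M. g k = f k)"
proof -
 have "(%k. if k < M then eval e \<sigma> (\<rho>(x := k)) else \<sigma> a k) k = f k" if "k < M" for k
  using that assms(3) by simp
 then show ?thesis using dexec_fill0[OF assms(1), of x m \<rho> \<sigma>] unfolding assms(2) by blast
qed

lemma fill_table:
 assumes "\<not> reads a e" "\<not> reads a m" "\<not> uses x m" "\<not> uses y m" "x \<noteq> y"
  "eval l \<sigma> \<rho> = L" "eval m \<sigma> \<rho> = M" "!!i j. i < L ==> j < M ==> eval e \<sigma> (\<rho>(x := i, y := j)) = f i j"
 shows "\<exists>g. dexec (For x l (For y m (Wr a (Var x \<otimes> m \<oplus> Var y) e))) \<rho> \<sigma> = \<sigma>(a := g) \<and>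
  (\<forall>i<L. \<forall>j<M. g (i * M + j) = f i j)"
proof -
 have "(%k. if k < L * M then eval e \<sigma> (\<rho>(x := k div M, y := k mod M)) else \<sigma> a k) (i * M + j) = f i j"
  if ij: "i < L" "j < M" for i j
 proof -
  have "Suc i * M <= L * M" using ij by (intro mult_right_mono) auto
  then have "i * M + j < L * M" using ij by simp
  then show ?thesis using row_index[OF ij(2), of i] assms(8)[OF ij] by simp
 qed
 then show ?thesis
  using dexec_table[OF assms(1-5) assms(7)[symmetric], of l] unfolding assms(6) by blast
qed

text \<open>Filling up to the total \<open>B\<close> in order of the index: each term takes as much
  as the previous ones have left over.\<close>

lemma sum_prefix_min:
 fixes a :: "nat => nat"
 shows "(\<Sum>i<m. min (a i) (B - (\<Sum>k<i. a k))) = min (\<Sum>i<m. a i) B"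
 by (induction m) auto

lemma sum_pieces:
 fixes f :: "nat => 'a :: semiring_1"
 assumes a: "!!i. i < m ==> a i <= M"
 shows "(\<Sum>p | p < m * M \<and> p mod M < a (p div M). f (p div M)) = (\<Sum>i<m. of_nat (a i) * f i)"
proof -
 let ?h = "%p. if p mod M < a (p div M) then f (p div M) else 0"
 have "(\<Sum>p | p < m * M \<and> p mod M < a (p div M). f (p div M)) = (\<Sum>p<m * M. ?h p)"
  by (rule sum.mono_neutral_cong_left) auto
 also have "\<dots> = (\<Sum>i<m. sum ?h {i * M..<i * M + M})" by (rule sum.nat_group[symmetric])
 also have "\<dots> = (\<Sum>i<m. of_nat (a i) * f i)"
 proof (intro sum.cong refl)
  fix i assume "i \<in> {..<m}"
  then have i: "a i <= M" by (intro a) simp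
  have "sum ?h {i * M..<i * M + M} = (\<Sum>k<M. ?h (k + i * M))"
   using sum.shift_bounds_nat_ivl[of ?h 0 "i * M" M] by (simp add: atLeast0LessThan add.commute)
  also have "\<dots> = (\<Sum>k<M. if k < a i then f i else 0)"
   using row_index[of _ M i] by (intro sum.cong refl) (simp add: add.commute)
  also have "\<dots> = (\<Sum>k<a i. f i)" using i by (intro sum.mono_neutral_cong_right) auto
  finally show "sum ?h {i * M..<i * M + M} = of_nat (a i) * f i" by simp
 qed
 finally show ?thesis .
qed

context inst
begin

text \<open>One facility fewer than \<open>N\<close> allows is rounded deterministically. A site
  with at least \<open>N\<close> units thereby keeps at least \<open>N\<close>, so that a remainder
  of \<open>X i j\<close> modulo \<open>N\<close>, which may exceed the remainder of
  \<open>Y i\<close>, still fits.\<close>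

definition "qf Y i = Y i div N - 1" for Y :: "nat => nat"
definition "hf Y X i j = min (X i j div N) (qf Y i)" for X :: "nat => nat => nat"
definition "Rf Y X j = min (r j - (\<Sum>i<ns. hf Y X i j)) (2 * ns)"
definition "Yr Y i = Y i - N * qf Y i"
definition "Xd Y X i j = X i j - N * hf Y X i j"
text \<open>The leftover connections may cover more than is still needed. They are cut off in the
  order of the sites, which makes their sum exactly \<open>N * Rf Y X j\<close>, the number of
  pieces that the partition expects.\<close>

definition "Xr Y X i j = min (Xd Y X i j) (N * Rf Y X j - (\<Sum>k<i. Xd Y X k j))"

definition "c_prep = c_y ;; c_x ;; c_q ;; c_xh ;; c_r ;; c_yr ;; c_xr ;; c_h ;; c_inp"

definition "prep_ok Y X \<tau> \<longleftrightarrow> base \<tau> \<and> (\<forall>i<ns. \<tau> 14 i = qf Y i) \<and> (\<forall>i<ns. \<tau> 17 i = Yr Y i) \<and>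
 (\<forall>i<ns. \<forall>j<nc. \<tau> 15 (i * nc + j) = hf Y X i j) \<and> (\<forall>j<nc. \<tau> 16 j = Rf Y X j) \<and>
 \<tau> 19 0 = (\<Sum>j<nc. Rf Y X j) \<and>
 (\<forall>j<nc. \<forall>p<PP. \<tau> 20 (j * PP + p) = of_bool (p mod (2 * N) < Xr Y X (p div (2 * N)) j))"

lemma prep:
 fixes \<rho> :: env
 assumes b: "base \<sigma>"
 shows "prep_ok (Yf (\<sigma> 9) (\<sigma> 11)) (Xf (rowA \<sigma>) (\<sigma> 9) (\<sigma> 11)) (dexec c_prep \<rho> \<sigma>)"
proof -
 define Y where "Y = Yf (\<sigma> 9) (\<sigma> 11)"
 define X where "X = Xf (rowA \<sigma>) (\<sigma> 9) (\<sigma> 11)"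
 have "\<exists>g1. dexec c_y \<rho> \<sigma> = \<sigma>(12 := g1) \<and> (\<forall>i<ns. g1 i = Y i)"
  unfolding c_y_def
 proof (rule fill_table0)
  show "eval (eSum 0 (eNC \<otimes> eNN) (eEq (Rd 9 vT \<oslash> eNC) vI \<otimes> Rd 11 vT)) \<sigma> (\<rho>(8 := i)) = Y i" for i
   by (simp add: baseD[OF b] Y_def Yf_def del: sum_of_bool_mult_eq)
 qed (simp_all add: exp_defs baseD[OF b])
 then obtain g1 where g1_: "dexec c_y \<rho> \<sigma> = \<sigma>(12 := g1)" "\<forall>i<ns. g1 i = Y i" by blast
 note g1 = g1_(1) g1_(2)[rule_format]
 define \<sigma>1 where "\<sigma>1 = \<sigma>(12 := g1)"
 have b1: "base \<sigma>1" unfolding \<sigma>1_def by (rule base_upd[OF b]) simp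
 have "\<exists>g2. dexec c_x \<rho> \<sigma>1 = \<sigma>1(13 := g2) \<and> (\<forall>i<ns. \<forall>j<nc. g2 (i * nc + j) = X i j)"
  unfolding c_x_def
 proof (rule fill_table)
  show "eval (eSum 0 (eNC \<otimes> eNN) (eEq (Rd 9 vT \<oslash> eNC) vI \<otimes> (Rd 10 (vT \<otimes> eNC \<oplus> vJ) \<otimes> Rd 11 vT)))
   \<sigma>1 (\<rho>(8 := i, 2 := j)) = X i j" for i j
   using baseD[OF b] by (simp add: \<sigma>1_def X_def Xf_def del: sum_of_bool_mult_eq)
 qed (simp_all add: exp_defs baseD[OF b1])
 then obtain g2 where g2_: "dexec c_x \<rho> \<sigma>1 = \<sigma>1(13 := g2)" "\<forall>i<ns. \<forall>j<nc. g2 (i * nc + j) = X i j" by blast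
 note g2 = g2_(1) g2_(2)[rule_format]
 define \<sigma>2 where "\<sigma>2 = \<sigma>1(13 := g2)"
 have b2: "base \<sigma>2" unfolding \<sigma>2_def by (rule base_upd[OF b1]) simp
 have y2: "\<sigma>2 12 i = Y i" if "i < ns" for i using g1(2)[OF that] by (simp add: \<sigma>2_def \<sigma>1_def)
 have x2: "\<sigma>2 13 (i * nc + j) = X i j" if "i < ns" "j < nc" for i j using g2(2)[OF that] by (simp add: \<sigma>2_def)
 have "\<exists>g3. dexec c_q \<rho> \<sigma>2 = \<sigma>2(14 := g3) \<and> (\<forall>i<ns. g3 i = qf Y i)"
  unfolding c_q_def
  by (rule fill_table0) (simp_all add: baseD[OF b2] qf_def y2)
 then obtain g3 where g3_: "dexec c_q \<rho> \<sigma>2 = \<sigma>2(14 := g3)" "\<forall>i<ns. g3 i = qf Y i" by blast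
 note g3 = g3_(1) g3_(2)[rule_format]
 define \<sigma>3 where "\<sigma>3 = \<sigma>2(14 := g3)"
 have b3: "base \<sigma>3" unfolding \<sigma>3_def by (rule base_upd[OF b2]) simp
 have y3: "\<sigma>3 12 i = Y i" "\<sigma>3 14 i = qf Y i" if "i < ns" for i using y2[OF that] g3(2)[OF that] by (simp_all add: \<sigma>3_def)
 have x3: "\<sigma>3 13 (i * nc + j) = X i j" if "i < ns" "j < nc" for i j using x2[OF that] by (simp add: \<sigma>3_def)
 have "\<exists>g4. dexec c_xh \<rho> \<sigma>3 = \<sigma>3(15 := g4) \<and> (\<forall>i<ns. \<forall>j<nc. g4 (i * nc + j) = hf Y X i j)"
  unfolding c_xh_def
 proof (rule fill_table)
  show "eval (eMin (Rd 13 (vI \<otimes> eNC \<oplus> vJ) \<oslash> eNN) (Rd 14 vI)) \<sigma>3 (\<rho>(8 := i, 2 := j)) = hf Y X i j"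
   if "i < ns" "j < nc" for i j
   by (simp add: baseD[OF b3] hf_def y3[OF that(1)] x3[OF that])
 qed (simp_all add: exp_defs baseD[OF b3])
 then obtain g4 where g4_: "dexec c_xh \<rho> \<sigma>3 = \<sigma>3(15 := g4)" "\<forall>i<ns. \<forall>j<nc. g4 (i * nc + j) = hf Y X i j" by blast
 note g4 = g4_(1) g4_(2)[rule_format]
 define \<sigma>4 where "\<sigma>4 = \<sigma>3(15 := g4)"
 have b4: "base \<sigma>4" unfolding \<sigma>4_def by (rule base_upd[OF b3]) simp
 have y4: "\<sigma>4 12 i = Y i" "\<sigma>4 14 i = qf Y i" if "i < ns" for i using y3[OF that] by (simp_all add: \<sigma>4_def)
 have x4: "\<sigma>4 13 (i * nc + j) = X i j" "\<sigma>4 15 (i * nc + j) = hf Y X i j" if "i < ns" "j < nc" for i j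
  using x3[OF that] g4(2)[OF that] by (simp_all add: \<sigma>4_def)
 have "\<exists>g5. dexec c_r \<rho> \<sigma>4 = \<sigma>4(16 := g5) \<and> (\<forall>j<nc. g5 j = Rf Y X j)"
  unfolding c_r_def
 proof (rule fill_table0)
  fix j assume j: "j < nc"
  have "(\<Sum>i<ns. \<sigma>4 15 (i * nc + j)) = (\<Sum>i<ns. hf Y X i j)" using x4(2) j by (intro sum.cong) simp_all
  then show "eval (eMin (eR vJ \<ominus> eSum 8 eNS (Rd 15 (vI \<otimes> eNC \<oplus> vJ))) (Num 2 \<otimes> eNS)) \<sigma>4 (\<rho>(2 := j)) = Rf Y X j"
   by (simp add: baseD[OF b4] Rf_def r_def)
 qed (simp_all add: exp_defs baseD[OF b4])
 then obtain g5 where g5_: "dexec c_r \<rho> \<sigma>4 = \<sigma>4(16 := g5)" "\<forall>j<nc. g5 j = Rf Y X j" by blast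
 note g5 = g5_(1) g5_(2)[rule_format]
 define \<sigma>5 where "\<sigma>5 = \<sigma>4(16 := g5)"
 have b5: "base \<sigma>5" unfolding \<sigma>5_def by (rule base_upd[OF b4]) simp
 have y5: "\<sigma>5 12 i = Y i" "\<sigma>5 14 i = qf Y i" if "i < ns" for i using y4[OF that] by (simp_all add: \<sigma>5_def)
 have x5: "\<sigma>5 13 (i * nc + j) = X i j" "\<sigma>5 15 (i * nc + j) = hf Y X i j" if "i < ns" "j < nc" for i j
  using x4[OF that] by (simp_all add: \<sigma>5_def)
 have "\<exists>g6. dexec c_yr \<rho> \<sigma>5 = \<sigma>5(17 := g6) \<and> (\<forall>i<ns. g6 i = Yr Y i)"
  unfolding c_yr_def
  by (rule fill_table0) (simp_all add: baseD[OF b5] Yr_def y5)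
 then obtain g6 where g6_: "dexec c_yr \<rho> \<sigma>5 = \<sigma>5(17 := g6)" "\<forall>i<ns. g6 i = Yr Y i" by blast
 note g6 = g6_(1) g6_(2)[rule_format]
 define \<sigma>6 where "\<sigma>6 = \<sigma>5(17 := g6)"
 have b6: "base \<sigma>6" unfolding \<sigma>6_def by (rule base_upd[OF b5]) simp
 have x6: "\<sigma>6 13 (i * nc + j) = X i j" "\<sigma>6 15 (i * nc + j) = hf Y X i j" if "i < ns" "j < nc" for i j
  using x5[OF that] by (simp_all add: \<sigma>6_def)
 have r6: "\<sigma>6 16 j = Rf Y X j" if "j < nc" for j using g5(2)[OF that] by (simp add: \<sigma>6_def \<sigma>5_def)
 have "\<exists>g7. dexec c_xr \<rho> \<sigma>6 = \<sigma>6(18 := g7) \<and> (\<forall>i<ns. \<forall>j<nc. g7 (i * nc + j) = Xr Y X i j)"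
  unfolding c_xr_def
 proof (rule fill_table)
  fix i j assume ij: "i < ns" "j < nc"
  have "(\<Sum>k<i. \<sigma>6 13 (k * nc + j) - N * \<sigma>6 15 (k * nc + j)) = (\<Sum>k<i. Xd Y X k j)"
   using x6 ij by (intro sum.cong) (simp_all add: Xd_def)
  then show "eval (eMin (Rd 13 (vI \<otimes> eNC \<oplus> vJ) \<ominus> eNN \<otimes> Rd 15 (vI \<otimes> eNC \<oplus> vJ))
   (eNN \<otimes> Rd 16 vJ \<ominus> eSum 9 vI (Rd 13 (vK \<otimes> eNC \<oplus> vJ) \<ominus> eNN \<otimes> Rd 15 (vK \<otimes> eNC \<oplus> vJ)))) \<sigma>6 (\<rho>(8 := i, 2 := j)) = Xr Y X i j"
   by (simp add: baseD[OF b6] Xr_def x6[OF ij] r6[OF ij(2)] Xd_def)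
 qed (simp_all add: exp_defs baseD[OF b6])
 then obtain g7 where g7_: "dexec c_xr \<rho> \<sigma>6 = \<sigma>6(18 := g7)" "\<forall>i<ns. \<forall>j<nc. g7 (i * nc + j) = Xr Y X i j" by blast
 note g7 = g7_(1) g7_(2)[rule_format]
 define \<sigma>7 where "\<sigma>7 = \<sigma>6(18 := g7)"
 have b7: "base \<sigma>7" unfolding \<sigma>7_def by (rule base_upd[OF b6]) simp
 define \<sigma>8 where "\<sigma>8 = \<sigma>7(19 := (\<sigma>7 19)(0 := \<Sum>j<nc. Rf Y X j))"
 have 8: "dexec c_h \<rho> \<sigma>7 = \<sigma>8"
 proof -
  have "(\<Sum>j<nc. \<sigma>7 16 j) = (\<Sum>j<nc. Rf Y X j)" using r6 by (intro sum.cong) (simp_all add: \<sigma>7_def)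
  then show ?thesis by (simp add: c_h_def wr_def \<sigma>8_def baseD[OF b7])
 qed
 have b8: "base \<sigma>8" unfolding \<sigma>8_def by (rule base_upd[OF b7]) simp
 have x8: "\<sigma>8 18 (i * nc + j) = Xr Y X i j" if "i < ns" "j < nc" for i j
  using g7(2)[OF that] by (simp add: \<sigma>8_def \<sigma>7_def)
 have "\<exists>g9. dexec c_inp \<rho> \<sigma>8 = \<sigma>8(20 := g9) \<and> (\<forall>j<nc. \<forall>p<PP. g9 (j * PP + p) = of_bool (p mod (2 * N) < Xr Y X (p div (2 * N)) j))"
  unfolding c_inp_def
 proof (rule fill_table)
  fix j p assume jp: "j < nc" "p < PP"
  have "p div (2 * N) < ns" using jp(2) by (rule less_mult_imp_div_less)
  from x8[OF this jp(1)]
  show "eval (eLt (eMod vP (Num 2 \<otimes> eNN)) (Rd 18 (eSite vP \<otimes> eNC \<oplus> vJ))) \<sigma>8 (\<rho>(2 := j, 4 := p)) =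
   of_bool (p mod (2 * N) < Xr Y X (p div (2 * N)) j)"
   by (simp add: baseD[OF b8])
 qed (simp_all add: exp_defs baseD[OF b8])
 then obtain g9 where g9_: "dexec c_inp \<rho> \<sigma>8 = \<sigma>8(20 := g9)" "\<forall>j<nc. \<forall>p<PP. g9 (j * PP + p) = of_bool (p mod (2 * N) < Xr Y X (p div (2 * N)) j)" by blast
 note g9 = g9_(1) g9_(2)[rule_format]
 define \<sigma>9 where "\<sigma>9 = \<sigma>8(20 := g9)"
 have b9: "base \<sigma>9" unfolding \<sigma>9_def by (rule base_upd[OF b8]) simp
 have eq: "dexec c_prep \<rho> \<sigma> = \<sigma>9"
  unfolding c_prep_def by (simp only: dexec.simps(3) g1(1) \<sigma>1_def[symmetric] g2(1) \<sigma>2_def[symmetric] g3(1) \<sigma>3_def[symmetric]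
   g4(1) \<sigma>4_def[symmetric] g5(1) \<sigma>5_def[symmetric] g6(1) \<sigma>6_def[symmetric] g7(1) \<sigma>7_def[symmetric] 8 g9(1) \<sigma>9_def[symmetric])
 have a9: "\<sigma>9 14 = g3" "\<sigma>9 15 = g4" "\<sigma>9 16 = g5" "\<sigma>9 17 = g6" "\<sigma>9 20 = g9" "\<sigma>9 19 0 = (\<Sum>j<nc. Rf Y X j)"
  by (simp_all add: \<sigma>9_def \<sigma>8_def \<sigma>7_def \<sigma>6_def \<sigma>5_def \<sigma>4_def \<sigma>3_def)
 show ?thesis unfolding eq Y_def[symmetric] X_def[symmetric] prep_ok_def a9
  by (intro conjI b9 g3_(2) g6_(2) g4_(2) g5_(2) g9_(2) refl)
qed

text \<open>Each site retains fewer than \<open>2 * N\<close> units, hence a client retains a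
  residual demand of at most \<open>2 * ns\<close>. This keeps the numbers of units and pieces
  polynomial although demands are given in binary.\<close>

lemma prep_arith:
 fixes X :: "nat => nat => nat"
 assumes P: "0 < P" and XYa: "\<forall>i<ns. \<forall>j<nc. X i j <= Y i"
  and cova: "\<forall>j<nc. N * r j <= (\<Sum>i<ns. X i j)"
 shows "!!i. i < ns ==> Yr Y i < 2 * N" "!!i. i < ns ==> N * qf Y i + Yr Y i = Y i"
  "!!i j. hf Y X i j <= qf Y i" "!!i j. i < ns ==> j < nc ==> N * hf Y X i j + Xr Y X i j <= X i j"
  "!!i j. i < ns ==> j < nc ==> Xr Y X i j <= Yr Y i"
  "!!j. j < nc ==> (\<Sum>i<ns. Xr Y X i j) = N * Rf Y X j"
  "!!j. j < nc ==> r j <= Rf Y X j + (\<Sum>i<ns. hf Y X i j)"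
proof -
 note XY = XYa[rule_format] and cover = cova[rule_format]
 have N: "0 < N" using P by (simp add: gG_def)
 have Yq: "N * qf Y i <= Y i" "Y i < N * qf Y i + 2 * N" "N <= Y i ==> N * qf Y i + N <= Y i" "Y i < N ==> qf Y i = 0" for i
 proof -
  have m: "N * (Y i div N) <= Y i" "Y i < N * (Y i div N) + N"
   using mult_div_mod_eq[of N "Y i"] mod_less_divisor[OF N, of "Y i"] by linarith+
  show "Y i < N ==> qf Y i = 0" by (simp add: qf_def)
  show "N * qf Y i + N <= Y i" if "N <= Y i"
  proof -
   have "0 < Y i div N" using that N by (simp add: div_greater_zero_iff)
   then have "N * qf Y i + N = N * (Y i div N)" by (cases "Y i div N") (simp_all add: qf_def)
   then show ?thesis using m by simp
  qed
  show "Y i < N * qf Y i + 2 * N"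
   by (cases "Y i div N") (use m in \<open>simp_all add: qf_def\<close>)
  have "N * qf Y i <= N * (Y i div N)" unfolding qf_def by (intro mult_left_mono) simp_all
  then show "N * qf Y i <= Y i" using m by linarith
 qed
 show yr: "Yr Y i < 2 * N" "N * qf Y i + Yr Y i = Y i" for i
  using Yq(1,2)[of i] by (simp_all add: Yr_def)
 show hq: "hf Y X i j <= qf Y i" for i j by (simp add: hf_def)
 have h: "N * hf Y X i j <= X i j" for i j
 proof -
  have "N * hf Y X i j <= N * (X i j div N)" unfolding hf_def by (intro mult_left_mono) simp_all
  then show ?thesis using mult_div_mod_eq[of N "X i j"] by linarith
 qed
 show "N * hf Y X i j + Xr Y X i j <= X i j" for i j
  using h[of i j] by (simp add: Xr_def Xd_def)
 \<comment> \<open>A site with fewer than \<open>N\<close> units rounds nothing. Otherwise it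
   retains at least \<open>N\<close>, enough for a remainder modulo \<open>N\<close>; and where the
   cap \<open>qf\<close> is active, the inequality between \<open>X i j\<close> and
   \<open>Y i\<close> is inherited.\<close>
 have xd: "Xd Y X i j <= Yr Y i" if ij: "i < ns" "j < nc" for i j
 proof (cases "Y i < N")
  case True
  then show ?thesis using XY[OF ij] Yq(4)[of i] by (simp add: Xd_def Yr_def hf_def)
 next
  case False
  then have big: "N <= Yr Y i" using Yq(3)[of i] by (simp add: Yr_def)
  show ?thesis
  proof (cases "X i j div N <= qf Y i")
   case True
   then have "Xd Y X i j = X i j mod N" by (simp add: Xd_def hf_def minus_mult_div_eq_mod)
   then show ?thesis using mod_less_divisor[OF N, of "X i j"] big by linarith
  next
   case F: False
   then have "Xd Y X i j = X i j - N * qf Y i" by (simp add: Xd_def hf_def min_def)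
   then show ?thesis using XY[OF ij] by (simp add: Yr_def)
  qed
 qed
 then show "Xr Y X i j <= Yr Y i" if "i < ns" "j < nc" for i j using that by (simp add: Xr_def min.coboundedI1)
 have tot: "(\<Sum>i<ns. X i j) = N * (\<Sum>i<ns. hf Y X i j) + (\<Sum>i<ns. Xd Y X i j)" for j
  unfolding sum_distrib_left sum.distrib[symmetric] using h by (intro sum.cong refl) (simp add: Xd_def)
 have R: "Rf Y X j = r j - (\<Sum>i<ns. hf Y X i j)" and le: "N * Rf Y X j <= (\<Sum>i<ns. Xd Y X i j)" if j: "j < nc" for j
 proof -
  let ?R = "r j - (\<Sum>i<ns. hf Y X i j)"
  have 1: "N * ?R <= (\<Sum>i<ns. Xd Y X i j)" using cover[OF j] tot[of j] by (simp add: diff_mult_distrib2)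
  also have "\<dots> <= (\<Sum>i<ns. 2 * N)" using xd j yr(1) by (intro sum_mono) (meson lessThan_iff less_imp_le order.trans)
  also have "\<dots> = N * (2 * ns)" by simp
  finally have "?R <= 2 * ns" using N by simp
  then show "Rf Y X j = ?R" by (simp add: Rf_def)
  then show "N * Rf Y X j <= (\<Sum>i<ns. Xd Y X i j)" using 1 by simp
 qed
 show "(\<Sum>i<ns. Xr Y X i j) = N * Rf Y X j" if "j < nc" for j
  unfolding Xr_def sum_prefix_min using le[OF that] by simp
 show "r j <= Rf Y X j + (\<Sum>i<ns. hf Y X i j)" if "j < nc" for j using R[OF that] by simp
qed

end

section \<open>Random rounding of the residual instance\<close>

locale rounding_defs = partition nc H n N rd P d sel clu tk fl
 for nc H n N :: nat and rd :: "nat => nat" and P :: "nat => nat set" and d :: "nat => nat => nat"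
  and sel clu :: "nat => nat" and tk fl :: "nat => nat set" +
 fixes PP :: nat and V :: "nat set"
begin

definition "kp p = find_idx H (%\<kappa>. clu \<kappa> = \<kappa> \<and> p \<in> tk \<kappa>)"
text \<open>Group numbers below \<open>H\<close> are clusters. A piece in no cluster forms the group
  \<open>H + p\<close> by itself with position 0, hence opens with probability
  \<open>1 / n\<close>.\<close>

definition "grp p = (if kp p < H then kp p else H + p)"
definition "pos p = (if kp p < H then rk (<) (tk (kp p)) p else 0)"
definition "is_open U p \<longleftrightarrow> p \<in> V \<and> U (grp p) = pos p" for U :: "nat => nat"
definition "cand U t p \<longleftrightarrow> is_open U p \<and> (p \<in> tk t \<or> p \<in> fl t \<or> p \<in> tk (clu t))"
definition "cp U t = find_idx PP (%p. cand U t p \<and> (\<forall>p'<PP. \<not> cand U t p' \<or> d (sel t) p <= d (sel t) p'))"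

end

locale rounding = rounding_defs nc H n N rd P d sel clu tk fl PP V + partition_run nc H n N rd P d sel clu tk fl
 for nc H n N :: nat and rd :: "nat => nat" and P :: "nat => nat set" and d :: "nat => nat => nat"
  and sel clu :: "nat => nat" and tk fl :: "nat => nat set" and PP :: nat and V :: "nat set" +
 fixes cdist :: "nat => nat => real"
 assumes V: "V \<subseteq> {..<PP}" and PV: "!!j. j < nc ==> P j \<subseteq> V" and nN: "n < N" "N <= 2 * n"
  and num: "(1 - 1 / real n) ^ n + (1 - 1 / real n) ^ N <= real N / real n - 1"
  and tri: "!!j j' p. j < nc ==> j' < nc ==> p \<in> V ==> real (d j p) <= cdist j j' + real (d j' p)"
   "!!j j' p. j < nc ==> j' < nc ==> p \<in> V ==> cdist j j' <= real (d j p) + real (d j' p)"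
begin

lemma tk_V: "t < H ==> tk t \<subseteq> V"
 using tk_sub[of t] PV[OF selD(1)[of t]] by (auto simp: pool_def)

lemma nbr_V: "t < H ==> nbr t \<subseteq> V"
 using nbr_P[of t] PV[OF selD(1)[of t]] by auto

lemma kpD: "kp p < H ==> clu (kp p) = kp p \<and> p \<in> tk (kp p)"
 using find_idx_cases[of H "%\<kappa>. clu \<kappa> = \<kappa> \<and> p \<in> tk \<kappa>"] unfolding kp_def by auto

lemma kp_eq:
 assumes "\<kappa> < H" "clu \<kappa> = \<kappa>" "p \<in> tk \<kappa>"
 shows "kp p = \<kappa>"
proof -
 have k: "kp p < H \<and> clu (kp p) = kp p \<and> p \<in> tk (kp p)"
  unfolding kp_def using find_idx_found[of \<kappa> H "%\<kappa>. clu \<kappa> = \<kappa> \<and> p \<in> tk \<kappa>"] assms by blast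
 show ?thesis
 proof (rule ccontr)
  assume "kp p \<noteq> \<kappa>"
  then have "tk (kp p) \<inter> tk \<kappa> = {}" using k assms by (intro cluster_disjoint) auto
  then show False using k assms by blast
 qed
qed

lemma rank_less: "\<kappa> < H ==> clu \<kappa> = \<kappa> ==> p \<in> tk \<kappa> ==> rk (<) (tk \<kappa>) p < n"
 using bij_betwE[OF nat_lt.rk_bij[OF finite_tk[of \<kappa>]]] card_cluster[of \<kappa>] by auto

sublocale pg: piece_groups "{..<H + PP}" n grp pos V
proof
 show "finite V" by (rule finite_subset[OF V]) simp
 show "0 < n" by (rule n)
 fix p assume p: "p \<in> V"
 show "grp p \<in> {..<H + PP}" using p V by (auto simp: grp_def)
 show "pos p < n" using kpD[of p] rank_less[of "kp p" p] n by (simp add: pos_def)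
next
 show "inj_on (%p. (grp p, pos p)) V"
 proof (rule inj_onI)
  fix p q assume "p \<in> V" "q \<in> V" and e: "(grp p, pos p) = (grp q, pos q)"
  then have g: "grp p = grp q" and s: "pos p = pos q" by auto
  show "p = q"
  proof (cases "kp p < H")
   case True
   then have q: "kp q = kp p" using g by (auto simp: grp_def split: if_splits)
   have "rk (<) (tk (kp p)) p = rk (<) (tk (kp p)) q" using s True q by (simp add: pos_def)
   moreover have "inj_on (rk (<) (tk (kp p))) (tk (kp p))"
    by (rule bij_betw_imp_inj_on[OF nat_lt.rk_bij[OF finite_tk[OF True]]])
   ultimately show ?thesis using kpD[of p] kpD[of q] q True by (auto dest: inj_onD)
  next
   case False
   then show ?thesis using g by (auto simp: grp_def split: if_splits)
  qed
 qed
qed simp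

lemma is_open_iff: "p \<in> V ==> is_open U p \<longleftrightarrow> pg.opened U p"
 by (simp add: is_open_def pg.opened_def)

lemma cand_iff: "t < H ==> cand U t p \<longleftrightarrow> p \<in> {p \<in> nbr t \<union> tk (clu t). pg.opened U p}"
 using nbr_V[of t] tk_V[OF clu_less_H[of t]] is_open_iff[of p U] unfolding cand_def nbr_def by (auto simp: is_open_def)

text \<open>A cluster has exactly \<open>n\<close> pieces and their ranks exhaust the numbers below
  \<open>n\<close>, so every possible draw opens one of them: a unit always finds a
  candidate.\<close>

lemma cp_open:
 assumes t: "t < H" and U: "!!g. g < H + PP ==> U g < n"
 shows "cp U t < PP" "cand U t (cp U t)"
  "real (d (sel t) (cp U t)) = Min ((%p. real (d (sel t) p)) ` {p \<in> nbr t \<union> tk (clu t). pg.opened U p})"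
proof -
 let ?k = "clu t" and ?C = "{p \<in> nbr t \<union> tk (clu t). pg.opened U p}"
 have k: "?k < H" "clu ?k = ?k" using clu_less_H[OF t] clu_clu[OF t] by auto
 have "U ?k \<in> rk (<) (tk ?k) ` tk ?k"
  using bij_betw_imp_surj_on[OF nat_lt.rk_bij[OF finite_tk[OF k(1)]]] card_cluster[OF k] U[of ?k] k(1) by auto
 then obtain p0 where p0: "p0 \<in> tk ?k" "U ?k = rk (<) (tk ?k) p0" by auto
 have "kp p0 = ?k" by (rule kp_eq[OF k p0(1)])
 then have "pg.opened U p0" using p0 k by (simp add: pg.opened_def grp_def pos_def)
 then have ne: "?C \<noteq> {}" using p0 by auto
 have fin: "finite ?C" using finite_nbr[OF t] finite_tk[OF k(1)] by auto
 have "Min (d (sel t) ` ?C) \<in> d (sel t) ` ?C" using ne fin by (intro Min_in) auto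
 then obtain p where p: "p \<in> ?C" "Min (d (sel t) ` ?C) = d (sel t) p" by (metis (no_types, lifting) imageE)
 have min: "d (sel t) p <= d (sel t) q" if "q \<in> ?C" for q
  unfolding p(2)[symmetric] using fin that by (intro Min_le) auto
 have pP: "p < PP" using p(1) nbr_V[OF t] tk_V[OF k(1)] V by auto
 have "cp U t < PP \<and> cand U t (cp U t) \<and> (\<forall>p'<PP. \<not> cand U t p' \<or> d (sel t) (cp U t) <= d (sel t) p')"
  unfolding cp_def
  by (rule find_idx_found[OF pP]) (use p(1) min cand_iff[OF t] in blast)
 then show c: "cp U t < PP" "cand U t (cp U t)"
  and le: "real (d (sel t) (cp U t)) = Min ((%p. real (d (sel t) p)) ` ?C)"
 proof -
  assume a: "cp U t < PP \<and> cand U t (cp U t) \<and> (\<forall>p'<PP. \<not> cand U t p' \<or> d (sel t) (cp U t) <= d (sel t) p')"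
  then show "cp U t < PP" "cand U t (cp U t)" by auto
  have C: "cp U t \<in> ?C" using a cand_iff[OF t] by blast
  have "d (sel t) (cp U t) <= d (sel t) q" if q: "q \<in> ?C" for q
  proof -
   have "q < PP" using q nbr_V[OF t] tk_V[OF k(1)] V by auto
   then show ?thesis using a q cand_iff[OF t, of U q] by blast
  qed
  then show "real (d (sel t) (cp U t)) = Min ((%p. real (d (sel t) p)) ` ?C)"
   using fin C by (intro Min_eqI[symmetric]) auto
 qed
qed

text \<open>Own pieces and cluster of one unit are disjoint from own pieces and cluster of any other
  unit of the same client. This holds for every outcome of the draws, as feasibility is required
  with certainty.\<close>

lemma cp_inj:
 assumes "t < H" "t' < H" "t \<noteq> t'" "sel t = sel t'" and U: "!!g. g < H + PP ==> U g < n"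
 shows "cp U t \<noteq> cp U t'"
proof -
 have a: "cp U t \<in> nbr t \<union> tk (clu t)" "cp U t' \<in> nbr t' \<union> tk (clu t')"
  using iffD1[OF cand_iff[OF assms(1)] cp_open(2)[OF assms(1) U]] iffD1[OF cand_iff[OF assms(2)] cp_open(2)[OF assms(2) U]]
  by simp_all
 have "nbr t \<inter> nbr t' = {}" by (rule sib_nbr[OF assms(1-4)])
 moreover have "tk (clu t) \<inter> nbr t' = {}" by (rule cluster_sib_nbr[OF assms(1-4)])
 moreover have "tk (clu t') \<inter> nbr t = {}" by (rule cluster_sib_nbr) (use assms in auto)
 moreover have "tk (clu t) \<inter> tk (clu t') = {}"
  using clu_less_H clu_clu sib_clu[OF assms(1-4)] assms by (intro cluster_disjoint) auto
 ultimately show ?thesis using a by auto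
qed

lemma unif_fun_less: "U \<in> set_pmf (unif_fun {..<H + PP} n) ==> g < H + PP ==> U g < n"
 using n by (auto simp: set_Pi_pmf PiE_dflt_def set_pmf_lessThan)

lemma expected_demand:
 assumes t: "t < H"
 shows "pg.expect (%U. real (d (sel t) (cp U t))) <= (\<Sum>p\<in>nbr t. real (d (sel t) p)) / real n"
proof -
 let ?k = "clu t"
 have k: "?k < H" "clu ?k = ?k" using clu_less_H[OF t] clu_clu[OF t] by auto
 obtain Cs cm km p where g: "Cs \<subseteq> nbr t" "card Cs = n" "!!q. q \<in> Cs ==> d (sel t) q <= cm"
  "!!q. q \<in> nbr t - Cs ==> cm <= d (sel t) q" "!!q. q \<in> tk ?k ==> d (sel ?k) q <= km"
  "sum (d (sel ?k)) (tk ?k) + n * km <= sum (d (sel t)) Cs + n * cm" "p \<in> Cs" "p \<in> tk ?k"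
  using demand_geometry[OF t] by metis
 have "pg.expect (%U. real (d (sel t) (cp U t))) =
   pg.expect (%U. Min ((%p. real (d (sel t) p)) ` {p \<in> nbr t \<union> tk ?k. pg.opened U p}))"
 proof (intro integral_cong_AE)
  show "AE U in measure_pmf (unif_fun {..<H + PP} n). real (d (sel t) (cp U t)) =
    Min ((%p. real (d (sel t) p)) ` {p \<in> nbr t \<union> tk ?k. pg.opened U p})"
   unfolding AE_measure_pmf_iff by (intro ballI cp_open(3)[OF t]) (rule unif_fun_less)
 qed simp_all
 also have "\<dots> <= (\<Sum>p\<in>nbr t. real (d (sel t) p)) / real n"
 proof (rule pg.expected_connection[where Cs = Cs and \<kappa> = ?k and N = N and e = "%p. real (d (sel ?k) p)"
    and \<Delta> = "cdist (sel t) (sel ?k)" and cm = "real cm" and km = "real km"])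
  show "nbr t \<subseteq> V" "tk ?k \<subseteq> V" "Cs \<subseteq> nbr t" using nbr_V[OF t] tk_V[OF k(1)] g(1) by auto
  show "grp q = ?k" if "q \<in> tk ?k" for q using kp_eq[OF k that] k by (simp add: grp_def)
  show "q \<in> tk ?k" if "grp q = ?k" for q
   using that kpD[of q] k by (auto simp: grp_def split: if_splits)
  show "card Cs = n" "card (tk ?k) = n" "card (nbr t) = N" "n < N" "N <= 2 * n"
   using g(2) card_cluster[OF k] card_nbr[OF t] nN by auto
  have s: "sel t < nc" "sel ?k < nc" using selD(1) t k by auto
  show "real (d (sel t) q) <= cdist (sel t) (sel ?k) + real (d (sel ?k) q)"
   "cdist (sel t) (sel ?k) <= real (d (sel t) q) + real (d (sel ?k) q)" if "q \<in> tk ?k" for q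
   using tri[OF s, of q] tk_V[OF k(1)] that by auto
  show "cdist (sel t) (sel ?k) <= real cm + real km"
  proof -
   have "cdist (sel t) (sel ?k) <= real (d (sel t) p) + real (d (sel ?k) p)"
    using tri(2)[OF s, of p] tk_V[OF k(1)] g(8) by auto
   also have "\<dots> <= real cm + real km" using g(3)[OF g(7)] g(5)[OF g(8)] by simp
   finally show ?thesis .
  qed
  have "real (sum (d (sel ?k)) (tk ?k) + n * km) <= real (sum (d (sel t)) Cs + n * cm)" using g(6) by (rule of_nat_mono)
  then show "(\<Sum>p\<in>tk ?k. real (d (sel ?k) p)) + real n * real km <= (\<Sum>p\<in>Cs. real (d (sel t) p)) + real n * real cm" by simp
 qed (use g num in auto)
 finally show ?thesis .
qed

lemma expected_client:
 assumes j: "j < nc"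
 shows "(\<Sum>t | t < H \<and> sel t = j. pg.expect (%U. real (d j (cp U t)))) <= (\<Sum>p\<in>P j. real (d j p)) / real n"
proof -
 have "(\<Sum>t | t < H \<and> sel t = j. pg.expect (%U. real (d j (cp U t)))) <=
   (\<Sum>t | t < H \<and> sel t = j. (\<Sum>p\<in>nbr t. real (d j p)) / real n)"
  by (intro sum_mono) (use expected_demand in auto)
 also have "\<dots> = (\<Sum>t | t < H \<and> sel t = j. (\<Sum>p\<in>nbr t. real (d j p))) / real n" by (simp add: sum_divide_distrib)
 also have "\<dots> = (\<Sum>p\<in>P j. real (d j p)) / real n" unfolding sum_nbr[OF j] ..
 finally show ?thesis .
qed

lemma expect_open: "p \<in> V ==> pg.expect (%U. of_bool (is_open U p)) = 1 / real n"
 using pg.expect_opened[of p] by (simp add: is_open_iff)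

end

section \<open>Random draws, set-up and output stages of the program\<close>

text \<open>Successive draws into one array produce the product distribution. The assumption on
  \<open>E\<close> keeps the number of bits constant while the array is being filled.\<close>

lemma exec_random_table:
 fixes \<sigma> :: st
 assumes E: "!!g \<rho>. eval E (\<sigma>(a := g)) \<rho> = c"
 shows "for_loop (%v. exec (Rnd a (Var x) E) (\<rho>(x := v))) k i \<sigma> =
  map_pmf (%U. \<sigma>(a := (%q. if i <= q \<and> q < i + k then U q else \<sigma> a q))) (unif_fun {i..<i + k} (2 ^ c))"
 using E
proof (induction k arbitrary: i \<sigma>)
 case 0
 have "(%q. if i <= q \<and> q < i + 0 then U q else \<sigma> a q) = \<sigma> a" for U :: "nat => nat" by (auto simp: fun_eq_iff)
 then show ?case by simp
next
 case (Suc k)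
 have e: "eval E \<sigma> (\<rho>(x := i)) = c" using Suc.prems[of "\<sigma> a"] by simp
 have set: "{i..<i + Suc k} = insert i {Suc i..<Suc i + k}" by auto
 have IH: "for_loop (%v. exec (Rnd a (Var x) E) (\<rho>(x := v))) k (Suc i) (wr \<sigma> a i u) =
   map_pmf (%U. (wr \<sigma> a i u)(a := (%q. if Suc i <= q \<and> q < Suc i + k then U q else wr \<sigma> a i u a q)))
    (unif_fun {Suc i..<Suc i + k} (2 ^ c))" for u
  by (rule Suc.IH) (simp only: wr_def fun_upd_upd Suc.prems)
 have st: "(wr \<sigma> a i u)(a := (%q. if Suc i <= q \<and> q < Suc i + k then U q else wr \<sigma> a i u a q)) =
   \<sigma>(a := (%q. if i <= q \<and> q < i + Suc k then (U(i := u)) q else \<sigma> a q))" for u and U :: "nat => nat"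
  by (auto simp: wr_def fun_eq_iff)
 have "for_loop (%v. exec (Rnd a (Var x) E) (\<rho>(x := v))) (Suc k) i \<sigma> =
  bind_pmf (pmf_of_set {..<2 ^ c}) (%u. map_pmf (%U. \<sigma>(a := (%q. if i <= q \<and> q < i + Suc k then (U(i := u)) q else \<sigma> a q)))
   (unif_fun {Suc i..<Suc i + k} (2 ^ c)))"
  unfolding for_loop.simps(2) exec.simps(2) e bind_map_pmf eval.simps(2) fun_upd_same IH st ..
 also have "\<dots> = map_pmf (%U. \<sigma>(a := (%q. if i <= q \<and> q < i + Suc k then U q else \<sigma> a q)))
   (unif_fun {i..<i + Suc k} (2 ^ c))"
  unfolding set by (subst Pi_pmf_insert') (simp_all add: map_bind_pmf map_pmf_def bind_assoc_pmf bind_return_pmf del: fun_upd_apply)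
 finally show ?case .
qed

lemma find_idx_least: "v < find_idx m Q ==> \<not> Q v"
proof
 assume v: "v < find_idx m Q" "Q v"
 then have le: "(LEAST v. Q v) <= v" by (intro Least_le)
 show False
 proof (cases "\<exists>v<m. Q v")
  case True
  then have "find_idx m Q = (LEAST v. Q v)" unfolding find_idx_def by (rule if_P)
  then show False using v le by simp
 next
  case False
  then have "find_idx m Q = m" unfolding find_idx_def by (rule if_not_P)
  then have "v < m" using v(1) by simp
  then show False using v(2) False by blast
 qed
qed

definition "c_setup = c_den ;; c_cost ;; c_exp ;; c_pow"

lemma setup_effect:
 fixes \<rho> :: env
 assumes ns: "\<sigma> 1 0 = ns" and nc: "\<sigma> 1 1 = nc"
 defines "\<tau> \<equiv> dexec c_setup \<rho> \<sigma>" and "DEN \<equiv> \<Prod>v<ns + ns * nc. \<sigma> 0 (3 + 2 * v)"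
 shows "\<tau> 0 = \<sigma> 0" "\<tau> 1 = \<sigma> 1" "!!v. v < ns + ns * nc ==> \<tau> 3 v = \<sigma> 0 (2 + 2 * v) * (DEN div \<sigma> 0 (3 + 2 * v))"
  "\<tau> 5 0 = 2 ^ \<tau> 4 0" "nc <= \<tau> 5 0"
proof -
 define \<sigma>1 where "\<sigma>1 = \<sigma>(2 := (\<sigma> 2)(0 := DEN))"
 have 1: "dexec c_den \<rho> \<sigma> = \<sigma>1" using ns nc by (simp add: c_den_def wr_def \<sigma>1_def DEN_def)
 have d1: "\<sigma>1 0 = \<sigma> 0" "\<sigma>1 (Suc 0) 0 = ns" "\<sigma>1 (Suc 0) (Suc 0) = nc" "\<sigma>1 2 0 = DEN" using ns nc by (simp_all add: \<sigma>1_def)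
 have "\<exists>g. dexec c_cost \<rho> \<sigma>1 = \<sigma>1(3 := g) \<and> (\<forall>v<ns + ns * nc. g v = \<sigma> 0 (2 + 2 * v) * (DEN div \<sigma> 0 (3 + 2 * v)))"
  unfolding c_cost_def by (rule fill_table0) (simp_all add: d1)
 then obtain g where g: "dexec c_cost \<rho> \<sigma>1 = \<sigma>1(3 := g)" "\<forall>v<ns + ns * nc. g v = \<sigma> 0 (2 + 2 * v) * (DEN div \<sigma> 0 (3 + 2 * v))" by blast
 define \<sigma>2 where "\<sigma>2 = \<sigma>1(3 := g)"
 define e where "e = find_idx nc (%v. nc <= 2 ^ v)"
 define \<sigma>3 where "\<sigma>3 = \<sigma>2(4 := (\<sigma>2 4)(0 := e))"
 have 3: "dexec c_exp \<rho> \<sigma>2 = \<sigma>3" using ns nc by (simp add: c_exp_def wr_def \<sigma>3_def \<sigma>2_def \<sigma>1_def e_def)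
 have e: "nc <= 2 ^ e \<and> 2 ^ e <= 2 * nc + 2"
 proof (cases nc)
  case 0
  then have "e = 0" by (simp add: e_def find_idx_def)
  then show ?thesis using 0 by simp
 next
  case (Suc m)
  have "Suc m <= 2 ^ m" by (simp add: Suc_le_eq)
  then have f: "e < nc \<and> nc <= 2 ^ e" unfolding e_def by (intro find_idx_found[of m]) (simp_all add: Suc)
  have "2 ^ e <= 2 * nc + 2"
  proof (cases e)
   case (Suc k)
   then have "\<not> nc <= 2 ^ k" using find_idx_least[of k nc "%v. nc <= 2 ^ v"] by (simp add: e_def)
   then show ?thesis using Suc by simp
  qed simp
  then show ?thesis using f by simp
 qed
 have "dexec c_pow \<rho> \<sigma>3 = \<sigma>3(5 := (\<sigma>3 5)(0 := 2 ^ e))"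
  using ns nc e by (simp add: c_pow_def wr_def \<sigma>3_def \<sigma>2_def \<sigma>1_def min_def)
 then have \<tau>: "\<tau> = \<sigma>3(5 := (\<sigma>3 5)(0 := 2 ^ e))"
  unfolding \<tau>_def c_setup_def by (simp only: dexec.simps(3) 1 g(1) \<sigma>2_def[symmetric] 3)
 show "\<tau> 0 = \<sigma> 0" "\<tau> 1 = \<sigma> 1" "\<tau> 5 0 = 2 ^ \<tau> 4 0" "nc <= \<tau> 5 0"
  using e by (simp_all add: \<tau> \<sigma>3_def \<sigma>2_def \<sigma>1_def)
 show "\<tau> 3 v = \<sigma> 0 (2 + 2 * v) * (DEN div \<sigma> 0 (3 + 2 * v))" if "v < ns + ns * nc" for v
  using g(2) that by (simp add: \<tau> \<sigma>3_def \<sigma>2_def)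
qed

context inst2
begin

definition "pieces yr = {p. p < PP \<and> p mod (2 * N) < yr (p div (2 * N))}" for yr :: "nat => nat"
abbreviation "st_open \<sigma> \<equiv> rounding_defs.is_open H (\<sigma> 25) (row \<sigma> 36) (pieces (\<sigma> 17))" for \<sigma> :: st
abbreviation "st_cp \<sigma> \<equiv> rounding_defs.cp H dp (\<sigma> 24) (\<sigma> 25) (row \<sigma> 36) (row \<sigma> 28) PP (pieces (\<sigma> 17))" for \<sigma> :: st

lemma post_out:
 fixes \<rho> :: env and \<sigma> :: st
 assumes b: "base2 \<sigma>" and le1: "!!t p. t < H ==> p < PP ==> \<sigma> 36 (t * PP + p) <= 1"
 shows "(\<forall>i<ns. dexec c_post \<rho> \<sigma> 37 i = \<sigma> 14 i + card {p. p < PP \<and> p div (2 * N) = i \<and> st_open \<sigma> (\<sigma> 29) p}) \<and>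
  (\<forall>i<ns. \<forall>j<nc. dexec c_post \<rho> \<sigma> 37 (ns + (i * nc + j)) =
   \<sigma> 15 (i * nc + j) + card {t. t < H \<and> \<sigma> 24 t = j \<and> st_cp \<sigma> (\<sigma> 29) t div (2 * N) = i})"
proof -
 define U where "U = \<sigma> 29"
 define V where "V = pieces (\<sigma> 17)"
 define tk where "tk = row \<sigma> 36"
 define fl where "fl = row \<sigma> 28"
 define sel where "sel = \<sigma> 24"
 define clu where "clu = \<sigma> 25"
 interpret rd: rounding_defs nc H n N RR Pset dp sel clu tk fl PP V .
 have tkr: "\<sigma> 36 (t * PP + p) \<noteq> 0 \<longleftrightarrow> p \<in> tk t" "\<sigma> 28 (t * PP + p) \<noteq> 0 \<longleftrightarrow> p \<in> fl t" if "p < PP" for t p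
  using that by (simp_all add: tk_def fl_def row_def)
 have "\<exists>g. dexec c_kp \<rho> \<sigma> = \<sigma>(33 := g) \<and> (\<forall>p<PP. g p = rd.kp p)"
  unfolding c_kp_def
 proof (rule fill_table0)
  fix p assume p: "p < PP"
  show "eval (eFind 1 eHH (eEq (Rd 25 vT') vT' \<otimes> e_tk vT' vP)) \<sigma> (\<rho>(4 := p)) = rd.kp p"
   unfolding rd.kp_def by (simp add: base2D[OF b], intro find_idx_cong refl) (use tkr(1)[OF p] in \<open>simp add: clu_def\<close>)
 qed (simp_all add: exp_defs base2D[OF b])
 then obtain g1 where g1: "dexec c_kp \<rho> \<sigma> = \<sigma>(33 := g1)" "\<forall>p<PP. g1 p = rd.kp p" by blast
 define \<sigma>1 where "\<sigma>1 = \<sigma>(33 := g1)"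
 have b1: "base2 \<sigma>1" unfolding \<sigma>1_def by (rule base2_upd[OF b]) simp
 have s1: "\<sigma>1 33 = g1" "\<sigma>1 29 = U" "\<sigma>1 17 = \<sigma> 17" "\<sigma>1 36 = \<sigma> 36" by (simp_all add: \<sigma>1_def U_def)
 have "\<exists>g. dexec c_op \<rho> \<sigma>1 = \<sigma>1(30 := g) \<and> (\<forall>p<PP. g p = of_bool (rd.is_open U p))"
  unfolding c_op_def
 proof (rule fill_table0)
  fix p assume p: "p < PP"
  have g1p: "g1 p = rd.kp p" using g1(2) p by blast
  have rank: "(\<Sum>p'<p. \<sigma> 36 (rd.kp p * PP + p')) = rk (<) (tk (rd.kp p)) p" if "rd.kp p < H"
  proof -
   have "(\<Sum>p'<p. \<sigma> 36 (rd.kp p * PP + p')) = card {p'. p' < p \<and> \<sigma> 36 (rd.kp p * PP + p') \<noteq> 0}"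
    by (rule sum_bool_card) (use le1[OF that] p in simp)
   also have "{p'. p' < p \<and> \<sigma> 36 (rd.kp p * PP + p') \<noteq> 0} = {q \<in> tk (rd.kp p). q < p}"
    using p by (auto simp: tk_def row_def)
   finally show ?thesis by (simp add: rk_def)
  qed
  have V: "p \<in> V \<longleftrightarrow> p mod (2 * N) < \<sigma> 17 (p div (2 * N))" using p by (simp add: V_def pieces_def)
  show "eval (eLt (eMod vP (Num 2 \<otimes> eNN)) (Rd 17 (eSite vP)) \<otimes>
    eIte (eLt (Rd 33 vP) eHH) (eEq (Rd 29 (Rd 33 vP)) (eSum 5 vP (e_tk (Rd 33 vP) vP')))
    (eEq (Rd 29 (eHH \<oplus> vP)) (Num 0))) \<sigma>1 (\<rho>(4 := p)) = of_bool (rd.is_open U p)"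
  proof (cases "rd.kp p < H")
   case True
   then show ?thesis using rank[OF True]
    by (simp add: base2D[OF b1] s1 g1p rd.is_open_def rd.grp_def rd.pos_def V)
  next
   case False
   then show ?thesis
    by (simp add: base2D[OF b1] s1 g1p rd.is_open_def rd.grp_def rd.pos_def V)
  qed
 qed (simp_all add: exp_defs base2D[OF b1])
 then obtain g2 where g2: "dexec c_op \<rho> \<sigma>1 = \<sigma>1(30 := g2)" "\<forall>p<PP. g2 p = of_bool (rd.is_open U p)" by blast
 define \<sigma>2 where "\<sigma>2 = \<sigma>1(30 := g2)"
 have b2: "base2 \<sigma>2" unfolding \<sigma>2_def by (rule base2_upd[OF b1]) simp
 have s2: "\<sigma>2 30 = g2" "\<sigma>2 36 = \<sigma> 36" "\<sigma>2 28 = \<sigma> 28" "\<sigma>2 25 = clu" "\<sigma>2 24 = sel"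
  by (simp_all add: \<sigma>2_def \<sigma>1_def clu_def sel_def)
 have cand: "g2 p * of_bool (\<sigma> 36 (t * PP + p) \<noteq> 0 \<or> of_bool (\<sigma> 28 (t * PP + p) \<noteq> 0 \<or> \<sigma> 36 (clu t * PP + p) \<noteq> 0) \<noteq> (0::nat)) =
  of_bool (rd.cand U t p)" if "p < PP" for t p
  using g2(2) that tkr[OF that] by (simp add: rd.cand_def)
 have ec: "eval (e_cand q) \<sigma>2 \<rho>' = of_bool (rd.cand U (\<rho>' 0) (eval q \<sigma>2 \<rho>'))" if "eval q \<sigma>2 \<rho>' < PP" for q \<rho>'
  using cand[OF that, of "\<rho>' 0"] by (simp add: e_cand_def base2D[OF b2] s2)
 have "\<exists>g. dexec c_cp \<rho> \<sigma>2 = \<sigma>2(31 := g) \<and> (\<forall>t<H. g t = rd.cp U t)"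
  unfolding c_cp_def
 proof (rule fill_table0)
  fix t
  show "eval (eFind 4 ePP (e_cand vP \<otimes>
   eAll 5 ePP (eOr (eNot (e_cand vP')) (eLe (eDP (Rd 24 vT) vP) (eDP (Rd 24 vT) vP'))))) \<sigma>2 (\<rho>(0 := t)) = rd.cp U t"
   unfolding rd.cp_def by (simp add: base2D[OF b2] s2 dp_def d_def, intro find_idx_cong refl) (auto simp: ec)
 qed (simp_all add: exp_defs base2D[OF b2])
 then obtain g3 where g3: "dexec c_cp \<rho> \<sigma>2 = \<sigma>2(31 := g3)" "\<forall>t<H. g3 t = rd.cp U t" by blast
 define \<sigma>3 where "\<sigma>3 = \<sigma>2(31 := g3)"
 have b3: "base2 \<sigma>3" unfolding \<sigma>3_def by (rule base2_upd[OF b2]) simp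
 have s3: "\<sigma>3 30 = g2" "\<sigma>3 14 = \<sigma> 14" by (simp_all add: \<sigma>3_def \<sigma>2_def \<sigma>1_def)
 have "\<exists>g. dexec c_outy \<rho> \<sigma>3 = \<sigma>3(32 := g) \<and> (\<forall>i<ns. g i = \<sigma> 14 i + card {p. p < PP \<and> p div (2 * N) = i \<and> rd.is_open U p})"
  unfolding c_outy_def
 proof (rule fill_table0)
  fix i
  have "(\<Sum>p<PP. of_bool (p div (2 * N) = i) * g2 p) = (\<Sum>p<PP. of_bool (p div (2 * N) = i \<and> rd.is_open U p))"
   using g2(2) by (intro sum.cong) simp_all
  also have "\<dots> = card {p. p < PP \<and> of_bool (p div (2 * N) = i \<and> rd.is_open U p) \<noteq> (0::nat)}"
   by (rule sum_bool_card) simp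
  finally show "eval (Rd 14 vI \<oplus> eSum 4 ePP (eEq (eSite vP) vI \<otimes> Rd 30 vP)) \<sigma>3 (\<rho>(8 := i)) =
   \<sigma> 14 i + card {p. p < PP \<and> p div (2 * N) = i \<and> rd.is_open U p}"
   by (simp add: base2D[OF b3] s3 del: sum_of_bool_mult_eq sum_of_bool_eq)
 qed (simp_all add: exp_defs base2D[OF b3])
 then obtain g4 where g4: "dexec c_outy \<rho> \<sigma>3 = \<sigma>3(32 := g4)"
  "\<forall>i<ns. g4 i = \<sigma> 14 i + card {p. p < PP \<and> p div (2 * N) = i \<and> rd.is_open U p}" by blast
 define \<sigma>4 where "\<sigma>4 = \<sigma>3(32 := g4)"
 have b4: "base2 \<sigma>4" unfolding \<sigma>4_def by (rule base2_upd[OF b3]) simp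
 have s4: "\<sigma>4 31 = g3" "\<sigma>4 15 = \<sigma> 15" "\<sigma>4 24 = sel" by (simp_all add: \<sigma>4_def \<sigma>3_def \<sigma>2_def \<sigma>1_def sel_def)
 have "\<exists>g. dexec c_xo \<rho> \<sigma>4 = \<sigma>4(34 := g) \<and> (\<forall>i<ns. \<forall>j<nc. g (i * nc + j) =
  \<sigma> 15 (i * nc + j) + card {t. t < H \<and> sel t = j \<and> rd.cp U t div (2 * N) = i})"
  unfolding c_xo_def
 proof (rule fill_table)
  fix i j
  have "(\<Sum>t<H. of_bool (sel t = j) * of_bool (g3 t div (2 * N) = i) :: nat) = (\<Sum>t<H. of_bool (sel t = j \<and> rd.cp U t div (2 * N) = i))"
   using g3(2) by (intro sum.cong) simp_all
  also have "\<dots> = card {t. t < H \<and> of_bool (sel t = j \<and> rd.cp U t div (2 * N) = i) \<noteq> (0::nat)}"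
   by (rule sum_bool_card) simp
  finally show "eval (Rd 15 (vI \<otimes> eNC \<oplus> vJ) \<oplus> eSum 0 eHH (eEq (Rd 24 vT) vJ \<otimes> eEq (eSite (Rd 31 vT)) vI)) \<sigma>4 (\<rho>(8 := i, 2 := j)) =
   \<sigma> 15 (i * nc + j) + card {t. t < H \<and> sel t = j \<and> rd.cp U t div (2 * N) = i}"
   by (simp add: base2D[OF b4] s4 del: sum_of_bool_mult_eq sum_of_bool_eq sum_mult_of_bool_eq)
 qed (simp_all add: exp_defs base2D[OF b4])
 then obtain g5 where g5: "dexec c_xo \<rho> \<sigma>4 = \<sigma>4(34 := g5)"
  "\<forall>i<ns. \<forall>j<nc. g5 (i * nc + j) = \<sigma> 15 (i * nc + j) + card {t. t < H \<and> sel t = j \<and> rd.cp U t div (2 * N) = i}" by blast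
 define \<sigma>5 where "\<sigma>5 = \<sigma>4(34 := g5)"
 have b5: "base2 \<sigma>5" unfolding \<sigma>5_def by (rule base2_upd[OF b4]) simp
 define \<sigma>6 where "\<sigma>6 = \<sigma>5(37 := (%k. if ns <= k \<and> k < ns + ns * nc then g5 (k - ns) else \<sigma>5 37 k))"
 have 6: "dexec c_outx \<rho> \<sigma>5 = \<sigma>6"
  unfolding c_outx_def by (subst dexec_fill) (simp_all add: base2D[OF b5] base2D[OF b4] \<sigma>6_def \<sigma>5_def cong: if_cong)
 have b6: "base2 \<sigma>6" unfolding \<sigma>6_def by (rule base2_upd[OF b5]) simp
 have s6: "\<sigma>6 32 = g4" by (simp add: \<sigma>6_def \<sigma>5_def \<sigma>4_def)
 have 7: "dexec c_outy2 \<rho> \<sigma>6 = \<sigma>6(37 := (%k. if k < ns then g4 k else \<sigma>6 37 k))"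
  unfolding c_outy2_def by (subst dexec_fill0) (simp_all add: base2D[OF b6] s6 cong: if_cong)
 have eq: "dexec c_post \<rho> \<sigma> = \<sigma>6(37 := (%k. if k < ns then g4 k else \<sigma>6 37 k))"
  unfolding c_post_def by (simp only: dexec.simps(3) g1(1) \<sigma>1_def[symmetric] g2(1) \<sigma>2_def[symmetric] g3(1) \<sigma>3_def[symmetric]
   g4(1) \<sigma>4_def[symmetric] g5(1) \<sigma>5_def[symmetric] 6 7)
 have "dexec c_post \<rho> \<sigma> 37 (ns + (i * nc + j)) = g5 (i * nc + j)" if ij: "i < ns" "j < nc" for i j
 proof -
  have "Suc i * nc <= ns * nc" using ij by (intro mult_right_mono) auto
  then have "i * nc + j < ns * nc" using ij by simp
  then show ?thesis unfolding eq by (simp add: \<sigma>6_def)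
 qed
 moreover have "dexec c_post \<rho> \<sigma> 37 i = g4 i" if "i < ns" for i unfolding eq using that by simp
 ultimately show ?thesis
  using g4(2) g5(2) unfolding U_def V_def tk_def fl_def sel_def clu_def by simp
qed

end

lemma sum_fibres:
 fixes f :: "nat => real"
 assumes "finite S" "!!t. t \<in> S ==> g t < m"
 shows "(\<Sum>i<m. f i * real (card {t \<in> S. g t = i})) = (\<Sum>t\<in>S. f (g t))"
proof -
 have "(\<Sum>t\<in>S. f (g t)) = (\<Sum>i<m. \<Sum>t\<in>{t \<in> S. g t = i}. f (g t))"
  by (rule sum.group[symmetric]) (use assms in auto)
 also have "\<dots> = (\<Sum>i<m. f i * real (card {t \<in> S. g t = i}))"
 proof (intro sum.cong refl)
  fix i
  have "(\<Sum>t\<in>{t \<in> S. g t = i}. f (g t)) = (\<Sum>t\<in>{t \<in> S. g t = i}. f i)" by (intro sum.cong) auto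
  then show "(\<Sum>t\<in>{t \<in> S. g t = i}. f (g t)) = f i * real (card {t \<in> S. g t = i})" by simp
 qed
 finally show ?thesis ..
qed

section \<open>Feasibility and expected cost of the rounded solution\<close>

context inst2
begin

text \<open>The searches of the program realise the abstract specification. Before time
  \<open>H\<close> some client lacks a unit, so a minimal candidate exists and the search for it
  succeeds.\<close>

lemma make_run:
 assumes P: "0 < P" and card: "!!j. j < nc ==> card (Pset j) = N * RR j" and H: "H = (\<Sum>j<nc. RR j)"
  and ok: "!!t. t < H ==> part_ok sel clu tk t" and fok: "!!t. t < H ==> fill_ok sel tk fl t"
 shows "partition_run nc H n N RR Pset dp sel clu tk fl"
proof -
 interpret p: partition nc H n N RR Pset dp sel clu tk fl .
 have sel: "sel t < nc \<and> p.cnt t (sel t) < RR (sel t) \<and>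
   (\<forall>j<nc. p.cnt t j < RR j \<longrightarrow> val (sel t) (p.pool t (sel t)) <= val j (p.pool t j))" if t: "t < H" for t
 proof -
  let ?A = "{j. j < nc \<and> p.cnt t j < RR j}"
  have "\<exists>j<nc. p.cnt t j < RR j" by (rule p.unsatisfied_ex) (use t H in simp)
  then have ne: "?A \<noteq> {}" by auto
  have fin: "finite ?A" by simp
  have "Min ((%j. val j (p.pool t j)) ` ?A) \<in> (%j. val j (p.pool t j)) ` ?A" using ne fin by (intro Min_in) auto
  then obtain j0 where j0: "j0 \<in> ?A" "Min ((%j. val j (p.pool t j)) ` ?A) = val j0 (p.pool t j0)" by (metis (no_types, lifting) imageE)
  have min: "val j0 (p.pool t j0) <= val j (p.pool t j)" if "j \<in> ?A" for j
   unfolding j0(2)[symmetric] using fin that by (intro Min_le) auto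
  let ?Q = "%j. p.cnt t j < RR j \<and> (\<forall>j'<nc. \<not> p.cnt t j' < RR j' \<or> val j (p.pool t j) <= val j' (p.pool t j'))"
  have "?Q j0" using j0(1) min by blast
  then have "find_idx nc ?Q < nc \<and> ?Q (find_idx nc ?Q)" using j0(1) by (intro find_idx_found[of j0]) auto
  moreover have "sel t = find_idx nc ?Q" using ok[OF t] unfolding part_ok_def by blast
  ultimately show ?thesis by (simp only:) blast
 qed
 let ?B = "%t \<kappa>. clu \<kappa> = \<kappa> \<and> p.chunk (sel t) (p.pool t (sel t)) \<inter> tk \<kappa> \<noteq> {}"
 have clu: "clu t = find_idx t (?B t)" if t: "t < H" for t
  using ok[OF t] sel[OF t] unfolding part_ok_def by blast
 show ?thesis
 proof
  show "finite (Pset j)" for j by (simp add: Pset_def)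
  show "card (Pset j) = N * RR j" if "j < nc" for j by (rule card[OF that])
  show "0 < n" "n <= N" using P by (simp_all add: gQ_def gG_def gS_def)
  show "H = (\<Sum>j<nc. RR j)" by (rule H)
  fix t assume t: "t < H"
  show "sel t < nc \<and> p.cnt t (sel t) < RR (sel t) \<and>
   (\<forall>j<nc. p.cnt t j < RR j \<longrightarrow> val (sel t) (p.pool t (sel t)) <= val j (p.pool t j))" by (rule sel[OF t])
  show "clu t <= t" unfolding clu[OF t] by (rule find_idx_le)
  show "clu (clu t) = clu t \<and> p.chunk (sel t) (p.pool t (sel t)) \<inter> tk (clu t) \<noteq> {}" if "clu t < t"
   using find_idx_cases[of t "?B t"] that unfolding clu[OF t, symmetric] by simp
  show "p.chunk (sel t) (p.pool t (sel t)) \<inter> tk \<kappa> = {}" if k: "clu t = t" "\<kappa> < t" "clu \<kappa> = \<kappa>" for \<kappa>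
  proof -
   have "\<not> clu t < t" using k(1) by simp
   then have "\<forall>v<t. \<not> ?B t v" using find_idx_cases[of t "?B t"] unfolding clu[OF t, symmetric] by blast
   then show ?thesis using k(2,3) by blast
  qed
  show "tk t = (if clu t = t then p.chunk (sel t) (p.pool t (sel t)) else p.pool t (sel t) \<inter> tk (clu t))"
   using ok[OF t] sel[OF t] unfolding part_ok_def by blast
  show "fl t = {q \<in> p.free t. rk (<) (p.free t) q + card (tk t) < N}"
   using fok[OF t] unfolding fill_ok_def .
 qed
qed

definition "out_y \<sigma> U i = \<sigma> 14 i + card {p. p < PP \<and> p div (2 * N) = i \<and> st_open \<sigma> U p}" for \<sigma> :: st
definition "out_x \<sigma> U i j = \<sigma> 15 (i * nc + j) + card {t. t < H \<and> \<sigma> 24 t = j \<and> st_cp \<sigma> U t div (2 * N) = i}" for \<sigma> :: st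

text \<open>The output is a deterministic part plus a random part. The latter costs in expectation
  at most \<open>1 / n\<close> per residual unit of \<open>Y\<close> and \<open>X\<close>, so it
  remains to fit the deterministic part under the same denominator.\<close>

lemma quality:
 fixes X :: "nat => nat => nat" and \<sigma> :: st
 assumes P: "0 < P" and XY: "!!i j. i < ns ==> j < nc ==> X i j <= Y i"
  and cover: "!!j. j < nc ==> N * r j <= (\<Sum>i<ns. X i j)"
  and b: "base2 \<sigma>" and prep: "prep_ok Y X \<sigma>"
  and ok: "!!t. t < H ==> part_ok (\<sigma> 24) (\<sigma> 25) (row \<sigma> 36) t"
  and fok: "!!t. t < H ==> fill_ok (\<sigma> 24) (row \<sigma> 36) (row \<sigma> 28) t"
  and tri: "!!i j j'. i < ns ==> j < nc ==> j' < nc ==> real (d i j) <= cdist j j' + real (d i j')"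
   "!!i j j'. i < ns ==> j < nc ==> j' < nc ==> cdist j j' <= real (d i j) + real (d i j')"
 shows "!!U. U \<in> set_pmf (unif_fun {..<H + PP} n) ==>
   (\<forall>i<ns. \<forall>j<nc. out_x \<sigma> U i j <= out_y \<sigma> U i) \<and> (\<forall>j<nc. r j <= (\<Sum>i<ns. out_x \<sigma> U i j))"
  and "measure_pmf.expectation (unif_fun {..<H + PP} n)
   (%U. (\<Sum>i<ns. real (cst i) * real (out_y \<sigma> U i)) + (\<Sum>i<ns. \<Sum>j<nc. real (d i j) * real (out_x \<sigma> U i j))) <=
   ((\<Sum>i<ns. real (cst i) * real (Y i)) + (\<Sum>i<ns. \<Sum>j<nc. real (d i j) * real (X i j))) / real n"
proof -
 have XYa: "\<forall>i<ns. \<forall>j<nc. X i j <= Y i" and cova: "\<forall>j<nc. N * r j <= (\<Sum>i<ns. X i j)"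
  using XY cover by blast+
 note A = prep_arith[OF P XYa cova]
 have N0: "0 < 2 * N" using P by (simp add: gG_def)
 have q: "\<sigma> 14 i = qf Y i" and yr: "\<sigma> 17 i = Yr Y i" if "i < ns" for i
  using prep that unfolding prep_ok_def by blast+
 have xh: "\<sigma> 15 (i * nc + j) = hf Y X i j" if "i < ns" "j < nc" for i j
  using prep that unfolding prep_ok_def by blast
 have RR: "RR j = Rf Y X j" if "j < nc" for j
  using prep that base2D(2)[OF b] unfolding prep_ok_def by metis
 have H: "H = (\<Sum>j<nc. RR j)"
 proof -
  have "H = (\<Sum>j<nc. Rf Y X j)" using prep base2D(3)[OF b] unfolding prep_ok_def by metis
  then show ?thesis using RR by simp
 qed
 have INP: "INP (j * PP + p) = of_bool (p mod (2 * N) < Xr Y X (p div (2 * N)) j)" if "j < nc" "p < PP" for j p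
  using prep that base2D(4)[OF b] unfolding prep_ok_def by blast
 have Pset: "Pset j = {p. p < ns * (2 * N) \<and> p mod (2 * N) < Xr Y X (p div (2 * N)) j}" if "j < nc" for j
  unfolding Pset_def using INP[OF that] by auto
 have site: "p div (2 * N) < ns" if "p < PP" for p using that by (rule less_mult_imp_div_less)
 have Xr2: "Xr Y X i j <= 2 * N" if "i < ns" "j < nc" for i j using A(5)[OF that] A(1)[OF that(1)] by linarith
 have sumP: "(\<Sum>p\<in>Pset j. f (p div (2 * N))) = (\<Sum>i<ns. real (Xr Y X i j) * f i)" if "j < nc" for j and f :: "nat => real"
  unfolding Pset[OF that] by (rule sum_pieces) (rule Xr2[OF _ that])
 have cardP: "card (Pset j) = N * RR j" if j: "j < nc" for j
 proof -
  have "real (card (Pset j)) = (\<Sum>i<ns. real (Xr Y X i j) * 1)" using sumP[OF j, of "%_. 1"] by simp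
  also have "\<dots> = real (N * RR j)" unfolding RR[OF j] A(6)[OF j, symmetric] by simp
  finally show ?thesis by (simp only: of_nat_eq_iff)
 qed
 let ?V = "pieces (\<sigma> 17)"
 interpret p: partition_run nc H n N RR Pset dp "\<sigma> 24" "\<sigma> 25" "row \<sigma> 36" "row \<sigma> 28"
  by (rule make_run[OF P cardP H ok fok])
 interpret R: rounding nc H n N RR Pset dp "\<sigma> 24" "\<sigma> 25" "row \<sigma> 36" "row \<sigma> 28" PP ?V cdist
 proof
  show V: "?V \<subseteq> {..<PP}" by (auto simp: pieces_def)
  show "Pset j \<subseteq> ?V" if j: "j < nc" for j
  proof
   fix x assume "x \<in> Pset j"
   then have x: "x < PP" "x mod (2 * N) < Xr Y X (x div (2 * N)) j" using Pset[OF j] by auto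
   then have "x mod (2 * N) < \<sigma> 17 (x div (2 * N))" using A(5)[OF site[OF x(1)] j] yr[OF site[OF x(1)]] by linarith
   then show "x \<in> ?V" using x(1) by (simp add: pieces_def)
  qed
  show "n < N" "N <= 2 * n" using P by (simp_all add: gQ_def gG_def gS_def)
  show "(1 - 1 / real n) ^ n + (1 - 1 / real n) ^ N <= real N / real n - 1" by (rule rounding_numeric[OF P])
  fix j j' x assume j: "j < nc" "j' < nc" and "x \<in> ?V"
  then have "x div (2 * N) < ns" using V site by blast
  then show "real (dp j x) <= cdist j j' + real (dp j' x)" "cdist j j' <= real (dp j x) + real (dp j' x)"
   unfolding dp_def using tri j by blast+
 qed
 let ?S = "%j. {t. t < H \<and> \<sigma> 24 t = j}"
 have fib: "{t. t < H \<and> \<sigma> 24 t = j \<and> R.cp U t div (2 * N) = i} = {t \<in> ?S j. R.cp U t div (2 * N) = i}" for U i j by auto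
 have fibo: "{p. p < PP \<and> p div (2 * N) = i \<and> R.is_open U p} = {p \<in> {p. p < PP \<and> R.is_open U p}. p div (2 * N) = i}" for U i by auto
 have V: "p < PP" if "p \<in> ?V" for p using that by (simp add: pieces_def)
 {
  fix U assume "U \<in> set_pmf (unif_fun {..<H + PP} n)"
  then have U: "!!g. g < H + PP ==> U g < n" by (rule R.unif_fun_less)
  have cps: "R.cp U t div (2 * N) < ns" if "t < H" for t by (rule site[OF R.cp_open(1)[OF that U]])
  have 1: "out_x \<sigma> U i j <= out_y \<sigma> U i" if i: "i < ns" and j: "j < nc" for i j
  proof -
   have "card {t. t < H \<and> \<sigma> 24 t = j \<and> R.cp U t div (2 * N) = i} <= card {p. p < PP \<and> p div (2 * N) = i \<and> R.is_open U p}"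
   proof (rule card_inj_on_le)
    show "inj_on (R.cp U) {t. t < H \<and> \<sigma> 24 t = j \<and> R.cp U t div (2 * N) = i}"
     by (rule inj_onI, rule ccontr) (use R.cp_inj[OF _ _ _ _ U] in auto)
    show "R.cp U ` {t. t < H \<and> \<sigma> 24 t = j \<and> R.cp U t div (2 * N) = i} \<subseteq> {p. p < PP \<and> p div (2 * N) = i \<and> R.is_open U p}"
     using R.cp_open(1,2)[OF _ U] by (auto simp: R.cand_def)
   qed simp
   then show ?thesis unfolding out_x_def out_y_def xh[OF i j] q[OF i] by (intro add_mono A(3))
  qed
  have 2: "r j <= (\<Sum>i<ns. out_x \<sigma> U i j)" if j: "j < nc" for j
  proof -
   have "real (\<Sum>i<ns. card {t. t < H \<and> \<sigma> 24 t = j \<and> R.cp U t div (2 * N) = i}) = (\<Sum>t\<in>?S j. 1)"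
    unfolding fib using sum_fibres[of "?S j" "%t. R.cp U t div (2 * N)" ns "%_. 1"] cps by simp
   also have "\<dots> = real (RR j)" using p.cnt_H[OF j] by (simp add: p.cnt_def)
   finally have c: "(\<Sum>i<ns. card {t. t < H \<and> \<sigma> 24 t = j \<and> R.cp U t div (2 * N) = i}) = RR j" by (simp only: of_nat_eq_iff)
   have "(\<Sum>i<ns. out_x \<sigma> U i j) = (\<Sum>i<ns. hf Y X i j) + RR j"
    unfolding out_x_def sum.distrib c using xh j by simp
   then show ?thesis using A(7)[OF j] RR[OF j] by simp
  qed
  show "(\<forall>i<ns. \<forall>j<nc. out_x \<sigma> U i j <= out_y \<sigma> U i) \<and> (\<forall>j<nc. r j <= (\<Sum>i<ns. out_x \<sigma> U i j))"
   using 1 2 by blast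
 }
 define cq where "cq = (\<Sum>i<ns. real (cst i) * real (qf Y i))"
 define ch where "ch = (\<Sum>i<ns. \<Sum>j<nc. real (d i j) * real (hf Y X i j))"
 have ycost: "(\<Sum>i<ns. real (cst i) * real (out_y \<sigma> U i)) =
   cq + (\<Sum>p\<in>?V. real (cst (p div (2 * N))) * of_bool (R.is_open U p))" for U
 proof -
  have "(\<Sum>i<ns. real (cst i) * real (out_y \<sigma> U i)) = cq + (\<Sum>i<ns. real (cst i) * real (card {p. p < PP \<and> p div (2 * N) = i \<and> R.is_open U p}))"
   unfolding cq_def out_y_def sum.distrib[symmetric] by (intro sum.cong) (simp_all add: q algebra_simps)
  also have "(\<Sum>i<ns. real (cst i) * real (card {p. p < PP \<and> p div (2 * N) = i \<and> R.is_open U p})) =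
    (\<Sum>p | p < PP \<and> R.is_open U p. real (cst (p div (2 * N))))"
   unfolding fibo by (rule sum_fibres) (use site in auto)
  also have "\<dots> = (\<Sum>p\<in>?V. real (cst (p div (2 * N))) * of_bool (R.is_open U p))"
  proof (rule sum.mono_neutral_cong_left)
   show "finite ?V" by (simp add: pieces_def)
  qed (auto simp: R.is_open_def V)
  finally show ?thesis .
 qed
 have xcost: "(\<Sum>i<ns. \<Sum>j<nc. real (d i j) * real (out_x \<sigma> U i j)) = ch + (\<Sum>j<nc. \<Sum>t\<in>?S j. real (dp j (R.cp U t)))"
  if "U \<in> set_pmf (unif_fun {..<H + PP} n)" for U
 proof -
  have U: "!!g. g < H + PP ==> U g < n" using that by (rule R.unif_fun_less)
  have "(\<Sum>i<ns. \<Sum>j<nc. real (d i j) * real (out_x \<sigma> U i j)) =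
   ch + (\<Sum>i<ns. \<Sum>j<nc. real (d i j) * real (card {t. t < H \<and> \<sigma> 24 t = j \<and> R.cp U t div (2 * N) = i}))"
   unfolding ch_def out_x_def sum.distrib[symmetric] by (intro sum.cong refl) (simp only: xh lessThan_iff of_nat_add distrib_left)
  also have "(\<Sum>i<ns. \<Sum>j<nc. real (d i j) * real (card {t. t < H \<and> \<sigma> 24 t = j \<and> R.cp U t div (2 * N) = i})) =
   (\<Sum>j<nc. \<Sum>i<ns. real (d i j) * real (card {t. t < H \<and> \<sigma> 24 t = j \<and> R.cp U t div (2 * N) = i}))" by (rule sum.swap)
  also have "\<dots> = (\<Sum>j<nc. \<Sum>t\<in>?S j. real (d (R.cp U t div (2 * N)) j))"
   unfolding fib by (intro sum.cong refl sum_fibres) (use site R.cp_open(1)[OF _ U] in auto)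
  finally show ?thesis unfolding dp_def .
 qed
 let ?E = "measure_pmf.expectation (unif_fun {..<H + PP} n)"
 define G1 where "G1 U = (\<Sum>p\<in>?V. real (cst (p div (2 * N))) * of_bool (R.is_open U p))" for U
 define G2 where "G2 U = (\<Sum>j<nc. \<Sum>t\<in>?S j. real (dp j (R.cp U t)))" for U
 have i: "integrable (measure_pmf (unif_fun {..<H + PP} n)) f" for f :: "_ => real" by (rule R.pg.integrable)
 have e0: "?E (%U. (\<Sum>i<ns. real (cst i) * real (out_y \<sigma> U i)) + (\<Sum>i<ns. \<Sum>j<nc. real (d i j) * real (out_x \<sigma> U i j))) =
  ?E (%U. (cq + G1 U) + (ch + G2 U))"
 proof (intro integral_cong_AE)
  show "AE U in measure_pmf (unif_fun {..<H + PP} n). (\<Sum>i<ns. real (cst i) * real (out_y \<sigma> U i)) + (\<Sum>i<ns. \<Sum>j<nc. real (d i j) * real (out_x \<sigma> U i j)) =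
   (cq + G1 U) + (ch + G2 U)"
   unfolding AE_measure_pmf_iff ycost G1_def[symmetric]
  proof
   fix U assume "U \<in> set_pmf (unif_fun {..<H + PP} n)"
   from xcost[OF this]
   show "cq + G1 U + (\<Sum>i<ns. \<Sum>j<nc. real (d i j) * real (out_x \<sigma> U i j)) = cq + G1 U + (ch + G2 U)"
    unfolding G2_def by (simp only:)
  qed
 qed simp_all
 have e1: "?E (%U. (cq + G1 U) + (ch + G2 U)) = (cq + ?E G1) + (ch + ?E G2)" by (simp add: i)
 have e2: "?E G1 = (\<Sum>i<ns. real (cst i) * real (Yr Y i)) / real n"
 proof -
  have "?E G1 = (\<Sum>p\<in>?V. ?E (%U. real (cst (p div (2 * N))) * of_bool (R.is_open U p)))"
   unfolding G1_def by (rule Bochner_Integration.integral_sum) (rule i)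
  also have "\<dots> = (\<Sum>p\<in>?V. real (cst (p div (2 * N))) / real n)"
   by (intro sum.cong refl) (simp add: R.expect_open)
  also have "\<dots> = (\<Sum>p\<in>?V. real (cst (p div (2 * N)))) / real n" by (rule sum_divide_distrib[symmetric])
  finally have 1: "?E G1 = (\<Sum>p\<in>?V. real (cst (p div (2 * N)))) / real n" .
  have "(\<Sum>p\<in>?V. real (cst (p div (2 * N)))) = (\<Sum>i<ns. real (\<sigma> 17 i) * real (cst i))"
   unfolding pieces_def by (rule sum_pieces) (use A(1) yr in \<open>simp add: less_imp_le\<close>)
  then show ?thesis unfolding 1 by (simp add: yr mult.commute)
 qed
 have e3: "?E G2 <= (\<Sum>i<ns. \<Sum>j<nc. real (d i j) * real (Xr Y X i j)) / real n"
 proof -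
  have "?E G2 = (\<Sum>j<nc. ?E (%U. \<Sum>t\<in>?S j. real (dp j (R.cp U t))))"
   unfolding G2_def by (rule Bochner_Integration.integral_sum) (rule i)
  also have "\<dots> = (\<Sum>j<nc. \<Sum>t\<in>?S j. ?E (%U. real (dp j (R.cp U t))))"
   by (intro sum.cong refl Bochner_Integration.integral_sum i)
  finally have 1: "?E G2 = (\<Sum>j<nc. \<Sum>t\<in>?S j. ?E (%U. real (dp j (R.cp U t))))" .
  have 2: "(\<Sum>j<nc. \<Sum>t\<in>?S j. ?E (%U. real (dp j (R.cp U t)))) <= (\<Sum>j<nc. (\<Sum>p\<in>Pset j. real (dp j p)) / real n)"
   by (intro sum_mono R.expected_client) simp
  have 3: "(\<Sum>p\<in>Pset j. real (dp j p)) / real n = (\<Sum>i<ns. real (d i j) * real (Xr Y X i j)) / real n" if "j < nc" for j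
   using sumP[OF that, of "%i. real (d i j)"] unfolding dp_def by (simp add: mult.commute)
  have "(\<Sum>j<nc. (\<Sum>p\<in>Pset j. real (dp j p)) / real n) = (\<Sum>j<nc. (\<Sum>i<ns. real (d i j) * real (Xr Y X i j)) / real n)"
   by (intro sum.cong refl 3) simp
  also have "\<dots> = (\<Sum>j<nc. \<Sum>i<ns. real (d i j) * real (Xr Y X i j)) / real n" by (rule sum_divide_distrib[symmetric])
  finally have 4: "(\<Sum>j<nc. (\<Sum>p\<in>Pset j. real (dp j p)) / real n) = (\<Sum>j<nc. \<Sum>i<ns. real (d i j) * real (Xr Y X i j)) / real n" .
  have 5: "(\<Sum>i<ns. \<Sum>j<nc. real (d i j) * real (Xr Y X i j)) = (\<Sum>j<nc. \<Sum>i<ns. real (d i j) * real (Xr Y X i j))" by (rule sum.swap)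
  show ?thesis unfolding 1 5 using 2 unfolding 4 .
 qed
 have E: "?E (%U. (\<Sum>i<ns. real (cst i) * real (out_y \<sigma> U i)) + (\<Sum>i<ns. \<Sum>j<nc. real (d i j) * real (out_x \<sigma> U i j))) <=
   (cq + (\<Sum>i<ns. real (cst i) * real (Yr Y i)) / real n) + (ch + (\<Sum>i<ns. \<Sum>j<nc. real (d i j) * real (Xr Y X i j)) / real n)"
  unfolding e0 e1 e2 by (intro add_mono order.refl e3)
 have n0: "0 < real n" using p.n by simp
 have nN: "real n <= real N" using R.nN by simp
 have gen: "c * (real n * u + w) / real n = c * u + c * w / real n" for c u w :: real
 proof -
  have "c * (m * u + w) / m = c * u + c * w / m" if "0 < m" for m :: real using that by (simp add: field_simps)
  then show ?thesis using n0 by blast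
 qed
 \<comment> \<open>A facility of the deterministic part uses up \<open>N\<close> units of
   \<open>Y\<close> and is charged once, whereas the bound grants it \<open>N / n\<close>, which
   exceeds one. The same argument applies to the connections.\<close>
 have "cq + (\<Sum>i<ns. real (cst i) * real (Yr Y i)) / real n <= (\<Sum>i<ns. real (cst i) * real (Y i)) / real n"
  unfolding cq_def sum_divide_distrib sum.distrib[symmetric]
 proof (intro sum_mono)
  fix i assume "i \<in> {..<ns}"
  then have "real (Y i) = real N * real (qf Y i) + real (Yr Y i)" using A(2)[of i] by (metis lessThan_iff of_nat_add of_nat_mult)
  moreover have "real n * real (qf Y i) <= real N * real (qf Y i)" using nN by (intro mult_right_mono) simp_all
  ultimately have "real (cst i) * (real n * real (qf Y i) + real (Yr Y i)) <= real (cst i) * real (Y i)" by (intro mult_left_mono) simp_all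
  then have "real (cst i) * (real n * real (qf Y i) + real (Yr Y i)) / real n <= real (cst i) * real (Y i) / real n"
   using n0 by (intro divide_right_mono) simp_all
  moreover have "real (cst i) * (real n * real (qf Y i) + real (Yr Y i)) / real n = real (cst i) * real (qf Y i) + real (cst i) * real (Yr Y i) / real n"
   by (rule gen)
  ultimately show "real (cst i) * real (qf Y i) + real (cst i) * real (Yr Y i) / real n <= real (cst i) * real (Y i) / real n" by simp
 qed
 moreover have "ch + (\<Sum>i<ns. \<Sum>j<nc. real (d i j) * real (Xr Y X i j)) / real n <= (\<Sum>i<ns. \<Sum>j<nc. real (d i j) * real (X i j)) / real n"
  unfolding ch_def sum_divide_distrib sum.distrib[symmetric]
 proof (intro sum_mono)
  fix i j assume "i \<in> {..<ns}" "j \<in> {..<nc}"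
  then have "N * hf Y X i j + Xr Y X i j <= X i j" by (intro A(4)) simp_all
  then have "real N * real (hf Y X i j) + real (Xr Y X i j) <= real (X i j)" by (metis of_nat_add of_nat_le_iff of_nat_mult)
  moreover have "real n * real (hf Y X i j) <= real N * real (hf Y X i j)" using nN by (intro mult_right_mono) simp_all
  ultimately have "real (d i j) * (real n * real (hf Y X i j) + real (Xr Y X i j)) <= real (d i j) * real (X i j)" by (intro mult_left_mono) simp_all
  then have "real (d i j) * (real n * real (hf Y X i j) + real (Xr Y X i j)) / real n <= real (d i j) * real (X i j) / real n"
   using n0 by (intro divide_right_mono) simp_all
  moreover have "real (d i j) * (real n * real (hf Y X i j) + real (Xr Y X i j)) / real n = real (d i j) * real (hf Y X i j) + real (d i j) * real (Xr Y X i j) / real n"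
   by (rule gen)
  ultimately show "real (d i j) * real (hf Y X i j) + real (d i j) * real (Xr Y X i j) / real n <= real (d i j) * real (X i j) / real n" by simp
 qed
 ultimately show "?E (%U. (\<Sum>i<ns. real (cst i) * real (out_y \<sigma> U i)) + (\<Sum>i<ns. \<Sum>j<nc. real (d i j) * real (out_x \<sigma> U i j))) <=
   ((\<Sum>i<ns. real (cst i) * real (Y i)) + (\<Sum>i<ns. \<Sum>j<nc. real (d i j) * real (X i j))) / real n"
  using E unfolding add_divide_distrib by linarith
qed

end

section \<open>Layout of the encoded instance and the two optimal values\<close>

lemma upt_shift: "[a..<a + m] = map (%v. a + v) [0..<m]"
 using map_add_upt[of a m] by (simp add: add.commute)

lemma concat_rows:
 "concat (map (%i. concat (map (f i) [0..<m])) [0..<l]) = concat (map (%v. f (v div m) (v mod m)) [0..<l * m])"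
proof (induction l)
 case (Suc l)
 define F where "F v = f (v div m) (v mod m)" for v
 have IH: "concat (map (%i. concat (map (f i) [0..<m])) [0..<l]) = concat (map F [0..<l * m])"
  using Suc unfolding F_def .
 have u: "[0..<Suc l * m] = [0..<l * m] @ map (%j. l * m + j) [0..<m]"
  using upt_add_eq_append[of 0 "l * m" m] upt_shift[of "l * m" m] by (simp add: add.commute)
 have "map (%j. F (l * m + j)) [0..<m] = map (f l) [0..<m]"
  unfolding F_def using row_index[of _ m l] by (intro map_cong refl) simp
 then have "concat (map F [0..<Suc l * m]) = concat (map F [0..<l * m]) @ concat (map (f l) [0..<m])"
  unfolding u map_append concat_append map_map o_def by (simp only:)
 then show ?case unfolding F_def[symmetric] using IH by simp
qed simp

lemma concat_pairs:
 "length (concat (map (%v. [a v, b v]) [0..<m])) = 2 * m \<and> (\<forall>v<m.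
  concat (map (%v. [a v, b v]) [0..<m]) ! (2 * v) = a v \<and> concat (map (%v. [a v, b v]) [0..<m]) ! Suc (2 * v) = b v)"
proof (induction m)
 case (Suc m)
 then have len: "length (concat (map (%v. [a v, b v]) [0..<m])) = 2 * m" by blast
 let ?L = "concat (map (%v. [a v, b v]) [0..<m])"
 have ap: "concat (map (%v. [a v, b v]) [0..<Suc m]) = ?L @ [a m, b m]" by simp
 have IH: "?L ! (2 * v) = a v" "?L ! Suc (2 * v) = b v" if "v < m" for v using Suc that by blast+
 show ?case unfolding ap
 proof (intro conjI allI impI)
  fix v assume v: "v < Suc m"
  show "(?L @ [a m, b m]) ! (2 * v) = a v"
  proof (cases "v = m")
   case False
   then have "v < m" using v by simp
   then show ?thesis using IH(1) len by (simp add: nth_append)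
  qed (simp add: nth_append len)
  show "(?L @ [a m, b m]) ! Suc (2 * v) = b v"
  proof (cases "v = m")
   case False
   then have "v < m" using v by simp
   then show ?thesis using IH(2) len by (simp add: nth_append)
  qed (simp add: nth_append len)
 qed (use len in simp)
qed simp

lemma of_rat_quotient:
 assumes "0 <= q"
 shows "0 < nat (snd (quotient_of q)) \<and>
  (of_rat q :: real) = real (nat (fst (quotient_of q))) / real (nat (snd (quotient_of q)))"
proof -
 obtain a b where ab: "quotient_of q = (a, b)" by (cases "quotient_of q")
 have b: "0 < b" by (rule quotient_of_denom_pos[OF ab])
 have q: "q = of_int a / of_int b" by (rule quotient_of_div[OF ab])
 have a: "0 <= a" using assms b unfolding q by (simp add: zero_le_divide_iff)
 show ?thesis using a b ab by (simp add: q of_rat_divide)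
qed

text \<open>A common numbering of opening and connection costs, in the order of the encoding and of
  array 3.\<close>

definition cost_at :: "ftfp => nat => rat" where
 "cost_at I v = (if v < nsites I then open_cost I v
   else conn_cost I ((v - nsites I) div nclients I) ((v - nsites I) mod nclients I))"

lemma cost_at_simps:
 "i < nsites I ==> cost_at I i = open_cost I i"
 "j < nclients I ==> cost_at I (nsites I + (i * nclients I + j)) = conn_cost I i j"
 using row_index[of j "nclients I" i] by (simp_all add: cost_at_def)

lemma encode_layout:
 fixes I :: ftfp
 defines "m \<equiv> nsites I + nsites I * nclients I"
 shows "length (encode_ftfp I) = 2 + 2 * m + nclients I"
  "encode_ftfp I ! 0 = nsites I" "encode_ftfp I ! 1 = nclients I"
  "v < m ==> encode_ftfp I ! (2 + 2 * v) = nat (fst (quotient_of (cost_at I v)))"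
  "v < m ==> encode_ftfp I ! (3 + 2 * v) = nat (snd (quotient_of (cost_at I v)))"
  "j < nclients I ==> encode_ftfp I ! (2 + 2 * m + j) = demand I j"
proof -
 let ?ns = "nsites I" and ?nc = "nclients I"
 let ?a = "%v. nat (fst (quotient_of (cost_at I v)))" and ?b = "%v. nat (snd (quotient_of (cost_at I v)))"
 let ?C = "concat (map (%v. [?a v, ?b v]) [0..<m])"
 have er: "encode_rat q = [nat (fst (quotient_of q)), nat (snd (quotient_of q))]" for q
  by (simp add: encode_rat_def case_prod_beta)
 have "[0..<m] = [0..<?ns] @ map (%v. ?ns + v) [0..<?ns * ?nc]"
  unfolding m_def using upt_add_eq_append[of 0 ?ns "?ns * ?nc"] upt_shift[of ?ns "?ns * ?nc"] by simp
 then have "?C = concat (map (%v. encode_rat (cost_at I v)) [0..<?ns]) @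
   concat (map (%v. encode_rat (cost_at I (?ns + v))) [0..<?ns * ?nc])"
  by (simp add: er o_def)
 also have "map (%v. encode_rat (cost_at I v)) [0..<?ns] = map (%i. encode_rat (open_cost I i)) [0..<?ns]"
  by (intro map_cong refl) (simp add: cost_at_def)
 also have "map (%v. encode_rat (cost_at I (?ns + v))) [0..<?ns * ?nc] =
   map (%v. encode_rat (conn_cost I (v div ?nc) (v mod ?nc))) [0..<?ns * ?nc]"
  by (intro map_cong refl) (simp add: cost_at_def)
 also have "concat (map (%v. encode_rat (conn_cost I (v div ?nc) (v mod ?nc))) [0..<?ns * ?nc]) =
   concat (map (%i. concat (map (%j. encode_rat (conn_cost I i j)) [0..<?nc])) [0..<?ns])"
  by (rule concat_rows[symmetric])
 finally have e: "encode_ftfp I = [?ns, ?nc] @ (?C @ map (demand I) [0..<?nc])"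
  unfolding encode_ftfp_def by simp
 note C = concat_pairs[of ?a ?b m]
 have len: "length ?C = 2 * m" using C by blast
 show "length (encode_ftfp I) = 2 + 2 * m + ?nc" "encode_ftfp I ! 0 = ?ns" "encode_ftfp I ! 1 = ?nc"
  unfolding e using len by simp_all
 have nth: "encode_ftfp I ! (2 + k) = (?C @ map (demand I) [0..<?nc]) ! k" for k unfolding e by simp
 show "encode_ftfp I ! (2 + 2 * v) = ?a v" if "v < m"
  unfolding nth using C len that by (simp add: nth_append)
 show "encode_ftfp I ! (3 + 2 * v) = ?b v" if v: "v < m"
 proof -
  have "encode_ftfp I ! (3 + 2 * v) = encode_ftfp I ! (2 + Suc (2 * v))" by (rule arg_cong[where f = "(!) (encode_ftfp I)"]) simp
  also have "\<dots> = ?C ! Suc (2 * v)" unfolding nth using len v by (simp add: nth_append)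
  finally show ?thesis using C v by simp
 qed
 show "encode_ftfp I ! (2 + 2 * m + j) = demand I j" if "j < ?nc"
 proof -
  have "encode_ftfp I ! (2 + 2 * m + j) = (?C @ map (demand I) [0..<?nc]) ! (2 * m + j)" unfolding add.assoc nth ..
  also have "\<dots> = map (demand I) [0..<?nc] ! j" using len nth_append_length_plus[of ?C _ j] by simp
  finally show ?thesis using that by simp
 qed
qed

lemma points_iff: "Inl i \<in> points I \<longleftrightarrow> i < nsites I" "Inr j \<in> points I \<longleftrightarrow> j < nclients I"
 by (auto simp: points_def)

lemma lp_cost_nonneg:
 assumes "ftfp_instance I" "lp_feasible I y x"
 shows "0 <= lp_cost I y x"
proof -
 have "0 <= open_cost I i" if "i < nsites I" for i using assms(1) that by (simp add: ftfp_instance_def)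
 moreover have "0 <= conn_cost I i j" if "i < nsites I" "j < nclients I" for i j
 proof -
  have "Inl i \<in> points I" "Inr j \<in> points I" using that by (simp_all add: points_iff)
  then show ?thesis using assms(1) unfolding ftfp_instance_def conn_cost_def by blast
 qed
 moreover have "0 <= y i" "j < nclients I ==> 0 <= x i j" if "i < nsites I" for i j
  using assms(2) that by (simp_all add: lp_feasible_def)
 ultimately show ?thesis unfolding lp_cost_def
  by (intro add_nonneg_nonneg sum_nonneg mult_nonneg_nonneg) simp_all
qed

lemma int_lp_feasible: "int_feasible I y x ==> lp_feasible I (%i. real (y i)) (%i j. real (x i j))"
 unfolding int_feasible_def lp_feasible_def by (simp flip: of_nat_sum)

text \<open>Opening the total demand at every site is wasteful but feasible as soon as there is a
  site; it shows that both infima range over nonempty sets.\<close>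

lemma int_feasible_ex:
 assumes "ftfp_instance I"
 shows "int_feasible I (%_. \<Sum>j<nclients I. demand I j) (%_ j. demand I j)"
 unfolding int_feasible_def
proof (intro conjI allI impI)
 fix j assume j: "j < nclients I"
 show "demand I j <= (\<Sum>j<nclients I. demand I j)" using j by (intro member_le_sum) simp_all
 have "0 < nsites I" using assms j by (simp add: ftfp_instance_def)
 then have "1 * demand I j <= nsites I * demand I j" by (intro mult_right_mono) simp_all
 then show "demand I j <= (\<Sum>i<nsites I. demand I j)" by simp
qed

lemma LP_opt_le_OPT:
 assumes "ftfp_instance I"
 shows "LP_opt I <= OPT I"
 unfolding LP_opt_def OPT_def
proof (rule cInf_superset_mono)
 show "{int_cost I y x |y x. int_feasible I y x} \<noteq> {}" using int_feasible_ex[OF assms] by blast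
 show "bdd_below {lp_cost I y x |y x. lp_feasible I y x}" using lp_cost_nonneg[OF assms] by (intro bdd_belowI[of _ 0]) auto
 show "{int_cost I y x |y x. int_feasible I y x} \<subseteq> {lp_cost I y x |y x. lp_feasible I y x}"
 proof
  fix c assume "c \<in> {int_cost I y x |y x. int_feasible I y x}"
  then obtain y x where c: "c = int_cost I y x" "int_feasible I y x" by blast
  have "c = lp_cost I (%i. real (y i)) (%i j. real (x i j))" unfolding c int_cost_def lp_cost_def ..
  then show "c \<in> {lp_cost I y x |y x. lp_feasible I y x}" using int_lp_feasible[OF c(2)] by blast
 qed
qed

abbreviation arr_x :: "ftfp => (nat => nat) => nat => nat => nat" where
 "arr_x I f \<equiv> %i j. f (nsites I + i * nclients I + j)"

text \<open>Feasibility and cost look at the first \<open>ns + ns * nc\<close> cells only. This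
  matters because \<open>decode_solution\<close> is a function of the whole memory, of which only
  these cells are controlled.\<close>

lemma arr_cong:
 assumes "!!k. k < nsites I + nsites I * nclients I ==> f k = g k"
 shows "int_feasible I f (arr_x I f) = int_feasible I g (arr_x I g)"
  "int_cost I f (arr_x I f) = int_cost I g (arr_x I g)"
proof -
 have y: "f i = g i" if "i < nsites I" for i using assms that by simp
 have x: "f (nsites I + i * nclients I + j) = g (nsites I + i * nclients I + j)" if "i < nsites I" "j < nclients I" for i j
 proof (rule assms)
  have "Suc i * nclients I <= nsites I * nclients I" using that by (intro mult_right_mono) simp_all
  then show "nsites I + i * nclients I + j < nsites I + nsites I * nclients I" using that by simp
 qed
 have s: "(\<Sum>i<nsites I. f (nsites I + i * nclients I + j)) = (\<Sum>i<nsites I. g (nsites I + i * nclients I + j))"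
  if "j < nclients I" for j using x that by (intro sum.cong) simp_all
 show "int_feasible I f (arr_x I f) = int_feasible I g (arr_x I g)"
  unfolding int_feasible_def using x y s by (simp cong: imp_cong)
 show "int_cost I f (arr_x I f) = int_cost I g (arr_x I g)"
  unfolding int_cost_def using x y by (intro arg_cong2[where f = "(+)"] sum.cong refl) simp_all
qed

section \<open>The guarantee for the program and the final statement\<close>

lemma prog_quality:
 fixes I :: ftfp
 assumes inst: "ftfp_instance I"
 defines "D \<equiv> exec prog (%_. 0) (init_state (encode_ftfp I))"
 shows "\<forall>\<sigma>\<in>set_pmf D. int_feasible I (\<sigma> 37) (arr_x I (\<sigma> 37))"
  and "measure_pmf.expectation D (%\<sigma>. int_cost I (\<sigma> 37) (arr_x I (\<sigma> 37))) <= 1.575 * LP_opt I"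
proof -
 define ns where "ns = nsites I"
 define nc where "nc = nclients I"
 define m where "m = ns + ns * nc"
 define \<rho> :: env where "\<rho> = (%_. 0)"
 define xs where "xs = encode_ftfp I"
 note lay = encode_layout[where I = I, folded ns_def nc_def, folded m_def xs_def]
 define \<sigma>0 where "\<sigma>0 = init_state xs"
 have len: "length xs = 2 + 2 * m + nc" by (rule lay)
 have cell: "\<sigma>0 0 k = xs ! k" if "0 < k" "k < length xs" for k
 proof -
  have "min k (length xs - 1) = k" using that by linarith
  then show ?thesis using that by (simp add: \<sigma>0_def init_state_def)
 qed
 have dims: "\<sigma>0 1 0 = ns" "\<sigma>0 1 1 = nc" and z29: "\<sigma>0 29 = (%_. 0)"
  using lay(2,3) by (simp_all add: \<sigma>0_def init_state_def)
 define b where "b v = \<sigma>0 0 (3 + 2 * v)" for v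
 define DEN where "DEN = (\<Prod>v<m. b v)"
 have cost0: "0 <= cost_at I v" if "v < m" for v
 proof (cases "v < ns")
  case True
  then show ?thesis using inst by (simp add: cost_at_def ftfp_instance_def ns_def)
 next
  case False
  then have v: "v - ns < ns * nc" using that by (simp add: m_def)
  then have "0 < nc" by (cases "nc = 0") simp_all
  then have "(v - ns) mod nc < nc" by simp
  moreover have "(v - ns) div nc < ns" using v by (rule less_mult_imp_div_less)
  ultimately have "Inl ((v - ns) div nc) \<in> points I" "Inr ((v - ns) mod nc) \<in> points I" by (simp_all add: points_iff ns_def nc_def)
  then have "0 <= conn_cost I ((v - ns) div nc) ((v - ns) mod nc)"
   using inst unfolding ftfp_instance_def conn_cost_def by blast
  then show ?thesis using False by (simp add: cost_at_def ns_def nc_def)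
 qed
 have ab: "0 < b v" "(of_rat (cost_at I v) :: real) = real (\<sigma>0 0 (2 + 2 * v)) / real (b v)" if v: "v < m" for v
 proof -
  have c: "\<sigma>0 0 (2 + 2 * v) = nat (fst (quotient_of (cost_at I v)))" "b v = nat (snd (quotient_of (cost_at I v)))"
   unfolding b_def using cell[of "2 + 2 * v"] cell[of "3 + 2 * v"] lay(4,5)[OF v] len v by simp_all
  show "0 < b v" "(of_rat (cost_at I v) :: real) = real (\<sigma>0 0 (2 + 2 * v)) / real (b v)"
   using of_rat_quotient[OF cost0[OF v]] unfolding c by simp_all
 qed
 have DEN: "0 < DEN" unfolding DEN_def using ab(1) by (intro prod_pos) simp
 define \<sigma>1 where "\<sigma>1 = dexec c_setup \<rho> \<sigma>0"
 note S = setup_effect[where \<sigma> = \<sigma>0 and \<rho> = \<rho>, OF dims, folded m_def, folded b_def, folded DEN_def \<sigma>1_def]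
 define inp where "inp = \<sigma>0 0"
 define cst where "cst = \<sigma>1 3"
 define P where "P = \<sigma>1 5 0"
 have P: "0 < P" "nc <= P" using S(4,5) by (simp_all add: P_def)
 have cst: "real (cst v) = real DEN * of_rat (cost_at I v)" if v: "v < m" for v
 proof -
  have "b v dvd DEN" unfolding DEN_def using v by (intro dvd_prodI) simp_all
  then have "real (DEN div b v) = real DEN / real (b v)" by (rule real_of_nat_div)
  then show ?thesis unfolding cst_def S(3)[OF v] ab(2)[OF v] of_nat_mult by simp
 qed
 interpret i: inst inp cst ns nc P .
 have b1: "i.base \<sigma>1" unfolding i.base_def using S(1,2) dims by (simp add: inp_def cst_def P_def)
 define \<sigma>2 where "\<sigma>2 = dexec c_mw \<rho> \<sigma>1"
 have mw: "i.base \<sigma>2" "!!t. t < i.T ==> i.mw_ok (i.rowA \<sigma>2) (\<sigma>2 11) (\<sigma>2 9) t"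
  using i.mw_loop[OF b1, of \<rho>] unfolding \<sigma>2_def by blast+
 define Y where "Y = i.Yf (\<sigma>2 9) (\<sigma>2 11)"
 define X where "X = i.Xf (i.rowA \<sigma>2) (\<sigma>2 9) (\<sigma>2 11)"
 define \<sigma>3 where "\<sigma>3 = dexec inst.c_prep \<rho> \<sigma>2"
 have prep3: "i.prep_ok Y X \<sigma>3" unfolding \<sigma>3_def Y_def X_def by (rule i.prep[OF mw(1)])
 interpret j: inst2 inp cst ns nc P "\<sigma>3 16" "\<sigma>3 20" "\<sigma>3 19 0" .
 have "i.base \<sigma>3" using prep3 unfolding i.prep_ok_def by (rule conjunct1)
 then have b3: "j.base2 \<sigma>3" unfolding j.base2_def by (intro conjI refl)
 define \<sigma>4 where "\<sigma>4 = dexec c_part \<rho> \<sigma>3"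
 note part = j.part_loop[OF b3, of \<rho>, folded \<sigma>4_def]
 have b4: "j.base2 \<sigma>4" and le4: "!!t p. t < \<sigma>3 19 0 ==> p < i.PP ==> \<sigma>4 36 (t * i.PP + p) <= 1" using part by blast+
 define \<sigma>5 where "\<sigma>5 = dexec c_fill \<rho> \<sigma>4"
 have fill: "\<forall>t<\<sigma>3 19 0. j.fill_ok (\<sigma>5 24) (j.row \<sigma>5 36) (j.row \<sigma>5 28) t"
  unfolding \<sigma>5_def by (rule j.fill_loop[OF b4 le4])
 have wf: "\<sigma>5 a = \<sigma>4 a" if "a \<notin> {27, 28}" for a
  unfolding \<sigma>5_def by (rule dexec_unwritten) (use that in \<open>simp add: cmd_defs\<close>)
 have wp: "\<sigma>4 a = \<sigma>3 a" if "a \<notin> {21, 22, 23, 24, 25, 35, 36}" for a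
  unfolding \<sigma>4_def by (rule dexec_unwritten) (use that in \<open>simp add: cmd_defs\<close>)
 have s5: "\<sigma>5 24 = \<sigma>4 24" "\<sigma>5 25 = \<sigma>4 25" "\<sigma>5 36 = \<sigma>4 36" by (simp_all add: wf)
 have row5: "j.row \<sigma>5 36 = j.row \<sigma>4 36" using s5(3) by (simp add: j.row_def fun_eq_iff)
 have part5: "\<forall>t<\<sigma>3 19 0. j.part_ok (\<sigma>5 24) (\<sigma>5 25) (j.row \<sigma>5 36) t" unfolding row5 s5 using part by blast
 have le5: "!!t p. t < \<sigma>3 19 0 ==> p < i.PP ==> \<sigma>5 36 (t * i.PP + p) <= 1" unfolding s5 by (rule le4)
 have b5: "j.base2 \<sigma>5" using b4 by (simp add: j.base2_def i.base_def wf)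
 have bs5: "i.base \<sigma>5" by (rule j.base2D(1)[OF b5])
 have prep5: "i.prep_ok Y X \<sigma>5" using prep3 bs5 by (simp add: i.prep_ok_def wf wp)
 have r: "i.r j = demand I j" if "j < nc" for j
 proof -
  have "i.r j = inp (2 + 2 * m + j)" unfolding i.r_def m_def ..
  also have "inp (2 + 2 * m + j) = xs ! (2 + 2 * m + j)" unfolding inp_def
   by (rule cell) (use len that in simp_all)
  finally show ?thesis using lay(6)[OF that] by simp
 qed
 have open_c: "real (cst i) = real DEN * of_rat (open_cost I i)" if "i < ns" for i
  using cst[of i] cost_at_simps(1)[of i I] that by (simp add: m_def ns_def)
 have conn_c: "real (i.d i j) = real DEN * of_rat (conn_cost I i j)" if ij: "i < ns" "j < nc" for i j
 proof -
  have "Suc i * nc <= ns * nc" using ij by (intro mult_right_mono) simp_all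
  then have "ns + (i * nc + j) < m" using ij by (simp add: m_def)
  then have c: "real (cst (ns + (i * nc + j))) = real DEN * of_rat (cost_at I (ns + (i * nc + j)))" by (rule cst)
  have "j < nclients I" using ij(2) unfolding nc_def .
  from cost_at_simps(2)[OF this, of i] have e: "cost_at I (ns + (i * nc + j)) = conn_cost I i j"
   unfolding ns_def[symmetric] nc_def[symmetric] .
  show ?thesis unfolding i.d_def c e ..
 qed
 have scaled: "(\<Sum>i<ns. real (cst i) * y i) + (\<Sum>i<ns. \<Sum>j<nc. real (i.d i j) * x i j) = real DEN * lp_cost I y x" for y x
  unfolding lp_cost_def ns_def[symmetric] nc_def[symmetric] distrib_left sum_distrib_left
  by (intro arg_cong2[where f = "(+)"] sum.cong refl) (simp_all add: open_c conn_c)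
 \<comment> \<open>The history in memory is fixed, while \<open>y\<close> and \<open>x\<close> vary
   over all feasible fractional solutions. The summand \<epsilon> keeps the upper bound positive
   when the fractional cost is 0.\<close>
 have mwr: "(\<forall>j<nc. i.N * i.r j <= (\<Sum>i<ns. X i j)) \<and>
   (\<Sum>i<ns. real (cst i) * real (Y i)) + (\<Sum>i<ns. \<Sum>j<nc. real (i.d i j) * real (X i j)) <=
   (real DEN * lp_cost I y x + \<epsilon>) * (real gD * real nc + (1 + 2 / real gD) * real i.N + 1)"
  if f: "lp_feasible I y x" and e: "0 < \<epsilon>" for y x \<epsilon>
 proof -
  have rpos: "0 < i.r j" if "j < nc" for j using r[OF that] inst that by (simp add: ftfp_instance_def nc_def)
  have nsp: "0 < nc ==> 0 < ns" using inst by (simp add: ftfp_instance_def nc_def ns_def)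
  have L: "0 < real DEN * lp_cost I y x + \<epsilon>"
   using lp_cost_nonneg[OF inst f] e by (intro add_nonneg_pos mult_nonneg_nonneg) simp_all
  have y0: "0 <= y i" if "i < ns" for i using f that by (simp add: lp_feasible_def ns_def)
  have x0: "0 <= x i j \<and> x i j <= y i" if "i < ns" "j < nc" for i j using f that by (simp add: lp_feasible_def ns_def nc_def)
  have cov: "real (i.r j) <= (\<Sum>i<ns. x i j)" if "j < nc" for j using f that r[OF that] by (simp add: lp_feasible_def ns_def nc_def)
  have c: "(\<Sum>i<ns. real (cst i) * y i) + (\<Sum>i<ns. \<Sum>j<nc. real (i.d i j) * x i j) <= real DEN * lp_cost I y x + \<epsilon>"
   unfolding scaled using e by simp
  have "i.N * i.r j <= (\<Sum>i<ns. X i j)" if j: "j < nc" for j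
   unfolding X_def by (rule i.mw_result(1)[where A = "i.rowA \<sigma>2" and th = "\<sigma>2 11" and bv = "\<sigma>2 9" and y = y and x = x, OF mw(2) rpos nsp L y0 x0 cov c j])
  moreover have "(\<Sum>i<ns. real (cst i) * real (Y i)) + (\<Sum>i<ns. \<Sum>j<nc. real (i.d i j) * real (X i j)) <=
   (real DEN * lp_cost I y x + \<epsilon>) * (real gD * real nc + (1 + 2 / real gD) * real i.N + 1)"
   unfolding X_def Y_def by (rule i.mw_result(2)[where A = "i.rowA \<sigma>2" and th = "\<sigma>2 11" and bv = "\<sigma>2 9" and y = y and x = x, OF mw(2) rpos nsp L y0 x0 cov c])
  ultimately show ?thesis by blast
 qed
 note lp0 = int_lp_feasible[OF int_feasible_ex[OF inst]]
 have cover: "i.N * i.r j <= (\<Sum>i<ns. X i j)" if "j < nc" for j using mwr[OF lp0 zero_less_one] that by blast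
 have XY: "X i j <= Y i" if "j < nc" for i j unfolding X_def Y_def by (rule i.X_le_Y[OF mw(2) that])
 \<comment> \<open>Distances between clients are not part of the encoded input. The algorithm never
   consults them; they serve the triangle inequalities of the analysis.\<close>
 define cdist where "cdist j j' = real DEN * of_rat (dist_fn I (Inr j) (Inr j'))" for j j'
 have tri: "real (i.d i j) <= cdist j j' + real (i.d i j')" "cdist j j' <= real (i.d i j) + real (i.d i j')"
  if "i < ns" "j < nc" "j' < nc" for i j j'
 proof -
  have p: "Inl i \<in> points I" "Inr j \<in> points I" "Inr j' \<in> points I"
   using that by (simp_all add: points_iff ns_def nc_def)
  have T: "dist_fn I u w <= dist_fn I u v + dist_fn I v w" if "u \<in> points I" "v \<in> points I" "w \<in> points I" for u v w
   using inst that unfolding ftfp_instance_def by blast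
  have sy: "dist_fn I u v = dist_fn I v u" if "u \<in> points I" "v \<in> points I" for u v
   using inst that unfolding ftfp_instance_def by blast
  have "dist_fn I (Inl i) (Inr j) <= dist_fn I (Inr j) (Inr j') + dist_fn I (Inl i) (Inr j')"
   using T[OF p(1) p(3) p(2)] sy[OF p(3) p(2)] by simp
  then have 1: "(of_rat (dist_fn I (Inl i) (Inr j)) :: real) <= of_rat (dist_fn I (Inr j) (Inr j')) + of_rat (dist_fn I (Inl i) (Inr j'))"
   by (simp only: of_rat_less_eq flip: of_rat_add)
  have "dist_fn I (Inr j) (Inr j') <= dist_fn I (Inl i) (Inr j) + dist_fn I (Inl i) (Inr j')"
   using T[OF p(2) p(1) p(3)] sy[OF p(2) p(1)] by simp
  then have 2: "(of_rat (dist_fn I (Inr j) (Inr j')) :: real) <= of_rat (dist_fn I (Inl i) (Inr j)) + of_rat (dist_fn I (Inl i) (Inr j'))"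
   by (simp only: of_rat_less_eq flip: of_rat_add)
  show "real (i.d i j) <= cdist j j' + real (i.d i j')" "cdist j j' <= real (i.d i j) + real (i.d i j')"
   unfolding conn_c[OF that(1,2)] conn_c[OF that(1,3)] cdist_def conn_cost_def distrib_left[symmetric]
   by (intro mult_left_mono 1 2 of_nat_0_le_iff)+
 qed
 have Q1: "(\<forall>i<ns. \<forall>j<nc. j.out_x \<sigma>5 U i j <= j.out_y \<sigma>5 U i) \<and> (\<forall>j<nc. i.r j <= (\<Sum>i<ns. j.out_x \<sigma>5 U i j))"
  if "U \<in> set_pmf (unif_fun {..<\<sigma>3 19 0 + i.PP} i.n)" for U
  by (rule j.quality(1)[where X = X and Y = Y and \<sigma> = \<sigma>5 and cdist = cdist, OF P(1) XY cover b5 prep5 part5[rule_format] fill[rule_format] tri that])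
 have Q2: "measure_pmf.expectation (unif_fun {..<\<sigma>3 19 0 + i.PP} i.n)
   (%U. (\<Sum>i<ns. real (cst i) * real (j.out_y \<sigma>5 U i)) + (\<Sum>i<ns. \<Sum>j<nc. real (i.d i j) * real (j.out_x \<sigma>5 U i j))) <=
   ((\<Sum>i<ns. real (cst i) * real (Y i)) + (\<Sum>i<ns. \<Sum>j<nc. real (i.d i j) * real (X i j))) / real i.n"
  by (rule j.quality(2)[where X = X and Y = Y and \<sigma> = \<sigma>5 and cdist = cdist, OF P(1) XY cover b5 prep5 part5[rule_format] fill[rule_format] tri])
 let ?M = "unif_fun {..<\<sigma>3 19 0 + i.PP} i.n"
 define F where "F U = dexec c_post \<rho> (\<sigma>5(29 := U))" for U
 have pre: "dexec c_pre \<rho> \<sigma>0 = \<sigma>5"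
  unfolding \<sigma>5_def \<sigma>4_def \<sigma>3_def \<sigma>2_def \<sigma>1_def c_pre_def c_setup_def inst.c_prep_def by (simp only: dexec.simps(3))
 have "\<sigma>3 a = \<sigma>1 a" if "a \<in> {4, 29}" for a
 proof -
  have "\<sigma>3 a = \<sigma>2 a" unfolding \<sigma>3_def by (rule dexec_unwritten) (use that in \<open>auto simp: cmd_defs inst.c_prep_def\<close>)
  also have "\<sigma>2 a = \<sigma>1 a" unfolding \<sigma>2_def by (rule dexec_unwritten) (use that in \<open>auto simp: cmd_defs\<close>)
  finally show ?thesis .
 qed
 moreover have "\<sigma>1 29 = \<sigma>0 29" unfolding \<sigma>1_def by (rule dexec_unwritten) (simp add: cmd_defs c_setup_def)
 ultimately have s29: "\<sigma>5 29 = (%_. 0)" and s4: "\<sigma>5 4 0 = \<sigma>1 4 0" using z29 by (simp_all add: wf wp)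
 \<comment> \<open>The drawn numbers are uniform below a power of two, and by the choice of
   \<open>gQ\<close> and \<open>P\<close> this power is \<open>n\<close> itself.\<close>
 have n: "2 ^ (gS + \<sigma>1 4 0) = i.n" using S(4) by (simp add: P_def gQ_def power_add)
 have "exec c_rnd \<rho> \<sigma>5 = for_loop (%v. exec (Rnd 29 (Var 10) (Num gS \<oplus> Rd 4 (Num 0))) (\<rho>(10 := v))) (\<sigma>3 19 0 + i.PP) 0 \<sigma>5"
  unfolding c_rnd_def exec.simps(4) by (simp add: j.base2D[OF b5] del: exec.simps)
 also have "\<dots> = map_pmf (%U. \<sigma>5(29 := (%q. if 0 <= q \<and> q < 0 + (\<sigma>3 19 0 + i.PP) then U q else \<sigma>5 29 q)))
   (unif_fun {0..<0 + (\<sigma>3 19 0 + i.PP)} (2 ^ (gS + \<sigma>1 4 0)))"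
  by (rule exec_random_table) (simp add: s4)
 also have "\<dots> = map_pmf (%U. \<sigma>5(29 := U)) ?M"
  unfolding n add_0 atLeast0LessThan
 proof (intro map_pmf_cong refl)
  fix U assume "U \<in> set_pmf ?M"
  \<comment> \<open>Outside its index set the product distribution has the default 0, and array 29
    is still 0 everywhere, so the draws amount to replacing the whole array by
    \<open>U\<close>.\<close>
  then have "U q = 0" if "\<not> q < \<sigma>3 19 0 + i.PP" for q using that by (auto simp: set_Pi_pmf PiE_dflt_def)
  then have "(%q. if 0 <= q \<and> q < \<sigma>3 19 0 + i.PP then U q else \<sigma>5 29 q) = U" by (auto simp: s29 fun_eq_iff)
  then show "\<sigma>5(29 := (%q. if 0 <= q \<and> q < \<sigma>3 19 0 + i.PP then U q else \<sigma>5 29 q)) = \<sigma>5(29 := U)" by simp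
 qed
 finally have rnd: "exec c_rnd \<rho> \<sigma>5 = map_pmf (%U. \<sigma>5(29 := U)) ?M" .
 have "D = bind_pmf (exec c_pre \<rho> \<sigma>0) (%\<sigma>. bind_pmf (exec c_rnd \<rho> \<sigma>) (exec c_post \<rho>))"
  unfolding D_def prog_def \<rho>_def \<sigma>0_def xs_def exec.simps(3)[abs_def] ..
 also have "\<dots> = bind_pmf (exec c_rnd \<rho> \<sigma>5) (%\<sigma>. return_pmf (dexec c_post \<rho> \<sigma>))"
  unfolding exec_det[OF det_pre] pre bind_return_pmf exec_det[OF det_post, abs_def] ..
 also have "\<dots> = map_pmf F ?M" unfolding rnd F_def by (simp add: map_pmf_def bind_assoc_pmf bind_return_pmf)
 finally have D: "D = map_pmf F ?M" .
 have out: "F U 37 i = j.out_y \<sigma>5 U i" "j < nc ==> F U 37 (ns + i * nc + j) = j.out_x \<sigma>5 U i j" if i: "i < ns" for U i j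
 proof -
  have b: "j.base2 (\<sigma>5(29 := U))" by (rule j.base2_upd[OF b5]) simp
  have le: "(\<sigma>5(29 := U)) 36 (t * i.PP + p) <= 1" if "t < \<sigma>3 19 0" "p < i.PP" for t p using le5[OF that] by simp
  have rw: "j.row (\<sigma>5(29 := U)) 36 = j.row \<sigma>5 36" "j.row (\<sigma>5(29 := U)) 28 = j.row \<sigma>5 28" by (simp_all add: j.row_def fun_eq_iff)
  have up: "(\<sigma>5(29 := U)) 14 = \<sigma>5 14" "(\<sigma>5(29 := U)) 15 = \<sigma>5 15" "(\<sigma>5(29 := U)) 17 = \<sigma>5 17"
   "(\<sigma>5(29 := U)) 24 = \<sigma>5 24" "(\<sigma>5(29 := U)) 25 = \<sigma>5 25" "(\<sigma>5(29 := U)) 29 = U" by simp_all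
  have post: "(\<forall>i<ns. F U 37 i = j.out_y \<sigma>5 U i) \<and> (\<forall>i<ns. \<forall>j<nc. F U 37 (ns + (i * nc + j)) = j.out_x \<sigma>5 U i j)"
   unfolding j.out_y_def j.out_x_def F_def by (rule j.post_out[OF b le, of \<rho>, unfolded rw up])
  show "F U 37 i = j.out_y \<sigma>5 U i" using post i by blast
  show "F U 37 (ns + i * nc + j) = j.out_x \<sigma>5 U i j" if "j < nc" using post i that unfolding add.assoc by blast
 qed
 have feas: "int_feasible I (F U 37) (arr_x I (F U 37))" if U: "U \<in> set_pmf ?M" for U
 proof -
  have "(\<Sum>i<ns. F U 37 (ns + i * nc + j)) = (\<Sum>i<ns. j.out_x \<sigma>5 U i j)" if "j < nc" for j
   using out(2) that by (intro sum.cong) simp_all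
  then show ?thesis unfolding int_feasible_def ns_def[symmetric] nc_def[symmetric]
   using Q1[OF U] out r by simp
 qed
 then show "\<forall>\<sigma>\<in>set_pmf D. int_feasible I (\<sigma> 37) (arr_x I (\<sigma> 37))" unfolding D by auto
 define E where "E = measure_pmf.expectation D (%\<sigma>. int_cost I (\<sigma> 37) (arr_x I (\<sigma> 37)))"
 have cost: "real DEN * int_cost I (F U 37) (arr_x I (F U 37)) =
   (\<Sum>i<ns. real (cst i) * real (j.out_y \<sigma>5 U i)) + (\<Sum>i<ns. \<Sum>j<nc. real (i.d i j) * real (j.out_x \<sigma>5 U i j))" for U
  unfolding int_cost_def ns_def[symmetric] nc_def[symmetric] distrib_left sum_distrib_left
  by (intro arg_cong2[where f = "(+)"] sum.cong refl) (simp_all add: open_c conn_c out)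
 have "real DEN * E = measure_pmf.expectation ?M (%U. real DEN * int_cost I (F U 37) (arr_x I (F U 37)))"
  unfolding E_def D integral_map_pmf by simp
 also have "\<dots> <= ((\<Sum>i<ns. real (cst i) * real (Y i)) + (\<Sum>i<ns. \<Sum>j<nc. real (i.d i j) * real (X i j))) / real i.n"
  unfolding cost by (rule Q2)
 finally have E1: "real DEN * E <= ((\<Sum>i<ns. real (cst i) * real (Y i)) + (\<Sum>i<ns. \<Sum>j<nc. real (i.d i j) * real (X i j))) / real i.n" .
 have bound: "E <= 1.575 * lp_cost I y x" if f: "lp_feasible I y x" for y x
 proof -
  have "real DEN * E <= 1.575 * (real DEN * lp_cost I y x) + \<epsilon>" if e: "0 < \<epsilon>" for \<epsilon>
  proof -
   define L where "L = real DEN * lp_cost I y x + \<epsilon> / 1.575"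
   have L0: "0 <= L" unfolding L_def using lp_cost_nonneg[OF inst f] e by (intro add_nonneg_nonneg mult_nonneg_nonneg) simp_all
   have e': "0 < \<epsilon> / 1.575" using e by simp
   have c: "(\<Sum>i<ns. real (cst i) * real (Y i)) + (\<Sum>i<ns. \<Sum>j<nc. real (i.d i j) * real (X i j)) <=
    L * (real gD * real nc + (1 + 2 / real gD) * real i.N + 1)"
    unfolding L_def by (rule conjunct2[OF mwr[OF f e']])
   have "real DEN * E <= L * (real gD * real nc + (1 + 2 / real gD) * real i.N + 1) / real i.n"
    by (rule order.trans[OF E1 divide_right_mono[OF c]]) simp
   also have "\<dots> = L * ((real gD * real nc + (1 + 2 / real gD) * real i.N + 1) / real i.n)" by simp
   also have "\<dots> <= L * 1.575" using ratio_numeric[OF P] L0 by (intro mult_left_mono)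
   also have "\<dots> = 1.575 * (real DEN * lp_cost I y x) + \<epsilon>" by (simp add: L_def field_simps)
   finally show ?thesis .
  qed
  then have "real DEN * E <= 1.575 * (real DEN * lp_cost I y x)" by (rule field_le_epsilon)
  also have "\<dots> = real DEN * (1.575 * lp_cost I y x)" by simp
  finally show ?thesis by (rule mult_left_le_imp_le) (use DEN in simp)
 qed
 \<comment> \<open>The bound holds against each feasible fractional solution, so it passes to the
   infimum, attained or not.\<close>
 have "E / 1.575 <= LP_opt I" unfolding LP_opt_def
 proof (rule cInf_greatest)
  show "{lp_cost I y x |y x. lp_feasible I y x} \<noteq> {}" using lp0 by blast
  fix c assume "c \<in> {lp_cost I y x |y x. lp_feasible I y x}"
  then obtain y x where c: "c = lp_cost I y x" "lp_feasible I y x" by blast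
  show "E / 1.575 <= c" using bound[OF c(2)] unfolding c(1) by simp
 qed
 then show "measure_pmf.expectation D (%\<sigma>. int_cost I (\<sigma> 37) (arr_x I (\<sigma> 37))) <= 1.575 * LP_opt I"
  unfolding E_def by simp
qed

theorem theorem20:
 "\<exists>A :: ftfp => ((nat => nat) \<times> (nat => nat => nat)) pmf.
   rand_polytime encode_ftfp decode_solution {I. ftfp_instance I} A \<and>
   (\<forall>I. ftfp_instance I \<longrightarrow>
    (\<forall>(y, x)\<in>set_pmf (A I). int_feasible I y x) \<and>
    measure_pmf.expectation (A I) (%(y, x). int_cost I y x) <= 1.575 * LP_opt I \<and>
    1.575 * LP_opt I <= 1.575 * OPT I)"
proof -
 have oid: "\<not> small_arr 0" "(0::nat) < 37" "(37::nat) < 50" by (simp_all add: small_arr_def)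
 show ?thesis
 proof (rule program_correct[OF wf_prog good_prog low_prog oid(1) writes_prog oid(2,3)])
 fix P :: "com list" and p :: "nat poly"
 assume run: "!!xs ns nc R. length xs = 2 + 2 * ns + 2 * ns * nc + nc ==> xs ! 0 = ns ==> xs ! 1 = nc ==>
   R = run (poly p (input_size xs)) (P, load xs, 0) ==>
   (\<forall>(K, M, t)\<in>set_pmf R. K = [] \<and> t <= poly p (input_size xs)) \<and>
   map_pmf (%(K, M, t). %k. if k < ns + ns * nc then M k else 0) R =
   map_pmf (%\<sigma> k. if k < ns + ns * nc then \<sigma> 37 k else 0) (exec prog (%_. 0) (init_state xs))"
 define R where "R I = run (poly p (input_size (encode_ftfp I))) (P, load (encode_ftfp I), 0)" for I
 define A where "A I = map_pmf (%(K, M, t). decode_solution I M) (R I)" for I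
 let ?m = "%I. nsites I + nsites I * nclients I"
 have RI: "(\<forall>(K, M, t)\<in>set_pmf (R I). K = [] \<and> t <= poly p (input_size (encode_ftfp I)))"
  "map_pmf (%(K, M, t). %k. if k < ?m I then M k else 0) (R I) =
   map_pmf (%\<sigma> k. if k < ?m I then \<sigma> 37 k else 0) (exec prog (%_. 0) (init_state (encode_ftfp I)))" for I
 proof -
  have len: "length (encode_ftfp I) = 2 + 2 * nsites I + 2 * nsites I * nclients I + nclients I"
   using encode_layout(1)[of I] by simp
  note * = run[OF len encode_layout(2,3) R_def]
  show "(\<forall>(K, M, t)\<in>set_pmf (R I). K = [] \<and> t <= poly p (input_size (encode_ftfp I)))"
   by (rule conjunct1[OF *])
  show "map_pmf (%(K, M, t). %k. if k < ?m I then M k else 0) (R I) =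
    map_pmf (%\<sigma> k. if k < ?m I then \<sigma> 37 k else 0) (exec prog (%_. 0) (init_state (encode_ftfp I)))"
   by (rule conjunct2[OF *])
 qed
 have poly: "rand_polytime encode_ftfp decode_solution {I. ftfp_instance I} A"
  unfolding rand_polytime_def Let_def
 proof (rule exI[of _ P], rule exI[of _ p], rule ballI, rule conjI)
  fix I
  show "\<forall>(K, M, t)\<in>set_pmf (run (poly p (input_size (encode_ftfp I))) (P, load (encode_ftfp I), 0)).
   K = [] \<and> t <= poly p (input_size (encode_ftfp I))" using RI(1)[of I] unfolding R_def .
  show "A I = map_pmf (%(K, M, t). decode_solution I M) (run (poly p (input_size (encode_ftfp I))) (P, load (encode_ftfp I), 0))"
   unfolding A_def R_def ..
 qed
 have quality: "(\<forall>(y, x)\<in>set_pmf (A I). int_feasible I y x) \<and>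
   measure_pmf.expectation (A I) (%(y, x). int_cost I y x) <= 1.575 * LP_opt I \<and>
   1.575 * LP_opt I <= 1.575 * OPT I" if inst: "ftfp_instance I" for I
 proof -
  let ?D = "exec prog (%_. 0) (init_state (encode_ftfp I))"
  \<comment> \<open>Truncation to the output cells makes the memory of the machine comparable with
    array 37; by \<open>arr_cong\<close> it changes neither feasibility nor cost.\<close>
  define tr :: "(nat => nat) => nat => nat" where "tr f = (%k. if k < ?m I then f k else 0)" for f
  have trf: "int_feasible I (tr f) (arr_x I (tr f)) = int_feasible I f (arr_x I f)"
   "int_cost I (tr f) (arr_x I (tr f)) = int_cost I f (arr_x I f)" for f
   by (rule arr_cong, simp add: tr_def)+
  have eq: "map_pmf (%(K, M, t). tr M) (R I) = map_pmf (%\<sigma>. tr (\<sigma> 37)) ?D"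
   using RI(2)[of I] unfolding tr_def .
  have AI: "A I = map_pmf (%(K, M, t). (M, arr_x I M)) (R I)" unfolding A_def decode_solution_def ..
  have feas: "int_feasible I M (arr_x I M)" if "(K, M, t) \<in> set_pmf (R I)" for K M t
  proof -
   have "tr M \<in> set_pmf (map_pmf (%(K, M, t). tr M) (R I))" using that by force
   then obtain \<sigma> where "\<sigma> \<in> set_pmf ?D" "tr M = tr (\<sigma> 37)" unfolding eq by auto
   then show ?thesis using prog_quality(1)[OF inst] trf(1)[of M] trf(1)[of "\<sigma> 37"] by simp
  qed
  have 1: "\<forall>(y, x)\<in>set_pmf (A I). int_feasible I y x" unfolding AI using feas by auto
  have "measure_pmf.expectation (A I) (%(y, x). int_cost I y x) =
    measure_pmf.expectation (R I) (%(K, M, t). int_cost I (tr M) (arr_x I (tr M)))"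
   unfolding AI integral_map_pmf trf(2) by (simp add: case_prod_unfold)
  also have "\<dots> = measure_pmf.expectation (map_pmf (%(K, M, t). tr M) (R I)) (%f. int_cost I f (arr_x I f))"
   unfolding integral_map_pmf by (simp add: case_prod_unfold)
  also have "\<dots> = measure_pmf.expectation ?D (%\<sigma>. int_cost I (\<sigma> 37) (arr_x I (\<sigma> 37)))"
   unfolding eq integral_map_pmf trf(2) ..
  also have "\<dots> <= 1.575 * LP_opt I" by (rule prog_quality(2)[OF inst])
  finally have 2: "measure_pmf.expectation (A I) (%(y, x). int_cost I y x) <= 1.575 * LP_opt I" .
  show ?thesis using 1 2 LP_opt_le_OPT[OF inst] by simp
 qed
 show ?thesis by (rule exI[of _ A], rule conjI[OF poly], intro allI impI, rule quality)
 qed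
qed

end
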